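(* Let $(W,\omega)$ be a finite-dimensional graded symplectic vector space with form $\omega$ of even degree $N$ such that $Z:=\{a\in\mathbb{Z}: W_a\neq 0\}\subset\{0,\dots,N\}$, and suppose that $W$ is positively graded ($W_i=0$ for $i\le0$). Let $C^{\bullet,\bullet}_{\mathrm{com}}(W)_+$ be the quotient of the double graph complex $C^{\bullet,\bullet}_{\mathrm{com}}(W)$ by the positivity relation: (i) a graph which has a normal vertex $v$ satisfying $|v|\le0$ is zero; (ii) $(i_{v'}+i_{v''})d_v(\Gamma,o)=0$ for an oriented graph $(\Gamma,o)$ and a normal vertex $v$ of degree $0$, where $v',v''$ are the two new vertices created by $d_v$. Then the operators $d$ and $L=i\circ d-d\circ i$ on $C^{\bullet,\bullet}_{\mathrm{com}}(W)$ induce differentials on $C^{\bullet,\bullet}_{\mathrm{com}}(W)_+$.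
   Context: **Conventions.** All vector spaces are over a field $K$ of characteristic $0$. $V_i=V^{-i}$ is the part of homological degree $i$ (cohomological degree $-i$). $V[p]^i=V^{i+p}$, with elements written $x\sigma$, where $\sigma$ is a symbol of cohomological degree $-p$; $\sigma^{-1}$ is the symbol of the $(-N)$-suspension. In exponents of $-1$ a letter stands for its degree. The symmetric algebra $SV$ has $xy=(-1)^{xy}yx$; the exterior algebra $\Lambda V$ has $xy=-(-1)^{xy}yx$. The Koszul sign $\epsilon$ of $(v_1,\dots,v_k)\mapsto(v_{\pi(1)},\dots,v_{\pi(k)})$ is defined by $v_1\cdots v_k=\epsilon\,v_{\pi(1)}\cdots v_{\pi(k)}$ in $S^kV$. A symplectic form of degree $N$ on $W$ is a non-degenerate bilinear form with $\omega(x,y)=-(-1)^{xy}\omega(y,x)$, vanishing on $W_a\otimes W_b$ unless $a+b=N$. For a family $(V(u))_{u\in U}$ of graded vector spaces indexed by a finite set $U$ with $k$ elements, $\bigodot_{u\in U}V(u)$ (resp. $\bigwedge_{u\in U}V(u)$) is the span in $S^k(\bigoplus_uV(u))$ (resp. $\Lambda^k(\bigoplus_uV(u))$) of the products $v_{u_1}\cdots v_{u_k}$ with $v_{u_i}\in V(u_i)$ and $(u_1,\dots,u_k)$ an ordering of $U$. For a graded finite set $U$ and an ordering $(u_1,\dots,u_k)$, $[u_1,\dots,u_k]$ is the image of $u_1\otimes\cdots\otimes u_k$ in $\Lambda^k(KU)$ and $O(U)$ is the line it spans. Put $[x_1,\dots,x_k]_{cyc}=\sum_{\tau\in\mathbb{Z}/k}\epsilon\,x_{\tau(1)}\otimes\cdots\otimes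 x_{\tau(k)}$ (sum over cyclic permutations, $\epsilon$ the Koszul sign), and let $\mathrm{Cyc}(U)\subset(KU)^{\otimes k}$ be the span of the $[u_1,\dots,u_k]_{cyc}$ over all orderings of $U$. **$N$-graded graphs.** An $N$-graded graph $\Gamma$ consists of a set $H(\Gamma)$ of half-edges (finite); a partition $V(\Gamma)$ of $H(\Gamma)$ into nonempty subsets (vertices); a partition $E(\Gamma)$ of $H(\Gamma)$ into two-element subsets (edges); a map $|\cdot|:H(\Gamma)\to Z$ (cohomological degree) with $|h_1|+|h_2|=N$ for each edge $\{h_1,h_2\}$; and a decomposition $V_i(\Gamma)=V_n(\Gamma)\sqcup V_s(\Gamma)$ of the set of internal vertices (valency $\#v>1$) into normal and special ones. The degree of $v\in V(\Gamma)$ is $|v|=\sum_{h\in v}|h|-N$; every special vertex has degree $-1$ and valency $\ge3$. Vertices of valency $1$ are external (set $V_e(\Gamma)$). $\mathcal{G}(N)$ is the set of isomorphism classes (isomorphisms are bijections of half-edges preserving all the data). **Decorations.** For an internal vertex $v$ with $r=\#v$, $C(v)$ is the quotient of $\mathrm{Cyc}(v)[N]$ by the commutativity relations $\sum_{\tau\in\mathrm{Sh}(s,r-s-1)}\epsilon\,[h_{\tau(1)},\dots,h_{\tau(r-1)},h_r]_{cyc}\sigma=0$ for all orderings $(h_1,\dots,h_r)$ of $v$ and $0<s<r-1$, where $\tau\in\mathrm{Sh}(p,q)$ means that $\tau^{-1}$ is increasing on $\{1,\dots,p\}$ and on $\{p+1,\dots,p+q\}$, and $\epsilon$ is the Koszul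 sign. Set $$\tilde O_{com}(W,\Gamma)=\bigodot_{e\in E(\Gamma)}O(e)\otimes\bigodot_{u\in V_e(\Gamma)}W[-N]_{|u|}\otimes\bigwedge_{v\in V_s(\Gamma)}C(v)\otimes\bigwedge_{v\in V_n(\Gamma)}C(v).$$ Note $W[-N]_{|u|}=W_{|h|}[-N]$ for $u=\{h\}$. $\mathrm{Aut}(\Gamma)$ acts by the induced permutation of half-edges (with $C(v)\to C(\alpha(v))$ given by $[h_1,\dots,h_k]_{cyc}\mapsto[\alpha(h_1),\dots,\alpha(h_k)]_{cyc}$, and the identity $W[-N]_{|u|}\to W[-N]_{|\alpha(u)|}$); $O_{com}(W,\Gamma)$ is the space of coinvariants. Elements are written $(\Gamma,o)$ with $$o=[o_1,\dots,o_l;w_1,\dots,w_{k_e};c^s_1,\dots,c^s_{k_s};c_1,\dots,c_{k_n}]:=(o_1\cdots o_l)\otimes(w_1\cdots w_{k_e})\otimes(c^s_1\cdots c^s_{k_s})\otimes(c_1\cdots c_{k_n}),$$ the entries decorating edges, external, special and normal vertices. If each $o_j$ has the form $[\hat o_j]$ and each $c^s_j$, $c_j$ the form $[\hat c^s_j]_{cyc}\sigma$, $[\hat c_j]_{cyc}\sigma$ for orderings $\hat o_j,\hat c^s_j,\hat c_j$ of the corresponding edges and vertices, then $o$ is an orientation and $(\Gamma,o)$ an oriented graph. Put $\hat C^{\bullet,\bullet}_{com}(W)=\bigoplus_{\Gamma\in\mathcal{G}(N)}O_{com}(W,\Gamma)$, with bidegree $(p,q)$, $p=\#V_n(\Gamma)$,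 $q=\sum_{v\in V_n(\Gamma)}|v|$. Dashes below denote unchanged entries. **Operators.** For a normal vertex $v$, distinct half-edges $h^1,h^2\in v$ and $a,b\in Z$ with $a+b=N$, choose an ordering $h_1,\dots,h_r$ of $v$ with $h^1=h_r$, $h^2=h_i$ and set $$d^{a,b}_{v;h^1,h^2}(\Gamma,[-;-;-;[h_1,\dots,h_r]_{cyc}\sigma,-])=(\Gamma',[-,[h',h''];-;-;[h_1,\dots,h_i,h']_{cyc}\sigma,[h'',h_{i+1},\dots,h_r]_{cyc}\sigma,-]),$$ where $\Gamma'$ is obtained from $\Gamma$ by replacing $v$ by two normal vertices $v'=\{h_1,\dots,h_i,h'\}$, $v''=\{h'',h_{i+1},\dots,h_r\}$ and adding the edge $\{h',h''\}$, with $|h'|=a$, $|h''|=b$. Put $d_v=\frac12\sum_{a+b=N}\sum_{h^1\ne h^2\in v}d^{a,b}_{v;h^1,h^2}$ and $d=\sum_{v\in V_n(\Gamma)}d_v$. For a normal vertex $v$ of degree $-1$ and valency $\ge3$, $i_v(\Gamma,[-;-;-;c,-])=(i_v(\Gamma),[-;-;-,c;-])$ for $c\in C(v)$, where $i_v(\Gamma)$ is $\Gamma$ with $v$ converted to a special vertex; otherwise $i_v=0$. Put $i=\sum_{v\in V_n(\Gamma)}i_v$ and $L=i\circ d-d\circ i$. The operators $d,i,L$ have bidegree $(1,0),(-1,1),(0,1)$. **The double graph complex.** $C^{\bullet,\bullet}_{com}(W)$ is the quotient of $\hat C^{\bullet,\bullet}_{com}(W)$ by (1) ($A_\infty$-relation)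 $i_{v'}i_{v''}d_v(\Gamma,o)=0$ for $\Gamma\in\mathcal{G}(N)$ and normal vertices $v$ (of degree $-2$); (2) (cut-off relation) for every edge $e=\{h_1,h_2\}$, $$(\Gamma,[[h_1,h_2],-;-;-;-])=\sum_{|x^i|=a,|x^j|=b}\omega_{ij}\,(\Gamma_e,[[h_1,\bar h_1],[\bar h_2,h_2],-;x^i\sigma^{-1},x^j\sigma^{-1},-;-;-]),$$ where $\Gamma_e$ is obtained by replacing $e$ by the edges $\{h_1,\bar h_1\},\{h_2,\bar h_2\}$ with new external vertices $\{\bar h_1\},\{\bar h_2\}$, $|\bar h_1|=N-|h_1|=a$, $|\bar h_2|=N-|h_2|=b$, $\{x^i\}$ is a homogeneous basis of $W$ and $(\omega_{ij})$ is the inverse matrix of $(\omega(x^i,x^j))$. The operators $d,i,L$ induce operators on $C_{com}(W)$, which is a double complex with respect to $d$ and $L$ ($d^2=0$, $L^2=0$, $Ld+dL=0$).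
   Formalization: The operator d is taken with the extra Koszul sign (-1)^{k_s}, k_s the number of special vertices; without it i_w and d_v anticommute for distinct normal vertices w, v, and L = i∘d − d∘i does not respect positivity relation (i). *)

theory Defs
  imports
    Complex_Main
    "HOL-Library.Poly_Mapping"
    "HOL-Library.Disjoint_Sets"
    "HOL-Combinatorics.Multiset_Permutations"
begin

section \<open>Free vector spaces\<close>

text \<open>The free \<open>'k\<close>-vector space on \<open>'g\<close> is the type \<open>'g \<Rightarrow>\<^sub>0 'k\<close> of finitely supported
  functions.  Quotients are represented by a space together with a subspace of relations.\<close>

definition scale :: "'k::field \<Rightarrow> ('g \<Rightarrow>\<^sub>0 'k) \<Rightarrow> ('g \<Rightarrow>\<^sub>0 'k)" where
  "scale c x = Poly_Mapping.map ((*) c) x"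

lemma lookup_scale [simp]: "Poly_Mapping.lookup (scale c x) g = c * Poly_Mapping.lookup x g"
  by (simp add: scale_def Poly_Mapping.map.rep_eq when_def)

interpretation free: vector_space "scale :: 'k::field \<Rightarrow> ('g \<Rightarrow>\<^sub>0 'k) \<Rightarrow> ('g \<Rightarrow>\<^sub>0 'k)"
  by unfold_locales (auto intro!: poly_mapping_eqI simp: lookup_add algebra_simps)

definition gen :: "'g \<Rightarrow> ('g \<Rightarrow>\<^sub>0 'k::field)" where
  "gen g = Poly_Mapping.single g 1"

definition lin_ext :: "('g \<Rightarrow> ('h \<Rightarrow>\<^sub>0 'k)) \<Rightarrow> ('g \<Rightarrow>\<^sub>0 'k::field) \<Rightarrow> ('h \<Rightarrow>\<^sub>0 'k)" where
  "lin_ext f x = (\<Sum>g\<in>Poly_Mapping.keys x. scale (Poly_Mapping.lookup x g) (f g))"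

definition sgn_pow :: "int \<Rightarrow> 'k::field" where
  "sgn_pow n = (if even n then 1 else - 1)"


section \<open>Unordered products of a family of graded vector spaces\<close>

text \<open>
  Let \<open>V u = A u / B u\<close>, \<open>u \<in> U\<close>, be graded vector spaces, each concentrated in one
  degree \<open>\<delta> u\<close> (this is the case for all families below).  The product of the family \<open>V\<close> in
  the symmetric (exterior) algebra of the direct sum of the \<open>V u\<close> is spanned by the words
  \<open>x\<^sub>1 \<dots> x\<^sub>k\<close> with \<open>x\<^sub>i \<in> V u\<^sub>i\<close> for orderings \<open>u\<^sub>1, \<dots>, u\<^sub>k\<close> of \<open>U\<close>.  A word is
  represented by the list of the pairs \<open>(u\<^sub>i, x\<^sub>i)\<close>.  The relations between the words are
  multilinearity, the vanishing of words with an entry in \<open>B u\<close>, and the exchange rule, whose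
  sign is \<open>sgn_sym\<close> in the symmetric and \<open>sgn_alt\<close> in the exterior case.\<close>

definition words :: "'u set \<Rightarrow> ('u \<Rightarrow> 'v set) \<Rightarrow> ('u \<times> 'v) list set" where
  "words U A = {xs. distinct (map fst xs) \<and> set (map fst xs) = U \<and> (\<forall>(u, x)\<in>set xs. x \<in> A u)}"

definition sgn_sym :: "('u \<Rightarrow> int) \<Rightarrow> 'u \<Rightarrow> 'u \<Rightarrow> 'k::field" where
  "sgn_sym \<delta> u v = sgn_pow (\<delta> u * \<delta> v)"

definition sgn_alt :: "('u \<Rightarrow> int) \<Rightarrow> 'u \<Rightarrow> 'u \<Rightarrow> 'k::field" where
  "sgn_alt \<delta> u v = - sgn_pow (\<delta> u * \<delta> v)"

definition product_rels ::
  "('k::field \<Rightarrow> 'v::ab_group_add \<Rightarrow> 'v) \<Rightarrow> 'u set \<Rightarrow> ('u \<Rightarrow> 'v set) \<Rightarrow> ('u \<Rightarrow> 'v set) \<Rightarrow>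
    ('u \<Rightarrow> 'u \<Rightarrow> 'k) \<Rightarrow> (('u \<times> 'v) list \<Rightarrow>\<^sub>0 'k) set" where
  "product_rels sc U A B sg =
     {gen (xs @ (u, sc c x + y) # ys) - scale c (gen (xs @ (u, x) # ys)) - gen (xs @ (u, y) # ys) |
        xs u c x y ys. xs @ (u, x) # ys \<in> words U A \<and> xs @ (u, y) # ys \<in> words U A} \<union>
     {gen (xs @ (u, x) # ys) | xs u x ys. xs @ (u, x) # ys \<in> words U A \<and> x \<in> B u} \<union>
     {gen (xs @ p # q # ys) - scale (sg (fst p) (fst q)) (gen (xs @ q # p # ys)) |
        xs p q ys. xs @ p # q # ys \<in> words U A}"


section \<open>Graphs\<close>

text \<open>The finite set of half-edges is taken inside \<open>nat\<close>; every finite graph is isomorphic to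
  such a graph.  The values of \<open>hdeg\<close> outside \<open>halves\<close> are irrelevant.\<close>

record ngraph =
  halves :: "nat set"
  verts :: "nat set set"
  edges :: "nat set set"
  hdeg :: "nat \<Rightarrow> int"
  specials :: "nat set set"

definition externals :: "ngraph \<Rightarrow> nat set set" where
  "externals \<Gamma> = {v \<in> verts \<Gamma>. card v = 1}"

definition internals :: "ngraph \<Rightarrow> nat set set" where
  "internals \<Gamma> = {v \<in> verts \<Gamma>. card v > 1}"

definition normals :: "ngraph \<Rightarrow> nat set set" where
  "normals \<Gamma> = internals \<Gamma> - specials \<Gamma>"

definition vdeg :: "int \<Rightarrow> ngraph \<Rightarrow> nat set \<Rightarrow> int" where
  "vdeg N \<Gamma> v = (\<Sum>h\<in>v. hdeg \<Gamma> h) - N"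

definition is_ngraph :: "int \<Rightarrow> int set \<Rightarrow> ngraph \<Rightarrow> bool" where
  "is_ngraph N Z \<Gamma> \<longleftrightarrow>
     finite (halves \<Gamma>) \<and>
     partition_on (halves \<Gamma>) (verts \<Gamma>) \<and>
     partition_on (halves \<Gamma>) (edges \<Gamma>) \<and> (\<forall>e\<in>edges \<Gamma>. card e = 2) \<and>
     (\<forall>h\<in>halves \<Gamma>. hdeg \<Gamma> h \<in> Z) \<and>
     (\<forall>h1 h2. {h1, h2} \<in> edges \<Gamma> \<longrightarrow> hdeg \<Gamma> h1 + hdeg \<Gamma> h2 = N) \<and>
     specials \<Gamma> \<subseteq> internals \<Gamma> \<and>
     (\<forall>v\<in>specials \<Gamma>. vdeg N \<Gamma> v = - 1 \<and> card v \<ge> 3)"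

definition graph_iso :: "(nat \<Rightarrow> nat) \<Rightarrow> ngraph \<Rightarrow> ngraph \<Rightarrow> bool" where
  "graph_iso \<phi> \<Gamma> \<Gamma>' \<longleftrightarrow>
     bij_betw \<phi> (halves \<Gamma>) (halves \<Gamma>') \<and>
     (`) \<phi> ` verts \<Gamma> = verts \<Gamma>' \<and>
     (`) \<phi> ` edges \<Gamma> = edges \<Gamma>' \<and>
     (\<forall>h\<in>halves \<Gamma>. hdeg \<Gamma>' (\<phi> h) = hdeg \<Gamma> h) \<and>
     (`) \<phi> ` specials \<Gamma> = specials \<Gamma>'"


section \<open>Decorations\<close>

text \<open>The tensor algebra of the vector space spanned by the half-edges is \<open>nat list \<Rightarrow>\<^sub>0 'k\<close>; the
  word \<open>h\<^sub>1 \<otimes> \<dots> \<otimes> h\<^sub>k\<close> is \<open>gen [h\<^sub>1, \<dots>, h\<^sub>k]\<close>.\<close>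

text \<open>The Koszul sign of a reordering of a list of distinct half-edges: each pair of half-edges whose
  order is reversed contributes its exchange sign in the symmetric algebra.\<close>

definition before :: "'a \<Rightarrow> 'a \<Rightarrow> 'a list \<Rightarrow> bool" where
  "before a b xs \<longleftrightarrow> (\<exists>us vs ws. xs = us @ a # vs @ b # ws)"

definition koszul :: "(nat \<Rightarrow> int) \<Rightarrow> nat list \<Rightarrow> nat list \<Rightarrow> 'k::field" where
  "koszul \<delta> xs ys = (\<Prod>(a, b)\<in>{(a, b). before a b xs \<and> before b a ys}. sgn_pow (\<delta> a * \<delta> b))"

text \<open>\<open>O(U)\<close> is the image of the span of the orderings of \<open>U\<close> in the exterior algebra, that is,
  \<open>O_space U\<close> modulo \<open>O_null \<delta> U\<close>.\<close>

definition ext_ideal :: "(nat \<Rightarrow> int) \<Rightarrow> nat set \<Rightarrow> (nat list \<Rightarrow>\<^sub>0 'k::field) set" where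
  "ext_ideal \<delta> U = free.span
     {gen (xs @ a # b # ys) + scale (sgn_pow (\<delta> a * \<delta> b)) (gen (xs @ b # a # ys)) |
        xs a b ys. set (xs @ a # b # ys) \<subseteq> U}"

definition O_space :: "nat set \<Rightarrow> (nat list \<Rightarrow>\<^sub>0 'k::field) set" where
  "O_space U = free.span (gen ` permutations_of_set U)"

definition O_null :: "(nat \<Rightarrow> int) \<Rightarrow> nat set \<Rightarrow> (nat list \<Rightarrow>\<^sub>0 'k::field) set" where
  "O_null \<delta> U = O_space U \<inter> ext_ideal \<delta> U"

definition cyc :: "(nat \<Rightarrow> int) \<Rightarrow> nat list \<Rightarrow> (nat list \<Rightarrow>\<^sub>0 'k::field)" where
  "cyc \<delta> us = (\<Sum>k<length us. scale (koszul \<delta> us (rotate k us)) (gen (rotate k us)))"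

definition Cyc :: "(nat \<Rightarrow> int) \<Rightarrow> nat set \<Rightarrow> (nat list \<Rightarrow>\<^sub>0 'k::field) set" where
  "Cyc \<delta> U = free.span (cyc \<delta> ` permutations_of_set U)"

text \<open>\<open>C(v)\<close> is \<open>Cyc \<delta> v\<close> modulo \<open>C_null \<delta> v\<close>.  The suspension \<open>[N]\<close> only shifts the degree, so that
  all elements of \<open>C(v)\<close> have the degree \<open>vdeg\<close> of \<open>v\<close>; the symbol \<open>\<sigma>\<close> is omitted.  For a list
  \<open>hs\<close> of distinct half-edges, the words \<open>h\<^sub>\<tau>\<^sub>1, \<dots>, h\<^sub>\<tau>\<^sub>r\<^sub>-\<^sub>1\<close> for shuffles \<open>\<tau>\<close> are
  the elements of \<open>shuffles\<close>.\<close>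

definition C_null :: "(nat \<Rightarrow> int) \<Rightarrow> nat set \<Rightarrow> (nat list \<Rightarrow>\<^sub>0 'k::field) set" where
  "C_null \<delta> U = free.span
     {\<Sum>w\<in>shuffles (take s hs) (drop s hs). scale (koszul \<delta> hs w) (cyc \<delta> (w @ [h])) |
        hs h s. hs @ [h] \<in> permutations_of_set U \<and> 0 < s \<and> s < length hs}"


section \<open>The space of decorated graphs\<close>

text \<open>\<open>(\<Gamma>, os, ws, ss, ns)\<close> stands for \<open>(\<Gamma>, [os; ws; ss; ns])\<close>; the lists contain the
  decorations of edges, external, special and normal vertices, each paired with the edge or vertex
  which it decorates.  The graded space \<open>W\<close> is given by the family \<open>W a\<close>, \<open>a\<close> being the
  homological degree.\<close>

type_synonym ('k, 'w) dgraph =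
  "ngraph \<times> (nat set \<times> (nat list \<Rightarrow>\<^sub>0 'k)) list \<times> (nat set \<times> 'w) list \<times>
     (nat set \<times> (nat list \<Rightarrow>\<^sub>0 'k)) list \<times> (nat set \<times> (nat list \<Rightarrow>\<^sub>0 'k)) list"

definition degrees :: "(int \<Rightarrow> 'w::zero set) \<Rightarrow> int set" where
  "degrees W = {a. W a \<noteq> {0}}"

definition edge_words :: "ngraph \<Rightarrow> (nat set \<times> (nat list \<Rightarrow>\<^sub>0 'k::field)) list set" where
  "edge_words \<Gamma> = words (edges \<Gamma>) O_space"

text \<open>\<open>W[-N]\<close> in homological degree \<open>|u|\<close> is \<open>W\<close> in homological degree \<open>|u| + N\<close>.\<close>

definition external_words :: "int \<Rightarrow> (int \<Rightarrow> 'w set) \<Rightarrow> ngraph \<Rightarrow> (nat set \<times> 'w) list set" where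
  "external_words N W \<Gamma> = words (externals \<Gamma>) (\<lambda>u. W (vdeg N \<Gamma> u + N))"

definition special_words :: "ngraph \<Rightarrow> (nat set \<times> (nat list \<Rightarrow>\<^sub>0 'k::field)) list set" where
  "special_words \<Gamma> = words (specials \<Gamma>) (Cyc (hdeg \<Gamma>))"

definition normal_words :: "ngraph \<Rightarrow> (nat set \<times> (nat list \<Rightarrow>\<^sub>0 'k::field)) list set" where
  "normal_words \<Gamma> = words (normals \<Gamma>) (Cyc (hdeg \<Gamma>))"

definition dgraphs :: "int \<Rightarrow> (int \<Rightarrow> 'w::zero set) \<Rightarrow> ('k::field, 'w) dgraph set" where
  "dgraphs N W = {(\<Gamma>, os, ws, ss, ns).
     is_ngraph N (degrees W) \<Gamma> \<and> os \<in> edge_words \<Gamma> \<and> ws \<in> external_words N W \<Gamma> \<and>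
     ss \<in> special_words \<Gamma> \<and> ns \<in> normal_words \<Gamma>}"

definition oriented_graphs :: "int \<Rightarrow> (int \<Rightarrow> 'w::zero set) \<Rightarrow> ('k::field, 'w) dgraph set" where
  "oriented_graphs N W = {(\<Gamma>, os, ws, ss, ns) \<in> dgraphs N W.
     (\<forall>(e, x)\<in>set os. x \<in> gen ` permutations_of_set e) \<and>
     (\<forall>(v, c)\<in>set ss \<union> set ns. c \<in> cyc (hdeg \<Gamma>) ` permutations_of_set v)}"

text \<open>The relations of the tensor product of the four products of decorations of a graph \<open>\<Gamma>\<close>: each
  relation in one factor gives a relation for every choice of words in the other factors.\<close>

definition tensor_rels ::
  "('k::field \<Rightarrow> 'w::ab_group_add \<Rightarrow> 'w) \<Rightarrow> int \<Rightarrow> (int \<Rightarrow> 'w set) \<Rightarrow> ngraph \<Rightarrow>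
     (('k, 'w) dgraph \<Rightarrow>\<^sub>0 'k) set" where
  "tensor_rels scW N W \<Gamma> =
     {lin_ext (\<lambda>os. gen (\<Gamma>, os, ws, ss, ns)) r | r ws ss ns.
        r \<in> product_rels scale (edges \<Gamma>) O_space (O_null (hdeg \<Gamma>))
              (sgn_sym (\<lambda>e. \<Sum>h\<in>e. hdeg \<Gamma> h)) \<and>
        ws \<in> external_words N W \<Gamma> \<and> ss \<in> special_words \<Gamma> \<and> ns \<in> normal_words \<Gamma>} \<union>
     {lin_ext (\<lambda>ws. gen (\<Gamma>, os, ws, ss, ns)) r | r os ss ns.
        r \<in> product_rels scW (externals \<Gamma>) (\<lambda>u. W (vdeg N \<Gamma> u + N)) (\<lambda>u. {0})
              (sgn_sym (vdeg N \<Gamma>)) \<and>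
        os \<in> edge_words \<Gamma> \<and> ss \<in> special_words \<Gamma> \<and> ns \<in> normal_words \<Gamma>} \<union>
     {lin_ext (\<lambda>ss. gen (\<Gamma>, os, ws, ss, ns)) r | r os ws ns.
        r \<in> product_rels scale (specials \<Gamma>) (Cyc (hdeg \<Gamma>)) (C_null (hdeg \<Gamma>))
              (sgn_alt (vdeg N \<Gamma>)) \<and>
        os \<in> edge_words \<Gamma> \<and> ws \<in> external_words N W \<Gamma> \<and> ns \<in> normal_words \<Gamma>} \<union>
     {lin_ext (\<lambda>ns. gen (\<Gamma>, os, ws, ss, ns)) r | r os ws ss.
        r \<in> product_rels scale (normals \<Gamma>) (Cyc (hdeg \<Gamma>)) (C_null (hdeg \<Gamma>))
              (sgn_alt (vdeg N \<Gamma>)) \<and>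
        os \<in> edge_words \<Gamma> \<and> ws \<in> external_words N W \<Gamma> \<and> ss \<in> special_words \<Gamma>}"

definition transport ::
  "(nat \<Rightarrow> nat) \<Rightarrow> ngraph \<Rightarrow> ('k::field, 'w) dgraph \<Rightarrow> ('k, 'w) dgraph" where
  "transport \<phi> \<Gamma>' = (\<lambda>(\<Gamma>, os, ws, ss, ns).
     (\<Gamma>', map (map_prod ((`) \<phi>) (lin_ext (gen \<circ> map \<phi>))) os,
          map (map_prod ((`) \<phi>) id) ws,
          map (map_prod ((`) \<phi>) (lin_ext (gen \<circ> map \<phi>))) ss,
          map (map_prod ((`) \<phi>) (lin_ext (gen \<circ> map \<phi>))) ns))"

text \<open>The direct sum over isomorphism classes of the coinvariants under the automorphism groups is
  formed by taking all graphs and identifying every decorated graph with its transports along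
  isomorphisms.\<close>

definition iso_rels ::
  "int \<Rightarrow> (int \<Rightarrow> 'w::zero set) \<Rightarrow> (('k::field, 'w) dgraph \<Rightarrow>\<^sub>0 'k) set" where
  "iso_rels N W = {gen s - gen (transport \<phi> \<Gamma>' s) | s \<phi> \<Gamma>'.
     s \<in> dgraphs N W \<and> is_ngraph N (degrees W) \<Gamma>' \<and> graph_iso \<phi> (fst s) \<Gamma>'}"

text \<open>The direct sum of the spaces of coinvariants is \<open>chains N W\<close> modulo the span of
  \<open>hat_rels scW N W\<close>; its part of bidegree \<open>(p, q)\<close> is the image of \<open>chains_bideg N W p q\<close>.\<close>

definition chains :: "int \<Rightarrow> (int \<Rightarrow> 'w::zero set) \<Rightarrow> (('k::field, 'w) dgraph \<Rightarrow>\<^sub>0 'k) set" where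
  "chains N W = free.span (gen ` dgraphs N W)"

definition chains_bideg ::
  "int \<Rightarrow> (int \<Rightarrow> 'w::zero set) \<Rightarrow> int \<Rightarrow> int \<Rightarrow> (('k::field, 'w) dgraph \<Rightarrow>\<^sub>0 'k) set" where
  "chains_bideg N W p q = free.span (gen ` {s \<in> dgraphs N W.
     int (card (normals (fst s))) = p \<and> (\<Sum>v\<in>normals (fst s). vdeg N (fst s) v) = q})"

definition hat_rels ::
  "('k::field \<Rightarrow> 'w::ab_group_add \<Rightarrow> 'w) \<Rightarrow> int \<Rightarrow> (int \<Rightarrow> 'w set) \<Rightarrow>
     (('k, 'w) dgraph \<Rightarrow>\<^sub>0 'k) set" where
  "hat_rels scW N W = (\<Union>\<Gamma>\<in>{\<Gamma>. is_ngraph N (degrees W) \<Gamma>}. tensor_rels scW N W \<Gamma>) \<union> iso_rels N W"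


section \<open>Operators\<close>

definition new_half :: "ngraph \<Rightarrow> nat" where
  "new_half \<Gamma> = (LEAST n. \<forall>h\<in>halves \<Gamma>. h < n)"

text \<open>For a word \<open>ns\<close> containing \<open>v\<close>: the sign needed to move the decoration of \<open>v\<close> to the front by the
  exchange rule of the exterior algebra, the decoration of \<open>v\<close>, and the remaining word.\<close>

definition front_sgn :: "('u \<Rightarrow> int) \<Rightarrow> 'u \<Rightarrow> ('u \<times> 'v) list \<Rightarrow> 'k::field" where
  "front_sgn \<delta> v ns = (\<Prod>(u, _)\<leftarrow>takeWhile (\<lambda>p. fst p \<noteq> v) ns. sgn_alt \<delta> u v)"

definition entry :: "'u \<Rightarrow> ('u \<times> 'v) list \<Rightarrow> 'v" where
  "entry v ns = the (map_of ns v)"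

definition others :: "'u \<Rightarrow> ('u \<times> 'v) list \<Rightarrow> ('u \<times> 'v) list" where
  "others v ns = filter (\<lambda>p. fst p \<noteq> v) ns"

text \<open>\<open>split_term N a v A B s\<close> is the decorated graph obtained from \<open>s\<close> when \<open>v\<close> is decorated by the
  ordering \<open>A @ B\<close> and replaced by \<open>v' = A \<union> {h'}\<close> and \<open>v'' = {h''} \<union> B\<close>.

  The factor \<open>(- 1) ^ length ss\<close> is the Koszul sign of applying the splitting operator behind the
  decorations of the special vertices: with \<open>xy = -(-1)\<^bsup>xy\<^esup>yx\<close> for all internal vertices, moving \<open>v\<close>
  in front of a special vertex and moving \<open>v' v''\<close> back gives \<open>-1\<close>.  The subspaces of relations
  defined below do not depend on this factor.  It makes \<open>i\<^sub>w\<close> and \<open>d\<^sub>v\<close> commute for \<open>w \<noteq> v\<close>, so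
  that \<open>i \<circ> d - d \<circ> i\<close> is the sum over \<open>v\<close> of the operators \<open>(i\<^bsub>v'\<^esub> + i\<^bsub>v''\<^esub>) d\<^sub>v\<close>.  Without it
  they anticommute (already for the word \<open>w v\<close>: the exchange signs of \<open>w\<close> with \<open>v\<close> and with
  \<open>v' v''\<close> multiply to \<open>-1\<close>), and then \<open>i \<circ> d - d \<circ> i\<close> contains the terms \<open>-2 d\<^sub>v i\<^sub>w\<close>, does not have
  square zero and does not respect the positivity relation.\<close>

definition split_graph :: "int \<Rightarrow> int \<Rightarrow> nat set \<Rightarrow> nat list \<Rightarrow> nat list \<Rightarrow> ngraph \<Rightarrow> ngraph" where
  "split_graph N a v A B \<Gamma> =
     (let h' = new_half \<Gamma>; h'' = Suc h' in
      \<Gamma>\<lparr>halves := halves \<Gamma> \<union> {h', h''},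
        verts := (verts \<Gamma> - {v}) \<union> {set (A @ [h']), set (h'' # B)},
        edges := edges \<Gamma> \<union> {{h', h''}},
        hdeg := (hdeg \<Gamma>)(h' := a, h'' := N - a)\<rparr>)"

definition split_term ::
  "int \<Rightarrow> int \<Rightarrow> nat set \<Rightarrow> nat list \<Rightarrow> nat list \<Rightarrow> ('k::field, 'w) dgraph \<Rightarrow>
     (('k, 'w) dgraph \<Rightarrow>\<^sub>0 'k)" where
  "split_term N a v A B = (\<lambda>(\<Gamma>, os, ws, ss, ns).
     let h' = new_half \<Gamma>; h'' = Suc h'; \<Gamma>' = split_graph N a v A B \<Gamma> in
     scale ((- 1) ^ length ss * front_sgn (vdeg N \<Gamma>) v ns)
       (gen (\<Gamma>', os @ [({h', h''}, gen [h', h''])], ws, ss,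
             (set (A @ [h']), cyc (hdeg \<Gamma>') (A @ [h'])) #
             (set (h'' # B), cyc (hdeg \<Gamma>') (h'' # B)) # others v ns)))"

text \<open>\<open>d_half F N a v h1 h2\<close> is \<open>F v' v'' \<circ> d\<^bsup>a,b\<^esup>\<^bsub>v;h1,h2\<^esub>\<close>, \<open>b = N - a\<close>, where the operator
  \<open>F v' v''\<close> may depend on the two new vertices.  An arbitrary \<open>c\<close> in \<open>Cyc v\<close> is the sum of
  \<open>Poly_Mapping.lookup c us\<close> times \<open>cyc us\<close> over the orderings \<open>us\<close> of \<open>v\<close> which end in \<open>h1\<close>.  These are
  written as \<open>A @ B\<close> where \<open>A\<close> ends in \<open>h2\<close>.\<close>

definition d_half ::
  "(nat set \<Rightarrow> nat set \<Rightarrow> (('k::field, 'w) dgraph \<Rightarrow>\<^sub>0 'k) \<Rightarrow> (('k, 'w) dgraph \<Rightarrow>\<^sub>0 'k)) \<Rightarrow>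
     int \<Rightarrow> int \<Rightarrow> nat set \<Rightarrow> nat \<Rightarrow> nat \<Rightarrow> ('k, 'w) dgraph \<Rightarrow> (('k, 'w) dgraph \<Rightarrow>\<^sub>0 'k)" where
  "d_half F N a v h1 h2 = (\<lambda>(\<Gamma>, os, ws, ss, ns).
     \<Sum>(A, B)\<in>{(A, B). A @ B \<in> permutations_of_set v \<and> A \<noteq> [] \<and> B \<noteq> [] \<and>
                 last B = h1 \<and> last A = h2}.
       scale (Poly_Mapping.lookup (entry v ns) (A @ B))
         (F (set (A @ [new_half \<Gamma>])) (set (Suc (new_half \<Gamma>) # B))
            (split_term N a v A B (\<Gamma>, os, ws, ss, ns))))"

definition d_vertex ::
  "(nat set \<Rightarrow> nat set \<Rightarrow> (('k::field, 'w::zero) dgraph \<Rightarrow>\<^sub>0 'k) \<Rightarrow> (('k, 'w) dgraph \<Rightarrow>\<^sub>0 'k)) \<Rightarrow>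
     int \<Rightarrow> (int \<Rightarrow> 'w set) \<Rightarrow> nat set \<Rightarrow> ('k, 'w) dgraph \<Rightarrow> (('k, 'w) dgraph \<Rightarrow>\<^sub>0 'k)" where
  "d_vertex F N W v s = scale (1 / 2)
     (\<Sum>a\<in>{a. a \<in> degrees W \<and> N - a \<in> degrees W}.
      \<Sum>(h1, h2)\<in>{(h1, h2). h1 \<in> v \<and> h2 \<in> v \<and> h1 \<noteq> h2}. d_half F N a v h1 h2 s)"

definition op_d ::
  "int \<Rightarrow> (int \<Rightarrow> 'w::zero set) \<Rightarrow> (('k::field, 'w) dgraph \<Rightarrow>\<^sub>0 'k) \<Rightarrow> (('k, 'w) dgraph \<Rightarrow>\<^sub>0 'k)" where
  "op_d N W = lin_ext (\<lambda>s. \<Sum>v\<in>normals (fst s). d_vertex (\<lambda>v' v'' x. x) N W v s)"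

definition i_vertex ::
  "int \<Rightarrow> nat set \<Rightarrow> ('k::field, 'w) dgraph \<Rightarrow> (('k, 'w) dgraph \<Rightarrow>\<^sub>0 'k)" where
  "i_vertex N v = (\<lambda>(\<Gamma>, os, ws, ss, ns).
     if v \<in> normals \<Gamma> \<and> vdeg N \<Gamma> v = - 1 \<and> card v \<ge> 3
     then scale (front_sgn (vdeg N \<Gamma>) v ns)
            (gen (\<Gamma>\<lparr>specials := specials \<Gamma> \<union> {v}\<rparr>, os, ws, ss @ [(v, entry v ns)], others v ns))
     else 0)"

definition op_iv ::
  "int \<Rightarrow> nat set \<Rightarrow> (('k::field, 'w) dgraph \<Rightarrow>\<^sub>0 'k) \<Rightarrow> (('k, 'w) dgraph \<Rightarrow>\<^sub>0 'k)" where
  "op_iv N v = lin_ext (i_vertex N v)"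

definition op_i ::
  "int \<Rightarrow> (('k::field, 'w) dgraph \<Rightarrow>\<^sub>0 'k) \<Rightarrow> (('k, 'w) dgraph \<Rightarrow>\<^sub>0 'k)" where
  "op_i N = lin_ext (\<lambda>s. \<Sum>v\<in>normals (fst s). i_vertex N v s)"

definition op_L ::
  "int \<Rightarrow> (int \<Rightarrow> 'w::zero set) \<Rightarrow> (('k::field, 'w) dgraph \<Rightarrow>\<^sub>0 'k) \<Rightarrow> (('k, 'w) dgraph \<Rightarrow>\<^sub>0 'k)" where
  "op_L N W x = op_i N (op_d N W x) - op_d N W (op_i N x)"


section \<open>The double graph complex\<close>

definition Ainf_rels ::
  "int \<Rightarrow> (int \<Rightarrow> 'w::zero set) \<Rightarrow> (('k::field, 'w) dgraph \<Rightarrow>\<^sub>0 'k) set" where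
  "Ainf_rels N W = {d_vertex (\<lambda>v' v'' x. op_iv N v' (op_iv N v'' x)) N W v s | s v.
     s \<in> dgraphs N W \<and> v \<in> normals (fst s) \<and> vdeg N (fst s) v = - 2}"

definition cut_graph :: "int \<Rightarrow> nat \<Rightarrow> nat \<Rightarrow> ngraph \<Rightarrow> ngraph" where
  "cut_graph N h1 h2 \<Gamma> =
     (let k1 = new_half \<Gamma>; k2 = Suc k1 in
      \<Gamma>\<lparr>halves := halves \<Gamma> \<union> {k1, k2},
        verts := verts \<Gamma> \<union> {{k1}, {k2}},
        edges := (edges \<Gamma> - {{h1, h2}}) \<union> {{h1, k1}, {h2, k2}},
        hdeg := (hdeg \<Gamma>)(k1 := N - hdeg \<Gamma> h1, k2 := N - hdeg \<Gamma> h2)\<rparr>)"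

text \<open>\<open>X\<close> is a homogeneous basis of \<open>W\<close> and \<open>P\<close> is the inverse of the matrix of the symplectic form
  with respect to \<open>X\<close>.\<close>

definition cutoff_rels ::
  "int \<Rightarrow> (int \<Rightarrow> 'w::zero set) \<Rightarrow> 'w set \<Rightarrow> ('w \<Rightarrow> 'w \<Rightarrow> 'k) \<Rightarrow>
     (('k::field, 'w) dgraph \<Rightarrow>\<^sub>0 'k) set" where
  "cutoff_rels N W X P =
     {gen (\<Gamma>, ({h1, h2}, gen [h1, h2]) # os, ws, ss, ns) -
      (\<Sum>(x, y)\<in>{(x, y). x \<in> X \<and> y \<in> X \<and> x \<in> W (N - hdeg \<Gamma> h1) \<and> y \<in> W (N - hdeg \<Gamma> h2)}.
         scale (P x y)
           (gen (cut_graph N h1 h2 \<Gamma>,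
                 ({h1, new_half \<Gamma>}, gen [h1, new_half \<Gamma>]) #
                 ({Suc (new_half \<Gamma>), h2}, gen [Suc (new_half \<Gamma>), h2]) # os,
                 ({new_half \<Gamma>}, x) # ({Suc (new_half \<Gamma>)}, y) # ws, ss, ns))) |
      \<Gamma> h1 h2 os ws ss ns.
        (\<Gamma>, ({h1, h2}, gen [h1, h2]) # os, ws, ss, ns) \<in> dgraphs N W}"

text \<open>The double graph complex is \<open>chains N W\<close> modulo the span of \<open>com_rels scW N W X P\<close>, its quotient
  by the positivity relation is \<open>chains N W\<close> modulo \<open>com_plus_null scW N W X P\<close>.\<close>

definition com_rels ::
  "('k::field \<Rightarrow> 'w::ab_group_add \<Rightarrow> 'w) \<Rightarrow> int \<Rightarrow> (int \<Rightarrow> 'w set) \<Rightarrow> 'w set \<Rightarrow>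
     ('w \<Rightarrow> 'w \<Rightarrow> 'k) \<Rightarrow> (('k, 'w) dgraph \<Rightarrow>\<^sub>0 'k) set" where
  "com_rels scW N W X P = hat_rels scW N W \<union> Ainf_rels N W \<union> cutoff_rels N W X P"

definition positivity_rels ::
  "int \<Rightarrow> (int \<Rightarrow> 'w::zero set) \<Rightarrow> (('k::field, 'w) dgraph \<Rightarrow>\<^sub>0 'k) set" where
  "positivity_rels N W =
     {gen s | s. s \<in> dgraphs N W \<and> (\<exists>v\<in>normals (fst s). vdeg N (fst s) v \<le> 0)} \<union>
     {d_vertex (\<lambda>v' v'' x. op_iv N v' x + op_iv N v'' x) N W v s | s v.
        s \<in> oriented_graphs N W \<and> v \<in> normals (fst s) \<and> vdeg N (fst s) v = 0}"

definition com_plus_null ::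
  "('k::field \<Rightarrow> 'w::ab_group_add \<Rightarrow> 'w) \<Rightarrow> int \<Rightarrow> (int \<Rightarrow> 'w set) \<Rightarrow> 'w set \<Rightarrow>
     ('w \<Rightarrow> 'w \<Rightarrow> 'k) \<Rightarrow> (('k, 'w) dgraph \<Rightarrow>\<^sub>0 'k) set" where
  "com_plus_null scW N W X P = free.span (com_rels scW N W X P \<union> positivity_rels N W)"

text \<open>A linear operator \<open>D\<close> induces a differential of bidegree \<open>(k, l)\<close> on the quotient of
  \<open>chains N W\<close> by the subspace \<open>R\<close>.\<close>

definition induces_differential ::
  "int \<Rightarrow> (int \<Rightarrow> 'w::zero set) \<Rightarrow> (('k::field, 'w) dgraph \<Rightarrow>\<^sub>0 'k) set \<Rightarrow> int \<Rightarrow> int \<Rightarrow>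
     ((('k, 'w) dgraph \<Rightarrow>\<^sub>0 'k) \<Rightarrow> (('k, 'w) dgraph \<Rightarrow>\<^sub>0 'k)) \<Rightarrow> bool" where
  "induces_differential N W R k l D \<longleftrightarrow>
     Vector_Spaces.linear scale scale D \<and>
     D ` chains N W \<subseteq> chains N W \<and>
     D ` R \<subseteq> R \<and>
     (\<forall>p q. D ` chains_bideg N W p q \<subseteq> chains_bideg N W (p + k) (q + l)) \<and>
     (\<forall>x\<in>chains N W. D (D x) \<in> R)"


section \<open>Graded symplectic vector spaces\<close>

definition graded_space ::
  "('k::field \<Rightarrow> 'w::ab_group_add \<Rightarrow> 'w) \<Rightarrow> (int \<Rightarrow> 'w set) \<Rightarrow> bool" where
  "graded_space scW W \<longleftrightarrow> vector_space scW \<and>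
     (\<forall>a. module.subspace scW (W a)) \<and>
     (\<forall>x. \<exists>!f. (\<forall>a. f a \<in> W a) \<and> finite {a. f a \<noteq> 0} \<and> x = (\<Sum>a\<in>{a. f a \<noteq> 0}. f a))"

definition symplectic_form ::
  "('k::field \<Rightarrow> 'w::ab_group_add \<Rightarrow> 'w) \<Rightarrow> (int \<Rightarrow> 'w set) \<Rightarrow> int \<Rightarrow> ('w \<Rightarrow> 'w \<Rightarrow> 'k) \<Rightarrow> bool" where
  "symplectic_form scW W N \<omega> \<longleftrightarrow>
     (\<forall>x. Vector_Spaces.linear scW (*) (\<omega> x)) \<and>
     (\<forall>y. Vector_Spaces.linear scW (*) (\<lambda>x. \<omega> x y)) \<and>
     (\<forall>x. (\<forall>y. \<omega> x y = 0) \<longrightarrow> x = 0) \<and>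
     (\<forall>a b. \<forall>x\<in>W a. \<forall>y\<in>W b. \<omega> x y = - sgn_pow (a * b) * \<omega> y x) \<and>
     (\<forall>a b. \<forall>x\<in>W a. \<forall>y\<in>W b. a + b \<noteq> N \<longrightarrow> \<omega> x y = 0)"

definition homogeneous_basis ::
  "('k::field \<Rightarrow> 'w::ab_group_add \<Rightarrow> 'w) \<Rightarrow> (int \<Rightarrow> 'w set) \<Rightarrow> 'w set \<Rightarrow> bool" where
  "homogeneous_basis scW W X \<longleftrightarrow>
     \<not> module.dependent scW X \<and> module.span scW X = UNIV \<and> (\<forall>x\<in>X. \<exists>a. x \<in> W a)"

definition inverse_matrix :: "'w set \<Rightarrow> ('w \<Rightarrow> 'w \<Rightarrow> 'k::field) \<Rightarrow> ('w \<Rightarrow> 'w \<Rightarrow> 'k) \<Rightarrow> bool" where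
  "inverse_matrix X \<omega> P \<longleftrightarrow>
     (\<forall>x\<in>X. \<forall>z\<in>X. (\<Sum>y\<in>X. P x y * \<omega> y z) = (if x = z then 1 else 0)) \<and>
     (\<forall>x\<in>X. \<forall>z\<in>X. (\<Sum>y\<in>X. \<omega> x y * P y z) = (if x = z then 1 else 0))"

end

theory Submission
  imports Defs
begin

text \<open>Let \<open>v'\<close>, \<open>v''\<close> be the vertices into which \<open>d\<^sub>v\<close> splits \<open>v\<close>.  Besides \<open>d\<^sub>v\<close> consider the operators
  \<open>i\<^bsub>v'\<^esub> d\<^sub>v\<close>, \<open>i\<^bsub>v''\<^esub> d\<^sub>v\<close> and \<open>i\<^bsub>v'\<^esub> i\<^bsub>v''\<^esub> d\<^sub>v\<close>.  Since \<open>i\<^sub>w\<close> commutes with \<open>d\<^sub>v\<close> for \<open>w \<noteq> v\<close>,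
  \<open>L\<close> is the sum over \<open>v\<close> of \<open>(i\<^bsub>v'\<^esub> + i\<^bsub>v''\<^esub>) d\<^sub>v\<close>.

  Operators of this kind at two distinct vertices \<open>v\<close> and \<open>w\<close> anticommute: exchanging the order of the
  two splittings is an isomorphism which permutes the new half-edges, moving \<open>v' v''\<close> past \<open>w' w''\<close>
  gives the sign \<open>(-1)\<^bsup>vw\<^esup>\<close>, but moving \<open>v\<close> past \<open>w\<close> gives \<open>-(-1)\<^bsup>vw\<^esup>\<close>.  Hence in \<open>d\<^sup>2\<close> and \<open>L\<^sup>2\<close> only the
  terms remain in which one of the two new vertices is split again.  They replace \<open>v\<close> by a chain of
  three vertices, and every such chain arises by splitting off either end vertex first, with opposite signs.
  So these terms cancel in \<open>d\<^sup>2\<close>.  In \<open>L\<^sup>2\<close> two of the three vertices become special.  The terms with two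
  special end vertices cancel again; in the remaining ones the normal end vertex may be split off first,
  and then they have the form \<open>i\<^bsub>w'\<^esub> i\<^bsub>w''\<^esub> d\<^sub>w\<close> for a new vertex \<open>w\<close>.

  The same facts show that the relations are preserved.  For the positivity relation note that
  \<open>|v'| + |v''| = |v|\<close>: if \<open>|v| \<le> 0\<close>, one of the new vertices has degree \<open>\<le> 0\<close>, and if one of them
  becomes special, it has degree \<open>-1\<close> and the other one has degree \<open>|v| + 1\<close>, so that only \<open>|v| = 0\<close> is not
  covered by (i).  This is the case of (ii).\<close>

text \<open>The delicate point is that a splitting descends to \<open>C(v)\<close> at all. Cutting a
  sum over shuffles yields a shuffle relation in one of the two pieces, but this needs the sum over
  all orderings of one half with a fixed set of letters. Therefore the terms with prescribed
  half-edges \<open>h1\<close>, \<open>h2\<close> are regrouped by the set \<open>S\<close> of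
  letters of the first half, and the proof works with these groups. Vertices are not defined for
  isomorphism classes, so identities at a vertex are shown for one labelled graph, modulo its tensor
  relations. New half-edges always receive the next free labels; hence two orders of splitting give
  isomorphic and not equal graphs, and explicit permutations of labels compare them. The factor 1/2
  belongs to the flip from \<open>(a, S)\<close> to \<open>(N - a, v - S)\<close>, which exchanges
  \<open>v'\<close> and \<open>v''\<close>: each splitting is counted twice. Marking a vertex of
  wrong degree leads out of the \<open>N\<close>-graded graphs; there the chain space is zero, which
  keeps the identities uniform. The parity of \<open>N\<close> enters through signs: an edge has
  total degree \<open>N\<close>, so edges commute, and all exponents reduce to parities of block
  degrees.\<close>

type_synonym 'k tensor = "nat list \<Rightarrow>\<^sub>0 'k"
type_synonym ('k, 'w) chain = "('k, 'w) dgraph \<Rightarrow>\<^sub>0 'k"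

abbreviation perms :: "'a set \<Rightarrow> 'a list set" where "perms \<equiv> permutations_of_set"
abbreviation coeff :: "('g \<Rightarrow>\<^sub>0 'k::zero) \<Rightarrow> 'g \<Rightarrow> 'k" where "coeff \<equiv> Poly_Mapping.lookup"
lemmas perms_def = permutations_of_set_def

section \<open>Linear algebra\<close>

interpretation free_pair: vector_space_pair
  "scale :: 'k::field \<Rightarrow> ('g \<Rightarrow>\<^sub>0 'k) \<Rightarrow> ('g \<Rightarrow>\<^sub>0 'k)"
  "scale :: 'k::field \<Rightarrow> ('h \<Rightarrow>\<^sub>0 'k) \<Rightarrow> ('h \<Rightarrow>\<^sub>0 'k)"
  by unfold_locales

abbreviation lin :: "(('g \<Rightarrow>\<^sub>0 'k::field) \<Rightarrow> ('h \<Rightarrow>\<^sub>0 'k)) \<Rightarrow> bool" where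
  "lin f \<equiv> Vector_Spaces.linear scale scale f"

lemma linI:
  "(\<And>x y. f (x + y) = f x + f y) \<Longrightarrow> (\<And>c x. f (scale c x) = scale c (f x)) \<Longrightarrow> lin f"
  by (simp add: Vector_Spaces.linear_iff free.vector_space_axioms)

lemma lin_add: "lin f \<Longrightarrow> f (x + y) = f x + f y"
  and lin_scale: "lin f \<Longrightarrow> f (scale c x) = scale c (f x)"
  and lin_0: "lin f \<Longrightarrow> f 0 = 0"
  and lin_diff: "lin f \<Longrightarrow> f (x - y) = f x - f y"
  and lin_neg: "lin f \<Longrightarrow> f (- x) = - f x"
  and lin_sum: "lin f \<Longrightarrow> f (\<Sum>i\<in>A. g i) = (\<Sum>i\<in>A. f (g i))"
  by (simp_all add: free_pair.linear_add free_pair.linear_scale free_pair.linear_0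
      free_pair.linear_diff free_pair.linear_neg free_pair.linear_sum)

lemma lin_compose: "lin f \<Longrightarrow> lin g \<Longrightarrow> lin (\<lambda>x. g (f x))"
  by (simp add: Vector_Spaces.linear_iff)

lemma lin_id: "lin (\<lambda>x. x)"
  by (intro linI) auto

lemma lin_scale_op: "lin (scale c)"
  by (intro linI) (simp_all add: free.scale_right_distrib free.scale_scale mult.commute)

lemma lin_plus_op: "lin f \<Longrightarrow> lin g \<Longrightarrow> lin (\<lambda>x. f x + g x)"
  by (intro linI) (simp_all add: lin_add lin_scale free.scale_right_distrib)

lemma lin_minus_op: "lin f \<Longrightarrow> lin g \<Longrightarrow> lin (\<lambda>x. f x - g x)"
  by (intro linI) (simp_all add: lin_add lin_scale free.scale_right_diff_distrib)

lemma lin_sum_op: "(\<And>i. i \<in> A \<Longrightarrow> lin (f i)) \<Longrightarrow> lin (\<lambda>x. \<Sum>i\<in>A. f i x)"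
  by (intro linI) (simp_all add: lin_add lin_scale sum.distrib free.scale_sum_right)

lemma lin_span: "lin f \<Longrightarrow> (\<And>g. g \<in> G \<Longrightarrow> f g \<in> free.span R) \<Longrightarrow> x \<in> free.span G \<Longrightarrow> f x \<in> free.span R"
proof -
  assume f: "lin f" and G: "\<And>g. g \<in> G \<Longrightarrow> f g \<in> free.span R" and x: "x \<in> free.span G"
  show "f x \<in> free.span R"
    using x
  proof (induction rule: free.span_induct_alt)
    case base
    show ?case by (simp add: lin_0[OF f] free.span_zero)
  next
    case (step c g y)
    then show ?case
      by (simp add: lin_add[OF f] lin_scale[OF f] free.span_add free.span_scale G)
  qed
qed

lemma lin_eq_on_span:
  "lin f \<Longrightarrow> lin g \<Longrightarrow> (\<And>x. x \<in> G \<Longrightarrow> f x = g x) \<Longrightarrow> x \<in> free.span G \<Longrightarrow> f x = g x"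
  using lin_span[OF lin_minus_op, of f g G "{}" x] by (simp add: free.span_empty)

lemma lin_ext_superset:
  fixes x :: "'g \<Rightarrow>\<^sub>0 'k::field"
  assumes "finite S" "Poly_Mapping.keys x \<subseteq> S"
  shows "lin_ext f x = (\<Sum>g\<in>S. scale (coeff x g) (f g))"
  unfolding lin_ext_def using assms
  by (intro sum.mono_neutral_left) (auto simp: in_keys_iff)

lemma lin_lin_ext: "lin (lin_ext f :: ('g \<Rightarrow>\<^sub>0 'k::field) \<Rightarrow> ('h \<Rightarrow>\<^sub>0 'k))"
proof (rule linI)
  fix x y :: "'g \<Rightarrow>\<^sub>0 'k"
  let ?S = "Poly_Mapping.keys x \<union> Poly_Mapping.keys y"
  have "lin_ext f (x + y) = (\<Sum>g\<in>?S. scale (coeff (x + y) g) (f g))"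
    by (rule lin_ext_superset) (auto simp: Poly_Mapping.keys_add)
  also have "\<dots> = lin_ext f x + lin_ext f y"
    by (simp add: lin_ext_superset[of ?S] lookup_add free.scale_left_distrib sum.distrib)
  finally show "lin_ext f (x + y) = lin_ext f x + lin_ext f y" .
next
  fix c :: 'k and x :: "'g \<Rightarrow>\<^sub>0 'k"
  have "Poly_Mapping.keys (scale c x) \<subseteq> Poly_Mapping.keys x"
    by (auto simp: in_keys_iff)
  then show "lin_ext f (scale c x) = scale c (lin_ext f x)"
    by (simp add: lin_ext_superset[of "Poly_Mapping.keys x"] free.scale_sum_right)
qed

lemmas lin_ext_add = lin_add[OF lin_lin_ext]
  and lin_ext_scale = lin_scale[OF lin_lin_ext]
  and lin_ext_0 = lin_0[OF lin_lin_ext]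
  and lin_ext_diff = lin_diff[OF lin_lin_ext]
  and lin_ext_sum = lin_sum[OF lin_lin_ext]

lemma lookup_gen: "coeff (gen g :: _ \<Rightarrow>\<^sub>0 'k::field) h = (if g = h then 1 else 0)"
  by (simp add: gen_def lookup_single when_def)

lemma keys_gen [simp]: "Poly_Mapping.keys (gen g :: _ \<Rightarrow>\<^sub>0 'k::field) = {g}"
  by (simp add: gen_def)

lemma lin_ext_gen [simp]: "lin_ext f (gen g) = f g"
  by (simp add: lin_ext_def lookup_gen)

lemma expand_gen: "x = (\<Sum>g\<in>Poly_Mapping.keys x. scale (coeff x g) (gen g))"
proof -
  have *: "coeff (\<Sum>g\<in>S. scale (coeff x g) (gen g)) h =
     (if h \<in> S then coeff x h else 0)" if "finite S" for S h
    using that by induction (auto simp: lookup_add lookup_gen)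
  show ?thesis
    by (rule poly_mapping_eqI) (auto simp: * in_keys_iff)
qed

lemma in_span_gen: "x \<in> free.span (gen ` S) \<longleftrightarrow> Poly_Mapping.keys x \<subseteq> S"
proof
  assume "x \<in> free.span (gen ` S)"
  then show "Poly_Mapping.keys x \<subseteq> S"
  proof (induction rule: free.span_induct_alt)
    case (step c g y)
    then show ?case
      using Poly_Mapping.keys_add[of "scale c g" y]
      by (auto simp: in_keys_iff lookup_add lookup_gen split: if_splits)
  qed simp
next
  assume "Poly_Mapping.keys x \<subseteq> S"
  then show "x \<in> free.span (gen ` S)"
    by (subst expand_gen) (intro free.span_sum free.span_scale free.span_base, auto)
qed

lemma lin_lin_ext_compose: "lin L \<Longrightarrow> L (lin_ext f x) = lin_ext (\<lambda>g. L (f g)) x"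
  by (simp add: lin_ext_def lin_sum lin_scale)

lemma lin_ext_cong:
  "(\<And>g. g \<in> S \<Longrightarrow> f g = f' g) \<Longrightarrow> x \<in> free.span (gen ` S) \<Longrightarrow> lin_ext f x = lin_ext f' x"
  by (auto simp: in_span_gen lin_ext_def intro!: sum.cong)

lemma lin_ext_scale_fun: "lin_ext (\<lambda>g. scale c (f g)) x = scale c (lin_ext f x)"
  by (rule lin_lin_ext_compose[OF lin_scale_op, symmetric])

lemma lin_ext_sum_fun: "lin_ext (\<lambda>g. \<Sum>i\<in>A. f i g) x = (\<Sum>i\<in>A. lin_ext (f i) x)"
  unfolding lin_ext_def by (simp add: free.scale_sum_right sum.swap[of _ A])

section \<open>Congruence modulo the span of a set of relations\<close>

definition eqm :: "('g \<Rightarrow>\<^sub>0 'k::field) set \<Rightarrow> ('g \<Rightarrow>\<^sub>0 'k) \<Rightarrow> ('g \<Rightarrow>\<^sub>0 'k) \<Rightarrow> bool" where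
  "eqm R x y \<longleftrightarrow> x - y \<in> free.span R"

lemma eqm_refl [simp, intro]: "eqm R x x"
  by (simp add: eqm_def free.span_zero)

lemma eqm_sym: "eqm R x y \<Longrightarrow> eqm R y x"
  unfolding eqm_def using free.span_neg[of "x - y" R] by simp

lemma eqm_trans [trans]: "eqm R x y \<Longrightarrow> eqm R y z \<Longrightarrow> eqm R x z"
  unfolding eqm_def using free.span_add[of "x - y" R "y - z"] by simp

lemma eqm_add: "eqm R x y \<Longrightarrow> eqm R x' y' \<Longrightarrow> eqm R (x + x') (y + y')"
  unfolding eqm_def using free.span_add[of "x - y" R "x' - y'"] by (simp add: algebra_simps)

lemma eqm_scale: "eqm R x y \<Longrightarrow> eqm R (scale c x) (scale c y)"
  unfolding eqm_def using free.span_scale[of "x - y" R c] by (simp add: free.scale_right_diff_distrib)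

lemma eqm_neg: "eqm R x y \<Longrightarrow> eqm R (- x) (- y)"
  using eqm_scale[of R x y "- 1"] by (simp add: free.scale_minus_left)

lemma eqm_diff: "eqm R x y \<Longrightarrow> eqm R x' y' \<Longrightarrow> eqm R (x - x') (y - y')"
  using eqm_add[of R x y "- x'" "- y'"] by (simp add: eqm_neg)

lemma eqm_sum: "(\<And>i. i \<in> A \<Longrightarrow> eqm R (f i) (g i)) \<Longrightarrow> eqm R (sum f A) (sum g A)"
  unfolding eqm_def by (simp flip: sum_subtractf add: free.span_sum)

lemma eqm_mono: "eqm R x y \<Longrightarrow> R \<subseteq> free.span R' \<Longrightarrow> eqm R' x y"
  unfolding eqm_def by (metis free.span_mono free.span_span subsetD)

lemma eqm_0_iff: "eqm R x 0 \<longleftrightarrow> x \<in> free.span R"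
  by (simp add: eqm_def)

lemma eqm_in_span: "eqm R x y \<Longrightarrow> y \<in> free.span R \<Longrightarrow> x \<in> free.span R"
  using eqm_trans[of R x y 0] by (simp add: eqm_0_iff)

lemma eqm_lin:
  "lin f \<Longrightarrow> (\<And>r. r \<in> R \<Longrightarrow> f r \<in> free.span R') \<Longrightarrow> eqm R x y \<Longrightarrow> eqm R' (f x) (f y)"
  unfolding eqm_def using lin_span[of f R R' "x - y"] by (simp add: lin_diff)

lemma eqm_on_span:
  assumes "lin f" "lin g" "\<And>x. x \<in> G \<Longrightarrow> eqm R (f x) (g x)" "x \<in> free.span G"
  shows "eqm R (f x) (g x)"
  using lin_span[OF lin_minus_op[OF assms(1,2)], of G R x] assms(3,4) by (simp add: eqm_def)

section \<open>Signs\<close>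

lemma sgn_pow_add: "sgn_pow (a + b) = (sgn_pow a * sgn_pow b :: 'k::field)"
  by (simp add: sgn_pow_def)

lemma sgn_pow_0 [simp]: "sgn_pow 0 = 1"
  by (simp add: sgn_pow_def)

lemma sgn_pow_square [simp]: "sgn_pow a * sgn_pow a = (1 :: 'k::field)"
  by (simp add: sgn_pow_def)

lemma sgn_pow_square_left [simp]: "sgn_pow a * (sgn_pow a * x) = (x :: 'k::field)"
  by (simp add: sgn_pow_def)

lemma sgn_pow_sum: "finite A \<Longrightarrow> sgn_pow (\<Sum>a\<in>A. f a) = (\<Prod>a\<in>A. sgn_pow (f a) :: 'k::field)"
  by (induction rule: finite_induct) (simp_all add: sgn_pow_add)

lemma sgn_sym_square [simp]: "sgn_sym \<delta> u v * sgn_sym \<delta> v u = (1 :: 'k::field)"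
  by (simp add: sgn_sym_def mult.commute)

lemma sgn_alt_square [simp]: "sgn_alt \<delta> u v * sgn_alt \<delta> v u = (1 :: 'k::field)"
  by (simp add: sgn_alt_def mult.commute)

section \<open>Koszul signs of reorderings\<close>

lemma before_Nil [simp]: "\<not> before a b []"
  by (simp add: before_def)

lemma before_Cons: "before a b (x # xs) \<longleftrightarrow> (a = x \<and> b \<in> set xs) \<or> before a b xs"
proof
  assume "before a b (x # xs)"
  then obtain us vs ws where *: "x # xs = us @ a # vs @ b # ws" by (auto simp: before_def)
  show "(a = x \<and> b \<in> set xs) \<or> before a b xs"
  proof (cases us)
    case Nil with * show ?thesis by auto
  next
    case (Cons u us') with * show ?thesis by (auto simp: before_def)
  qed
next
  assume "(a = x \<and> b \<in> set xs) \<or> before a b xs"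
  then show "before a b (x # xs)"
  proof
    assume *: "a = x \<and> b \<in> set xs"
    then obtain vs ws where "xs = vs @ b # ws" by (meson split_list)
    with * show ?thesis unfolding before_def by (metis append_Nil)
  next
    assume "before a b xs"
    then obtain us vs ws where *: "xs = us @ a # vs @ b # ws" by (auto simp: before_def)
    show ?thesis unfolding before_def
      by (intro exI[of _ "x # us"] exI[of _ vs] exI[of _ ws]) (simp add: *)
  qed
qed

lemma before_append:
  "before a b (xs @ ys) \<longleftrightarrow> before a b xs \<or> before a b ys \<or> a \<in> set xs \<and> b \<in> set ys"
  by (induction xs) (auto simp: before_Cons)

lemma before_in_set: "before a b xs \<Longrightarrow> a \<in> set xs \<and> b \<in> set xs"
  by (auto simp: before_def)

lemma before_asym: "distinct xs \<Longrightarrow> before a b xs \<Longrightarrow> \<not> before b a xs \<and> a \<noteq> b"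
  by (induction xs) (auto simp: before_Cons dest: before_in_set)

lemma before_total: "a \<in> set xs \<Longrightarrow> b \<in> set xs \<Longrightarrow> a \<noteq> b \<Longrightarrow> before a b xs \<or> before b a xs"
  by (induction xs) (auto simp: before_Cons)

lemma before_map:
  assumes "inj_on \<phi> (set xs)" "a \<in> set xs" "b \<in> set xs"
  shows "before (\<phi> a) (\<phi> b) (map \<phi> xs) \<longleftrightarrow> before a b xs"
proof -
  have "before (\<phi> a) (\<phi> b) (map \<phi> ys) \<longleftrightarrow> before a b ys" if "set ys \<subseteq> set xs" for ys
    using that assms by (induction ys) (auto simp: before_Cons inj_on_eq_iff)
  then show ?thesis by blast
qed

text \<open>The index set of \<open>koszul\<close> changes with the first list. Indexing by
  numerically ordered pairs \<open>a < b\<close> makes it common to all orderings of the same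
  letters, so that products of signs can be formed factor by factor; the factor of a pair is
  symmetric in its two letters.\<close>

lemma koszul_altdef:
  assumes "distinct xs" "distinct ys" "set ys = set xs"
  shows "koszul \<delta> xs ys = (\<Prod>(a, b)\<in>{(a, b). a \<in> set xs \<and> b \<in> set xs \<and> a < b}.
     if before a b xs = before a b ys then 1 else sgn_pow (\<delta> a * \<delta> b) :: 'k::field)"
proof -
  let ?S = "{(a, b). a \<in> set xs \<and> b \<in> set xs \<and> a < b}"
  let ?T = "{(a, b). a \<in> set xs \<and> b \<in> set xs \<and> a < b \<and> before a b xs \<noteq> before a b ys}"
  have fin: "finite ?S"
    by (rule finite_subset[of _ "set xs \<times> set xs"]) auto
  have "koszul \<delta> xs ys = (\<Prod>(a, b)\<in>?T. sgn_pow (\<delta> a * \<delta> b) :: 'k)"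
    unfolding koszul_def
  proof (rule prod.reindex_bij_witness[of _ "\<lambda>(a, b). if before a b xs then (a, b) else (b, a)"
        "\<lambda>(a, b). (min a b, max a b)"], goal_cases)
    case (1 p)
    then show ?case
      using before_asym[OF assms(1)] before_asym[OF assms(2)]
      by (auto simp: min_def max_def)
  next
    case (2 p)
    obtain a b where p: "p = (a, b)" by force
    with 2 have ab: "before a b xs" "before b a ys" by auto
    then show ?case
      using before_asym[OF assms(1)] before_asym[OF assms(2)] before_in_set[OF ab(1)]
        linorder_less_linear[of a b] by (auto simp: p min_def max_def)
  next
    case (3 p)
    obtain a b where p: "p = (a, b)" by force
    with 3 show ?case
      using before_total[of a xs b] by (auto simp: min_def max_def)
  next
    case (4 p)
    obtain a b where p: "p = (a, b)" by force
    with 4 show ?case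
      using before_total[of a xs b] before_total[of a ys b] before_asym[OF assms(2)]
        before_asym[OF assms(1)] assms(3) by (auto split: if_splits)
  next
    case (5 p)
    then show ?case by (auto simp: min_def max_def mult.commute)
  qed
  also have "\<dots> = (\<Prod>p\<in>?S. if before (fst p) (snd p) xs = before (fst p) (snd p) ys then 1
       else sgn_pow (\<delta> (fst p) * \<delta> (snd p)))"
    using fin by (intro prod.mono_neutral_cong_left) (auto split: if_splits)
  finally show ?thesis by (simp add: case_prod_unfold)
qed

lemma koszul_refl [simp]: "distinct xs \<Longrightarrow> koszul \<delta> xs xs = (1 :: 'k::field)"
  by (auto simp: koszul_def dest: before_asym intro!: prod.neutral)

text \<open>A pair is reversed from \<open>xs\<close> to \<open>zs\<close> exactly when it is
  reversed in one but not both of the two steps, and a factor that occurs twice is the square of a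
  sign. Most sign comparisons below are instances of this cocycle rule.\<close>

lemma koszul_trans:
  assumes "distinct xs" "distinct ys" "distinct zs" "set ys = set xs" "set zs = set xs"
  shows "koszul \<delta> xs ys * koszul \<delta> ys zs = (koszul \<delta> xs zs :: 'k::field)"
  using assms
  by (simp add: koszul_altdef flip: prod.distrib) (auto intro!: prod.cong split: if_splits)

lemma koszul_cong: "(\<And>a. a \<in> set xs \<Longrightarrow> \<delta> a = \<delta>' a) \<Longrightarrow> koszul \<delta> xs ys = koszul \<delta>' xs ys"
  unfolding koszul_def by (intro prod.cong) (auto dest: before_in_set)

lemma koszul_append:
  assumes "distinct (xs @ ys)" "distinct xs'" "distinct ys'" "set xs' = set xs" "set ys' = set ys"
  shows "koszul \<delta> (xs @ ys) (xs' @ ys') = (koszul \<delta> xs xs' * koszul \<delta> ys ys' :: 'k::field)"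
proof -
  have eq: "{(a, b). before a b (xs @ ys) \<and> before b a (xs' @ ys')} =
    {(a, b). before a b xs \<and> before b a xs'} \<union> {(a, b). before a b ys \<and> before b a ys'}"
    using assms by (auto simp: before_append dest: before_in_set)
  have fin: "finite {(a, b). before a b zs \<and> before b a zs'}" for zs zs' :: "nat list"
    by (rule finite_subset[of _ "set zs \<times> set zs"]) (auto dest: before_in_set)
  show ?thesis unfolding koszul_def eq
    using assms by (intro prod.union_disjoint fin) (auto dest!: before_in_set)
qed

text \<open>The reversed pairs are exactly \<open>set xs \<times> set ys\<close>, so the exponent is
  the product of the total degrees: blocks are exchanged like single letters.\<close>

lemma koszul_swap:
  assumes "distinct (xs @ ys)"
  shows "koszul \<delta> (xs @ ys) (ys @ xs) = (sgn_pow (sum \<delta> (set xs) * sum \<delta> (set ys)) :: 'k::field)"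
proof -
  have eq: "{(a, b). before a b (xs @ ys) \<and> before b a (ys @ xs)} = set xs \<times> set ys"
  proof -
    have "\<not> (before a b xs \<and> before b a xs)" "\<not> (before a b ys \<and> before b a ys)" for a b
      using assms before_asym[of xs a b] before_asym[of ys a b] by (metis distinct_append)+
    moreover have "set xs \<inter> set ys = {}"
      using assms by simp
    ultimately show ?thesis
      unfolding before_append by (fast dest: before_in_set)
  qed
  show ?thesis
  proof -
    have "sum \<delta> (set xs) * sum \<delta> (set ys) = (\<Sum>p\<in>set xs \<times> set ys. \<delta> (fst p) * \<delta> (snd p))"
      by (simp only: sum_product sum.cartesian_product case_prod_unfold)
    then have "sgn_pow (sum \<delta> (set xs) * sum \<delta> (set ys)) =
      (\<Prod>p\<in>set xs \<times> set ys. sgn_pow (\<delta> (fst p) * \<delta> (snd p)) :: 'k)"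
      by (simp only: sgn_pow_sum finite_cartesian_product finite_set)
    then show ?thesis
      unfolding koszul_def eq by (simp only: case_prod_unfold)
  qed
qed

lemma koszul_map:
  assumes "inj_on \<phi> (set xs)" "set ys = set xs" "\<And>a. a \<in> set xs \<Longrightarrow> \<delta>' (\<phi> a) = \<delta> a"
  shows "koszul \<delta>' (map \<phi> xs) (map \<phi> ys) = koszul \<delta> xs ys"
  unfolding koszul_def
proof (rule prod.reindex_bij_witness[of _ "\<lambda>(a, b). (\<phi> a, \<phi> b)"
      "\<lambda>(a, b). (inv_into (set xs) \<phi> a, inv_into (set xs) \<phi> b)"], goal_cases)
  case (1 p)
  then obtain a b where p: "p = (a, b)" and ab: "before a b (map \<phi> xs)" by auto
  then have "a \<in> \<phi> ` set xs" "b \<in> \<phi> ` set xs"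
    using before_in_set[OF ab] by auto
  then show ?case by (simp add: p f_inv_into_f)
next
  case (2 p)
  then obtain a b where p: "p = (a, b)" and ab: "before a b (map \<phi> xs)" "before b a (map \<phi> ys)" by auto
  then obtain c d where "a = \<phi> c" "b = \<phi> d" "c \<in> set xs" "d \<in> set xs"
    using before_in_set[OF ab(1)] by auto
  with ab show ?case using assms before_map[of \<phi> xs] before_map[of \<phi> ys] by (auto simp: p)
next
  case (3 p)
  then show ?case using assms by (auto dest!: before_in_set)
next
  case (4 p)
  then show ?case using assms before_map[of \<phi> xs] before_map[of \<phi> ys] by (auto dest: before_in_set)
next
  case (5 p)
  then show ?case using assms by (auto dest!: before_in_set)
qed

section \<open>Cyclic words\<close>

lemma lookup_sum: "coeff (sum f A) x = (\<Sum>a\<in>A. coeff (f a) x)"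
  by (induction A rule: infinite_finite_induct) (simp_all add: lookup_add)

lemma cyc_Nil [simp]: "cyc \<delta> [] = 0"
  by (simp add: cyc_def)

lemma inj_on_rotate: "distinct us \<Longrightarrow> inj_on (\<lambda>k. rotate k us) {..<length us}"
proof (rule inj_onI)
  fix k l
  assume *: "distinct us" "k \<in> {..<length us}" "l \<in> {..<length us}" "rotate k us = rotate l us"
  then have "us \<noteq> []" by auto
  with * have "us ! k = us ! l"
    by (metis hd_rotate_conv_nth lessThan_iff mod_less)
  with * show "k = l" by (simp add: nth_eq_iff_index_eq)
qed

text \<open>Since the letters are distinct, the rotations by less than the length are pairwise
  different words. No two summands of \<open>cyc\<close> meet, and each coefficient is a single
  sign.\<close>

lemma lookup_cyc:
  assumes "distinct us" "us \<noteq> []"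
  shows "coeff (cyc \<delta> us) vs =
    (if \<exists>k. vs = rotate k us then koszul \<delta> us vs else (0 :: 'k::field))"
proof (cases "\<exists>k. vs = rotate k us")
  case True
  then obtain k where "vs = rotate k us" by blast
  then have vs: "vs = rotate (k mod length us) us"
    by (simp add: rotate_drop_take)
  have k: "k mod length us < length us" using assms by simp
  have "coeff (cyc \<delta> us) vs = (\<Sum>l<length us. if l = k mod length us then koszul \<delta> us vs else 0 :: 'k)"
    unfolding cyc_def lookup_sum lookup_scale lookup_gen
    using inj_on_rotate[OF assms(1)] k by (intro sum.cong) (auto simp: vs inj_on_def)
  then show ?thesis using True k by simp
next
  case False
  then show ?thesis
    unfolding cyc_def lookup_sum lookup_scale lookup_gen by (auto intro!: sum.neutral)
qed

lemma rotate_iff: "(\<exists>k. vs = rotate k us) \<longleftrightarrow> (\<exists>xs ys. us = xs @ ys \<and> vs = ys @ xs)"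
proof
  assume "\<exists>k. vs = rotate k us"
  then show "\<exists>xs ys. us = xs @ ys \<and> vs = ys @ xs"
    by (metis rotate_drop_take append_take_drop_id)
next
  assume "\<exists>xs ys. us = xs @ ys \<and> vs = ys @ xs"
  then show "\<exists>k. vs = rotate k us"
    by (metis rotate_append)
qed

lemma rotate_swap_iff: "(\<exists>k. vs = rotate k (xs @ ys)) \<longleftrightarrow> (\<exists>k. vs = rotate k (ys @ xs))"
  by (metis rotate_append rotate_rotate)

text \<open>Only one rotation of a word with distinct letters puts \<open>h\<close> last.\<close>

lemma rotate_to_last_iff:
  assumes "distinct (A @ h # P)"
  shows "(\<exists>k. A @ h # P = rotate k (w @ [h])) \<longleftrightarrow> w = P @ A"
proof
  assume "\<exists>k. A @ h # P = rotate k (w @ [h])"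
  then obtain xs ys where *: "w @ [h] = xs @ ys" "A @ h # P = ys @ xs"
    unfolding rotate_iff by blast
  show "w = P @ A"
  proof (cases ys rule: rev_cases)
    case Nil
    with * have eq: "A @ h # P = w @ h # []" by simp
    with assms have "h \<notin> set A" "h \<notin> set w" by (auto dest: arg_cong[of _ _ distinct])
    with eq show ?thesis by (auto simp: append_eq_append_conv2 Cons_eq_append_conv append_eq_Cons_conv)
  next
    case (snoc ys' y)
    with * have eq: "A @ h # P = ys' @ h # xs" and w: "w = xs @ ys'" by auto
    with assms have "h \<notin> set A" "h \<notin> set ys'" by (auto dest: arg_cong[of _ _ distinct])
    with eq w show ?thesis by (auto simp: append_eq_append_conv2 Cons_eq_append_conv append_eq_Cons_conv)
  qed
next
  assume "w = P @ A"
  then show "\<exists>k. A @ h # P = rotate k (w @ [h])"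
    unfolding rotate_iff by (intro exI[of _ P] exI[of _ "A @ [h]"]) auto
qed

text \<open>By the cocycle rule, all coefficients of the two cyclic words differ by the same sign.
  This allows a new half-edge to stand at either end of a piece.\<close>

lemma cyc_swap:
  assumes "distinct (xs @ ys)"
  shows "cyc \<delta> (ys @ xs) = scale (koszul \<delta> (ys @ xs) (xs @ ys)) (cyc \<delta> (xs @ ys) :: _ \<Rightarrow>\<^sub>0 'k::field)"
proof (cases "xs @ ys = []")
  case False
  show ?thesis
  proof (rule poly_mapping_eqI)
    fix vs
    show "coeff (cyc \<delta> (ys @ xs)) vs =
      coeff (scale (koszul \<delta> (ys @ xs) (xs @ ys)) (cyc \<delta> (xs @ ys)) :: _ \<Rightarrow>\<^sub>0 'k) vs"
    proof (cases "\<exists>k. vs = rotate k (xs @ ys)")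
      case True
      then have "distinct vs" "set vs = set (ys @ xs)" using assms by auto
      then have "koszul \<delta> (ys @ xs) (xs @ ys) * koszul \<delta> (xs @ ys) vs = (koszul \<delta> (ys @ xs) vs :: 'k)"
        using assms by (intro koszul_trans) auto
      moreover have "coeff (cyc \<delta> (xs @ ys)) vs = (koszul \<delta> (xs @ ys) vs :: 'k)"
        by (subst lookup_cyc) (use assms False True in simp_all)
      moreover have "coeff (cyc \<delta> (ys @ xs)) vs = (koszul \<delta> (ys @ xs) vs :: 'k)"
        by (subst lookup_cyc) (use assms False True[unfolded rotate_swap_iff[of vs xs ys]] in auto)
      ultimately show ?thesis by simp
    next
      case no: False
      then have no': "\<not> (\<exists>k. vs = rotate k (ys @ xs))"
        using rotate_swap_iff by blast
      show ?thesis
        using assms False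
        by (subst lookup_scale, subst (1 2) lookup_cyc) (auto simp only: no no', auto)
    qed
  qed
qed simp

lemma cyc_in_Cyc: "us \<in> perms U \<Longrightarrow> cyc \<delta> us \<in> Cyc \<delta> U"
  unfolding Cyc_def by (intro free.span_base) auto

lemma subspace_Cyc: "free.subspace (Cyc \<delta> U)"
  by (simp add: Cyc_def)

lemma cyc_cong: "(\<And>a. a \<in> set us \<Longrightarrow> \<delta> a = \<delta>' a) \<Longrightarrow> cyc \<delta> us = cyc \<delta>' us"
  unfolding cyc_def by (auto intro!: sum.cong arg_cong2[of _ _ _ _ scale] koszul_cong)

lemma Cyc_cong: "(\<And>a. a \<in> U \<Longrightarrow> \<delta> a = \<delta>' a) \<Longrightarrow> Cyc \<delta> U = Cyc \<delta>' U"
  unfolding Cyc_def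
  by (intro arg_cong[of _ _ free.span] image_cong cyc_cong) (auto dest: permutations_of_setD)

lemma keys_cyc: "Poly_Mapping.keys (cyc \<delta> us :: _ \<Rightarrow>\<^sub>0 'k::field) \<subseteq> {vs. \<exists>k. vs = rotate k us}"
proof
  fix vs
  assume "vs \<in> Poly_Mapping.keys (cyc \<delta> us :: _ \<Rightarrow>\<^sub>0 'k)"
  then have "(\<Sum>k<length us. koszul \<delta> us (rotate k us) * (if rotate k us = vs then 1 else 0)) \<noteq> (0 :: 'k)"
    unfolding in_keys_iff cyc_def lookup_sum lookup_scale lookup_gen .
  then obtain k where "koszul \<delta> us (rotate k us) * (if rotate k us = vs then 1 else 0) \<noteq> (0 :: 'k)"
    by (meson sum.neutral)
  then show "vs \<in> {vs. \<exists>k. vs = rotate k us}"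
    by (auto split: if_splits)
qed

lemma keys_Cyc: "c \<in> Cyc \<delta> U \<Longrightarrow> Poly_Mapping.keys c \<subseteq> perms U"
proof -
  assume c: "c \<in> Cyc \<delta> U"
  have "Cyc \<delta> U \<subseteq> free.span (gen ` perms U :: (nat list \<Rightarrow>\<^sub>0 'a) set)"
    unfolding Cyc_def
  proof (rule free.span_minimal)
    show "cyc \<delta> ` perms U \<subseteq> free.span (gen ` perms U :: (nat list \<Rightarrow>\<^sub>0 'a) set)"
      using keys_cyc by (fastforce simp: in_span_gen perms_def)
  qed auto
  with c show ?thesis by (auto simp: in_span_gen[symmetric])
qed

text \<open>The rule is linear in \<open>c\<close>, so it suffices to check the generators, where it
  is the cocycle rule. For a splitting it compares the coefficient at \<open>A @ B\<close> with that
  at \<open>B @ A\<close>, that is, the same cut with its two pieces in the other order.\<close>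

lemma lookup_Cyc_swap:
  assumes "c \<in> Cyc \<delta> U" "xs @ ys \<in> perms U"
  shows "coeff c (ys @ xs) =
    (koszul \<delta> (xs @ ys) (ys @ xs) :: 'k::field) * coeff c (xs @ ys)"
  using assms(1) unfolding Cyc_def
proof (induction rule: free.span_induct_alt)
  case base
  then show ?case by simp
next
  case (step k g y)
  then obtain us where us: "us \<in> perms U" "g = cyc \<delta> us" by blast
  have d: "distinct us" "set us = U" "distinct (xs @ ys)" "set xs \<union> set ys = U"
    using us assms(2) by (auto simp: perms_def)
  have "coeff g (ys @ xs) = koszul \<delta> (xs @ ys) (ys @ xs) * coeff g (xs @ ys)"
  proof (cases "us = []")
    case False
    have "koszul \<delta> us (xs @ ys) * koszul \<delta> (xs @ ys) (ys @ xs) = (koszul \<delta> us (ys @ xs) :: 'k)"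
      using d by (intro koszul_trans) auto
    moreover have "(\<exists>k. xs @ ys = rotate k us) \<longleftrightarrow> (\<exists>k. ys @ xs = rotate k us)"
      by (metis rotate_append rotate_rotate)
    ultimately show ?thesis
      using d False by (auto simp: us(2) lookup_cyc mult.commute)
  qed (simp add: us)
  with step show ?case by (simp add: lookup_add algebra_simps)
qed

lemma cyc_map:
  assumes "inj_on \<phi> (set us)" "\<And>a. a \<in> set us \<Longrightarrow> \<delta>' (\<phi> a) = \<delta> a"
  shows "lin_ext (gen \<circ> map \<phi>) (cyc \<delta> us) = cyc \<delta>' (map \<phi> us)"
  unfolding cyc_def lin_ext_sum lin_ext_scale lin_ext_gen
  using assms by (auto intro!: sum.cong simp: rotate_map koszul_map)

lemma map_map_gen_id:
  assumes "Poly_Mapping.keys c \<subseteq> perms U" "\<And>a. a \<in> U \<Longrightarrow> \<phi> a = a"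
  shows "lin_ext (gen \<circ> map \<phi>) c = c"
proof -
  have "lin_ext (gen \<circ> map \<phi>) c = lin_ext gen c"
    using assms by (intro lin_ext_cong[of "perms U"])
      (auto simp: in_span_gen map_idI perms_def)
  also have "\<dots> = c" unfolding lin_ext_def by (rule expand_gen[symmetric])
  finally show ?thesis .
qed

lemma lookup_map_gen:
  assumes "Poly_Mapping.keys c \<subseteq> perms U" "inj_on \<phi> U" "set us = U"
  shows "coeff (lin_ext (gen \<circ> map \<phi>) c) (map \<phi> us) = coeff c us"
proof -
  have "coeff (lin_ext (gen \<circ> map \<phi>) c) (map \<phi> us) =
    (\<Sum>g\<in>Poly_Mapping.keys c. if g = us then coeff c g else 0)"
    unfolding lin_ext_def lookup_sum lookup_scale comp_def lookup_gen
  proof (intro sum.cong refl)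
    fix g assume "g \<in> Poly_Mapping.keys c"
    then have "set g = U" using assms by (auto simp: perms_def)
    then have "map \<phi> g = map \<phi> us \<longleftrightarrow> g = us"
      using assms by (metis inj_on_map_eq_map sup.idem)
    then show "coeff c g * (if map \<phi> g = map \<phi> us then 1 else 0) =
      (if g = us then coeff c g else 0)" by simp
  qed
  also have "\<dots> = coeff c us"
    by (simp add: in_keys_iff)
  finally show ?thesis .
qed

subsection \<open>The commutativity relations\<close>

text \<open>The generators of the commutativity relations, with the two shuffled words as separate
  arguments instead of one word and a cut position; the words can then be restricted to a piece of
  the vertex one by one.\<close>

definition shuffle_cyc :: "(nat \<Rightarrow> int) \<Rightarrow> nat list \<Rightarrow> nat list \<Rightarrow> nat \<Rightarrow> (nat list \<Rightarrow>\<^sub>0 'k::field)" where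
  "shuffle_cyc \<delta> xs ys h = (\<Sum>w\<in>shuffles xs ys. scale (koszul \<delta> (xs @ ys) w) (cyc \<delta> (w @ [h])))"

lemma C_null_altdef:
  "C_null \<delta> U = free.span {shuffle_cyc \<delta> xs ys h | xs ys h.
     xs @ ys @ [h] \<in> perms U \<and> xs \<noteq> [] \<and> ys \<noteq> []}"
proof -
  have "{\<Sum>w\<in>shuffles (take s hs) (drop s hs). scale (koszul \<delta> hs w) (cyc \<delta> (w @ [h])) :: nat list \<Rightarrow>\<^sub>0 'a |
        hs h s. hs @ [h] \<in> perms U \<and> 0 < s \<and> s < length hs} =
     {shuffle_cyc \<delta> xs ys h | xs ys h.
       xs @ ys @ [h] \<in> perms U \<and> xs \<noteq> [] \<and> ys \<noteq> []}" (is "?A = ?B")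
  proof
    show "?A \<subseteq> ?B"
    proof
      fix c assume "c \<in> ?A"
      then obtain hs h s where *: "c = (\<Sum>w\<in>shuffles (take s hs) (drop s hs). scale (koszul \<delta> hs w) (cyc \<delta> (w @ [h])))"
        "hs @ [h] \<in> perms U" "0 < s" "s < length hs" by blast
      then show "c \<in> ?B"
        by (intro CollectI exI[of _ "take s hs"] exI[of _ "drop s hs"] exI[of _ h])
          (auto simp: shuffle_cyc_def append_assoc[symmetric] simp del: append_assoc)
    qed
    show "?B \<subseteq> ?A"
    proof
      fix c assume "c \<in> ?B"
      then obtain xs ys h where *: "c = shuffle_cyc \<delta> xs ys h"
        "xs @ ys @ [h] \<in> perms U" "xs \<noteq> []" "ys \<noteq> []" by blast
      then show "c \<in> ?A"
        by (intro CollectI exI[of _ "xs @ ys"] exI[of _ h] exI[of _ "length xs"])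
          (auto simp: shuffle_cyc_def)
    qed
  qed
  then show ?thesis by (simp add: C_null_def)
qed

lemma shuffle_cyc_in_C_null:
  "xs @ ys @ [h] \<in> perms U \<Longrightarrow> xs \<noteq> [] \<Longrightarrow> ys \<noteq> [] \<Longrightarrow> shuffle_cyc \<delta> xs ys h \<in> C_null \<delta> U"
  unfolding C_null_altdef by (rule free.span_base) blast

text \<open>Without common letters, a shuffle is recognised by its restrictions to the two
  alphabets. This criterion is compatible with concatenation, which is what cutting a word
  requires.\<close>

lemma in_shuffles_iff:
  assumes "set xs \<inter> set ys = {}" "set w = set xs \<union> set ys"
  shows "w \<in> shuffles xs ys \<longleftrightarrow> filter (\<lambda>a. a \<in> set xs) w = xs \<and> filter (\<lambda>a. a \<in> set ys) w = ys"
proof -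
  have eq: "filter (\<lambda>a. a \<notin> set xs) w = filter (\<lambda>a. a \<in> set ys) w"
    using assms by (intro filter_cong) auto
  show ?thesis
  proof
    assume "w \<in> shuffles xs ys"
    then show "filter (\<lambda>a. a \<in> set xs) w = xs \<and> filter (\<lambda>a. a \<in> set ys) w = ys"
      using filter_shuffles_disjoint1[OF assms(1)] filter_shuffles_disjoint2[OF assms(1)] by simp
  next
    assume "filter (\<lambda>a. a \<in> set xs) w = xs \<and> filter (\<lambda>a. a \<in> set ys) w = ys"
    then show "w \<in> shuffles xs ys"
      using partition_in_shuffles[of w "\<lambda>a. a \<in> set xs"] eq by simp
  qed
qed

lemma shuffles_distinct:
  "distinct (xs @ ys) \<Longrightarrow> w \<in> shuffles xs ys \<Longrightarrow> distinct w \<and> set w = set xs \<union> set ys"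
  by (auto simp: set_shuffles dest: distinct_disjoint_shuffles)

lemma shuffle_cyc_commute:
  assumes "distinct (xs @ ys)"
  shows "shuffle_cyc \<delta> ys xs h = scale (koszul \<delta> (ys @ xs) (xs @ ys)) (shuffle_cyc \<delta> xs ys h :: _ \<Rightarrow>\<^sub>0 'k::field)"
  unfolding shuffle_cyc_def free.scale_sum_right free.scale_scale shuffles_commutes[of ys]
proof (intro sum.cong refl)
  fix w assume "w \<in> shuffles xs ys"
  then have "set w = set xs \<union> set ys" "distinct w"
    using assms shuffles_distinct by auto
  then have "koszul \<delta> (ys @ xs) (xs @ ys) * koszul \<delta> (xs @ ys) w = (koszul \<delta> (ys @ xs) w :: 'k)"
    using assms by (intro koszul_trans) auto
  then show "scale (koszul \<delta> (ys @ xs) w) (cyc \<delta> (w @ [h])) =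
    scale (koszul \<delta> (ys @ xs) (xs @ ys) * koszul \<delta> (xs @ ys) w :: 'k) (cyc \<delta> (w @ [h]))" by simp
qed

text \<open>\<open>A h P\<close> is a rotation of \<open>P A h\<close> and of no other word ending
  in \<open>h\<close>, so at most one shuffle contributes. The sign of the shuffle and the sign of
  the rotation combine to the sign of the reordering of \<open>xs ys h\<close>.\<close>

lemma lookup_shuffle_cyc:
  assumes "distinct (xs @ ys @ [h])" "distinct (A @ h # P)" "set A \<union> set P = set xs \<union> set ys"
  shows "coeff (shuffle_cyc \<delta> xs ys h) (A @ h # P) =
    (if P @ A \<in> shuffles xs ys then koszul \<delta> (xs @ ys @ [h]) (A @ h # P) else (0 :: 'k::field))"
proof -
  have "coeff (shuffle_cyc \<delta> xs ys h) (A @ h # P) =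
    (\<Sum>w\<in>shuffles xs ys. if w = P @ A then koszul \<delta> (xs @ ys @ [h]) (A @ h # P) else (0 :: 'k))"
    unfolding shuffle_cyc_def lookup_sum lookup_scale
  proof (intro sum.cong refl)
    fix w assume w: "w \<in> shuffles xs ys"
    then have s: "set w = set xs \<union> set ys" and d: "distinct w"
      using assms shuffles_distinct[of xs ys w] by auto
    then have d': "distinct (w @ [h])" using assms by auto
    have k: "koszul \<delta> (xs @ ys) w * koszul \<delta> (w @ [h]) (A @ h # P) = (koszul \<delta> (xs @ ys @ [h]) (A @ h # P) :: 'k)"
    proof -
      have "koszul \<delta> ((xs @ ys) @ [h]) (w @ [h]) = (koszul \<delta> (xs @ ys) w * koszul \<delta> [h] [h] :: 'k)"
        using assms s d by (intro koszul_append) auto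
      then have "koszul \<delta> (xs @ ys) w = (koszul \<delta> (xs @ ys @ [h]) (w @ [h]) :: 'k)" by simp
      moreover have "koszul \<delta> (xs @ ys @ [h]) (w @ [h]) * koszul \<delta> (w @ [h]) (A @ h # P) =
          (koszul \<delta> (xs @ ys @ [h]) (A @ h # P) :: 'k)"
        using assms s d' by (intro koszul_trans) auto
      ultimately show ?thesis by simp
    qed
    have "coeff (cyc \<delta> (w @ [h])) (A @ h # P) =
       (if w = P @ A then koszul \<delta> (w @ [h]) (A @ h # P) else (0 :: 'k))"
      using lookup_cyc[OF d', of \<delta> "A @ h # P"] rotate_to_last_iff[OF assms(2), of w] by auto
    with k show "koszul \<delta> (xs @ ys) w * coeff (cyc \<delta> (w @ [h])) (A @ h # P) =
      (if w = P @ A then koszul \<delta> (xs @ ys @ [h]) (A @ h # P) else (0 :: 'k))" by auto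
  qed
  then show ?thesis by simp
qed

lemma koszul_sq: "koszul \<delta> xs ys * koszul \<delta> xs ys = (1 :: 'k::field)"
  unfolding koszul_def prod.distrib[symmetric] by (auto intro!: prod.neutral)

text \<open>Inserting a tensor as a decoration is not linear in the free space on decorated graphs;
  it becomes linear only modulo the multilinearity relations, and only for tensors in the space
  \<open>A\<close> that belongs to the vertex.\<close>

definition lin_mod ::
  "('g \<Rightarrow>\<^sub>0 'k::field) set \<Rightarrow> ('a \<Rightarrow>\<^sub>0 'k) set \<Rightarrow> (('a \<Rightarrow>\<^sub>0 'k) \<Rightarrow> ('g \<Rightarrow>\<^sub>0 'k)) \<Rightarrow> bool" where
  "lin_mod R A f \<longleftrightarrow> (\<forall>k. \<forall>x\<in>A. \<forall>y\<in>A. eqm R (f (scale k x + y)) (scale k (f x) + f y))"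

lemma lin_mod_0:
  assumes "free.subspace A" "lin_mod R A f"
  shows "eqm R (f 0) 0"
proof -
  have "0 \<in> A" using assms by (simp add: free.subspace_0)
  then have "eqm R (f (scale 1 0 + 0)) (scale 1 (f 0) + f 0)"
    using assms unfolding lin_mod_def by blast
  then have "eqm R (f 0 + f 0) (f 0)" by (simp add: eqm_sym)
  then show ?thesis by (simp add: eqm_def)
qed

lemma lin_mod_scale:
  assumes "free.subspace A" "lin_mod R A f" "x \<in> A"
  shows "eqm R (f (scale k x)) (scale k (f x))"
proof -
  have "0 \<in> A" using assms by (simp add: free.subspace_0)
  then have "eqm R (f (scale k x + 0)) (scale k (f x) + f 0)"
    using assms unfolding lin_mod_def by blast
  also have "eqm R \<dots> (scale k (f x) + 0)"
    by (intro eqm_add lin_mod_0[OF assms(1,2)]) auto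
  finally show ?thesis by simp
qed

lemma lin_mod_sum:
  assumes "free.subspace A" "lin_mod R A f" "\<And>i. i \<in> I \<Longrightarrow> x i \<in> A"
  shows "eqm R (f (\<Sum>i\<in>I. scale (k i) (x i))) (\<Sum>i\<in>I. scale (k i) (f (x i)))"
  using assms(3)
proof (induction I rule: infinite_finite_induct)
  case (insert i I)
  have "(\<Sum>i\<in>I. scale (k i) (x i)) \<in> A"
    using insert.prems assms(1) by (intro free.subspace_sum free.subspace_scale) auto
  then have "eqm R (f (scale (k i) (x i) + (\<Sum>i\<in>I. scale (k i) (x i))))
     (scale (k i) (f (x i)) + f (\<Sum>i\<in>I. scale (k i) (x i)))"
    using assms(2) insert.prems unfolding lin_mod_def by blast
  also have "eqm R \<dots> (scale (k i) (f (x i)) + (\<Sum>i\<in>I. scale (k i) (f (x i))))"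
    by (intro eqm_add insert.IH eqm_refl) (use insert.prems in auto)
  finally show ?case using insert.hyps by simp
qed (use lin_mod_0[OF assms(1,2)] in auto)

text \<open>A nonempty block has only one place in a word with distinct letters. Below the block is
  the last letter \<open>h\<close> of a relation, a new half-edge, or the whole word
  \<open>A\<close>.\<close>

lemma append_eq_middle:
  assumes "distinct (p @ a @ r)" "a \<noteq> []" "p @ a @ r = p' @ a @ r'"
  shows "p = p' \<and> r = r'"
proof -
  obtain x a' where a: "a = x # a'" using assms(2) by (cases a) auto
  have "distinct (p' @ a @ r')" using assms by simp
  then have "x \<notin> set p" "x \<notin> set p'" using assms(1) a by auto
  with assms(3) show ?thesis
    unfolding a by (auto simp: append_eq_append_conv2 Cons_eq_append_conv append_eq_Cons_conv)
qed

lemma filter_eq_self: "(\<And>a. a \<in> set xs \<Longrightarrow> P a) \<Longrightarrow> filter P xs = xs"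
  by simp

lemma filter_eq_Nil: "(\<And>a. a \<in> set xs \<Longrightarrow> \<not> P a) \<Longrightarrow> filter P xs = []"
  by simp

text \<open>The two pieces of a cut cyclic word \<open>P A R h\<close> are \<open>A\<close> and \<open>R h P\<close>.  In a sum over the shuffles of
  \<open>xs\<close> and \<open>ys\<close>, either \<open>A\<close> runs through the shuffles of nonempty parts of \<open>xs\<close> and \<open>ys\<close>, or \<open>A\<close> is a part of
  one of the two words and the rest, with \<open>h''\<close> in the place of \<open>A\<close>, runs through all shuffles.\<close>

context
  fixes \<delta> \<delta>' :: "nat \<Rightarrow> int" and S T :: "nat set" and h' h'' :: nat
    and \<Psi> :: "(nat list \<Rightarrow>\<^sub>0 'k::field) \<Rightarrow> 'k tensor \<Rightarrow> ('g \<Rightarrow>\<^sub>0 'k)" and R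
  assumes ST: "S \<inter> T = {}" "S \<noteq> {}"
    and new: "h' \<notin> S \<union> T" "h'' \<notin> S \<union> T"
    and \<delta>: "\<And>a. a \<in> S \<union> T \<Longrightarrow> \<delta>' a = \<delta> a"
    and lin1: "\<And>\<beta>. \<beta> \<in> Cyc \<delta>' (insert h'' T) \<Longrightarrow> lin_mod R (Cyc \<delta>' (insert h' S)) (\<lambda>\<alpha>. \<Psi> \<alpha> \<beta>)"
    and null1: "\<And>\<alpha> \<beta>. \<alpha> \<in> C_null \<delta>' (insert h' S) \<Longrightarrow> \<beta> \<in> Cyc \<delta>' (insert h'' T) \<Longrightarrow> \<Psi> \<alpha> \<beta> \<in> free.span R"
    and lin2: "\<And>\<alpha>. \<alpha> \<in> Cyc \<delta>' (insert h' S) \<Longrightarrow> lin_mod R (Cyc \<delta>' (insert h'' T)) (\<Psi> \<alpha>)"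
    and null2: "\<And>\<alpha> \<beta>. \<alpha> \<in> Cyc \<delta>' (insert h' S) \<Longrightarrow> \<beta> \<in> C_null \<delta>' (insert h'' T) \<Longrightarrow> \<Psi> \<alpha> \<beta> \<in> free.span R"
begin

text \<open>The word \<open>B = Q h P\<close> is fixed. If any \<open>A\<close> occurs with it, then
  \<open>P\<close> and \<open>Q\<close> already contain the right parts of \<open>xs\<close> and
  \<open>ys\<close> outside \<open>S\<close>; hence the possible \<open>A\<close> are exactly the
  shuffles of the restrictions of \<open>xs\<close> and \<open>ys\<close> to \<open>S\<close>, and
  their sum is a shuffle relation closed by \<open>h'\<close>.\<close>

lemma split_shuffle_left:
  assumes xyh: "xs @ ys @ [h] \<in> perms (S \<union> T)" and h: "h \<in> T"
    and ne: "filter (\<lambda>a. a \<in> S) xs \<noteq> []" "filter (\<lambda>a. a \<in> S) ys \<noteq> []"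
    and B: "B \<in> perms T"
  shows "(\<Sum>A\<in>perms S. scale (coeff (shuffle_cyc \<delta> xs ys h) (A @ B))
     (\<Psi> (cyc \<delta>' (A @ [h'])) (cyc \<delta>' (B @ [h''])))) \<in> free.span R"
proof -
  let ?xS = "filter (\<lambda>a. a \<in> S) xs" and ?yS = "filter (\<lambda>a. a \<in> S) ys"
  let ?\<beta> = "cyc \<delta>' (B @ [h''])"
  have xyd: "distinct xs" "distinct ys" "set xs \<inter> set ys = {}" "h \<notin> set xs" "h \<notin> set ys"
    "set xs \<union> set ys = S \<union> T - {h}"
    using xyh by (auto simp: perms_def)
  have hS: "h \<notin> S" using h ST by auto
  have Sxy: "S \<subseteq> set xs \<union> set ys" using xyd hS by auto
  have \<beta>: "?\<beta> \<in> Cyc \<delta>' (insert h'' T)"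
    using B new by (intro cyc_in_Cyc) (auto simp: perms_def)
  have "h \<in> set B" using B h by (simp add: perms_def)
  then obtain Q P where BQ: "B = Q @ h # P" by (meson split_list)
  have Bd: "distinct (Q @ h # P)" "set Q \<union> set P = T - {h}"
    using B BQ by (auto simp: perms_def)
  have co: "coeff (shuffle_cyc \<delta> xs ys h) (A @ B) =
      (if P @ A @ Q \<in> shuffles xs ys then koszul \<delta> (xs @ ys @ [h]) (A @ B) else (0 :: 'k))"
    if "A \<in> perms S" for A
  proof -
    have A: "distinct A" "set A = S" using that by (auto simp: perms_def)
    have "set (A @ Q) \<union> set P = set xs \<union> set ys"
      using A Bd(2) hS unfolding xyd(6) by auto
    moreover have "distinct (A @ Q @ h # P)" using A Bd ST h by auto
    ultimately show ?thesis
      using lookup_shuffle_cyc[of xs ys h "A @ Q" P \<delta>, where 'k = 'k, unfolded append_assoc] xyd BQ by simp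
  qed
  show ?thesis
  proof (cases "\<exists>A\<in>perms S. P @ A @ Q \<in> shuffles xs ys")
    case False
    then show ?thesis
      using co by (auto intro!: free.span_sum free.span_zero)
  next
    case True
    then obtain A0 where A0: "A0 \<in> perms S" "P @ A0 @ Q \<in> shuffles xs ys" by blast
    have sPAQ: "set (P @ A @ Q) = set xs \<union> set ys" if "A \<in> perms S" for A
      using that Bd xyd ST h by (auto simp: perms_def)
    note shiff = in_shuffles_iff[OF xyd(3) sPAQ]
    have nS: "filter (\<lambda>a. a \<in> S) (filter X P) = []" "filter (\<lambda>a. a \<in> S) (filter X Q) = []" for X
      using Bd ST by (auto intro!: filter_eq_Nil)
    have AS: "filter (\<lambda>a. a \<in> S) (filter X A) = filter X A" if "A \<in> perms S" for A X
      using that by (intro filter_eq_self) (auto simp: perms_def)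
    have eqs: "filter (\<lambda>a. a \<in> set xs) P @ filter (\<lambda>a. a \<in> set xs) A0 @ filter (\<lambda>a. a \<in> set xs) Q = xs"
      "filter (\<lambda>a. a \<in> set ys) P @ filter (\<lambda>a. a \<in> set ys) A0 @ filter (\<lambda>a. a \<in> set ys) Q = ys"
      using A0(2) unfolding shiff[OF A0(1)] by auto
    have "?xS = filter (\<lambda>a. a \<in> set xs) A0" "?yS = filter (\<lambda>a. a \<in> set ys) A0"
      by (subst eqs[symmetric], simp add: nS AS[OF A0(1)] del: filter_filter)+
    then have iff: "P @ A @ Q \<in> shuffles xs ys \<longleftrightarrow>
        filter (\<lambda>a. a \<in> set xs) A = ?xS \<and> filter (\<lambda>a. a \<in> set ys) A = ?yS"
      if "A \<in> perms S" for A
      unfolding shiff[OF that] using eqs by (metis filter_append append_same_eq same_append_eq)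
    have cong: "filter (\<lambda>a. a \<in> set xs) A = filter (\<lambda>a. a \<in> set ?xS) A"
      "filter (\<lambda>a. a \<in> set ys) A = filter (\<lambda>a. a \<in> set ?yS) A" if "A \<in> perms S" for A
      using that by (auto intro!: filter_cong simp: perms_def)
    have Sset: "set ?xS \<union> set ?yS = S" using Sxy by auto
    have d2: "distinct (?xS @ ?yS)" using xyd by auto
    have shS: "{A \<in> perms S. P @ A @ Q \<in> shuffles xs ys} = shuffles ?xS ?yS"
    proof (intro equalityI subsetI)
      fix A assume "A \<in> {A \<in> perms S. P @ A @ Q \<in> shuffles xs ys}"
      then have A: "A \<in> perms S" "P @ A @ Q \<in> shuffles xs ys" by auto
      have "set A = set ?xS \<union> set ?yS" using A(1) Sset by (auto simp: perms_def)
      then show "A \<in> shuffles ?xS ?yS"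
        using d2 A iff[OF A(1)] cong[OF A(1)] by (subst in_shuffles_iff) auto
    next
      fix A assume A: "A \<in> shuffles ?xS ?yS"
      then have A1: "A \<in> perms S"
        using shuffles_distinct[OF d2 A] Sset by (auto simp: perms_def)
      have "set A = set ?xS \<union> set ?yS" using A1 Sset by (auto simp: perms_def)
      then show "A \<in> {A \<in> perms S. P @ A @ Q \<in> shuffles xs ys}"
        using A d2 A1 iff[OF A1] cong[OF A1] in_shuffles_iff[of ?xS ?yS A] by auto
    qed
    \<comment> \<open>The sign of \<open>A\<close> relative to the reference order
      \<open>?xS @ ?yS\<close> splits off, and \<open>?K\<close> does not depend on
      \<open>A\<close>.\<close>
    let ?K = "koszul \<delta> (xs @ ys @ [h]) ((?xS @ ?yS) @ B) :: 'k"
    have k: "koszul \<delta> (xs @ ys @ [h]) (A @ B) = ?K * koszul \<delta>' (?xS @ ?yS) A"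
      if "A \<in> perms S" for A
    proof -
      have A: "distinct A" "set A = S" "distinct B" "set B = T"
        using that B by (auto simp: perms_def)
      have "koszul \<delta> ((?xS @ ?yS) @ B) (A @ B) = (koszul \<delta> (?xS @ ?yS) A * koszul \<delta> B B :: 'k)"
        using A Sset d2 ST by (intro koszul_append) auto
      moreover have "koszul \<delta> (?xS @ ?yS) A = (koszul \<delta>' (?xS @ ?yS) A :: 'k)"
        using \<delta> Sset by (intro koszul_cong) auto
      moreover have "?K * koszul \<delta> ((?xS @ ?yS) @ B) (A @ B) = koszul \<delta> (xs @ ys @ [h]) (A @ B)"
      proof -
      have e: "set (xs @ ys @ [h]) = S \<union> T" using xyd(6) h by auto
      have "set ((?xS @ ?yS) @ B) = set (xs @ ys @ [h])" "set (A @ B) = set (xs @ ys @ [h])"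
        unfolding e by (simp_all only: set_append A Sset)
      moreover have "distinct (xs @ ys @ [h])" "distinct ((?xS @ ?yS) @ B)" "distinct (A @ B)"
        using A d2 ST xyd by auto
      ultimately show ?thesis
        by (intro koszul_trans)
      qed
      ultimately show ?thesis using A by simp
    qed
    have "(\<Sum>A\<in>perms S. scale (coeff (shuffle_cyc \<delta> xs ys h) (A @ B))
         (\<Psi> (cyc \<delta>' (A @ [h'])) ?\<beta>)) =
       (\<Sum>A\<in>shuffles ?xS ?yS. scale (?K * koszul \<delta>' (?xS @ ?yS) A) (\<Psi> (cyc \<delta>' (A @ [h'])) ?\<beta>))"
      unfolding shS[symmetric]
      by (rule sum.mono_neutral_cong_right) (auto simp: co k)
    also have "\<dots> = scale ?K (\<Sum>A\<in>shuffles ?xS ?yS. scale (koszul \<delta>' (?xS @ ?yS) A) (\<Psi> (cyc \<delta>' (A @ [h'])) ?\<beta>))"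
      by (simp add: free.scale_sum_right)
    also have "\<dots> \<in> free.span R"
    proof (rule free.span_scale)
      have "cyc \<delta>' (A @ [h']) \<in> Cyc \<delta>' (insert h' S)" if "A \<in> shuffles ?xS ?yS" for A
        using that unfolding shS[symmetric] using new
        by (intro cyc_in_Cyc) (auto simp: perms_def)
      then have "eqm R (\<Psi> (shuffle_cyc \<delta>' ?xS ?yS h') ?\<beta>)
         (\<Sum>A\<in>shuffles ?xS ?yS. scale (koszul \<delta>' (?xS @ ?yS) A) (\<Psi> (cyc \<delta>' (A @ [h'])) ?\<beta>))"
        unfolding shuffle_cyc_def by (intro lin_mod_sum[OF subspace_Cyc lin1[OF \<beta>]])
      moreover have "shuffle_cyc \<delta>' ?xS ?yS h' \<in> C_null \<delta>' (insert h' S)"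
        using ne by (intro shuffle_cyc_in_C_null) (use d2 Sset new in \<open>auto simp: perms_def\<close>)
      then have "\<Psi> (shuffle_cyc \<delta>' ?xS ?yS h') ?\<beta> \<in> free.span R"
        using null1 \<beta> by blast
      ultimately show "(\<Sum>A\<in>shuffles ?xS ?yS. scale (koszul \<delta>' (?xS @ ?yS) A) (\<Psi> (cyc \<delta>' (A @ [h'])) ?\<beta>))
         \<in> free.span R"
        using eqm_in_span eqm_sym by blast
    qed
    finally show ?thesis .
  qed
qed

text \<open>As \<open>xs\<close> misses \<open>S\<close>, in a shuffle \<open>P A Q\<close> the word
  \<open>A\<close> must be a contiguous block of \<open>ys\<close>. Contracting this block to the
  letter \<open>h''\<close> turns the condition on \<open>P\<close> and \<open>Q\<close> into
  membership of \<open>P h'' Q\<close> in the shuffles of \<open>xs\<close> with the contracted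
  word, which is a relation for the second piece.\<close>

lemma split_shuffle_right:
  assumes xyh: "xs @ ys @ [h] \<in> perms (S \<union> T)" and h: "h \<in> T"
    and xS: "filter (\<lambda>a. a \<in> S) xs = []" and ne: "xs \<noteq> []"
    and A: "A \<in> perms S"
  shows "(\<Sum>B\<in>perms T. scale (coeff (shuffle_cyc \<delta> xs ys h) (A @ B))
     (\<Psi> (cyc \<delta>' (A @ [h'])) (cyc \<delta>' (B @ [h''])))) \<in> free.span R"
proof -
  let ?\<alpha> = "cyc \<delta>' (A @ [h'])"
  have xyd: "distinct xs" "distinct ys" "set xs \<inter> set ys = {}" "h \<notin> set xs" "h \<notin> set ys"
    "set xs \<union> set ys = S \<union> T - {h}"
    using xyh by (auto simp: perms_def)
  have hS: "h \<notin> S" using h ST by auto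
  have A': "distinct A" "set A = S" "A \<noteq> []" using A ST by (auto simp: perms_def)
  have xS': "set xs \<inter> S = {}" using xS by (auto simp: filter_empty_conv)
  then have Sy: "S \<subseteq> set ys" using xyd(6) hS by auto
  have \<alpha>: "?\<alpha> \<in> Cyc \<delta>' (insert h' S)"
    using A new by (intro cyc_in_Cyc) (auto simp: perms_def)
  have co: "coeff (shuffle_cyc \<delta> xs ys h) (A @ Q @ h # P) =
      (if P @ A @ Q \<in> shuffles xs ys then koszul \<delta> (xs @ ys @ [h]) (A @ Q @ h # P) else (0 :: 'k))"
    if "Q @ h # P \<in> perms T" for P Q
  proof -
    have Bd: "distinct (Q @ h # P)" "set Q \<union> set P = T - {h}"
      using that by (auto simp: perms_def)
    have "set (A @ Q) \<union> set P = set xs \<union> set ys"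
      using A' Bd(2) hS unfolding xyd(6) by auto
    moreover have "distinct (A @ Q @ h # P)" using A' Bd ST h by auto
    ultimately show ?thesis
      using lookup_shuffle_cyc[of xs ys h "A @ Q" P \<delta>, where 'k = 'k, unfolded append_assoc] xyd by simp
  qed
  have yfil: "filter (\<lambda>a. a \<in> set ys) P @ A @ filter (\<lambda>a. a \<in> set ys) Q = ys"
    "filter (\<lambda>a. a \<in> set xs) P @ filter (\<lambda>a. a \<in> set xs) Q = xs"
    if "P @ A @ Q \<in> shuffles xs ys" for P Q
  proof -
    have "filter (\<lambda>a. a \<in> set ys) (P @ A @ Q) = ys" "filter (\<lambda>a. a \<in> set xs) (P @ A @ Q) = xs"
      using filter_shuffles_disjoint1[OF xyd(3) that] filter_shuffles_disjoint2[OF xyd(3) that] by simp_all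
    moreover have "filter (\<lambda>a. a \<in> set ys) A = A" using A' Sy by (intro filter_eq_self) auto
    moreover have "filter (\<lambda>a. a \<in> set xs) A = []" using A' xS' by (intro filter_eq_Nil) auto
    ultimately show "filter (\<lambda>a. a \<in> set ys) P @ A @ filter (\<lambda>a. a \<in> set ys) Q = ys"
      "filter (\<lambda>a. a \<in> set xs) P @ filter (\<lambda>a. a \<in> set xs) Q = xs" by auto
  qed
  show ?thesis
  proof (cases "\<exists>y1 y3. ys = y1 @ A @ y3")
    case False
    have "coeff (shuffle_cyc \<delta> xs ys h) (A @ B) = (0 :: 'k)"
      if "B \<in> perms T" for B
    proof -
      have "h \<in> set B" using that h by (simp add: perms_def)
      then obtain Q P where BQ: "B = Q @ h # P" by (meson split_list)
      have "P @ A @ Q \<notin> shuffles xs ys"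
      proof
        assume "P @ A @ Q \<in> shuffles xs ys"
        from yfil(1)[OF this, symmetric] False show False by blast
      qed
      then show ?thesis using co[of Q P] that BQ by simp
    qed
    then show ?thesis by (auto intro!: free.span_sum free.span_zero)
  next
    case True
    then obtain y1 y3 where ys: "ys = y1 @ A @ y3" by blast
    let ?z = "y1 @ h'' # y3"
    \<comment> \<open>A reference ordering of \<open>T\<close>, from which the signs of all
      orderings of \<open>T\<close> are measured.\<close>
    let ?E = "xs @ y1 @ y3 @ [h]"
    have h''1: "h'' \<notin> set xs" "h'' \<notin> set ys" "h'' \<noteq> h" "h'' \<notin> T" "h'' \<notin> S" using new xyd(6) h by auto
    have yd: "distinct y1" "distinct y3" "set y1 \<inter> set y3 = {}" "set y1 \<inter> S = {}" "set y3 \<inter> S = {}"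
      using xyd(2) A' by (auto simp: ys)
    have zset: "set xs \<union> set ?z = insert h'' T - {h}"
      using xyd(6) yd A' ST hS xS' h''1 by (auto simp: ys)
    have yT: "set xs \<union> set y1 \<union> set y3 = T - {h}"
      using xyd(6) yd A' ST hS xS' by (auto simp: ys)
    have zd: "distinct (xs @ ?z)"
      using xyd yd h''1 by (auto simp: ys)
    have zh: "h \<notin> set xs" "h \<notin> set ?z" using xyd h''1 by (auto simp: ys)
    have iff: "P @ A @ Q \<in> shuffles xs ys \<longleftrightarrow> P @ h'' # Q \<in> shuffles xs ?z"
      if "Q @ h # P \<in> perms T" for P Q
    proof -
      have Bd: "distinct (Q @ h # P)" "set Q \<union> set P = T - {h}"
        using that by (auto simp: perms_def)
      have 1: "set (P @ A @ Q) = set xs \<union> set ys"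
        using Bd(2) A' hS unfolding xyd(6) by auto
      have 2: "set (P @ h'' # Q) = set xs \<union> set ?z"
        using Bd(2) h''1 unfolding zset by auto
      have f1: "filter (\<lambda>a. a \<in> set ys) A = A" using A' Sy by (intro filter_eq_self) auto
      have f2: "filter (\<lambda>a. a \<in> set xs) A = []" using A' xS' by (intro filter_eq_Nil) auto
      have f3: "filter (\<lambda>a. a \<in> set ?z) X = filter (\<lambda>a. a \<in> set ys) X" if "X = P \<or> X = Q" for X
      proof (rule filter_cong)
        fix a assume "a \<in> set X"
        then have "a \<notin> S" "a \<noteq> h''" using that Bd(2) ST h''1 by auto
        then show "(a \<in> set ?z) = (a \<in> set ys)" using A' by (auto simp: ys)
      qed simp
      have "P @ A @ Q \<in> shuffles xs ys \<longleftrightarrow>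
        filter (\<lambda>a. a \<in> set xs) P @ filter (\<lambda>a. a \<in> set xs) Q = xs \<and>
        filter (\<lambda>a. a \<in> set ys) P @ A @ filter (\<lambda>a. a \<in> set ys) Q = y1 @ A @ y3"
        by (subst in_shuffles_iff[OF xyd(3) 1]) (simp only: filter_append f1 f2 append_Nil, simp only: ys[symmetric])
      also have "filter (\<lambda>a. a \<in> set ys) P @ A @ filter (\<lambda>a. a \<in> set ys) Q = y1 @ A @ y3 \<longleftrightarrow>
         filter (\<lambda>a. a \<in> set ys) P @ [h''] @ filter (\<lambda>a. a \<in> set ys) Q = y1 @ [h''] @ y3"
        using append_eq_middle[of y1 A y3] append_eq_middle[of y1 "[h'']" y3] xyd(2) zd A'(3)
        unfolding ys[symmetric] by (metis append_Cons append_Nil distinct_append list.discI ys)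
      also have "filter (\<lambda>a. a \<in> set xs) P @ filter (\<lambda>a. a \<in> set xs) Q = xs \<and>
          filter (\<lambda>a. a \<in> set ys) P @ [h''] @ filter (\<lambda>a. a \<in> set ys) Q = y1 @ [h''] @ y3 \<longleftrightarrow>
         P @ h'' # Q \<in> shuffles xs ?z"
      proof -
        have "filter (\<lambda>a. a \<in> set xs) (P @ h'' # Q) = filter (\<lambda>a. a \<in> set xs) P @ filter (\<lambda>a. a \<in> set xs) Q"
          using h''1 by simp
        moreover have "h'' \<in> set ?z" by simp
        then have "filter (\<lambda>a. a \<in> set ?z) (P @ h'' # Q) =
            filter (\<lambda>a. a \<in> set ys) P @ [h''] @ filter (\<lambda>a. a \<in> set ys) Q"
          using f3[of P] f3[of Q] by (simp only: filter_append filter.simps if_True simp_thms append.simps)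
        moreover have "set xs \<inter> set ?z = {}" using zd by simp
        ultimately show ?thesis
          by (subst in_shuffles_iff[OF _ 2]) (simp_all only: append_Cons append_Nil)
      qed
      finally show ?thesis .
    qed
    let ?D = "{B \<in> perms T. \<exists>Q P. B = Q @ h # P \<and> P @ A @ Q \<in> shuffles xs ys}"
    \<comment> \<open>Exchanges the two sides of a marked letter and renames it:
      \<open>Q a P\<close> becomes \<open>P b Q\<close>. \<open>ex h h''\<close> takes the
      contributing orderings \<open>B\<close> of \<open>T\<close> to shuffles, and
      \<open>ex h'' h\<close> is its inverse.\<close>
    define ex :: "nat \<Rightarrow> nat \<Rightarrow> nat list \<Rightarrow> nat list" where
      "ex a b B = tl (dropWhile (\<lambda>x. x \<noteq> a) B) @ b # takeWhile (\<lambda>x. x \<noteq> a) B" for a b B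
    have ex: "ex a b (Q @ a # P) = P @ b # Q" if "a \<notin> set Q" for a b Q P
    proof -
      have "takeWhile (\<lambda>x. x \<noteq> a) (Q @ a # P) = Q" "dropWhile (\<lambda>x. x \<noteq> a) (Q @ a # P) = a # P"
        using that by (induction Q) auto
      then show ?thesis by (simp add: ex_def)
    qed
    \<comment> \<open>The sign of \<open>Q h P\<close> relative to \<open>?E\<close> occurs both in
      the coefficient and in the sign of the shuffle \<open>w\<close>; comparing the two leaves this
      constant, which is independent of \<open>w\<close>.\<close>
    let ?K = "koszul \<delta> (xs @ ys @ [h]) (A @ ?E) * koszul \<delta>' (xs @ ?z @ [h]) (?E @ [h'']) :: 'k"
    have D_iff: "w \<in> shuffles xs ?z \<longleftrightarrow> (\<exists>Q P. w = P @ h'' # Q \<and> Q @ h # P \<in> ?D)" for w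
    proof
      assume w: "w \<in> shuffles xs ?z"
      then have wd: "distinct w" "set w = insert h'' T - {h}"
        using shuffles_distinct[OF zd w] zset by auto
      then have "h'' \<in> set w" using h''1 by auto
      then obtain P Q where PQ: "w = P @ h'' # Q" by (meson split_list)
      have "h'' \<notin> set P" "h'' \<notin> set Q" "insert h'' (set P \<union> set Q) = insert h'' (T - {h})"
        using wd h''1 unfolding PQ by auto
      then have "set P \<union> set Q = T - {h}"
        using h''1 by (simp add: insert_ident)
      then have p: "Q @ h # P \<in> perms T"
        using wd(1) h unfolding PQ by (intro permutations_of_setI) auto
      then show "\<exists>Q P. w = P @ h'' # Q \<and> Q @ h # P \<in> ?D"
        using w iff[OF p] unfolding PQ by blast
    next
      assume "\<exists>Q P. w = P @ h'' # Q \<and> Q @ h # P \<in> ?D"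
      then obtain Q P where w: "w = P @ h'' # Q" and D: "Q @ h # P \<in> ?D" by blast
      then obtain Q' P' where *: "Q @ h # P \<in> perms T" "Q @ h # P = Q' @ h # P'"
        "P' @ A @ Q' \<in> shuffles xs ys" by blast
      then have "Q = Q' \<and> P = P'"
        using append_eq_middle[of Q "[h]" P Q' P'] by (auto simp: perms_def)
      then show "w \<in> shuffles xs ?z" using * iff[of Q P] w by simp
    qed
    have trm: "eqm R (scale (coeff (shuffle_cyc \<delta> xs ys h) (A @ B)) (\<Psi> ?\<alpha> (cyc \<delta>' (B @ [h'']))))
        (scale (?K * koszul \<delta>' (xs @ ?z) w) (\<Psi> ?\<alpha> (cyc \<delta>' (w @ [h]))))"
      if w: "w \<in> shuffles xs ?z" and wPQ: "w = P @ h'' # Q" and BQ: "B = Q @ h # P"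
        and B: "B \<in> perms T" for w P Q B
    proof -
      have Bd: "distinct (Q @ h # P)" "set Q \<union> set P = T - {h}"
        using B BQ by (auto simp: perms_def)
      have wd: "distinct w" "set w = set xs \<union> set ?z" using shuffles_distinct[OF zd w] by auto
      let ?F = "Q @ h # P"
      have Eset: "distinct ?E" "set ?E = T"
      proof -
        show "distinct ?E" using zd zh by auto
        have "set ?E = insert h (set xs \<union> set y1 \<union> set y3)" by auto
        also have "\<dots> = T" unfolding yT using h by auto
        finally show "set ?E = T" .
      qed
      have Fset: "distinct ?F" "set ?F = T" using Bd h by auto
      let ?e = "koszul \<delta>' ?E ?F :: 'k"
      have 1: "koszul \<delta> (xs @ ys @ [h]) (A @ ?E) * ?e = (koszul \<delta> (xs @ ys @ [h]) (A @ ?F) :: 'k)"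
      proof -
        have "koszul \<delta> (A @ ?E) (A @ ?F) = (koszul \<delta> A A * koszul \<delta> ?E ?F :: 'k)"
          using A' Eset Fset ST by (intro koszul_append) auto
        moreover have "koszul \<delta> ?E ?F = ?e"
          using Eset \<delta> by (intro koszul_cong) auto
        moreover have e: "set (xs @ ys @ [h]) = S \<union> T" using xyd(6) h by auto
        have s: "set (A @ ?E) = set (xs @ ys @ [h])" "set (A @ ?F) = set (xs @ ys @ [h])"
          unfolding e set_append[of A] Eset Fset A'(2) by (rule refl)+
        have d: "distinct (xs @ ys @ [h])" "distinct (A @ ?E)" "distinct (A @ ?F)"
          unfolding distinct_append[of A] Eset(2) Fset(2) A'(2)
          using A'(1) Eset(1) Fset(1) ST(1) xyd by auto
        have "koszul \<delta> (xs @ ys @ [h]) (A @ ?E) * koszul \<delta> (A @ ?E) (A @ ?F) =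
          (koszul \<delta> (xs @ ys @ [h]) (A @ ?F) :: 'k)"
          by (rule koszul_trans) (fact d s)+
        ultimately show ?thesis using A' by simp
      qed
      have 2: "koszul \<delta>' (xs @ ?z @ [h]) (?E @ [h'']) * ?e * koszul \<delta>' (?F @ [h'']) (w @ [h]) = (koszul \<delta>' (xs @ ?z) w :: 'k)"
      proof -
        have "koszul \<delta>' (?E @ [h'']) (?F @ [h'']) = (?e * koszul \<delta>' [h''] [h''] :: 'k)"
          using Eset Fset h''1 by (intro koszul_append) auto
        moreover have "koszul \<delta>' ((xs @ ?z) @ [h]) (w @ [h]) = (koszul \<delta>' (xs @ ?z) w * koszul \<delta>' [h] [h] :: 'k)"
          using zd zh wd by (intro koszul_append) auto
        moreover have s: "set (?E @ [h'']) = set ((xs @ ?z) @ [h])" "set (?F @ [h'']) = set ((xs @ ?z) @ [h])"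
          "set (w @ [h]) = set ((xs @ ?z) @ [h])"
          using Eset Fset wd by auto
        have d: "distinct ((xs @ ?z) @ [h])" "distinct (?E @ [h''])" "distinct (?F @ [h''])" "distinct (w @ [h])"
          using zd zh Eset Fset h''1 wd by auto
        have "koszul \<delta>' ((xs @ ?z) @ [h]) (?E @ [h'']) * koszul \<delta>' (?E @ [h'']) (?F @ [h'']) =
            (koszul \<delta>' ((xs @ ?z) @ [h]) (?F @ [h'']) :: 'k)"
          by (rule koszul_trans) (fact d s)+
        moreover have "koszul \<delta>' ((xs @ ?z) @ [h]) (?F @ [h'']) * koszul \<delta>' (?F @ [h'']) (w @ [h]) =
            (koszul \<delta>' ((xs @ ?z) @ [h]) (w @ [h]) :: 'k)"
          by (rule koszul_trans) (fact d s)+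
        ultimately show ?thesis by simp
      qed
      have 3: "cyc \<delta>' (B @ [h'']) = scale (koszul \<delta>' (?F @ [h'']) (w @ [h])) (cyc \<delta>' (w @ [h]) :: _ \<Rightarrow>\<^sub>0 'k)"
        using cyc_swap[of "P @ [h'']" "Q @ [h]" \<delta>'] wd(1) Bd(1) h''1(3) unfolding wPQ BQ by simp
      have c: "cyc \<delta>' (w @ [h]) \<in> Cyc \<delta>' (insert h'' T)"
        using wd zh zset h by (intro cyc_in_Cyc) (auto simp: perms_def)
      have PAQ: "P @ A @ Q \<in> shuffles xs ys" using w wPQ iff[of Q P] B BQ by simp
      have sq: "k * k' = k * k2 * (k2 * (k' :: 'k))" if "k2 * k2 = 1" for k k' k2
        using that by (simp add: algebra_simps)
      have "?K * koszul \<delta>' (xs @ ?z) w = koszul \<delta> (xs @ ys @ [h]) (A @ ?F) * koszul \<delta>' (?F @ [h'']) (w @ [h])"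
        unfolding 1[symmetric] 2[symmetric]
        using koszul_sq[of \<delta>' "xs @ ?z @ [h]" "?E @ [h'']", where 'k = 'k] by (simp add: algebra_simps)
      then have eq: "coeff (shuffle_cyc \<delta> xs ys h) (A @ B) * koszul \<delta>' (?F @ [h'']) (w @ [h]) =
          ?K * koszul \<delta>' (xs @ ?z) w"
        using co[of Q P] PAQ B BQ by simp
      show ?thesis
        unfolding 3 eq[symmetric] free.scale_scale[symmetric]
        by (intro eqm_scale lin_mod_scale[OF subspace_Cyc lin2[OF \<alpha>]] c)
    qed
    have s1: "(\<Sum>B\<in>perms T. scale (coeff (shuffle_cyc \<delta> xs ys h) (A @ B))
         (\<Psi> ?\<alpha> (cyc \<delta>' (B @ [h''])))) =
       (\<Sum>B\<in>?D. scale (coeff (shuffle_cyc \<delta> xs ys h) (A @ B))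
         (\<Psi> ?\<alpha> (cyc \<delta>' (B @ [h'']))))"
    proof (rule sum.mono_neutral_right)
      show "\<forall>B\<in>perms T - ?D. scale (coeff (shuffle_cyc \<delta> xs ys h) (A @ B))
         (\<Psi> ?\<alpha> (cyc \<delta>' (B @ [h'']))) = 0"
      proof
        fix B assume B: "B \<in> perms T - ?D"
        then have "h \<in> set B" using h by (simp add: perms_def)
        then obtain Q P where BQ: "B = Q @ h # P" by (meson split_list)
        with B have "P @ A @ Q \<notin> shuffles xs ys" by blast
        then show "scale (coeff (shuffle_cyc \<delta> xs ys h) (A @ B))
         (\<Psi> ?\<alpha> (cyc \<delta>' (B @ [h'']))) = 0"
          using co[of Q P] B BQ by simp
      qed
    qed auto
    have s2: "(\<Sum>B\<in>?D. scale (coeff (shuffle_cyc \<delta> xs ys h) (A @ B))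
         (\<Psi> ?\<alpha> (cyc \<delta>' (B @ [h''])))) = (\<Sum>w\<in>shuffles xs ?z. scale (coeff (shuffle_cyc \<delta> xs ys h) (A @ ex h'' h w))
         (\<Psi> ?\<alpha> (cyc \<delta>' (ex h'' h w @ [h'']))))"
    proof (rule sum.reindex_bij_witness[of _ "ex h'' h" "ex h h''"], goal_cases)
      case (1 B)
      then obtain Q P where "B = Q @ h # P" "h \<notin> set Q" "h'' \<notin> set P"
        using h''1 by (auto simp: perms_def)
      then show ?case by (simp add: ex)
    next
      case (2 B)
      then obtain Q P where BQ: "B = Q @ h # P" "h \<notin> set Q" "h'' \<notin> set P"
        using h''1 by (auto simp: perms_def)
      with 2 show ?case unfolding D_iff by (auto simp: ex)
    next
      case (3 w)
      then obtain Q P where "w = P @ h'' # Q" "Q @ h # P \<in> ?D" unfolding D_iff by blast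
      moreover from this have "h'' \<notin> set P" "h \<notin> set Q" using h''1 by (auto simp: perms_def)
      ultimately show ?case by (simp add: ex)
    next
      case (4 w)
      then obtain Q P where "w = P @ h'' # Q" "Q @ h # P \<in> ?D" unfolding D_iff by blast
      moreover from this have "h'' \<notin> set P" "h \<notin> set Q" using h''1 by (auto simp: perms_def)
      ultimately show ?case by (simp add: ex)
    next
      case (5 B)
      then obtain Q P where "B = Q @ h # P" "h \<notin> set Q" "h'' \<notin> set P"
        using h''1 by (auto simp: perms_def)
      then show ?case by (simp add: ex)
    qed
    have s3: "eqm R (\<Sum>w\<in>shuffles xs ?z. scale (coeff (shuffle_cyc \<delta> xs ys h) (A @ ex h'' h w))
         (\<Psi> ?\<alpha> (cyc \<delta>' (ex h'' h w @ [h''])))) (\<Sum>w\<in>shuffles xs ?z. scale (?K * koszul \<delta>' (xs @ ?z) w) (\<Psi> ?\<alpha> (cyc \<delta>' (w @ [h]))))"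
    proof (rule eqm_sum)
      fix w assume w: "w \<in> shuffles xs ?z"
      then obtain Q P where wPQ: "w = P @ h'' # Q" and D: "Q @ h # P \<in> ?D" unfolding D_iff by blast
      then have "h'' \<notin> set P" using h''1 by (auto simp: perms_def)
      then have "ex h'' h w = Q @ h # P" by (simp add: wPQ ex)
      with trm[OF w wPQ] D show "eqm R (scale (coeff (shuffle_cyc \<delta> xs ys h) (A @ ex h'' h w))
         (\<Psi> ?\<alpha> (cyc \<delta>' (ex h'' h w @ [h'']))))
         (scale (?K * koszul \<delta>' (xs @ ?z) w) (\<Psi> ?\<alpha> (cyc \<delta>' (w @ [h]))))" by simp
    qed
    have s4: "(\<Sum>w\<in>shuffles xs ?z. scale (?K * koszul \<delta>' (xs @ ?z) w) (\<Psi> ?\<alpha> (cyc \<delta>' (w @ [h])))) = scale ?K (\<Sum>w\<in>shuffles xs ?z. scale (koszul \<delta>' (xs @ ?z) w) (\<Psi> ?\<alpha> (cyc \<delta>' (w @ [h]))))"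
      by (simp add: free.scale_sum_right mult.assoc)
    have s5: "eqm R (scale ?K (\<Sum>w\<in>shuffles xs ?z. scale (koszul \<delta>' (xs @ ?z) w) (\<Psi> ?\<alpha> (cyc \<delta>' (w @ [h]))))) (scale ?K (\<Psi> ?\<alpha> (shuffle_cyc \<delta>' xs ?z h)))"
      unfolding shuffle_cyc_def
    proof (intro eqm_scale eqm_sym[OF lin_mod_sum[OF subspace_Cyc lin2[OF \<alpha>]]])
      fix w assume "w \<in> shuffles xs ?z"
      then have "distinct w" "set w = set xs \<union> set ?z" using shuffles_distinct[OF zd] by auto
      then show "cyc \<delta>' (w @ [h]) \<in> Cyc \<delta>' (insert h'' T)"
        using zh zset h by (intro cyc_in_Cyc) (auto simp: perms_def)
    qed
    have fin: "eqm R (\<Sum>B\<in>perms T. scale (coeff (shuffle_cyc \<delta> xs ys h) (A @ B))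
         (\<Psi> ?\<alpha> (cyc \<delta>' (B @ [h''])))) (scale ?K (\<Psi> ?\<alpha> (shuffle_cyc \<delta>' xs ?z h)))"
      unfolding s1 s2 by (rule eqm_trans[OF s3[unfolded s4] s5])
    have "xs @ ?z @ [h] \<in> perms (insert h'' T)"
      using zd zh zset h by (auto simp: perms_def)
    then have "shuffle_cyc \<delta>' xs ?z h \<in> C_null \<delta>' (insert h'' T)"
      using ne by (intro shuffle_cyc_in_C_null) auto
    then have "\<Psi> ?\<alpha> (shuffle_cyc \<delta>' xs ?z h) \<in> free.span R"
      using null2 \<alpha> by blast
    then show ?thesis
      using eqm_in_span[OF fin] free.span_scale by blast
  qed
qed

text \<open>Since \<open>S\<close> is nonempty and \<open>h\<close> lies in \<open>T\<close>,
  letters of \<open>S\<close> occur in both words or in exactly one of them. If \<open>ys\<close>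
  misses \<open>S\<close>, the two words are exchanged at the cost of a constant sign.\<close>

lemma split_shuffle_aux:
  assumes xyh: "xs @ ys @ [h] \<in> perms (S \<union> T)" and h: "h \<in> T"
    and ne: "xs \<noteq> []" "ys \<noteq> []"
  shows "(\<Sum>A\<in>perms S. \<Sum>B\<in>perms T.
     scale (coeff (shuffle_cyc \<delta> xs ys h) (A @ B))
     (\<Psi> (cyc \<delta>' (A @ [h'])) (cyc \<delta>' (B @ [h''])))) \<in> free.span R"
proof -
  consider "filter (\<lambda>a. a \<in> S) xs \<noteq> []" "filter (\<lambda>a. a \<in> S) ys \<noteq> []"
    | "filter (\<lambda>a. a \<in> S) xs = []" | "filter (\<lambda>a. a \<in> S) ys = []" by blast
  then show ?thesis
  proof cases
    case 1
    show ?thesis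
      by (subst sum.swap) (intro free.span_sum split_shuffle_left xyh h 1)
  next
    case 2
    show ?thesis
      by (intro free.span_sum split_shuffle_right xyh h 2 ne)
  next
    case 3
    have d: "distinct (ys @ xs)" and yxh: "ys @ xs @ [h] \<in> perms (S \<union> T)"
      using xyh by (auto simp: perms_def)
    have "(\<Sum>A\<in>perms S. \<Sum>B\<in>perms T.
       scale (coeff (shuffle_cyc \<delta> xs ys h) (A @ B))
         (\<Psi> (cyc \<delta>' (A @ [h'])) (cyc \<delta>' (B @ [h''])))) =
      scale (koszul \<delta> (xs @ ys) (ys @ xs)) (\<Sum>A\<in>perms S. \<Sum>B\<in>perms T.
       scale (coeff (shuffle_cyc \<delta> ys xs h) (A @ B))
         (\<Psi> (cyc \<delta>' (A @ [h'])) (cyc \<delta>' (B @ [h'']))))"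
      unfolding shuffle_cyc_commute[OF d] lookup_scale free.scale_sum_right free.scale_scale ..
    also have "\<dots> \<in> free.span R"
      by (intro free.span_scale free.span_sum split_shuffle_right yxh h 3 ne)
    finally show ?thesis .
  qed
qed

end

text \<open>The last letter \<open>h\<close> of a relation may lie in either piece. If it lies in
  \<open>S\<close>, passing from \<open>A @ B\<close> to \<open>B @ A\<close> costs a sign that
  depends only on total degrees, and the previous case applies with the pieces exchanged.
  \<open>\<Psi>\<close> is an abstract map, linear in each argument modulo \<open>R\<close>, so that
  its arguments can be exchanged as well.\<close>

lemma split_C_null:
  fixes \<Psi> :: "(nat list \<Rightarrow>\<^sub>0 'k::field) \<Rightarrow> 'k tensor \<Rightarrow> ('g \<Rightarrow>\<^sub>0 'k)"
  assumes c: "c \<in> C_null \<delta> (S \<union> T)"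
    and ST: "S \<inter> T = {}" "S \<noteq> {}" "T \<noteq> {}"
    and new: "h' \<notin> S \<union> T" "h'' \<notin> S \<union> T"
    and \<delta>: "\<And>a. a \<in> S \<union> T \<Longrightarrow> \<delta>' a = \<delta> a"
    and lin1: "\<And>\<beta>. \<beta> \<in> Cyc \<delta>' (insert h'' T) \<Longrightarrow> lin_mod R (Cyc \<delta>' (insert h' S)) (\<lambda>\<alpha>. \<Psi> \<alpha> \<beta>)"
    and null1: "\<And>\<alpha> \<beta>. \<alpha> \<in> C_null \<delta>' (insert h' S) \<Longrightarrow> \<beta> \<in> Cyc \<delta>' (insert h'' T) \<Longrightarrow> \<Psi> \<alpha> \<beta> \<in> free.span R"
    and lin2: "\<And>\<alpha>. \<alpha> \<in> Cyc \<delta>' (insert h' S) \<Longrightarrow> lin_mod R (Cyc \<delta>' (insert h'' T)) (\<Psi> \<alpha>)"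
    and null2: "\<And>\<alpha> \<beta>. \<alpha> \<in> Cyc \<delta>' (insert h' S) \<Longrightarrow> \<beta> \<in> C_null \<delta>' (insert h'' T) \<Longrightarrow> \<Psi> \<alpha> \<beta> \<in> free.span R"
  shows "(\<Sum>A\<in>perms S. \<Sum>B\<in>perms T. scale (coeff c (A @ B))
     (\<Psi> (cyc \<delta>' (A @ [h'])) (cyc \<delta>' (B @ [h''])))) \<in> free.span R"
    (is "?L c \<in> _")
proof (rule lin_span[of ?L _ R, OF _ _ c[unfolded C_null_altdef]])
  show "lin ?L"
    by (intro linI) (simp_all add: lookup_add free.scale_left_distrib sum.distrib free.scale_sum_right)
  fix g :: "nat list \<Rightarrow>\<^sub>0 'k"
  assume "g \<in> {shuffle_cyc \<delta> xs ys h | xs ys h.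
     xs @ ys @ [h] \<in> perms (S \<union> T) \<and> xs \<noteq> [] \<and> ys \<noteq> []}"
  then obtain xs ys h where g: "g = shuffle_cyc \<delta> xs ys h"
    and xyh: "xs @ ys @ [h] \<in> perms (S \<union> T)" and ne: "xs \<noteq> []" "ys \<noteq> []" by blast
  have gC: "g \<in> Cyc \<delta> (S \<union> T)"
    unfolding g shuffle_cyc_def
  proof (intro free.subspace_sum[OF subspace_Cyc] free.subspace_scale[OF subspace_Cyc] cyc_in_Cyc)
    fix w assume "w \<in> shuffles xs ys"
    then show "w @ [h] \<in> perms (S \<union> T)"
      using xyh shuffles_distinct[of xs ys w] by (auto simp: perms_def)
  qed
  show "?L g \<in> free.span R"
  proof (cases "h \<in> T")
    case True
    show ?thesis unfolding g
      by (rule split_shuffle_aux[where \<Psi> = \<Psi>]) (use assms xyh ne True in blast)+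
  next
    case False
    then have h: "h \<in> S" using xyh by (auto simp: perms_def)
    have TS: "S \<union> T = T \<union> S" by auto
    have *: "(\<Sum>B\<in>perms T. \<Sum>A\<in>perms S.
       scale (coeff (shuffle_cyc \<delta> xs ys h) (B @ A))
         (\<Psi> (cyc \<delta>' (A @ [h'])) (cyc \<delta>' (B @ [h''])))) \<in> free.span R"
      by (rule split_shuffle_aux[where \<Psi> = "\<lambda>\<alpha> \<beta>. \<Psi> \<beta> \<alpha>"])
         (use assms xyh[unfolded TS] ne h in \<open>blast+\<close>)
    have "?L g = scale (sgn_pow (sum \<delta> T * sum \<delta> S)) (\<Sum>A\<in>perms S. \<Sum>B\<in>perms T.
       scale (coeff g (B @ A))
         (\<Psi> (cyc \<delta>' (A @ [h'])) (cyc \<delta>' (B @ [h'']))))"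
      unfolding free.scale_sum_right free.scale_scale
    proof (intro sum.cong refl)
      fix A B assume AB: "A \<in> perms S" "B \<in> perms T"
      then have "coeff g (A @ B) = koszul \<delta> (B @ A) (A @ B) * coeff g (B @ A)"
        using ST by (intro lookup_Cyc_swap[OF gC]) (auto simp: perms_def)
      also have "koszul \<delta> (B @ A) (A @ B) = (sgn_pow (sum \<delta> T * sum \<delta> S) :: 'k)"
        using AB ST by (subst koszul_swap) (auto simp: perms_def)
      finally show "scale (coeff g (A @ B)) (\<Psi> (cyc \<delta>' (A @ [h'])) (cyc \<delta>' (B @ [h'']))) =
          scale (sgn_pow (sum \<delta> T * sum \<delta> S) * coeff g (B @ A)) (\<Psi> (cyc \<delta>' (A @ [h'])) (cyc \<delta>' (B @ [h''])))"
        by simp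
    qed
    with * show ?thesis
      unfolding g by (subst (asm) sum.swap) (auto intro: free.span_scale)
  qed
qed

section \<open>Products of decorations\<close>

lemma product_rels_image:
  fixes f :: "(('u \<times> 'v::ab_group_add) list \<Rightarrow>\<^sub>0 'k::field) \<Rightarrow> ('g \<Rightarrow>\<^sub>0 'k)"
  assumes r: "r \<in> product_rels sc U A B sg" and f: "lin f"
    and 1: "\<And>xs u c x y ys. xs @ (u, x) # ys \<in> words U A \<Longrightarrow> xs @ (u, y) # ys \<in> words U A \<Longrightarrow>
      eqm R (f (gen (xs @ (u, sc c x + y) # ys)))
        (scale c (f (gen (xs @ (u, x) # ys))) + f (gen (xs @ (u, y) # ys)))"
    and 2: "\<And>xs u x ys. xs @ (u, x) # ys \<in> words U A \<Longrightarrow> x \<in> B u \<Longrightarrow>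
      f (gen (xs @ (u, x) # ys)) \<in> free.span R"
    and 3: "\<And>xs p q ys. xs @ p # q # ys \<in> words U A \<Longrightarrow>
      eqm R (f (gen (xs @ p # q # ys))) (scale (sg (fst p) (fst q)) (f (gen (xs @ q # p # ys))))"
  shows "f r \<in> free.span R"
proof -
  have *: "f (a - scale c b - d) = f a - (scale c (f b) + f d)" "f (a - scale c b) = f a - scale c (f b)" for a b c d
    by (simp_all only: lin_diff[OF f] lin_scale[OF f] diff_diff_eq[symmetric])
  show ?thesis
    using r unfolding product_rels_def
    by (elim UnE CollectE exE conjE)
      (use 1 2 3 in \<open>simp_all add: * eqm_def[symmetric]\<close>)
qed

lemma product_rels_lin:
  "xs @ (u, x) # ys \<in> words U A \<Longrightarrow> xs @ (u, y) # ys \<in> words U A \<Longrightarrow>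
   eqm (product_rels sc U A B sg) (gen (xs @ (u, sc c x + y) # ys))
        (scale c (gen (xs @ (u, x) # ys)) + gen (xs @ (u, y) # ys))"
  unfolding eqm_def diff_diff_eq[symmetric] product_rels_def by (rule free.span_base) blast

lemma product_rels_null:
  "xs @ (u, x) # ys \<in> words U A \<Longrightarrow> x \<in> B u \<Longrightarrow>
   eqm (product_rels sc U A B sg) (gen (xs @ (u, x) # ys)) 0"
  unfolding eqm_0_iff product_rels_def by (rule free.span_base) blast

lemma product_rels_swap:
  "xs @ p # q # ys \<in> words U A \<Longrightarrow>
   eqm (product_rels sc U A B sg) (gen (xs @ p # q # ys)) (scale (sg (fst p) (fst q)) (gen (xs @ q # p # ys)))"
  unfolding eqm_def product_rels_def by (rule free.span_base) blast

text \<open>Fixed factors placed around a product carry its relations to relations of the larger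
  product. This covers the factors that an operator merely extends at an end.\<close>

lemma product_rels_extend:
  fixes A :: "'u \<Rightarrow> 'v::ab_group_add set"
  assumes r: "r \<in> product_rels sc U A B sg"
    and w: "\<And>xs. xs \<in> words U A \<Longrightarrow> pre @ xs @ post \<in> words U' A'"
    and B: "\<And>u. u \<in> U \<Longrightarrow> B u \<subseteq> B' u"
    and sg: "\<And>u v. u \<in> U \<Longrightarrow> v \<in> U \<Longrightarrow> sg u v = sg' u v"
  shows "lin_ext (\<lambda>xs. gen (pre @ xs @ post)) r \<in> free.span (product_rels sc U' A' B' sg')"
proof (rule product_rels_image[OF r lin_lin_ext], unfold lin_ext_gen, goal_cases)
  case (1 xs u c x y ys)
  then show ?case
    using product_rels_lin[of "pre @ xs" u x "ys @ post" U' A' y sc B' sg' c] w[OF 1(1)] w[OF 1(2)] by simp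
next
  case (2 xs u x ys)
  then have "x \<in> B' u" using B by (fastforce simp: words_def)
  then show ?case
    using product_rels_null[of "pre @ xs" u x "ys @ post" U' A' B' sc sg'] w[OF 2(1)] by (simp add: eqm_0_iff)
next
  case (3 xs p q ys)
  then have "fst p \<in> U" "fst q \<in> U" by (auto simp: words_def)
  then show ?case
    using product_rels_swap[of "pre @ xs" p q "ys @ post" U' A' sc B' sg'] w[OF 3] sg by simp
qed

lemma others_append [simp]: "others v (xs @ ys) = others v xs @ others v ys"
  and others_Nil [simp]: "others v [] = []"
  and others_Cons [simp]: "others v (p # ys) = (if fst p = v then others v ys else p # others v ys)"
  by (simp_all add: others_def)

lemma others_absent [simp]: "v \<notin> fst ` set xs \<Longrightarrow> others v xs = xs"
  unfolding others_def by (rule filter_eq_self) auto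

lemma entry_Cons [simp]: "entry v (p # ys) = (if fst p = v then snd p else entry v ys)"
  by (cases p) (simp add: entry_def)

lemma entry_append: "entry v (xs @ ys) = (if v \<in> fst ` set xs then entry v xs else entry v ys)"
  by (induction xs) auto

lemma front_sgn_Nil [simp]: "front_sgn \<delta> v [] = 1"
  and front_sgn_Cons [simp]:
    "front_sgn \<delta> v (p # ys) = (if fst p = v then 1 else sgn_alt \<delta> (fst p) v * front_sgn \<delta> v ys)"
  by (simp_all add: front_sgn_def case_prod_unfold)

lemma front_sgn_append:
  "front_sgn \<delta> v (xs @ ys) =
    (if v \<in> fst ` set xs then front_sgn \<delta> v xs else front_sgn \<delta> v xs * front_sgn \<delta> v ys)"
  by (induction xs) (auto simp: mult.assoc)

lemma front_sgn_cong:
  "(\<And>u. u \<in> fst ` set xs \<Longrightarrow> \<delta> u = \<delta>' u) \<Longrightarrow> \<delta> v = \<delta>' v \<Longrightarrow> front_sgn \<delta> v xs = front_sgn \<delta>' v xs"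
  by (induction xs) (auto simp: sgn_alt_def)

lemma entry_in_set: "v \<in> fst ` set xs \<Longrightarrow> (v, entry v xs) \<in> set xs"
  by (induction xs) auto

lemma set_others: "set (others v xs) = {p \<in> set xs. fst p \<noteq> v}"
  by (simp add: others_def)

lemma words_iff: "xs \<in> words U A \<longleftrightarrow>
    distinct (map fst xs) \<and> fst ` set xs = U \<and> (\<forall>p\<in>set xs. snd p \<in> A (fst p))"
  by (auto simp: words_def)

lemma words_others: "xs \<in> words U A \<Longrightarrow> others v xs \<in> words (U - {v}) A"
  by (auto simp: words_iff set_others) (simp add: others_def distinct_map_filter)

lemma words_entry: "xs \<in> words U A \<Longrightarrow> v \<in> U \<Longrightarrow> entry v xs \<in> A v"
  using entry_in_set[of v xs] by (auto simp: words_iff)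

lemma words_Cons: "v \<in> U \<Longrightarrow> x \<in> A v \<Longrightarrow> xs \<in> words (U - {v}) A \<Longrightarrow> (v, x) # xs \<in> words U A"
  by (auto simp: words_iff)

lemma words_cong: "(\<And>u. u \<in> U \<Longrightarrow> A u = A' u) \<Longrightarrow> words U A = words U A'"
  unfolding set_eq_iff words_iff by (metis imageI)

lemma words_length: "xs \<in> words U A \<Longrightarrow> length xs = card U"
  by (auto simp: words_iff) (metis distinct_card length_map list.set_map)

lemma others_commute: "others u (others v xs) = others v (others u xs)"
  by (simp add: others_def conj_commute)

lemma entry_others: "u \<noteq> v \<Longrightarrow> entry u (others v xs) = entry u xs"
  by (induction xs) auto

lemma eqm_scale_lin:
  assumes "eqm R x (scale c y + z)"
  shows "eqm R (scale k x) (scale c (scale k y) + scale k z)"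
  using eqm_scale[OF assms, of k] by (simp add: free.scale_right_distrib mult.commute)

text \<open>An operator at \<open>v\<close> acts on a word after the decoration of \<open>v\<close>
  has been pulled to the front. Relations at \<open>v\<close> become conditions on the first
  argument of \<open>G\<close>, relations elsewhere become relations of the product without
  \<open>v\<close>, and an exchange with \<open>v\<close> itself is absorbed by the change of
  \<open>front_sgn\<close>.\<close>

lemma front_respects:
  fixes G :: "'v::ab_group_add \<Rightarrow> ('u \<times> 'v) list \<Rightarrow> ('g \<Rightarrow>\<^sub>0 'k::field)"
  assumes v: "v \<in> U"
    and lin: "\<And>ns x y c. ns \<in> words (U - {v}) A \<Longrightarrow> x \<in> A v \<Longrightarrow> y \<in> A v \<Longrightarrow>
      eqm R (G (sc c x + y) ns) (scale c (G x ns) + G y ns)"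
    and null: "\<And>ns x. ns \<in> words (U - {v}) A \<Longrightarrow> x \<in> A v \<Longrightarrow> x \<in> B v \<Longrightarrow> G x ns \<in> free.span R"
    and rel: "\<And>r x. x \<in> A v \<Longrightarrow> r \<in> product_rels sc (U - {v}) A B (sgn_alt \<delta>) \<Longrightarrow>
      lin_ext (G x) r \<in> free.span R"
    and r: "r \<in> product_rels sc U A B (sgn_alt \<delta>)"
  shows "lin_ext (\<lambda>ns. scale (front_sgn \<delta> v ns) (G (entry v ns) (others v ns))) r \<in> free.span R"
proof -
  let ?f = "\<lambda>ns. scale (front_sgn \<delta> v ns) (G (entry v ns) (others v ns))"
  have rel': "eqm R (lin_ext (G x) a) (lin_ext (G x) b)"
    if "x \<in> A v" "eqm (product_rels sc (U - {v}) A B (sgn_alt \<delta>)) a b" for x a b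
    by (rule eqm_lin[OF lin_lin_ext _ that(2)]) (rule rel[OF that(1)])
  show ?thesis
  proof (rule product_rels_image[OF r lin_lin_ext], unfold lin_ext_gen, goal_cases)
    case (1 xs u c x y ys)
    note e = words_entry[OF 1(1) v] words_entry[OF 1(2) v]
    note o = words_others[OF 1(1), of v] words_others[OF 1(2), of v]
    show ?case
    proof (cases "u = v")
      case True
      then have "v \<notin> fst ` set xs" "v \<notin> fst ` set ys" using 1 by (auto simp: words_iff)
      then show ?thesis
        using lin[of "xs @ ys" x y c] e o True
        by (auto simp: entry_append front_sgn_append simp del: free.scale_scale intro!: eqm_scale_lin)
    next
      case False
      let ?c = "entry v (xs @ ys)"
      define k :: 'k where "k = front_sgn \<delta> v (xs @ (u, x) # ys)"
      have en: "entry v (xs @ (u, z) # ys) = ?c" "front_sgn \<delta> v (xs @ (u, z) # ys) = k" for z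
        using False by (simp_all add: entry_append front_sgn_append k_def)
      have "eqm R (lin_ext (G ?c) (gen (others v xs @ (u, sc c x + y) # others v ys)))
         (lin_ext (G ?c) (scale c (gen (others v xs @ (u, x) # others v ys)) + gen (others v xs @ (u, y) # others v ys)))"
        using e o False by (intro rel' product_rels_lin) (auto simp: en)
      then show ?thesis
        unfolding en using False
        by (simp add: lin_ext_add lin_ext_scale eqm_scale_lin del: free.scale_scale)
    qed
  next
    case (2 xs u x ys)
    note e = words_entry[OF 2(1) v]
    note o = words_others[OF 2(1), of v]
    show ?case
    proof (cases "u = v")
      case True
      then have "v \<notin> fst ` set xs" "v \<notin> fst ` set ys" using 2 by (auto simp: words_iff)
      then show ?thesis
        using null[of "xs @ ys" x] e o True 2(2)
        by (auto simp: entry_append front_sgn_append intro!: free.span_scale)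
    next
      case False
      have "eqm R (lin_ext (G (entry v (xs @ (u, x) # ys))) (gen (others v xs @ (u, x) # others v ys))) (lin_ext (G (entry v (xs @ (u, x) # ys))) 0)"
        using e o False 2(2) by (intro rel' product_rels_null) auto
      then show ?thesis using False by (auto simp: lin_ext_0 eqm_0_iff intro!: free.span_scale)
    qed
  next
    case (3 xs p q ys)
    note e = words_entry[OF 3 v]
    note o = words_others[OF 3, of v]
    have d: "fst p \<noteq> fst q" "fst p \<notin> fst ` set xs" "fst q \<notin> fst ` set xs"
      using 3 by (auto simp: words_iff)
    show ?case
    proof (cases "fst p = v \<or> fst q = v")
      case True
      then show ?thesis
        using d by (auto simp: entry_append front_sgn_append free.scale_scale mult.assoc mult.left_commute)
    next
      case False
      define k :: 'k where "k = front_sgn \<delta> v (xs @ p # q # ys)"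
      have en: "entry v (xs @ q # p # ys) = entry v (xs @ p # q # ys)"
        "front_sgn \<delta> v (xs @ q # p # ys) = k"
        using False by (simp_all add: entry_append front_sgn_append mult.left_commute k_def)
      have "eqm R (lin_ext (G (entry v (xs @ p # q # ys))) (gen (others v xs @ p # q # others v ys)))
         (lin_ext (G (entry v (xs @ p # q # ys))) (scale (sgn_alt \<delta> (fst p) (fst q)) (gen (others v xs @ q # p # others v ys))))"
        using e o False by (intro rel' product_rels_swap) auto
      then show ?thesis
        unfolding en k_def[symmetric] using False
        by (simp add: lin_ext_scale free.scale_left_commute[of "sgn_alt \<delta> (fst p) (fst q)"] eqm_scale del: free.scale_scale)
    qed
  qed
qed

section \<open>Graphs with a split or a marked vertex\<close>

abbreviation vert1 :: "ngraph \<Rightarrow> nat set \<Rightarrow> nat set" where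
  "vert1 \<Gamma> S \<equiv> insert (new_half \<Gamma>) S"

abbreviation vert2 :: "ngraph \<Rightarrow> nat set \<Rightarrow> nat set \<Rightarrow> nat set" where
  "vert2 \<Gamma> v S \<equiv> insert (Suc (new_half \<Gamma>)) (v - S)"

text \<open>The graph \<open>split_graph N a v A B \<Gamma>\<close> depends only on the set \<open>S\<close> of the entries of \<open>A\<close>.\<close>

definition sgraph :: "int \<Rightarrow> int \<Rightarrow> nat set \<Rightarrow> nat set \<Rightarrow> ngraph \<Rightarrow> ngraph" where
  "sgraph N a v S \<Gamma> = \<Gamma>\<lparr>halves := halves \<Gamma> \<union> {new_half \<Gamma>, Suc (new_half \<Gamma>)},
     verts := (verts \<Gamma> - {v}) \<union> {vert1 \<Gamma> S, vert2 \<Gamma> v S},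
     edges := edges \<Gamma> \<union> {{new_half \<Gamma>, Suc (new_half \<Gamma>)}},
     hdeg := (hdeg \<Gamma>)(new_half \<Gamma> := a, Suc (new_half \<Gamma>) := N - a)\<rparr>"

definition mark :: "nat set \<Rightarrow> ngraph \<Rightarrow> ngraph" where
  "mark v \<Gamma> = \<Gamma>\<lparr>specials := specials \<Gamma> \<union> {v}\<rparr>"

lemma sgraph_simps [simp]:
  "halves (sgraph N a v S \<Gamma>) = halves \<Gamma> \<union> {new_half \<Gamma>, Suc (new_half \<Gamma>)}"
  "verts (sgraph N a v S \<Gamma>) = (verts \<Gamma> - {v}) \<union> {vert1 \<Gamma> S, vert2 \<Gamma> v S}"
  "edges (sgraph N a v S \<Gamma>) = edges \<Gamma> \<union> {{new_half \<Gamma>, Suc (new_half \<Gamma>)}}"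
  "hdeg (sgraph N a v S \<Gamma>) = (hdeg \<Gamma>)(new_half \<Gamma> := a, Suc (new_half \<Gamma>) := N - a)"
  "specials (sgraph N a v S \<Gamma>) = specials \<Gamma>"
  by (simp_all add: sgraph_def)

lemma mark_simps [simp]:
  "halves (mark v \<Gamma>) = halves \<Gamma>" "verts (mark v \<Gamma>) = verts \<Gamma>" "edges (mark v \<Gamma>) = edges \<Gamma>"
  "hdeg (mark v \<Gamma>) = hdeg \<Gamma>" "specials (mark v \<Gamma>) = insert v (specials \<Gamma>)"
  "new_half (mark v \<Gamma>) = new_half \<Gamma>" "externals (mark v \<Gamma>) = externals \<Gamma>"
  "internals (mark v \<Gamma>) = internals \<Gamma>" "normals (mark v \<Gamma>) = normals \<Gamma> - {v}"
  "vdeg N (mark v \<Gamma>) = vdeg N \<Gamma>"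
  by (auto simp: mark_def new_half_def externals_def internals_def normals_def vdeg_def)

lemma sgraph_mark: "sgraph N a w T (mark v \<Gamma>) = mark v (sgraph N a w T \<Gamma>)"
  by (simp add: sgraph_def mark_def new_half_def)

lemma mark_commute: "mark v (mark w \<Gamma>) = mark w (mark v \<Gamma>)"
  by (simp add: mark_def insert_commute Un_insert_right)

lemma split_graph_eq: "set A = S \<Longrightarrow> set B = v - S \<Longrightarrow> split_graph N a v A B \<Gamma> = sgraph N a v S \<Gamma>"
  by (simp add: split_graph_def sgraph_def Let_def insert_commute)

lemma new_half_gt:
  assumes "finite (halves \<Gamma>)" "h \<in> halves \<Gamma>"
  shows "h < new_half \<Gamma>"
proof -
  have "\<forall>h\<in>halves \<Gamma>. h < Suc (Max (halves \<Gamma>))" using assms(1) by (auto simp: less_Suc_eq_le)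
  then have "\<forall>h\<in>halves \<Gamma>. h < new_half \<Gamma>" unfolding new_half_def by (rule LeastI)
  with assms(2) show ?thesis by blast
qed

lemma new_half_sgraph:
  assumes "finite (halves \<Gamma>)"
  shows "new_half (sgraph N a v S \<Gamma>) = Suc (Suc (new_half \<Gamma>))"
  unfolding new_half_def[of "sgraph N a v S \<Gamma>"]
  by (rule Least_equality) (use new_half_gt[OF assms] in \<open>auto intro: less_SucI\<close>)

section \<open>Relations between the decorations of one graph\<close>

locale graph_complex =
  fixes scW :: "'k::field_char_0 \<Rightarrow> 'w::ab_group_add \<Rightarrow> 'w"
    and W :: "int \<Rightarrow> 'w set" and N :: int
  assumes vsW: "vector_space scW"
    and subspaceW: "\<And>a. module.subspace scW (W a)"
    and even_N: "even N"
    and finite_degrees: "finite (degrees W)"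
begin

abbreviation DG :: "('k, 'w) dgraph set" where "DG \<equiv> dgraphs N W"
abbreviation TR :: "ngraph \<Rightarrow> ('k, 'w) chain set" where "TR \<equiv> tensor_rels scW N W"
abbreviation "is_graph \<equiv> is_ngraph N (degrees W)"

abbreviation EP :: "ngraph \<Rightarrow> ((nat set \<times> 'k tensor) list \<Rightarrow>\<^sub>0 'k) set" where
  "EP \<Gamma> \<equiv> product_rels scale (edges \<Gamma>) O_space (O_null (hdeg \<Gamma>)) (sgn_sym (\<lambda>e. \<Sum>h\<in>e. hdeg \<Gamma> h))"
abbreviation XP :: "ngraph \<Rightarrow> ((nat set \<times> 'w) list \<Rightarrow>\<^sub>0 'k) set" where
  "XP \<Gamma> \<equiv> product_rels scW (externals \<Gamma>) (\<lambda>u. W (vdeg N \<Gamma> u + N)) (\<lambda>u. {0}) (sgn_sym (vdeg N \<Gamma>))"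
abbreviation SP :: "ngraph \<Rightarrow> ((nat set \<times> 'k tensor) list \<Rightarrow>\<^sub>0 'k) set" where
  "SP \<Gamma> \<equiv> product_rels scale (specials \<Gamma>) (Cyc (hdeg \<Gamma>)) (C_null (hdeg \<Gamma>)) (sgn_alt (vdeg N \<Gamma>))"
abbreviation NP :: "ngraph \<Rightarrow> ((nat set \<times> 'k tensor) list \<Rightarrow>\<^sub>0 'k) set" where
  "NP \<Gamma> \<equiv> product_rels scale (normals \<Gamma>) (Cyc (hdeg \<Gamma>)) (C_null (hdeg \<Gamma>)) (sgn_alt (vdeg N \<Gamma>))"

lemma DG_iff: "(\<Gamma>, os, ws, ss, ns) \<in> DG \<longleftrightarrow> is_graph \<Gamma> \<and> os \<in> edge_words \<Gamma> \<and>
   ws \<in> external_words N W \<Gamma> \<and> ss \<in> special_words \<Gamma> \<and> ns \<in> normal_words \<Gamma>"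
  by (simp add: dgraphs_def)

lemma tensor_rels_image:
  fixes f :: "('k, 'w) chain \<Rightarrow> ('g \<Rightarrow>\<^sub>0 'k)"
  assumes r: "r \<in> TR \<Gamma>" and f: "lin f"
    and "\<And>r ws ss ns. r \<in> EP \<Gamma> \<Longrightarrow> ws \<in> external_words N W \<Gamma> \<Longrightarrow> ss \<in> special_words \<Gamma> \<Longrightarrow>
      ns \<in> normal_words \<Gamma> \<Longrightarrow> lin_ext (\<lambda>os. f (gen (\<Gamma>, os, ws, ss, ns))) r \<in> free.span R"
    and "\<And>r os ss ns. r \<in> XP \<Gamma> \<Longrightarrow> os \<in> edge_words \<Gamma> \<Longrightarrow> ss \<in> special_words \<Gamma> \<Longrightarrow>
      ns \<in> normal_words \<Gamma> \<Longrightarrow> lin_ext (\<lambda>ws. f (gen (\<Gamma>, os, ws, ss, ns))) r \<in> free.span R"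
    and "\<And>r os ws ns. r \<in> SP \<Gamma> \<Longrightarrow> os \<in> edge_words \<Gamma> \<Longrightarrow> ws \<in> external_words N W \<Gamma> \<Longrightarrow>
      ns \<in> normal_words \<Gamma> \<Longrightarrow> lin_ext (\<lambda>ss. f (gen (\<Gamma>, os, ws, ss, ns))) r \<in> free.span R"
    and "\<And>r os ws ss. r \<in> NP \<Gamma> \<Longrightarrow> os \<in> edge_words \<Gamma> \<Longrightarrow> ws \<in> external_words N W \<Gamma> \<Longrightarrow>
      ss \<in> special_words \<Gamma> \<Longrightarrow> lin_ext (\<lambda>ns. f (gen (\<Gamma>, os, ws, ss, ns))) r \<in> free.span R"
  shows "f r \<in> free.span R"
  using r unfolding tensor_rels_def
  by (elim UnE CollectE exE conjE) (simp_all add: lin_lin_ext_compose[OF f] assms(3-))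

lemma TR_os:
  assumes "eqm (EP \<Gamma>) x y" "ws \<in> external_words N W \<Gamma>" "ss \<in> special_words \<Gamma>" "ns \<in> normal_words \<Gamma>"
  shows "eqm (TR \<Gamma>) (lin_ext (\<lambda>os. gen (\<Gamma>, os, ws, ss, ns)) x) (lin_ext (\<lambda>os. gen (\<Gamma>, os, ws, ss, ns)) y)"
  by (rule eqm_lin[OF lin_lin_ext _ assms(1)], rule free.span_base) (use assms in \<open>auto simp: tensor_rels_def\<close>)

lemma TR_ws:
  assumes "eqm (XP \<Gamma>) x y" "os \<in> edge_words \<Gamma>" "ss \<in> special_words \<Gamma>" "ns \<in> normal_words \<Gamma>"
  shows "eqm (TR \<Gamma>) (lin_ext (\<lambda>ws. gen (\<Gamma>, os, ws, ss, ns)) x) (lin_ext (\<lambda>ws. gen (\<Gamma>, os, ws, ss, ns)) y)"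
  by (rule eqm_lin[OF lin_lin_ext _ assms(1)], rule free.span_base) (use assms in \<open>auto simp: tensor_rels_def\<close>)

lemma TR_ss:
  assumes "eqm (SP \<Gamma>) x y" "os \<in> edge_words \<Gamma>" "ws \<in> external_words N W \<Gamma>" "ns \<in> normal_words \<Gamma>"
  shows "eqm (TR \<Gamma>) (lin_ext (\<lambda>ss. gen (\<Gamma>, os, ws, ss, ns)) x) (lin_ext (\<lambda>ss. gen (\<Gamma>, os, ws, ss, ns)) y)"
  by (rule eqm_lin[OF lin_lin_ext _ assms(1)], rule free.span_base) (use assms in \<open>auto simp: tensor_rels_def\<close>)

lemma TR_ns:
  assumes "eqm (NP \<Gamma>) x y" "os \<in> edge_words \<Gamma>" "ws \<in> external_words N W \<Gamma>" "ss \<in> special_words \<Gamma>"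
  shows "eqm (TR \<Gamma>) (lin_ext (\<lambda>ns. gen (\<Gamma>, os, ws, ss, ns)) x) (lin_ext (\<lambda>ns. gen (\<Gamma>, os, ws, ss, ns)) y)"
  by (rule eqm_lin[OF lin_lin_ext _ assms(1)], rule free.span_base) (use assms in \<open>auto simp: tensor_rels_def\<close>)

lemma TR_ns_swap:
  assumes "(\<Gamma>, os, ws, ss, xs @ p # q # ys) \<in> DG"
  shows "eqm (TR \<Gamma>) (gen (\<Gamma>, os, ws, ss, xs @ p # q # ys))
    (scale (sgn_alt (vdeg N \<Gamma>) (fst p) (fst q)) (gen (\<Gamma>, os, ws, ss, xs @ q # p # ys)))"
  using TR_ns[OF product_rels_swap, of xs p q ys \<Gamma> os ws ss] assms
  by (simp add: DG_iff normal_words_def lin_ext_scale)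

lemma TR_ss_swap:
  assumes "(\<Gamma>, os, ws, xs @ p # q # ys, ns) \<in> DG"
  shows "eqm (TR \<Gamma>) (gen (\<Gamma>, os, ws, xs @ p # q # ys, ns))
    (scale (sgn_alt (vdeg N \<Gamma>) (fst p) (fst q)) (gen (\<Gamma>, os, ws, xs @ q # p # ys, ns)))"
  using TR_ss[OF product_rels_swap, of xs p q ys \<Gamma> os ws ns] assms
  by (simp add: DG_iff special_words_def lin_ext_scale)

lemma words_replace:
  "xs @ (u, x) # ys \<in> words U A \<Longrightarrow> xs @ (u, y) # ys \<in> words U A \<longleftrightarrow> y \<in> A u"
  by (auto simp: words_iff)

lemma TR_ns_lin:
  assumes "(\<Gamma>, os, ws, ss, xs @ (u, x) # ys) \<in> DG"
  shows "lin_mod (TR \<Gamma>) (Cyc (hdeg \<Gamma>) u) (\<lambda>x. gen (\<Gamma>, os, ws, ss, xs @ (u, x) # ys))"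
  unfolding lin_mod_def
proof (intro allI ballI)
  fix k :: 'k and y z :: "nat list \<Rightarrow>\<^sub>0 'k" assume yz: "y \<in> Cyc (hdeg \<Gamma>) u" "z \<in> Cyc (hdeg \<Gamma>) u"
  have w: "xs @ (u, x) # ys \<in> words (normals \<Gamma>) (Cyc (hdeg \<Gamma>))"
    using assms by (simp add: DG_iff normal_words_def)
  show "eqm (TR \<Gamma>) (gen (\<Gamma>, os, ws, ss, xs @ (u, scale k y + z) # ys))
     (scale k (gen (\<Gamma>, os, ws, ss, xs @ (u, y) # ys)) + gen (\<Gamma>, os, ws, ss, xs @ (u, z) # ys))"
    using TR_ns[OF product_rels_lin, of xs u y ys \<Gamma> z os ws ss k]
      words_replace[OF w, of y] words_replace[OF w, of z] yz assms
    by (simp add: DG_iff lin_ext_scale lin_ext_add)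
qed

lemma TR_ns_null:
  assumes "(\<Gamma>, os, ws, ss, xs @ (u, x) # ys) \<in> DG" "x \<in> C_null (hdeg \<Gamma>) u"
  shows "gen (\<Gamma>, os, ws, ss, xs @ (u, x) # ys) \<in> free.span (TR \<Gamma>)"
  using TR_ns[OF product_rels_null, of xs u x ys \<Gamma> os ws ss] assms
  by (simp add: DG_iff normal_words_def lin_ext_0 eqm_0_iff)

lemma TR_ns_scale:
  assumes "(\<Gamma>, os, ws, ss, xs @ (u, x) # ys) \<in> DG"
  shows "eqm (TR \<Gamma>) (gen (\<Gamma>, os, ws, ss, xs @ (u, scale k x) # ys)) (scale k (gen (\<Gamma>, os, ws, ss, xs @ (u, x) # ys)))"
proof -
  have "x \<in> Cyc (hdeg \<Gamma>) u" using assms by (auto simp: DG_iff normal_words_def words_iff)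
  then show ?thesis by (rule lin_mod_scale[OF subspace_Cyc TR_ns_lin[OF assms]])
qed

lemma edge_degree:
  assumes "is_graph \<Gamma>" "e \<in> edges \<Gamma>"
  shows "(\<Sum>h\<in>e. hdeg \<Gamma> h) = N"
proof -
  have "card e = 2" using assms by (simp add: is_ngraph_def)
  then obtain h1 h2 where "e = {h1, h2}" "h1 \<noteq> h2" by (meson card_2_iff)
  then show ?thesis using assms by (auto simp: is_ngraph_def)
qed

text \<open>The degree of an edge factor is the total degree \<open>N\<close> of its two half-edges.
  As \<open>N\<close> is even, the exchange sign of the symmetric algebra is 1.\<close>

lemma TR_os_swap:
  assumes "(\<Gamma>, xs @ p # q # ys, ws, ss, ns) \<in> DG"
  shows "eqm (TR \<Gamma>) (gen (\<Gamma>, xs @ p # q # ys, ws, ss, ns)) (gen (\<Gamma>, xs @ q # p # ys, ws, ss, ns))"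
proof -
  have "fst p \<in> edges \<Gamma>" "fst q \<in> edges \<Gamma>" "is_graph \<Gamma>"
    using assms by (auto simp: DG_iff edge_words_def words_iff)
  then have "sgn_sym (\<lambda>e. \<Sum>h\<in>e. hdeg \<Gamma> h) (fst p) (fst q) = (1 :: 'k)"
    using even_N by (simp add: sgn_sym_def edge_degree sgn_pow_def)
  then show ?thesis
    using TR_os[OF product_rels_swap, of xs p q ys \<Gamma> ws ss ns] assms
    by (simp add: DG_iff edge_words_def lin_ext_scale)
qed

lemma O_null_flip:
  assumes "h \<noteq> k"
  shows "gen [k, h] + scale (sgn_pow (\<delta> h * \<delta> k)) (gen [h, k]) \<in> O_null \<delta> {h, k}"
  unfolding O_null_def O_space_def ext_ideal_def
proof
  show "gen [k, h] + scale (sgn_pow (\<delta> h * \<delta> k)) (gen [h, k]) \<in> free.span (gen ` perms {h, k})"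
    by (intro free.span_add free.span_scale free.span_base) (use assms in \<open>simp_all add: permutations_of_set_doubleton\<close>)
  have "gen ([] @ k # h # []) + scale (sgn_pow (\<delta> k * \<delta> h)) (gen ([] @ h # k # [])) \<in> free.span
     {gen (xs @ a # b # ys) + scale (sgn_pow (\<delta> a * \<delta> b)) (gen (xs @ b # a # ys)) |
        xs a b ys. set (xs @ a # b # ys) \<subseteq> {h, k}}"
    by (rule free.span_base, intro CollectI exI conjI, rule refl) auto
  then show "gen [k, h] + scale (sgn_pow (\<delta> h * \<delta> k)) (gen [h, k]) \<in> free.span
     {gen (xs @ a # b # ys) + scale (sgn_pow (\<delta> a * \<delta> b)) (gen (xs @ b # a # ys)) |
        xs a b ys. set (xs @ a # b # ys) \<subseteq> {h, k}}"
    by (simp add: mult.commute)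
qed

lemma TR_os_flip:
  assumes "(\<Gamma>, xs @ ({h, k}, gen [h, k]) # ys, ws, ss, ns) \<in> DG" "h \<noteq> k"
  shows "eqm (TR \<Gamma>) (gen (\<Gamma>, xs @ ({h, k}, gen [k, h]) # ys, ws, ss, ns))
     (scale (- sgn_pow (hdeg \<Gamma> h * hdeg \<Gamma> k)) (gen (\<Gamma>, xs @ ({h, k}, gen [h, k]) # ys, ws, ss, ns)))"
proof -
  let ?z = "gen [k, h] + scale (sgn_pow (hdeg \<Gamma> h * hdeg \<Gamma> k)) (gen [h, k] :: _ \<Rightarrow>\<^sub>0 'k)"
  let ?c = "- sgn_pow (hdeg \<Gamma> h * hdeg \<Gamma> k) :: 'k"
  have z: "?z \<in> O_null (hdeg \<Gamma>) {h, k}" by (rule O_null_flip[OF assms(2)])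
  then have zO: "?z \<in> O_space {h, k}" by (simp add: O_null_def)
  have w: "xs @ ({h, k}, gen [h, k]) # ys \<in> words (edges \<Gamma>) (O_space :: _ \<Rightarrow> 'k tensor set)"
    using assms by (simp add: DG_iff edge_words_def)
  have w': "xs @ ({h, k}, ?z) # ys \<in> words (edges \<Gamma>) O_space"
    using zO words_replace[OF w] by blast
  \<comment> \<open>The reversed edge differs from a multiple of \<open>gen [h, k]\<close> by the
    exterior relation \<open>?z\<close>; multilinearity followed by the vanishing of words with a
    null entry gives the sign.\<close>
  have "gen [k, h] = scale ?c (gen [h, k]) + ?z" by (simp add: free.scale_minus_left)
  then have "eqm (EP \<Gamma>) (gen (xs @ ({h, k}, gen [k, h]) # ys))
     (scale ?c (gen (xs @ ({h, k}, gen [h, k]) # ys)) + gen (xs @ ({h, k}, ?z) # ys))"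
    using product_rels_lin[OF w w'] by metis
  also have "eqm (EP \<Gamma>) \<dots> (scale ?c (gen (xs @ ({h, k}, gen [h, k]) # ys)) + 0)"
    by (intro eqm_add eqm_refl product_rels_null w' z)
  finally have "eqm (EP \<Gamma>) (gen (xs @ ({h, k}, gen [k, h]) # ys))
     (scale ?c (gen (xs @ ({h, k}, gen [h, k]) # ys)))" by simp
  from TR_os[OF this, of ws ss ns] show ?thesis
    using assms(1) by (simp add: DG_iff lin_ext_scale lin_neg[OF lin_lin_ext])
qed

subsection \<open>Split graphs\<close>

definition splittable :: "int \<Rightarrow> nat set \<Rightarrow> nat set \<Rightarrow> ngraph \<Rightarrow> bool" where
  "splittable a v S \<Gamma> \<longleftrightarrow> is_graph \<Gamma> \<and> v \<in> normals \<Gamma> \<and> S \<subseteq> v \<and> S \<noteq> {} \<and> S \<noteq> v \<and>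
     a \<in> degrees W \<and> N - a \<in> degrees W"

lemma graph_finite: "is_graph \<Gamma> \<Longrightarrow> finite (halves \<Gamma>)"
  by (simp add: is_ngraph_def)

lemma vert_halves: "is_graph \<Gamma> \<Longrightarrow> v \<in> verts \<Gamma> \<Longrightarrow> v \<subseteq> halves \<Gamma>"
  by (auto simp: is_ngraph_def partition_on_def)

lemma edge_halves: "is_graph \<Gamma> \<Longrightarrow> v \<in> edges \<Gamma> \<Longrightarrow> v \<subseteq> halves \<Gamma>"
  by (auto simp: is_ngraph_def partition_on_def)

lemma vert_disjoint: "is_graph \<Gamma> \<Longrightarrow> v \<in> verts \<Gamma> \<Longrightarrow> w \<in> verts \<Gamma> \<Longrightarrow> v \<noteq> w \<Longrightarrow> v \<inter> w = {}"
  by (auto simp: is_ngraph_def partition_on_def disjoint_def)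

lemma vert_nonempty: "is_graph \<Gamma> \<Longrightarrow> v \<in> verts \<Gamma> \<Longrightarrow> v \<noteq> {}"
  by (auto simp: is_ngraph_def partition_on_def)

lemma vert_finite: "is_graph \<Gamma> \<Longrightarrow> v \<in> verts \<Gamma> \<Longrightarrow> finite v"
  using vert_halves graph_finite finite_subset by blast

lemma vert_lt: "is_graph \<Gamma> \<Longrightarrow> v \<in> verts \<Gamma> \<Longrightarrow> h \<in> v \<Longrightarrow> h < new_half \<Gamma>"
  using vert_halves graph_finite new_half_gt by blast

lemma edge_lt: "is_graph \<Gamma> \<Longrightarrow> v \<in> edges \<Gamma> \<Longrightarrow> h \<in> v \<Longrightarrow> h < new_half \<Gamma>"
  using edge_halves graph_finite new_half_gt by blast

lemma normal_vert: "v \<in> normals \<Gamma> \<Longrightarrow> v \<in> verts \<Gamma>"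
  by (simp add: normals_def internals_def)

lemma special_vert: "is_graph \<Gamma> \<Longrightarrow> v \<in> specials \<Gamma> \<Longrightarrow> v \<in> verts \<Gamma>"
  by (auto simp: is_ngraph_def internals_def)

lemma finite_verts: "is_graph \<Gamma> \<Longrightarrow> finite (verts \<Gamma>)"
  by (metis graph_finite is_ngraph_def finite_elements)

lemma finite_normals: "is_graph \<Gamma> \<Longrightarrow> finite (normals \<Gamma>)"
  using finite_verts by (simp add: normals_def internals_def)

lemma splittableD:
  assumes "splittable a v S \<Gamma>"
  shows "is_graph \<Gamma>" "v \<in> normals \<Gamma>" "v \<in> verts \<Gamma>" "finite (halves \<Gamma>)" "finite v" "finite S"
    "S \<subseteq> v" "S \<noteq> {}" "v - S \<noteq> {}" "v \<notin> specials \<Gamma>"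
    "new_half \<Gamma> \<notin> halves \<Gamma>" "Suc (new_half \<Gamma>) \<notin> halves \<Gamma>"
    "new_half \<Gamma> \<notin> v" "Suc (new_half \<Gamma>) \<notin> v"
proof -
  show *: "is_graph \<Gamma>" "v \<in> normals \<Gamma>" "v \<in> verts \<Gamma>" "S \<subseteq> v" "S \<noteq> {}" "v - S \<noteq> {}" "v \<notin> specials \<Gamma>"
    using assms by (auto simp: splittable_def normals_def internals_def)
  show "finite (halves \<Gamma>)" "finite v" "finite S"
    using graph_finite * vert_finite finite_subset by blast+
  show **: "new_half \<Gamma> \<notin> halves \<Gamma>" "Suc (new_half \<Gamma>) \<notin> halves \<Gamma>"
    using new_half_gt[OF graph_finite[OF *(1)]] by fastforce+
  then show "new_half \<Gamma> \<notin> v" "Suc (new_half \<Gamma>) \<notin> v"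
    using vert_halves[OF *(1,3)] by blast+
qed

lemma vdeg_sgraph_old:
  assumes "is_graph \<Gamma>" "u \<in> verts \<Gamma>"
  shows "vdeg N (sgraph N a v S \<Gamma>) u = vdeg N \<Gamma> u"
  unfolding vdeg_def
  by (intro arg_cong2[of _ _ _ _ "(-)"] sum.cong) (use vert_lt[OF assms] in fastforce)+

lemma vdeg_sgraph_new:
  assumes "splittable a v S \<Gamma>"
  shows "vdeg N (sgraph N a v S \<Gamma>) (vert1 \<Gamma> S) = (\<Sum>h\<in>S. hdeg \<Gamma> h) + a - N"
    "vdeg N (sgraph N a v S \<Gamma>) (vert2 \<Gamma> v S) = (\<Sum>h\<in>v - S. hdeg \<Gamma> h) - a"
proof -
  note s = splittableD[OF assms]
  have 1: "new_half \<Gamma> \<notin> S" "Suc (new_half \<Gamma>) \<notin> v - S" using s by auto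
  have 2: "(\<Sum>h\<in>S. hdeg (sgraph N a v S \<Gamma>) h) = (\<Sum>h\<in>S. hdeg \<Gamma> h)"
    "(\<Sum>h\<in>v - S. hdeg (sgraph N a v S \<Gamma>) h) = (\<Sum>h\<in>v - S. hdeg \<Gamma> h)"
    by (intro sum.cong refl; use s in auto)+
  show "vdeg N (sgraph N a v S \<Gamma>) (vert1 \<Gamma> S) = (\<Sum>h\<in>S. hdeg \<Gamma> h) + a - N"
    "vdeg N (sgraph N a v S \<Gamma>) (vert2 \<Gamma> v S) = (\<Sum>h\<in>v - S. hdeg \<Gamma> h) - a"
    unfolding vdeg_def using s 1 2 by (simp_all add: sum.insert)
qed

text \<open>The new half-edges contribute \<open>a + (N - a) = N\<close>, which compensates for the
  shift by \<open>N\<close> now being subtracted for two vertices instead of one.\<close>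

lemma vdeg_sgraph_sum:
  assumes "splittable a v S \<Gamma>"
  shows "vdeg N (sgraph N a v S \<Gamma>) (vert1 \<Gamma> S) +
     vdeg N (sgraph N a v S \<Gamma>) (vert2 \<Gamma> v S) = vdeg N \<Gamma> v"
proof -
  have "(\<Sum>h\<in>v. hdeg \<Gamma> h) = (\<Sum>h\<in>v - S. hdeg \<Gamma> h) + (\<Sum>h\<in>S. hdeg \<Gamma> h)"
    using splittableD[OF assms] by (intro sum.subset_diff) auto
  then show ?thesis unfolding vdeg_sgraph_new[OF assms] by (simp add: vdeg_def)
qed

lemma new_verts_sgraph:
  assumes "splittable a v S \<Gamma>"
  shows "vert1 \<Gamma> S \<notin> verts \<Gamma>" "vert2 \<Gamma> v S \<notin> verts \<Gamma>"
    "vert1 \<Gamma> S \<noteq> vert2 \<Gamma> v S"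
proof -
  note s = splittableD[OF assms]
  show "vert1 \<Gamma> S \<notin> verts \<Gamma>"
    using vert_halves[OF s(1)] s(11) by blast
  show "vert2 \<Gamma> v S \<notin> verts \<Gamma>"
    using vert_halves[OF s(1)] s(12) by blast
  have "new_half \<Gamma> \<notin> vert2 \<Gamma> v S"
    using s(13) by simp
  then show "vert1 \<Gamma> S \<noteq> vert2 \<Gamma> v S"
    by blast
qed

lemma card_new_sgraph:
  assumes "splittable a v S \<Gamma>"
  shows "card (vert1 \<Gamma> S) > 1" "card (vert2 \<Gamma> v S) > 1"
proof -
  note s = splittableD[OF assms]
  have "card S > 0" "card (v - S) > 0" using s(5,6,8,9) by (auto simp only: card_gt_0_iff finite_Diff)
  moreover have "new_half \<Gamma> \<notin> S" using s(7,13) by blast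
  ultimately show "card (vert1 \<Gamma> S) > 1" "card (vert2 \<Gamma> v S) > 1"
    using s(5,6,14) by simp_all
qed

lemma externals_sgraph:
  assumes "splittable a v S \<Gamma>"
  shows "externals (sgraph N a v S \<Gamma>) = externals \<Gamma>"
proof -
  have "card v \<noteq> 1" using assms by (simp add: splittable_def normals_def internals_def)
  then show ?thesis using card_new_sgraph[OF assms] by (auto simp: externals_def)
qed

lemma internals_sgraph:
  assumes "splittable a v S \<Gamma>"
  shows "internals (sgraph N a v S \<Gamma>) = (internals \<Gamma> - {v}) \<union> {vert1 \<Gamma> S, vert2 \<Gamma> v S}"
  using card_new_sgraph[OF assms] by (auto simp: internals_def)

lemma normals_sgraph:
  assumes "splittable a v S \<Gamma>"
  shows "normals (sgraph N a v S \<Gamma>) = (normals \<Gamma> - {v}) \<union> {vert1 \<Gamma> S, vert2 \<Gamma> v S}"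
proof -
  have "specials \<Gamma> \<subseteq> verts \<Gamma>" using special_vert splittableD(1)[OF assms] by blast
  then show ?thesis
    using new_verts_sgraph[OF assms] by (auto simp: normals_def internals_sgraph[OF assms])
qed

lemma is_graph_sgraph:
  assumes "splittable a v S \<Gamma>"
  shows "is_graph (sgraph N a v S \<Gamma>)"
proof -
  note s = splittableD[OF assms]
  let ?G = "sgraph N a v S \<Gamma>" and ?n = "new_half \<Gamma>"
  have pv: "partition_on (halves \<Gamma>) (verts \<Gamma>)" and pe: "partition_on (halves \<Gamma>) (edges \<Gamma>)"
    using s by (auto simp: is_ngraph_def)
  have "partition_on (halves ?G) (verts ?G)"
  proof (rule partition_onI)
    show "\<Union> (verts ?G) = halves ?G"
      using pv s vert_halves[OF s(1)] by (auto simp: partition_on_def)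
    let ?v1 = "insert ?n S" and ?v2 = "insert (Suc ?n) (v - S)"
    fix p q assume pq: "p \<in> verts ?G" "q \<in> verts ?G" "p \<noteq> q"
    have old: "u \<inter> ?v1 = {}" "u \<inter> ?v2 = {}" "?v1 \<inter> u = {}" "?v2 \<inter> u = {}"
      if "u \<in> verts \<Gamma> - {v}" for u
    proof -
      have "u \<inter> v = {}" "?n \<notin> u" "Suc ?n \<notin> u"
        using that vert_disjoint[OF s(1) _ s(3), of u] vert_halves[OF s(1), of u] s(11,12) by auto
      then show "u \<inter> ?v1 = {}" "u \<inter> ?v2 = {}" "?v1 \<inter> u = {}" "?v2 \<inter> u = {}"
        using s(7) by blast+
    qed
    have new: "?v1 \<inter> ?v2 = {}"
      using s(7,13,14) n_not_Suc_n[of ?n] by blast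
    then have new': "?v2 \<inter> ?v1 = {}" by blast
    from pq have "p \<in> verts \<Gamma> - {v} \<or> p = ?v1 \<or> p = ?v2" "q \<in> verts \<Gamma> - {v} \<or> q = ?v1 \<or> q = ?v2"
      by auto
    moreover have "p \<inter> q = {}" if "p \<in> verts \<Gamma> - {v}" "q \<in> verts \<Gamma> - {v}"
      using vert_disjoint[OF s(1), of p q] that pq(3) by blast
    ultimately show "disjnt p q"
      unfolding disjnt_def using old new new' pq(3) by metis
  next
    show "{} \<notin> verts ?G" using vert_nonempty[OF s(1)] by auto
  qed
  moreover have "partition_on (halves ?G) (edges ?G)"
  proof (rule partition_onI)
    show "\<Union> (edges ?G) = halves ?G"
      using pe by (auto simp: partition_on_def)
    fix p q assume "p \<in> edges ?G" "q \<in> edges ?G" "p \<noteq> q"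
    moreover have "?n \<notin> u" "Suc ?n \<notin> u" if "u \<in> edges \<Gamma>" for u
      using edge_halves[OF s(1) that] s(11,12) by auto
    moreover have "p \<inter> q = {}" if "p \<in> edges \<Gamma>" "q \<in> edges \<Gamma>"
      using pe that \<open>p \<noteq> q\<close> by (auto simp: partition_on_def disjoint_def)
    ultimately show "disjnt p q"
      by (auto simp: disjnt_def)
  next
    show "{} \<notin> edges ?G" using pe by (auto simp: partition_on_def)
  qed
  moreover have "\<forall>e\<in>edges ?G. card e = 2"
    using s by (auto simp: is_ngraph_def)
  moreover have "\<forall>h\<in>halves ?G. hdeg ?G h \<in> degrees W"
    using assms by (auto simp: is_ngraph_def splittable_def)
  moreover have "\<forall>h1 h2. {h1, h2} \<in> edges ?G \<longrightarrow> hdeg ?G h1 + hdeg ?G h2 = N"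
  proof (intro allI impI)
    fix h1 h2 assume e: "{h1, h2} \<in> edges ?G"
    show "hdeg ?G h1 + hdeg ?G h2 = N"
    proof (cases "{h1, h2} \<in> edges \<Gamma>")
      case True
      then have "h1 < ?n" "h2 < ?n" using edge_lt[OF s(1) True] by auto
      then show ?thesis using True s by (auto simp: is_ngraph_def)
    next
      case False
      with e have "{h1, h2} = {?n, Suc ?n}" by simp
      then show ?thesis by (auto simp: doubleton_eq_iff)
    qed
  qed
  moreover have "specials ?G \<subseteq> internals ?G"
    using s unfolding internals_sgraph[OF assms] by (auto simp: is_ngraph_def)
  moreover have "\<forall>u\<in>specials ?G. vdeg N ?G u = - 1 \<and> card u \<ge> 3"
    using s vdeg_sgraph_old[OF s(1)] special_vert[OF s(1)] by (auto simp: is_ngraph_def)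
  ultimately show ?thesis using s by (auto simp: is_ngraph_def)
qed

lemma is_graph_mark:
  "is_graph \<Gamma> \<Longrightarrow> v \<in> normals \<Gamma> \<Longrightarrow> vdeg N \<Gamma> v = - 1 \<Longrightarrow> card v \<ge> 3 \<Longrightarrow> is_graph (mark v \<Gamma>)"
  by (auto simp: is_ngraph_def normals_def)

end

section \<open>The splitting operators\<close>

declare sgraph_simps(4) [simp del]

lemma ext_ideal_cong: "(\<And>a. a \<in> U \<Longrightarrow> \<delta> a = \<delta>' a) \<Longrightarrow> ext_ideal \<delta> U = ext_ideal \<delta>' U"
  unfolding ext_ideal_def by (intro arg_cong[of _ _ free.span] Collect_cong arg_cong[of _ _ Ex] ext) auto

lemma O_null_cong: "(\<And>a. a \<in> U \<Longrightarrow> \<delta> a = \<delta>' a) \<Longrightarrow> O_null \<delta> U = O_null \<delta>' U"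
  unfolding O_null_def by (intro arg_cong2[of _ _ _ _ "(\<inter>)"] ext_ideal_cong) auto

lemma shuffle_cyc_in_Cyc:
  assumes "xs @ ys @ [h] \<in> perms U"
  shows "shuffle_cyc \<delta> xs ys h \<in> Cyc \<delta> U"
  unfolding shuffle_cyc_def
proof (intro free.subspace_sum[OF subspace_Cyc] free.subspace_scale[OF subspace_Cyc] cyc_in_Cyc)
  fix w assume "w \<in> shuffles xs ys"
  then show "w @ [h] \<in> perms U"
    using assms shuffles_distinct[of xs ys w] by (auto simp: perms_def)
qed

lemma C_null_subset_Cyc: "C_null \<delta> U \<subseteq> Cyc \<delta> U"
  unfolding C_null_altdef
  by (rule free.span_minimal[OF _ subspace_Cyc]) (use shuffle_cyc_in_Cyc in blast)

lemma shuffle_cyc_cong: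
  assumes "\<And>a. a \<in> set xs \<union> set ys \<union> {h} \<Longrightarrow> \<delta> a = \<delta>' a"
  shows "shuffle_cyc \<delta> xs ys h = shuffle_cyc \<delta>' xs ys h"
  unfolding shuffle_cyc_def
  by (intro sum.cong arg_cong2[of _ _ _ _ scale] koszul_cong cyc_cong)
    (use assms set_shuffles in fastforce)+

lemma C_null_cong:
  assumes "\<And>a. a \<in> U \<Longrightarrow> \<delta> a = \<delta>' a"
  shows "C_null \<delta> U = C_null \<delta>' U"
proof -
  have "shuffle_cyc \<delta> xs ys h = shuffle_cyc \<delta>' xs ys h"
    if "xs @ ys @ [h] \<in> perms U" for xs ys h
    using that assms by (intro shuffle_cyc_cong) (auto simp: perms_def)
  then show ?thesis
    unfolding C_null_altdef by (intro arg_cong[of _ _ free.span] Collect_cong arg_cong[of _ _ Ex] ext) auto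
qed

lemma product_rels_length:
  assumes "r \<in> product_rels sc U A B sg"
  shows "r \<in> free.span (gen ` {xs. length xs = card U})"
proof (rule product_rels_image[OF assms lin_id], goal_cases)
  case (1 xs u c x y ys)
  have "length (xs @ (u, z) # ys) = card U" for z using words_length[OF 1(1)] by simp
  then show ?case unfolding eqm_def
    by (intro free.span_diff free.span_add free.span_scale free.span_base) auto
next
  case (2 xs u x ys)
  then show ?case using words_length[OF 2(1)] by (intro free.span_base) auto
next
  case (3 xs p q ys)
  have "length (xs @ p # q # ys) = card U" "length (xs @ q # p # ys) = card U"
    using words_length[OF 3] by simp_all
  then show ?case unfolding eqm_def
    by (intro free.span_diff free.span_add free.span_scale free.span_base) auto
qed

context graph_complex
begin

text \<open>All orderings of \<open>S\<close> and of \<open>v - S\<close> occur, not only those with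
  prescribed last letters; only then does the value respect the shuffle relations of
  \<open>C(v)\<close>.\<close>

definition split_sum where
  "split_sum a v S \<Gamma> os ws ss c ns =
    (\<Sum>A\<in>perms S. \<Sum>B\<in>perms (v - S). scale (coeff c (A @ B))
      (gen (sgraph N a v S \<Gamma>, os @ [({new_half \<Gamma>, Suc (new_half \<Gamma>)}, gen [new_half \<Gamma>, Suc (new_half \<Gamma>)])], ws, ss,
        (vert1 \<Gamma> S, cyc (hdeg (sgraph N a v S \<Gamma>)) (A @ [new_half \<Gamma>])) #
        (vert2 \<Gamma> v S, cyc (hdeg (sgraph N a v S \<Gamma>)) (Suc (new_half \<Gamma>) # B)) # ns)
       :: ('k, 'w) dgraph \<Rightarrow>\<^sub>0 'k))"

text \<open>\<open>Sp a v S\<close> is the part of \<open>2 d\<^sub>v\<close> in which \<open>v\<close> is split into \<open>S \<union> {h'}\<close> and \<open>{h''} \<union> (v - S)\<close> with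
  \<open>|h'| = a\<close>.\<close>

definition Sp :: "int \<Rightarrow> nat set \<Rightarrow> nat set \<Rightarrow> ('k, 'w) chain \<Rightarrow> ('k, 'w) chain" where
  "Sp a v S = lin_ext (\<lambda>(\<Gamma>, os, ws, ss, ns).
     scale ((- 1) ^ length ss * front_sgn (vdeg N \<Gamma>) v ns)
       (split_sum a v S \<Gamma> os ws ss (entry v ns) (others v ns)))"

lemma lin_Sp: "lin (Sp a v S)"
  unfolding Sp_def by (rule lin_lin_ext)

lemma Sp_gen: "Sp a v S (gen (\<Gamma>, os, ws, ss, ns)) =
    scale ((- 1) ^ length ss * front_sgn (vdeg N \<Gamma>) v ns)
       (split_sum a v S \<Gamma> os ws ss (entry v ns) (others v ns))"
  by (simp add: Sp_def)

text \<open>The operators at a single vertex are studied on these subspaces, because a vertex is not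
  defined for an isomorphism class of graphs.\<close>

definition chainsG :: "ngraph \<Rightarrow> ('k, 'w) chain set" where
  "chainsG \<Gamma> = free.span (gen ` {s \<in> DG. fst s = \<Gamma>})"

lemma gen_chainsG: "(\<Gamma>, os, ws, ss, ns) \<in> DG \<Longrightarrow> gen (\<Gamma>, os, ws, ss, ns) \<in> chainsG \<Gamma>"
  unfolding chainsG_def by (rule free.span_base) auto

lemma chainsG_image:
  assumes "lin f" "\<And>os ws ss ns. (\<Gamma>, os, ws, ss, ns) \<in> DG \<Longrightarrow> f (gen (\<Gamma>, os, ws, ss, ns)) \<in> free.span R"
    and "x \<in> chainsG \<Gamma>"
  shows "f x \<in> free.span R"
  using assms(3) unfolding chainsG_def
  by (rule lin_span[OF assms(1), rotated]) (use assms(2) in auto)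

lemma chainsG_eqm:
  assumes "lin f" "lin g"
    and "\<And>os ws ss ns. (\<Gamma>, os, ws, ss, ns) \<in> DG \<Longrightarrow> eqm R (f (gen (\<Gamma>, os, ws, ss, ns))) (g (gen (\<Gamma>, os, ws, ss, ns)))"
    and "x \<in> chainsG \<Gamma>"
  shows "eqm R (f x) (g x)"
  using assms(4) unfolding chainsG_def
  by (rule eqm_on_span[OF assms(1,2), rotated]) (use assms(3) in auto)

lemma chainsG_eq:
  assumes "lin f" "lin g"
    and "\<And>os ws ss ns. (\<Gamma>, os, ws, ss, ns) \<in> DG \<Longrightarrow> f (gen (\<Gamma>, os, ws, ss, ns)) = g (gen (\<Gamma>, os, ws, ss, ns))"
    and "x \<in> chainsG \<Gamma>"
  shows "f x = g x"
  using assms(4) unfolding chainsG_def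
  by (rule lin_eq_on_span[OF assms(1,2), rotated]) (use assms(3) in auto)

lemma hdeg_sgraph_old: "is_graph \<Gamma> \<Longrightarrow> u \<in> verts \<Gamma> \<Longrightarrow> h \<in> u \<Longrightarrow> hdeg (sgraph N a v S \<Gamma>) h = hdeg \<Gamma> h"
  using vert_lt[of \<Gamma> u h] by (auto simp: sgraph_simps(4))

lemma Cyc_sgraph: "is_graph \<Gamma> \<Longrightarrow> u \<in> verts \<Gamma> \<Longrightarrow> Cyc (hdeg (sgraph N a v S \<Gamma>)) u = Cyc (hdeg \<Gamma>) u"
  by (rule Cyc_cong) (rule hdeg_sgraph_old)

lemma C_null_sgraph: "is_graph \<Gamma> \<Longrightarrow> u \<in> verts \<Gamma> \<Longrightarrow> C_null (hdeg (sgraph N a v S \<Gamma>)) u = C_null (hdeg \<Gamma>) u"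
  by (rule C_null_cong) (rule hdeg_sgraph_old)

lemma O_null_sgraph: "is_graph \<Gamma> \<Longrightarrow> u \<in> edges \<Gamma> \<Longrightarrow> O_null (hdeg (sgraph N a v S \<Gamma>)) u = O_null (hdeg \<Gamma>) u"
  by (rule O_null_cong) (use edge_lt in \<open>fastforce simp: sgraph_simps(4)\<close>)

lemma edge_words_sgraph:
  assumes "splittable a v S \<Gamma>" "os \<in> edge_words \<Gamma>"
  shows "os @ [({new_half \<Gamma>, Suc (new_half \<Gamma>)}, gen [new_half \<Gamma>, Suc (new_half \<Gamma>)])] \<in> edge_words (sgraph N a v S \<Gamma>)"
proof -
  have "{new_half \<Gamma>, Suc (new_half \<Gamma>)} \<notin> edges \<Gamma>"
    using edge_halves[OF splittableD(1)[OF assms(1)]] splittableD(11)[OF assms(1)] by blast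
  moreover have "gen [new_half \<Gamma>, Suc (new_half \<Gamma>)] \<in> O_space {new_half \<Gamma>, Suc (new_half \<Gamma>)}"
    unfolding O_space_def by (intro free.span_base) (simp add: permutations_of_set_doubleton)
  ultimately show ?thesis using assms(2)
    by (auto simp: edge_words_def words_iff)
qed

lemma external_words_sgraph:
  assumes "splittable a v S \<Gamma>"
  shows "external_words N W (sgraph N a v S \<Gamma>) = external_words N W \<Gamma>"
  unfolding external_words_def externals_sgraph[OF assms]
  by (rule words_cong) (simp add: vdeg_sgraph_old[OF splittableD(1)[OF assms]] externals_def)

lemma special_words_sgraph:
  assumes "splittable a v S \<Gamma>"
  shows "special_words (sgraph N a v S \<Gamma>) = special_words \<Gamma>"
  unfolding special_words_def sgraph_simps(5)
  by (rule words_cong) (use Cyc_sgraph special_vert splittableD(1)[OF assms] in blast)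

lemma normal_words_sgraph:
  assumes s: "splittable a v S \<Gamma>" and ns: "ns \<in> words (normals \<Gamma> - {v}) (Cyc (hdeg \<Gamma>))"
    and \<alpha>: "\<alpha> \<in> Cyc (hdeg (sgraph N a v S \<Gamma>)) (vert1 \<Gamma> S)"
    and \<beta>: "\<beta> \<in> Cyc (hdeg (sgraph N a v S \<Gamma>)) (vert2 \<Gamma> v S)"
  shows "(vert1 \<Gamma> S, \<alpha>) # (vert2 \<Gamma> v S, \<beta>) # ns \<in> normal_words (sgraph N a v S \<Gamma>)"
proof -
  have "ns \<in> words (normals \<Gamma> - {v}) (Cyc (hdeg (sgraph N a v S \<Gamma>)))"
    using ns by (subst words_cong[OF Cyc_sgraph[OF splittableD(1)[OF s]]]) (auto simp: normal_vert)
  moreover have "vert1 \<Gamma> S \<notin> normals \<Gamma>" "vert2 \<Gamma> v S \<notin> normals \<Gamma>"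
    using new_verts_sgraph[OF s] normal_vert by blast+
  ultimately show ?thesis
    unfolding normal_words_def normals_sgraph[OF s] using \<alpha> \<beta> new_verts_sgraph(3)[OF s]
    by (auto simp: words_iff)
qed

lemma cyc_new:
  assumes s: "splittable a v S \<Gamma>"
  shows "A \<in> perms S \<Longrightarrow> cyc (hdeg (sgraph N a v S \<Gamma>)) (A @ [new_half \<Gamma>]) \<in> Cyc (hdeg (sgraph N a v S \<Gamma>)) (vert1 \<Gamma> S)"
    and "B \<in> perms (v - S) \<Longrightarrow> cyc (hdeg (sgraph N a v S \<Gamma>)) (Suc (new_half \<Gamma>) # B)
        \<in> Cyc (hdeg (sgraph N a v S \<Gamma>)) (vert2 \<Gamma> v S)"
  using splittableD(7,13,14)[OF s] by (auto intro!: cyc_in_Cyc simp: perms_def)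

lemma split_DG:
  assumes s: "splittable a v S \<Gamma>"
    and DG: "os \<in> edge_words \<Gamma>" "ws \<in> external_words N W \<Gamma>" "ss \<in> special_words \<Gamma>"
      "ns \<in> words (normals \<Gamma> - {v}) (Cyc (hdeg \<Gamma>))"
    and \<alpha>: "\<alpha> \<in> Cyc (hdeg (sgraph N a v S \<Gamma>)) (vert1 \<Gamma> S)"
    and \<beta>: "\<beta> \<in> Cyc (hdeg (sgraph N a v S \<Gamma>)) (vert2 \<Gamma> v S)"
  shows "(sgraph N a v S \<Gamma>, os @ [({new_half \<Gamma>, Suc (new_half \<Gamma>)}, gen [new_half \<Gamma>, Suc (new_half \<Gamma>)])], ws, ss,
        (vert1 \<Gamma> S, \<alpha>) # (vert2 \<Gamma> v S, \<beta>) # ns) \<in> DG"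
  unfolding DG_iff
  using is_graph_sgraph[OF s] edge_words_sgraph[OF s DG(1)] external_words_sgraph[OF s]
    special_words_sgraph[OF s] normal_words_sgraph[OF s DG(4) \<alpha> \<beta>] DG(2,3) by auto

lemma others_normal_words: "ns \<in> normal_words \<Gamma> \<Longrightarrow> others v ns \<in> words (normals \<Gamma> - {v}) (Cyc (hdeg \<Gamma>))"
  unfolding normal_words_def by (rule words_others)

lemma Sp_chainsG:
  assumes s: "splittable a v S \<Gamma>" and x: "x \<in> chainsG \<Gamma>"
  shows "Sp a v S x \<in> chainsG (sgraph N a v S \<Gamma>)"
  using x unfolding chainsG_def[of "sgraph N a v S \<Gamma>"]
proof (rule chainsG_image[OF lin_Sp, rotated])
  fix os ws ss ns
  assume D: "(\<Gamma>, os, ws, ss, ns) \<in> DG"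
  show "Sp a v S (gen (\<Gamma>, os, ws, ss, ns)) \<in> free.span (gen ` {s \<in> DG. fst s = sgraph N a v S \<Gamma>})"
    unfolding Sp_gen split_sum_def
    by (intro free.span_scale free.span_sum free.span_base imageI CollectI conjI split_DG[OF s] cyc_new[OF s] others_normal_words)
      (use D in \<open>simp_all add: DG_iff\<close>)
qed

lemma split_sum_lin:
  "split_sum a v S \<Gamma> os ws ss (scale k x + y) ns = scale k (split_sum a v S \<Gamma> os ws ss x ns) + split_sum a v S \<Gamma> os ws ss y ns"
  by (simp add: split_sum_def lookup_add free.scale_left_distrib sum.distrib free.scale_sum_right)

text \<open>This is where the commutativity relations are used: in \<open>split_C_null\<close>,
  \<open>\<Psi>\<close> inserts its arguments as decorations of the two new vertices.\<close>

lemma TR_split_null: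
  assumes s: "splittable a v S \<Gamma>"
    and DG: "os \<in> edge_words \<Gamma>" "ws \<in> external_words N W \<Gamma>" "ss \<in> special_words \<Gamma>"
      "ns \<in> words (normals \<Gamma> - {v}) (Cyc (hdeg \<Gamma>))"
    and c: "c \<in> C_null (hdeg \<Gamma>) v"
  shows "split_sum a v S \<Gamma> os ws ss c ns \<in> free.span (TR (sgraph N a v S \<Gamma>))"
proof -
  let ?n = "new_half \<Gamma>" and ?G = "sgraph N a v S \<Gamma>"
  let ?v1 = "insert ?n S" and ?v2 = "insert (Suc ?n) (v - S)" and ?os = "os @ [({?n, Suc ?n}, gen [?n, Suc ?n])]"
  \<comment> \<open>\<open>split_sum\<close> has \<open>h''\<close> in front of \<open>B\<close>,
    whereas the shuffle argument has it at the end. The sign of this rotation depends only on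
    degrees and is absorbed into \<open>\<Psi>\<close>.\<close>
  define k :: 'k where "k = sgn_pow (hdeg ?G (Suc ?n) * sum (hdeg ?G) (v - S))"
  define \<Psi> where "\<Psi> \<alpha> \<beta> = (gen (?G, ?os, ws, ss, (?v1, \<alpha>) # (?v2, scale k \<beta>) # ns) :: _ \<Rightarrow>\<^sub>0 'k)" for \<alpha> \<beta>
  note sD = splittableD[OF s]
  have Sv: "S \<union> (v - S) = v" using sD(7) by auto
  have k: "cyc (hdeg ?G) (Suc ?n # B) = scale k (cyc (hdeg ?G) (B @ [Suc ?n]))"
    if "B \<in> perms (v - S)" for B
  proof -
    have B: "distinct B" "set B = v - S" using that by (auto simp: perms_def)
    have "cyc (hdeg ?G) ([Suc ?n] @ B) = scale (koszul (hdeg ?G) ([Suc ?n] @ B) (B @ [Suc ?n])) (cyc (hdeg ?G) (B @ [Suc ?n]) :: _ \<Rightarrow>\<^sub>0 'k)"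
      using B sD by (intro cyc_swap) auto
    moreover have "koszul (hdeg ?G) ([Suc ?n] @ B) (B @ [Suc ?n]) = k"
      unfolding k_def using B sD by (subst koszul_swap) auto
    ultimately show ?thesis by simp
  qed
  have scl: "scale k \<beta> \<in> Cyc (hdeg ?G) ?v2" if "\<beta> \<in> Cyc (hdeg ?G) ?v2" for \<beta>
    using free.subspace_scale[OF subspace_Cyc that] .
  have D: "(?G, ?os, ws, ss, (?v1, \<alpha>) # (?v2, scale k \<beta>) # ns) \<in> DG"
    if "\<alpha> \<in> Cyc (hdeg ?G) ?v1" "\<beta> \<in> Cyc (hdeg ?G) ?v2" for \<alpha> \<beta>
    using that by (intro split_DG[OF s DG] scl)
  have "(\<Sum>A\<in>perms S. \<Sum>B\<in>perms (v - S). scale (coeff c (A @ B))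
     (\<Psi> (cyc (hdeg ?G) (A @ [?n])) (cyc (hdeg ?G) (B @ [Suc ?n])))) \<in> free.span (TR ?G)"
  proof (rule split_C_null[where \<delta> = "hdeg \<Gamma>" and \<delta>' = "hdeg ?G"], goal_cases)
    case 1 then show ?case using c Sv by simp
  next
    case (7 a)
    then show ?case using hdeg_sgraph_old[OF sD(1,3)] Sv by blast
  next
    case (8 \<beta>)
    have "lin_mod (TR ?G) (Cyc (hdeg ?G) ?v1) (\<lambda>x. gen (?G, ?os, ws, ss, [] @ (?v1, x) # (?v2, scale k \<beta>) # ns))"
      by (rule TR_ns_lin[of _ _ _ _ _ _ 0]) (use D[OF free.subspace_0[OF subspace_Cyc] 8] in simp)
    then show ?case unfolding \<Psi>_def append_Nil .
  next
    case (9 \<alpha> \<beta>)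
    moreover have "\<alpha> \<in> Cyc (hdeg ?G) ?v1" using 9(1) C_null_subset_Cyc by blast
    ultimately show ?case unfolding \<Psi>_def
      using TR_ns_null[of ?G ?os ws ss "[]" ?v1 \<alpha> "(?v2, scale k \<beta>) # ns"] D by simp
  next
    case (10 \<alpha>)
    show ?case unfolding lin_mod_def
    proof (intro ballI allI)
      fix l :: 'k and x y :: "nat list \<Rightarrow>\<^sub>0 'k"
      assume xy: "x \<in> Cyc (hdeg ?G) ?v2" "y \<in> Cyc (hdeg ?G) ?v2"
      have "lin_mod (TR ?G) (Cyc (hdeg ?G) ?v2) (\<lambda>x. gen (?G, ?os, ws, ss, [(?v1, \<alpha>)] @ (?v2, x) # ns))"
        by (rule TR_ns_lin) (use D[OF 10 xy(1)] in simp)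
      then have "eqm (TR ?G) (gen (?G, ?os, ws, ss, [(?v1, \<alpha>)] @ (?v2, scale l (scale k x) + scale k y) # ns))
        (scale l (gen (?G, ?os, ws, ss, [(?v1, \<alpha>)] @ (?v2, scale k x) # ns)) + gen (?G, ?os, ws, ss, [(?v1, \<alpha>)] @ (?v2, scale k y) # ns))"
        unfolding lin_mod_def using scl xy by blast
      moreover have "scale k (scale l x + y) = scale l (scale k x) + scale k y"
        by (simp add: free.scale_right_distrib mult.commute)
      ultimately show "eqm (TR ?G) (\<Psi> \<alpha> (scale l x + y)) (scale l (\<Psi> \<alpha> x) + \<Psi> \<alpha> y)"
        unfolding \<Psi>_def by simp
    qed
  next
    case (11 \<alpha> \<beta>)
    moreover have "\<beta> \<in> Cyc (hdeg ?G) ?v2" using 11(2) C_null_subset_Cyc by blast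
    moreover have "scale k \<beta> \<in> C_null (hdeg ?G) ?v2"
      using 11(2) unfolding C_null_def by (rule free.span_scale)
    ultimately show ?case unfolding \<Psi>_def
      using TR_ns_null[of ?G ?os ws ss "[(?v1, \<alpha>)]" ?v2 "scale k \<beta>" ns] D by simp
  qed (use sD in auto)
  then show ?thesis
    unfolding split_sum_def \<Psi>_def by (simp add: k cong: sum.cong)
qed

text \<open>Relations in the edge, external and special factors pass through, because the splitting
  at most appends a factor there. In the normal factor \<open>front_respects\<close> reduces the
  claim to linearity in the decoration of \<open>v\<close> and to its vanishing on
  \<open>C_null\<close>.\<close>

lemma Sp_TR:
  assumes s: "splittable a v S \<Gamma>" and r: "r \<in> TR \<Gamma>"
  shows "Sp a v S r \<in> free.span (TR (sgraph N a v S \<Gamma>))"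
proof -
  let ?n = "new_half \<Gamma>" and ?G = "sgraph N a v S \<Gamma>"
  let ?v1 = "insert ?n S" and ?v2 = "insert (Suc ?n) (v - S)" and ?e = "({?n, Suc ?n}, gen [?n, Suc ?n])"
  note sD = splittableD[OF s]
  have nw: "(?v1, cyc (hdeg ?G) (A @ [?n])) # (?v2, cyc (hdeg ?G) (Suc ?n # B)) # ns \<in> normal_words ?G"
    if "ns \<in> words (normals \<Gamma> - {v}) (Cyc (hdeg \<Gamma>))" "A \<in> perms S" "B \<in> perms (v - S)" for A B ns
    using that by (intro normal_words_sgraph[OF s] cyc_new[OF s])
  show ?thesis
  proof (rule tensor_rels_image[OF r lin_Sp], goal_cases)
    case (1 r ws ss ns)
    have "lin_ext (\<lambda>os. gen ([] @ os @ [?e])) r \<in> free.span (EP ?G)"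
    proof (rule product_rels_extend[OF 1(1)])
      show "[] @ xs @ [?e] \<in> words (edges ?G) O_space" if "xs \<in> words (edges \<Gamma>) O_space" for xs :: "(nat set \<times> 'k tensor) list"
        using edge_words_sgraph[OF s, of xs] that by (simp add: edge_words_def)
      show "O_null (hdeg \<Gamma>) u \<subseteq> O_null (hdeg ?G) u" if "u \<in> edges \<Gamma>" for u
        using O_null_sgraph[OF sD(1) that] by blast
      show "sgn_sym (\<lambda>e. \<Sum>h\<in>e. hdeg \<Gamma> h) u w = sgn_sym (\<lambda>e. \<Sum>h\<in>e. hdeg ?G h) u w"
        if "u \<in> edges \<Gamma>" "w \<in> edges \<Gamma>" for u w
        using that edge_degree[OF sD(1)] edge_degree[OF is_graph_sgraph[OF s]] by (simp add: sgn_sym_def)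
    qed
    then have "eqm (EP ?G) (lin_ext (\<lambda>os. gen (os @ [?e])) r) 0" by (simp add: eqm_0_iff)
    from TR_os[OF this, of ws ss] have *: "lin_ext (\<lambda>os. gen (?G, os @ [?e], ws, ss, ns')) r \<in> free.span (TR ?G)"
      if "ns' \<in> normal_words ?G" for ns'
      using that 1
      by (simp add: external_words_sgraph[OF s] special_words_sgraph[OF s] lin_lin_ext_compose[OF lin_lin_ext] lin_ext_0 eqm_0_iff)
    show ?case
      unfolding Sp_gen split_sum_def lin_ext_scale_fun lin_ext_sum_fun
      by (intro free.span_scale free.span_sum * nw others_normal_words 1)
  next
    case (2 r os ss ns)
    have "lin_ext (\<lambda>ws. gen ([] @ ws @ [])) r \<in> free.span (XP ?G)"
    proof (rule product_rels_extend[OF 2(1)])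
      show "[] @ xs @ [] \<in> words (externals ?G) (\<lambda>u. W (vdeg N ?G u + N))"
        if "xs \<in> words (externals \<Gamma>) (\<lambda>u. W (vdeg N \<Gamma> u + N))" for xs
        using external_words_sgraph[OF s] that by (simp add: external_words_def)
      show "sgn_sym (vdeg N \<Gamma>) u w = sgn_sym (vdeg N ?G) u w"
        if "u \<in> externals \<Gamma>" "w \<in> externals \<Gamma>" for u w
        using that vdeg_sgraph_old[OF sD(1)] by (simp add: sgn_sym_def externals_def)
    qed simp
    then have "eqm (XP ?G) (lin_ext (\<lambda>ws. gen ws) r) 0" by (simp add: eqm_0_iff)
    from TR_ws[OF this, of "os @ [?e]" ss] have *: "lin_ext (\<lambda>ws. gen (?G, os @ [?e], ws, ss, ns')) r \<in> free.span (TR ?G)"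
      if "ns' \<in> normal_words ?G" for ns'
      using that 2 by (simp add: edge_words_sgraph[OF s] special_words_sgraph[OF s] lin_lin_ext_compose[OF lin_lin_ext] lin_ext_0 eqm_0_iff)
    show ?case
      unfolding Sp_gen split_sum_def lin_ext_scale_fun lin_ext_sum_fun
      by (intro free.span_scale free.span_sum * nw others_normal_words 2)
  next
    case (3 r os ws ns)
    have "lin_ext (\<lambda>ss. gen ([] @ ss @ [])) r \<in> free.span (SP ?G)"
    proof (rule product_rels_extend[OF 3(1)])
      have sv: "u \<in> verts \<Gamma>" if "u \<in> specials \<Gamma>" for u using special_vert[OF sD(1) that] .
      show "[] @ xs @ [] \<in> words (specials ?G) (Cyc (hdeg ?G))" if "xs \<in> words (specials \<Gamma>) (Cyc (hdeg \<Gamma>))" for xs :: "(nat set \<times> 'k tensor) list"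
        using special_words_sgraph[OF s] that by (auto simp: special_words_def)
      show "C_null (hdeg \<Gamma>) u \<subseteq> C_null (hdeg ?G) u" if "u \<in> specials \<Gamma>" for u
        using C_null_sgraph[OF sD(1) sv[OF that]] by blast
      show "sgn_alt (vdeg N \<Gamma>) u w = sgn_alt (vdeg N ?G) u w"
        if "u \<in> specials \<Gamma>" "w \<in> specials \<Gamma>" for u w
        using that sv vdeg_sgraph_old[OF sD(1)] by (simp add: sgn_alt_def)
    qed
    then have "eqm (SP ?G) (lin_ext (\<lambda>ss. gen ss) r) 0" by (simp add: eqm_0_iff)
    from TR_ss[OF this, of "os @ [?e]" ws] have *: "lin_ext (\<lambda>ss. gen (?G, os @ [?e], ws, ss, ns')) r \<in> free.span (TR ?G)"
      if "ns' \<in> normal_words ?G" for ns'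
      using that 3
      by (simp add: external_words_sgraph[OF s] edge_words_sgraph[OF s] lin_lin_ext_compose[OF lin_lin_ext] lin_ext_0 eqm_0_iff)
    \<comment> \<open>All words in a relation between special factors have the same length, so the
      sign \<open>(- 1) ^ length ss\<close> is constant and can be taken out of the sum.\<close>
    have "lin_ext (\<lambda>ss. Sp a v S (gen (\<Gamma>, os, ws, ss, ns))) r =
      lin_ext (\<lambda>ss. scale ((- 1) ^ card (specials \<Gamma>) * front_sgn (vdeg N \<Gamma>) v ns)
       (split_sum a v S \<Gamma> os ws ss (entry v ns) (others v ns))) r"
      by (rule lin_ext_cong[OF _ product_rels_length[OF 3(1)]]) (simp add: Sp_gen)
    also have "\<dots> \<in> free.span (TR ?G)"
      unfolding split_sum_def lin_ext_scale_fun lin_ext_sum_fun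
      by (intro free.span_scale free.span_sum * nw others_normal_words 3)
    finally show ?case .
  next
    case (4 r os ws ss)
    have *: "lin_ext (\<lambda>ns. scale (front_sgn (vdeg N \<Gamma>) v ns) (split_sum a v S \<Gamma> os ws ss (entry v ns) (others v ns))) r \<in> free.span (TR ?G)"
    proof (rule front_respects[OF sD(2) _ _ _ 4(1)], goal_cases)
      case (1 ns x y c)
      then show ?case by (simp add: split_sum_lin)
    next
      case (2 ns x)
      then show ?case by (intro TR_split_null[OF s] 4) auto
    next
      case (3 r x)
      have "lin_ext (\<lambda>ns. gen ([p1, p2] @ ns @ [])) r \<in> free.span (NP ?G)"
        if "p1 = (?v1, cyc (hdeg ?G) (A @ [?n]))" "p2 = (?v2, cyc (hdeg ?G) (Suc ?n # B))"
          "A \<in> perms S" "B \<in> perms (v - S)" for p1 p2 A B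
      proof (rule product_rels_extend[OF 3(2)])
        have nv: "u \<in> verts \<Gamma>" if "u \<in> normals \<Gamma> - {v}" for u using normal_vert that by blast
        show "[p1, p2] @ xs @ [] \<in> words (normals ?G) (Cyc (hdeg ?G))" if "xs \<in> words (normals \<Gamma> - {v}) (Cyc (hdeg \<Gamma>))" for xs
          using nw[OF that \<open>A \<in> _\<close> \<open>B \<in> _\<close>] \<open>p1 = _\<close> \<open>p2 = _\<close> by (simp add: normal_words_def)
        show "C_null (hdeg \<Gamma>) u \<subseteq> C_null (hdeg ?G) u" if "u \<in> normals \<Gamma> - {v}" for u
          using C_null_sgraph[OF sD(1) nv[OF that]] by blast
        show "sgn_alt (vdeg N \<Gamma>) u w = sgn_alt (vdeg N ?G) u w"
          if "u \<in> normals \<Gamma> - {v}" "w \<in> normals \<Gamma> - {v}" for u w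
          using that nv vdeg_sgraph_old[OF sD(1)] by (simp add: sgn_alt_def)
      qed
      then have e: "eqm (NP ?G) (lin_ext (\<lambda>ns. gen ((?v1, cyc (hdeg ?G) (A @ [?n])) # (?v2, cyc (hdeg ?G) (Suc ?n # B)) # ns)) r) 0"
        if "A \<in> perms S" "B \<in> perms (v - S)" for A B
        using that by (simp add: eqm_0_iff)
      from TR_ns[OF e, of _ _ "os @ [?e]" ws ss]
      have "lin_ext (\<lambda>ns. gen (?G, os @ [?e], ws, ss, (?v1, cyc (hdeg ?G) (A @ [?n])) # (?v2, cyc (hdeg ?G) (Suc ?n # B)) # ns)) r \<in> free.span (TR ?G)"
        if "A \<in> perms S" "B \<in> perms (v - S)" for A B
        using that 4
        by (simp add: external_words_sgraph[OF s] edge_words_sgraph[OF s] special_words_sgraph[OF s] lin_lin_ext_compose[OF lin_lin_ext] lin_ext_0 eqm_0_iff)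
      then show ?case
        unfolding split_sum_def lin_ext_scale_fun lin_ext_sum_fun
        by (intro free.span_scale free.span_sum)
    qed
    show ?case
      unfolding Sp_gen free.scale_scale[symmetric] lin_ext_scale_fun by (intro free.span_scale *)
  qed
qed

end

section \<open>Transport along isomorphisms\<close>

abbreviation tword :: "(nat \<Rightarrow> nat) \<Rightarrow> (nat set \<times> (nat list \<Rightarrow>\<^sub>0 'k::field)) list \<Rightarrow> (nat set \<times> 'k tensor) list" where
  "tword \<phi> \<equiv> map (map_prod ((`) \<phi>) (lin_ext (gen \<circ> map \<phi>)))"

text \<open>For such words transport along a map depends only on its values on \<open>H\<close>; in
  particular a map that fixes the old half-edges fixes all old decorations.\<close>

definition supported :: "nat set \<Rightarrow> (nat set \<times> (nat list \<Rightarrow>\<^sub>0 'k::field)) list \<Rightarrow> bool" where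
  "supported H xs \<longleftrightarrow> (\<forall>p\<in>set xs. fst p \<subseteq> H \<and> Poly_Mapping.keys (snd p) \<subseteq> perms (fst p))"

lemma supported_others: "supported H xs \<Longrightarrow> supported H (others v xs)"
  by (auto simp: supported_def set_others)

lemma map_gen_cong:
  assumes "Poly_Mapping.keys c \<subseteq> perms u" "\<And>h. h \<in> u \<Longrightarrow> \<phi> h = \<psi> h"
  shows "lin_ext (gen \<circ> map \<phi>) c = lin_ext (gen \<circ> map \<psi>) c"
  by (rule lin_ext_cong[of "perms u"])
    (use assms in \<open>auto simp: in_span_gen perms_def intro!: arg_cong[of _ _ gen] map_cong\<close>)

lemma tword_cong:
  assumes "supported H xs" "\<And>h. h \<in> H \<Longrightarrow> \<phi> h = \<psi> h"
  shows "tword \<phi> xs = tword \<psi> xs"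
proof (rule map_cong[OF refl])
  fix p assume "p \<in> set xs"
  then have p: "fst p \<subseteq> H" "Poly_Mapping.keys (snd p) \<subseteq> perms (fst p)"
    using assms(1) by (auto simp: supported_def)
  have "\<phi> ` fst p = \<psi> ` fst p" using p(1) assms(2) by (intro image_cong) auto
  moreover have "lin_ext (gen \<circ> map \<phi>) (snd p) = lin_ext (gen \<circ> map \<psi>) (snd p)"
    using p assms(2) by (intro map_gen_cong) auto
  ultimately show "map_prod ((`) \<phi>) (lin_ext (gen \<circ> map \<phi>)) p = map_prod ((`) \<psi>) (lin_ext (gen \<circ> map \<psi>)) p"
    by (cases p) simp
qed

lemma tword_id:
  assumes "supported H xs" "\<And>h. h \<in> H \<Longrightarrow> \<phi> h = h"
  shows "tword \<phi> xs = xs"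
proof (rule map_idI)
  fix p assume "p \<in> set xs"
  then have p: "fst p \<subseteq> H" "Poly_Mapping.keys (snd p) \<subseteq> perms (fst p)"
    using assms(1) by (auto simp: supported_def)
  have "\<phi> ` fst p = fst p" using p(1) assms(2) by force
  moreover have "lin_ext (gen \<circ> map \<phi>) (snd p) = snd p"
    using p assms(2) by (intro map_map_gen_id[of _ "fst p"]) auto
  ultimately show "map_prod ((`) \<phi>) (lin_ext (gen \<circ> map \<phi>)) p = p"
    by (cases p) simp
qed

lemma keys_O_space: "x \<in> O_space U \<Longrightarrow> Poly_Mapping.keys x \<subseteq> perms U"
  by (simp add: O_space_def in_span_gen)

lemma image_fix:
  assumes "\<And>u. u \<in> \<U> \<Longrightarrow> u \<subseteq> H" "\<And>h. h \<in> H \<Longrightarrow> \<phi> h = h"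
  shows "(`) \<phi> ` \<U> = \<U>"
proof -
  have "\<phi> ` u = u" if "u \<in> \<U>" for u
    using assms(1)[OF that] assms(2) by force
  then show ?thesis by simp
qed

lemma involution_bij_betw:
  assumes "\<And>h. \<phi> (\<phi> h) = h" "\<phi> ` X = Y"
  shows "bij_betw \<phi> X Y"
  using assms by (metis bij_betw_def inj_onI)

text \<open>Exchanges the two ends of a new edge. This identifies the graph with \<open>S\<close>
  split off in degree \<open>a\<close> and the graph with \<open>v - S\<close> split off in degree
  \<open>N - a\<close>.\<close>

definition swap2 :: "nat \<Rightarrow> nat \<Rightarrow> nat" where
  "swap2 n h = (if h = n then Suc n else if h = Suc n then n else h)"

text \<open>The isomorphism which exchanges the half-edges created by two successive splittings.\<close>

definition swap4 :: "nat \<Rightarrow> nat \<Rightarrow> nat" where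
  "swap4 n h = (if h = n then Suc (Suc n) else if h = Suc n then Suc (Suc (Suc n))
     else if h = Suc (Suc n) then n else if h = Suc (Suc (Suc n)) then Suc n else h)"

lemma swap2_simps [simp]: "swap2 n n = Suc n" "swap2 n (Suc n) = n" "swap2 n (swap2 n h) = h"
  "h < n \<Longrightarrow> swap2 n h = h"
  by (auto simp: swap2_def)

lemma swap4_simps [simp]: "swap4 n n = Suc (Suc n)" "swap4 n (Suc n) = Suc (Suc (Suc n))"
  "swap4 n (Suc (Suc n)) = n" "swap4 n (Suc (Suc (Suc n))) = Suc n" "swap4 n (swap4 n h) = h"
  "h < n \<Longrightarrow> swap4 n h = h"
  by (auto simp: swap4_def)

lemma image_below: "(\<And>h. h \<in> u \<Longrightarrow> h < n) \<Longrightarrow> (\<And>h. h < n \<Longrightarrow> \<phi> h = h) \<Longrightarrow> \<phi> ` u = u"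
  by force

lemma words_permute: "mset xs = mset ys \<Longrightarrow> xs \<in> words U A \<Longrightarrow> ys \<in> words U A"
  unfolding words_iff by (metis mset_eq_setD mset_eq_imp_distinct_iff mset_map)

context graph_complex
begin

abbreviation HR :: "('k, 'w) chain set" where "HR \<equiv> hat_rels scW N W"

definition trl :: "(nat \<Rightarrow> nat) \<Rightarrow> ngraph \<Rightarrow> ('k, 'w) chain \<Rightarrow> ('k, 'w) chain" where
  "trl \<phi> \<Gamma>' = lin_ext (\<lambda>s. gen (transport \<phi> \<Gamma>' s))"

lemma lin_trl: "lin (trl \<phi> \<Gamma>')"
  unfolding trl_def by (rule lin_lin_ext)

lemma trl_gen: "trl \<phi> \<Gamma>' (gen (\<Gamma>, os, ws, ss, ns)) =
    gen (\<Gamma>', tword \<phi> os, map (map_prod ((`) \<phi>) id) ws, tword \<phi> ss, tword \<phi> ns)"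
  by (simp add: trl_def transport_def)

lemma TR_HR: "is_graph \<Gamma> \<Longrightarrow> TR \<Gamma> \<subseteq> HR"
  by (auto simp: hat_rels_def)

lemma trl_HR:
  assumes "x \<in> chainsG \<Gamma>" "graph_iso \<phi> \<Gamma> \<Gamma>'" "is_graph \<Gamma>'"
  shows "eqm HR x (trl \<phi> \<Gamma>' x)"
proof (rule chainsG_eqm[OF lin_id lin_trl _ assms(1)])
  fix os ws ss ns assume D: "(\<Gamma>, os, ws, ss, ns) \<in> DG"
  have "gen (\<Gamma>, os, ws, ss, ns) - gen (transport \<phi> \<Gamma>' (\<Gamma>, os, ws, ss, ns)) \<in> iso_rels N W"
    unfolding iso_rels_def
    by (intro CollectI exI[of _ "(\<Gamma>, os, ws, ss, ns)"] exI[of _ \<phi>] exI[of _ \<Gamma>'] conjI refl D assms(3))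
      (use assms(2) in simp)
  then show "eqm HR (gen (\<Gamma>, os, ws, ss, ns)) (trl \<phi> \<Gamma>' (gen (\<Gamma>, os, ws, ss, ns)))"
    unfolding eqm_def trl_def lin_ext_gen by (intro free.span_base) (simp add: hat_rels_def)
qed

lemma DG_supported:
  assumes "(\<Gamma>, os, ws, ss, ns) \<in> DG"
  shows "supported (halves \<Gamma>) os" "supported (halves \<Gamma>) ss" "supported (halves \<Gamma>) ns"
proof -
  have g: "is_graph \<Gamma>" using assms by (simp add: DG_iff)
  show "supported (halves \<Gamma>) os"
    unfolding supported_def
  proof
    fix p assume "p \<in> set os"
    then have "fst p \<in> edges \<Gamma>" "snd p \<in> O_space (fst p)"
      using assms by (auto simp: DG_iff edge_words_def words_iff)
    then show "fst p \<subseteq> halves \<Gamma> \<and> Poly_Mapping.keys (snd p) \<subseteq> perms (fst p)"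
      using keys_O_space edge_halves[OF g] by blast
  qed
  show "supported (halves \<Gamma>) ss"
    unfolding supported_def
  proof
    fix p assume "p \<in> set ss"
    then have "fst p \<in> specials \<Gamma>" "snd p \<in> Cyc (hdeg \<Gamma>) (fst p)"
      using assms by (auto simp: DG_iff special_words_def words_iff)
    then show "fst p \<subseteq> halves \<Gamma> \<and> Poly_Mapping.keys (snd p) \<subseteq> perms (fst p)"
      using keys_Cyc vert_halves[OF g] special_vert[OF g] by blast
  qed
  show "supported (halves \<Gamma>) ns"
    unfolding supported_def
  proof
    fix p assume "p \<in> set ns"
    then have "fst p \<in> normals \<Gamma>" "snd p \<in> Cyc (hdeg \<Gamma>) (fst p)"
      using assms by (auto simp: DG_iff normal_words_def words_iff)
    then show "fst p \<subseteq> halves \<Gamma> \<and> Poly_Mapping.keys (snd p) \<subseteq> perms (fst p)"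
      using keys_Cyc vert_halves[OF g] normal_vert by blast
  qed
qed

lemma external_words_id:
  assumes "(\<Gamma>, os, ws, ss, ns) \<in> DG" "\<And>h. h \<in> halves \<Gamma> \<Longrightarrow> \<phi> h = h"
  shows "map (map_prod ((`) \<phi>) id) ws = ws"
proof (rule map_idI)
  fix p assume "p \<in> set ws"
  then have "fst p \<in> verts \<Gamma>" "is_graph \<Gamma>" using assms(1) by (auto simp: DG_iff external_words_def words_iff externals_def)
  then have "fst p \<subseteq> halves \<Gamma>" using vert_halves by blast
  then have "\<phi> ` fst p = fst p" using assms(2) by force
  then show "map_prod ((`) \<phi>) id p = p" by (cases p) simp
qed

lemma graph_iso_swap2:
  assumes s: "splittable a v S \<Gamma>"
  shows "graph_iso (swap2 (new_half \<Gamma>)) (sgraph N a v S \<Gamma>) (sgraph N (N - a) v (v - S) \<Gamma>)"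
proof -
  let ?n = "new_half \<Gamma>" and ?\<phi> = "swap2 (new_half \<Gamma>)"
  note sD = splittableD[OF s]
  have fix1: "?\<phi> h = h" if "h \<in> halves \<Gamma>" for h
    using new_half_gt[OF sD(4) that] by simp
  have fv: "(`) ?\<phi> ` (verts \<Gamma> - {v}) = verts \<Gamma> - {v}"
    by (rule image_fix[of _ "halves \<Gamma>"]) (use vert_halves[OF sD(1)] fix1 in auto)
  have fe: "(`) ?\<phi> ` edges \<Gamma> = edges \<Gamma>"
    by (rule image_fix[of _ "halves \<Gamma>"]) (use edge_halves[OF sD(1)] fix1 in auto)
  have fs: "(`) ?\<phi> ` specials \<Gamma> = specials \<Gamma>"
    by (rule image_fix[of _ "halves \<Gamma>"]) (use vert_halves[OF sD(1)] special_vert[OF sD(1)] fix1 in auto)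
  have fh: "?\<phi> ` halves \<Gamma> = halves \<Gamma>" using fix1 by simp
  have vh: "v \<subseteq> halves \<Gamma>" using vert_halves[OF sD(1,3)] .
  have fS: "?\<phi> ` S = S" "?\<phi> ` (v - S) = v - S" using fix1 sD(7) vh by force+
  have vS: "v - (v - S) = S" using sD(7) by auto
  show ?thesis
    unfolding graph_iso_def
  proof (intro conjI)
    show "bij_betw ?\<phi> (halves (sgraph N a v S \<Gamma>)) (halves (sgraph N (N - a) v (v - S) \<Gamma>))"
      by (rule involution_bij_betw) (simp_all add: image_Un fh insert_commute)
    show "(`) ?\<phi> ` verts (sgraph N a v S \<Gamma>) = verts (sgraph N (N - a) v (v - S) \<Gamma>)"
      unfolding sgraph_simps image_Un fv vS by (simp add: fS insert_commute)
    show "(`) ?\<phi> ` edges (sgraph N a v S \<Gamma>) = edges (sgraph N (N - a) v (v - S) \<Gamma>)"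
      unfolding sgraph_simps image_Un fe by (simp add: insert_commute)
    show "(`) ?\<phi> ` specials (sgraph N a v S \<Gamma>) = specials (sgraph N (N - a) v (v - S) \<Gamma>)"
      by (simp add: fs)
    show "\<forall>h\<in>halves (sgraph N a v S \<Gamma>). hdeg (sgraph N (N - a) v (v - S) \<Gamma>) (?\<phi> h) = hdeg (sgraph N a v S \<Gamma>) h"
    proof
      fix h assume "h \<in> halves (sgraph N a v S \<Gamma>)"
      then consider "h \<in> halves \<Gamma>" | "h = ?n" | "h = Suc ?n" by auto
      then show "hdeg (sgraph N (N - a) v (v - S) \<Gamma>) (?\<phi> h) = hdeg (sgraph N a v S \<Gamma>) h"
      proof cases
        case 1
        then show ?thesis using new_half_gt[OF sD(4) 1] by (simp add: sgraph_simps(4))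
      qed (simp_all add: sgraph_simps(4))
    qed
  qed
qed

lemma swap4_fix:
  assumes "is_graph \<Gamma>"
  shows "\<And>h. h \<in> halves \<Gamma> \<Longrightarrow> swap4 (new_half \<Gamma>) h = h"
    "swap4 (new_half \<Gamma>) ` halves \<Gamma> = halves \<Gamma>"
    "(`) (swap4 (new_half \<Gamma>)) ` edges \<Gamma> = edges \<Gamma>"
    "\<And>V. V \<subseteq> verts \<Gamma> \<Longrightarrow> (`) (swap4 (new_half \<Gamma>)) ` V = V"
    "(`) (swap4 (new_half \<Gamma>)) ` specials \<Gamma> = specials \<Gamma>"
    "\<And>U v. v \<in> verts \<Gamma> \<Longrightarrow> U \<subseteq> v \<Longrightarrow> swap4 (new_half \<Gamma>) ` U = U"
proof -
  show fix1: "\<And>h. h \<in> halves \<Gamma> \<Longrightarrow> swap4 (new_half \<Gamma>) h = h"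
    using new_half_gt[OF graph_finite[OF assms]] by simp
  then show "swap4 (new_half \<Gamma>) ` halves \<Gamma> = halves \<Gamma>" by simp
  show "(`) (swap4 (new_half \<Gamma>)) ` edges \<Gamma> = edges \<Gamma>"
    by (rule image_fix[of _ "halves \<Gamma>"]) (use edge_halves[OF assms] fix1 in auto)
  show V: "\<And>V. V \<subseteq> verts \<Gamma> \<Longrightarrow> (`) (swap4 (new_half \<Gamma>)) ` V = V"
    by (rule image_fix[of _ "halves \<Gamma>"]) (use vert_halves[OF assms] fix1 in auto)
  show "(`) (swap4 (new_half \<Gamma>)) ` specials \<Gamma> = specials \<Gamma>"
    by (rule V) (use special_vert[OF assms] in auto)
  show "\<And>U v. v \<in> verts \<Gamma> \<Longrightarrow> U \<subseteq> v \<Longrightarrow> swap4 (new_half \<Gamma>) ` U = U"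
    using vert_halves[OF assms] fix1 by (force simp: subset_iff)
qed

text \<open>The common part of two comparisons, for splittings of two distinct vertices and for
  chains of three vertices: half-edges, edges and degrees change in the same way, and only the
  vertices need separate treatment.\<close>

lemma graph_iso_swap4I:
  fixes \<Gamma> :: ngraph
  assumes g: "is_graph \<Gamma>" and n: "n = new_half \<Gamma>"
    and h: "halves G = halves \<Gamma> \<union> {n, Suc n, Suc (Suc n), Suc (Suc (Suc n))}"
      "halves G' = halves \<Gamma> \<union> {n, Suc n, Suc (Suc n), Suc (Suc (Suc n))}"
    and v: "(`) (swap4 n) ` verts G = verts G'"
    and e: "edges G = edges \<Gamma> \<union> {{n, Suc n}, {Suc (Suc n), Suc (Suc (Suc n))}}"
      "edges G' = edges \<Gamma> \<union> {{n, Suc n}, {Suc (Suc n), Suc (Suc (Suc n))}}"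
    and d: "hdeg G = (hdeg \<Gamma>)(n := b, Suc n := N - b, Suc (Suc n) := a, Suc (Suc (Suc n)) := N - a)"
      "hdeg G' = (hdeg \<Gamma>)(n := a, Suc n := N - a, Suc (Suc n) := b, Suc (Suc (Suc n)) := N - b)"
    and s: "specials G = specials \<Gamma>" "specials G' = specials \<Gamma>"
  shows "graph_iso (swap4 n) G G'"
  unfolding graph_iso_def
proof (intro conjI)
  note f = swap4_fix[OF g, folded n]
  show "bij_betw (swap4 n) (halves G) (halves G')"
    by (rule involution_bij_betw) (auto simp: h image_Un f)
  show "(`) (swap4 n) ` verts G = verts G'" by (rule v)
  show "(`) (swap4 n) ` edges G = edges G'"
    unfolding e image_Un f by (simp add: insert_commute)
  show "(`) (swap4 n) ` specials G = specials G'" by (simp add: s f)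
  show "\<forall>h\<in>halves G. hdeg G' (swap4 n h) = hdeg G h"
  proof
    fix k assume "k \<in> halves G"
    then consider "k \<in> halves \<Gamma>" | "k = n" | "k = Suc n" | "k = Suc (Suc n)" | "k = Suc (Suc (Suc n))"
      by (auto simp: h)
    then show "hdeg G' (swap4 n k) = hdeg G k"
    proof cases
      case 1
      then have "k < n" using new_half_gt[OF graph_finite[OF g]] n by blast
      then show ?thesis by (simp add: d)
    qed (simp_all add: d)
  qed
qed

subsection \<open>Reordering decorations\<close>

lemma DG_permute:
  assumes "(\<Gamma>, os, ws, ss, ns) \<in> DG" "mset os' = mset os" "mset ns' = mset ns" "mset ss' = mset ss"
  shows "(\<Gamma>, os', ws, ss', ns') \<in> DG"
  using assms words_permute[of os os'] words_permute[of ns ns'] words_permute[of ss ss']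
  by (simp add: DG_iff edge_words_def special_words_def normal_words_def)

lemma eqm_scale_trans: "eqm R x (scale a y) \<Longrightarrow> eqm R y (scale b z) \<Longrightarrow> eqm R x (scale (a * b) z)"
  using eqm_trans[of R x "scale a y" "scale a (scale b z)"] eqm_scale[of R y "scale b z" a] by simp

text \<open>Four transpositions contribute four minus signs, which cancel. Thus pairs of vertices
  pass each other with the sign of the symmetric algebra for their total degrees.\<close>

lemma TR_ns_swap22:
  assumes D: "(\<Gamma>, os, ws, ss, p1 # p2 # q1 # q2 # ys) \<in> DG"
  shows "eqm (TR \<Gamma>) (gen (\<Gamma>, os, ws, ss, p1 # p2 # q1 # q2 # ys))
    (scale (sgn_pow ((vdeg N \<Gamma> (fst p1) + vdeg N \<Gamma> (fst p2)) * (vdeg N \<Gamma> (fst q1) + vdeg N \<Gamma> (fst q2))))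
      (gen (\<Gamma>, os, ws, ss, q1 # q2 # p1 # p2 # ys)))"
proof -
  let ?s = "sgn_alt (vdeg N \<Gamma>) :: _ \<Rightarrow> _ \<Rightarrow> 'k"
  have D2: "(\<Gamma>, os, ws, ss, p1 # q1 # p2 # q2 # ys) \<in> DG" by (rule DG_permute[OF D]) (simp_all add: add_mset_commute)
  have D3: "(\<Gamma>, os, ws, ss, q1 # p1 # p2 # q2 # ys) \<in> DG" by (rule DG_permute[OF D]) (simp_all add: add_mset_commute)
  have D4: "(\<Gamma>, os, ws, ss, q1 # p1 # q2 # p2 # ys) \<in> DG" by (rule DG_permute[OF D]) (simp_all add: add_mset_commute)
  have 1: "eqm (TR \<Gamma>) (gen (\<Gamma>, os, ws, ss, p1 # p2 # q1 # q2 # ys)) (scale (?s (fst p2) (fst q1)) (gen (\<Gamma>, os, ws, ss, p1 # q1 # p2 # q2 # ys)))"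
    using TR_ns_swap[of \<Gamma> os ws ss "[p1]"] D by simp
  have 2: "eqm (TR \<Gamma>) (gen (\<Gamma>, os, ws, ss, p1 # q1 # p2 # q2 # ys)) (scale (?s (fst p1) (fst q1)) (gen (\<Gamma>, os, ws, ss, q1 # p1 # p2 # q2 # ys)))"
    using TR_ns_swap[of \<Gamma> os ws ss "[]"] D2 by simp
  have 3: "eqm (TR \<Gamma>) (gen (\<Gamma>, os, ws, ss, q1 # p1 # p2 # q2 # ys)) (scale (?s (fst p2) (fst q2)) (gen (\<Gamma>, os, ws, ss, q1 # p1 # q2 # p2 # ys)))"
    using TR_ns_swap[of \<Gamma> os ws ss "[q1, p1]"] D3 by simp
  have 4: "eqm (TR \<Gamma>) (gen (\<Gamma>, os, ws, ss, q1 # p1 # q2 # p2 # ys)) (scale (?s (fst p1) (fst q2)) (gen (\<Gamma>, os, ws, ss, q1 # q2 # p1 # p2 # ys)))"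
    using TR_ns_swap[of \<Gamma> os ws ss "[q1]"] D4 by simp
  have "?s (fst p2) (fst q1) * (?s (fst p1) (fst q1) * (?s (fst p2) (fst q2) * ?s (fst p1) (fst q2))) =
     sgn_pow ((vdeg N \<Gamma> (fst p1) + vdeg N \<Gamma> (fst p2)) * (vdeg N \<Gamma> (fst q1) + vdeg N \<Gamma> (fst q2)))"
    by (simp add: sgn_alt_def sgn_pow_add algebra_simps)
  then show ?thesis
    using eqm_scale_trans[OF 1 eqm_scale_trans[OF 2 eqm_scale_trans[OF 3 4]]] by simp
qed

text \<open>Pulling out \<open>v\<close> and \<open>w\<close> in the two possible orders differs by
  a single exchange of \<open>v\<close> and \<open>w\<close>, since a factor standing before both
  contributes equally to the two sides. This exterior exchange is the origin of the minus sign when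
  operators at distinct vertices anticommute.\<close>

lemma front_sgn_others:
  assumes "distinct (map fst xs)" "v \<in> fst ` set xs" "w \<in> fst ` set xs" "v \<noteq> w"
  shows "front_sgn \<delta> v xs * front_sgn \<delta> w (others v xs) =
    - sgn_pow (\<delta> v * \<delta> w) * (front_sgn \<delta> w xs * front_sgn \<delta> v (others w xs) :: 'k)"
  using assms
proof (induction xs)
  case (Cons p xs)
  consider "fst p = v" | "fst p = w" | "fst p \<noteq> v" "fst p \<noteq> w" by blast
  then show ?case
  proof cases
    case 1
    then have "v \<notin> fst ` set xs" using Cons.prems by auto
    then show ?thesis using 1 Cons.prems by (simp add: sgn_alt_def)
  next
    case 2
    then have "w \<notin> fst ` set xs" using Cons.prems by auto
    then show ?thesis using 2 Cons.prems by (simp add: sgn_alt_def mult.commute)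
  next
    case 3
    then have IH: "front_sgn \<delta> v xs * front_sgn \<delta> w (others v xs) =
      - sgn_pow (\<delta> v * \<delta> w) * (front_sgn \<delta> w xs * front_sgn \<delta> v (others w xs) :: 'k)"
      using Cons by auto
    have "front_sgn \<delta> v (p # xs) * front_sgn \<delta> w (others v (p # xs)) =
      sgn_alt \<delta> (fst p) v * sgn_alt \<delta> (fst p) w * (front_sgn \<delta> v xs * front_sgn \<delta> w (others v xs) :: 'k)"
      using 3 by simp
    also have "\<dots> = - sgn_pow (\<delta> v * \<delta> w) * (front_sgn \<delta> w (p # xs) * front_sgn \<delta> v (others w (p # xs)))"
      unfolding IH using 3 by simp
    finally show ?thesis .
  qed
qed simp

end

lemma sum_swap4:
  fixes f :: "'a \<Rightarrow> 'b \<Rightarrow> 'a \<Rightarrow> 'b \<Rightarrow> 'e::comm_monoid_add"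
  shows "(\<Sum>A\<in>X. \<Sum>B\<in>Y. \<Sum>C\<in>Z. \<Sum>E\<in>U. f A B C E) = (\<Sum>C\<in>Z. \<Sum>E\<in>U. \<Sum>A\<in>X. \<Sum>B\<in>Y. f A B C E)"
proof -
  have pair: "(\<Sum>A\<in>P. \<Sum>B\<in>Q. g A B) = (\<Sum>p\<in>P \<times> Q. g (fst p) (snd p))" for P :: "'a set" and Q :: "'b set" and g :: "'a \<Rightarrow> 'b \<Rightarrow> 'e"
    by (simp add: sum.cartesian_product case_prod_unfold)
  show ?thesis
    unfolding pair[where P = X and Q = Y] pair[where P = Z and Q = U] by (rule sum.swap)
qed

lemma cyc_map_involution:
  assumes "\<And>h. \<phi> (\<phi> h) = h" "\<And>a. a \<in> set us \<Longrightarrow> \<delta>' (\<phi> a) = \<delta> a"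
  shows "lin_ext (gen \<circ> map \<phi>) (cyc \<delta> us) = cyc \<delta>' (map \<phi> us)"
  by (rule cyc_map) (use assms in \<open>metis inj_onI\<close>)+

lemma map_below: "(\<And>h. h \<in> set A \<Longrightarrow> h < n) \<Longrightarrow> (\<And>h. h < n \<Longrightarrow> \<phi> h = h) \<Longrightarrow> map \<phi> A = A"
  by (rule map_idI) blast

lemma cyc_snoc:
  assumes "distinct (A @ [h])"
  shows "cyc \<delta> (A @ [h]) = scale (sgn_pow (sum \<delta> (set A) * \<delta> h)) (cyc \<delta> (h # A) :: _ \<Rightarrow>\<^sub>0 'k::field)"
proof -
  have "cyc \<delta> (A @ [h]) = scale (koszul \<delta> (A @ [h]) ([h] @ A)) (cyc \<delta> ([h] @ A) :: _ \<Rightarrow>\<^sub>0 'k)"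
    by (rule cyc_swap) (use assms in auto)
  also have "koszul \<delta> (A @ [h]) ([h] @ A) = (sgn_pow (sum \<delta> (set A) * \<delta> h) :: 'k)"
    by (subst koszul_swap) (use assms in auto)
  finally show ?thesis by simp
qed

section \<open>The flip of one splitting and the order of two splittings\<close>

context graph_complex
begin

lemma split_DG':
  assumes "splittable a v S \<Gamma>" "(\<Gamma>, os, ws, ss, ns) \<in> DG"
    and "\<alpha> \<in> Cyc (hdeg (sgraph N a v S \<Gamma>)) (vert1 \<Gamma> S)"
    and "\<beta> \<in> Cyc (hdeg (sgraph N a v S \<Gamma>)) (vert2 \<Gamma> v S)"
  shows "(sgraph N a v S \<Gamma>, os @ [({new_half \<Gamma>, Suc (new_half \<Gamma>)}, gen [new_half \<Gamma>, Suc (new_half \<Gamma>)])], ws, ss,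
        (vert1 \<Gamma> S, \<alpha>) # (vert2 \<Gamma> v S, \<beta>) # others v ns) \<in> DG"
  by (rule split_DG[OF assms(1) _ _ _ others_normal_words assms(3,4)]) (use assms(2) in \<open>simp_all add: DG_iff\<close>)

lemma splittable_flip: "splittable a v S \<Gamma> \<Longrightarrow> splittable (N - a) v (v - S) \<Gamma>"
  by (auto simp: splittable_def)

lemma hdeg_sgraph_S:
  assumes "splittable a v S \<Gamma>" "U \<subseteq> v"
  shows "sum (hdeg (sgraph N a' v' S' \<Gamma>)) U = sum (hdeg \<Gamma>) U"
  by (rule sum.cong) (use hdeg_sgraph_old[OF splittableD(1,3)[OF assms(1)]] assms(2) in blast)+

text \<open>Four signs arise: from reversing the new edge, from exchanging the two new vertices, and
  from rotating each of the two cyclic words. Together they give the sign of exchanging the blocks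
  \<open>A\<close> and \<open>B\<close>, which is the sign between the coefficients at
  \<open>B @ A\<close> and \<open>A @ B\<close>.\<close>

lemma Sp_flip_term:
  assumes s: "splittable a v S \<Gamma>" and D: "(\<Gamma>, os, ws, ss, ns) \<in> DG"
    and A: "A \<in> perms S" and B: "B \<in> perms (v - S)"
    and n: "n = new_half \<Gamma>" and G: "G = sgraph N (N - a) v (v - S) \<Gamma>"
  shows "eqm (TR G)
    (scale (coeff (entry v ns) (B @ A))
      (gen (G, os @ [({n, Suc n}, gen [n, Suc n])], ws, ss,
        (insert n (v - S), cyc (hdeg G) (B @ [n])) # (insert (Suc n) S, cyc (hdeg G) (Suc n # A)) # others v ns)))
    (scale (coeff (entry v ns) (A @ B))
      (gen (G, os @ [({n, Suc n}, gen [Suc n, n])], ws, ss,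
        (insert (Suc n) S, cyc (hdeg G) (A @ [Suc n])) # (insert n (v - S), cyc (hdeg G) (n # B)) # others v ns)))"
proof -
  note sD = splittableD[OF s]
  note sf = splittable_flip[OF s]
  have vS: "v - (v - S) = S" using sD(7) by auto
  let ?v1 = "insert n (v - S)" and ?v2 = "insert (Suc n) S" and ?d = "hdeg G" and ?r = "others v ns"
  have A': "distinct A" "set A = S" and B': "distinct B" "set B = v - S"
    using A B by (auto simp: perms_def)
  have dn: "?d n = N - a" "?d (Suc n) = a" by (simp_all add: G n sgraph_simps(4))
  have dS: "sum ?d S = sum (hdeg \<Gamma>) S" "sum ?d (v - S) = sum (hdeg \<Gamma>) (v - S)"
    unfolding G by (rule hdeg_sgraph_S[OF s]; use sD(7) in auto)+
  have vd: "vdeg N G ?v1 = sum (hdeg \<Gamma>) (v - S) + (N - a) - N" "vdeg N G ?v2 = sum (hdeg \<Gamma>) S - (N - a)"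
    using vdeg_sgraph_new[OF sf] by (simp_all add: G n vS)
  have new: "n \<notin> v" "Suc n \<notin> v" using sD(13,14) by (simp_all add: n)
  then have newS: "n \<notin> S" "Suc n \<notin> S" using sD(7) by auto
  have DD: "(G, os @ [({n, Suc n}, gen [n, Suc n])], ws, ss, (?v1, \<alpha>) # (?v2, \<beta>) # ?r) \<in> DG"
    if "\<alpha> \<in> Cyc ?d ?v1" "\<beta> \<in> Cyc ?d ?v2" for \<alpha> \<beta>
    using split_DG'[OF sf D, of \<alpha> \<beta>] that by (simp add: G n vS)
  have cB: "cyc ?d (B @ [n]) \<in> Cyc ?d ?v1" "cyc ?d (n # B) \<in> Cyc ?d ?v1"
    by (rule cyc_in_Cyc, rule permutations_of_setI; use B' new in simp)+
  have cA: "cyc ?d (A @ [Suc n]) \<in> Cyc ?d ?v2" "cyc ?d (Suc n # A) \<in> Cyc ?d ?v2"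
    by (rule cyc_in_Cyc, rule permutations_of_setI; use A' newS in simp)+
  let ?X = "gen (G, os @ [({n, Suc n}, gen [n, Suc n])], ws, ss, (?v1, cyc ?d (B @ [n])) # (?v2, cyc ?d (Suc n # A)) # ?r) :: _ \<Rightarrow>\<^sub>0 'k"
  have 1: "eqm (TR G) (gen (G, os @ [({n, Suc n}, gen [Suc n, n])], ws, ss, (?v2, cyc ?d (A @ [Suc n])) # (?v1, cyc ?d (n # B)) # ?r))
     (scale (- sgn_pow ((N - a) * a)) (gen (G, os @ [({n, Suc n}, gen [n, Suc n])], ws, ss, (?v2, cyc ?d (A @ [Suc n])) # (?v1, cyc ?d (n # B)) # ?r)))"
    using TR_os_flip[of G os n "Suc n" "[]"] DG_permute[OF DD[OF cB(2) cA(1)] refl _ refl, of "(?v2, cyc ?d (A @ [Suc n])) # (?v1, cyc ?d (n # B)) # ?r"] dn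
    by (simp add: add_mset_commute)
  have 2: "eqm (TR G) (gen (G, os @ [({n, Suc n}, gen [n, Suc n])], ws, ss, (?v2, cyc ?d (A @ [Suc n])) # (?v1, cyc ?d (n # B)) # ?r))
     (scale (sgn_alt (vdeg N G) ?v2 ?v1) (gen (G, os @ [({n, Suc n}, gen [n, Suc n])], ws, ss, (?v1, cyc ?d (n # B)) # (?v2, cyc ?d (A @ [Suc n])) # ?r)))"
    using TR_ns_swap[of G "os @ [({n, Suc n}, gen [n, Suc n])]" ws ss "[]" "(?v2, cyc ?d (A @ [Suc n]))" "(?v1, cyc ?d (n # B))" ?r]
      DG_permute[OF DD[OF cB(2) cA(1)] refl _ refl, of "(?v2, cyc ?d (A @ [Suc n])) # (?v1, cyc ?d (n # B)) # ?r"]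
    by (simp add: add_mset_commute)
  have eA: "cyc ?d (A @ [Suc n]) = scale (sgn_pow (sum (hdeg \<Gamma>) S * a)) (cyc ?d (Suc n # A) :: _ \<Rightarrow>\<^sub>0 'k)"
    using cyc_snoc[of A "Suc n" ?d, where 'k = 'k] A' newS by (simp add: dn dS)
  have eB: "cyc ?d (n # B) = scale (sgn_pow (sum (hdeg \<Gamma>) (v - S) * (N - a))) (cyc ?d (B @ [n]) :: _ \<Rightarrow>\<^sub>0 'k)"
    using cyc_snoc[of B n ?d, where 'k = 'k] B' new by (simp add: dn dS)
  have 3: "eqm (TR G) (gen (G, os @ [({n, Suc n}, gen [n, Suc n])], ws, ss, (?v1, cyc ?d (n # B)) # (?v2, cyc ?d (A @ [Suc n])) # ?r))
     (scale (sgn_pow (sum (hdeg \<Gamma>) S * a)) (gen (G, os @ [({n, Suc n}, gen [n, Suc n])], ws, ss, (?v1, cyc ?d (n # B)) # (?v2, cyc ?d (Suc n # A)) # ?r)))"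
    unfolding eA using TR_ns_scale[of G "os @ [({n, Suc n}, gen [n, Suc n])]" ws ss "[(?v1, cyc ?d (n # B))]" ?v2 "cyc ?d (Suc n # A)" ?r] DD[OF cB(2) cA(2)] by simp
  have 4: "eqm (TR G) (gen (G, os @ [({n, Suc n}, gen [n, Suc n])], ws, ss, (?v1, cyc ?d (n # B)) # (?v2, cyc ?d (Suc n # A)) # ?r))
     (scale (sgn_pow (sum (hdeg \<Gamma>) (v - S) * (N - a))) ?X)"
    unfolding eB using TR_ns_scale[of G "os @ [({n, Suc n}, gen [n, Suc n])]" ws ss "[]" ?v1 "cyc ?d (B @ [n])"] DD[OF cB(1) cA(2)] by simp
  let ?c = "- sgn_pow ((N - a) * a) * (sgn_alt (vdeg N G) ?v2 ?v1 * (sgn_pow (sum (hdeg \<Gamma>) S * a) * sgn_pow (sum (hdeg \<Gamma>) (v - S) * (N - a)))) :: 'k"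
  have 5: "eqm (TR G) (gen (G, os @ [({n, Suc n}, gen [Suc n, n])], ws, ss, (?v2, cyc ?d (A @ [Suc n])) # (?v1, cyc ?d (n # B)) # ?r)) (scale ?c ?X)"
    by (rule eqm_scale_trans[OF 1 eqm_scale_trans[OF 2 eqm_scale_trans[OF 3 4]]])
  \<comment> \<open>As \<open>N\<close> is even, all exponents are determined modulo 2 by the
    parities of \<open>a\<close> and of the two block degrees, which leaves eight cases.\<close>
  have c: "?c = sgn_pow (sum (hdeg \<Gamma>) S * sum (hdeg \<Gamma>) (v - S))"
    unfolding sgn_alt_def vd using even_N
    by (cases "even a"; cases "even (sum (hdeg \<Gamma>) S)"; cases "even (sum (hdeg \<Gamma>) (v - S))")
      (simp_all add: sgn_pow_def)
  have "entry v ns \<in> Cyc (hdeg \<Gamma>) v" using D sD(2) by (intro words_entry[of _ "normals \<Gamma>"]) (auto simp: DG_iff normal_words_def)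
  then have "coeff (entry v ns) (B @ A) = koszul (hdeg \<Gamma>) (A @ B) (B @ A) * coeff (entry v ns) (A @ B)"
    by (rule lookup_Cyc_swap) (use A' B' sD(7) in \<open>auto simp: perms_def\<close>)
  also have "koszul (hdeg \<Gamma>) (A @ B) (B @ A) = ?c"
    unfolding c using A' B' by (subst koszul_swap) auto
  finally have "coeff (entry v ns) (B @ A) = coeff (entry v ns) (A @ B) * ?c" by simp
  then show ?thesis
    using eqm_sym[OF eqm_scale[OF 5, of "coeff (entry v ns) (A @ B)"]] by simp
qed

lemma Sp_flip:
  assumes s: "splittable a v S \<Gamma>" and x: "x \<in> chainsG \<Gamma>"
  shows "eqm (TR (sgraph N (N - a) v (v - S) \<Gamma>)) (Sp (N - a) v (v - S) x)
    (trl (swap2 (new_half \<Gamma>)) (sgraph N (N - a) v (v - S) \<Gamma>) (Sp a v S x))"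
proof (rule chainsG_eqm[OF lin_Sp lin_compose[OF lin_Sp lin_trl] _ x])
  fix os ws ss ns assume D: "(\<Gamma>, os, ws, ss, ns) \<in> DG"
  note sD = splittableD[OF s]
  define n where "n = new_half \<Gamma>"
  define G where "G = sgraph N (N - a) v (v - S) \<Gamma>"
  let ?v1 = "insert n (v - S)" and ?v2 = "insert (Suc n) S" and ?d = "hdeg G" and ?r = "others v ns"
  let ?K = "(- 1) ^ length ss * front_sgn (vdeg N \<Gamma>) v ns :: 'k"
  have vS: "v - (v - S) = S" using sD(7) by auto
  have lt: "h < n" if "h \<in> v" for h using vert_lt[OF sD(1,3) that] by (simp add: n_def)
  have fixh: "swap2 n h = h" if "h \<in> halves \<Gamma>" for h using new_half_gt[OF sD(4) that] by (simp add: n_def)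
  have L: "Sp (N - a) v (v - S) (gen (\<Gamma>, os, ws, ss, ns)) = scale ?K
     (\<Sum>A\<in>perms S. \<Sum>B\<in>perms (v - S). scale (coeff (entry v ns) (B @ A))
      (gen (G, os @ [({n, Suc n}, gen [n, Suc n])], ws, ss,
        (?v1, cyc ?d (B @ [n])) # (?v2, cyc ?d (Suc n # A)) # ?r)))"
    unfolding Sp_gen split_sum_def vS G_def n_def by (subst sum.swap) simp
  have c1: "lin_ext (gen \<circ> map (swap2 n)) (cyc (hdeg (sgraph N a v S \<Gamma>)) (A @ [n])) = cyc ?d (A @ [Suc n])"
    if "A \<in> perms S" for A
  proof -
    have "set A \<subseteq> v" using that sD(7) by (auto simp: perms_def)
    then have "map (swap2 n) A = A" using lt by (intro map_below[of _ n]) auto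
    moreover have "?d (swap2 n h) = hdeg (sgraph N a v S \<Gamma>) h" if "h \<in> set (A @ [n])" for h
      using that \<open>set A \<subseteq> v\<close> lt by (auto simp: G_def n_def sgraph_simps(4))
    ultimately show ?thesis
      by (subst cyc_map_involution[of _ _ ?d]) auto
  qed
  have c2: "lin_ext (gen \<circ> map (swap2 n)) (cyc (hdeg (sgraph N a v S \<Gamma>)) (Suc n # B)) = cyc ?d (n # B)"
    if "B \<in> perms (v - S)" for B
  proof -
    have "set B \<subseteq> v" using that by (auto simp: perms_def)
    then have "map (swap2 n) B = B" using lt by (intro map_below[of _ n]) auto
    moreover have "?d (swap2 n h) = hdeg (sgraph N a v S \<Gamma>) h" if "h \<in> set (Suc n # B)" for h
      using that \<open>set B \<subseteq> v\<close> lt by (auto simp: G_def n_def sgraph_simps(4))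
    ultimately show ?thesis
      by (subst cyc_map_involution[of _ _ ?d]) auto
  qed
  have fS: "swap2 n ` S = S" "swap2 n ` (v - S) = v - S"
    by (rule image_below[of _ n]; use lt sD(7) in auto)+
  note ids = tword_id[OF DG_supported(1)[OF D] fixh] tword_id[OF DG_supported(2)[OF D] fixh]
    tword_id[OF supported_others[OF DG_supported(3)[OF D]] fixh] external_words_id[OF D fixh]
  have R: "trl (swap2 n) G (Sp a v S (gen (\<Gamma>, os, ws, ss, ns))) = scale ?K
     (\<Sum>A\<in>perms S. \<Sum>B\<in>perms (v - S). scale (coeff (entry v ns) (A @ B))
      (gen (G, os @ [({n, Suc n}, gen [Suc n, n])], ws, ss,
        (?v2, cyc ?d (A @ [Suc n])) # (?v1, cyc ?d (n # B)) # ?r)))"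
    unfolding Sp_gen split_sum_def lin_scale[OF lin_trl] lin_sum[OF lin_trl] trl_gen n_def[symmetric]
    by (intro arg_cong[of _ _ "scale ?K"] sum.cong refl) (simp add: ids c1 c2 fS insert_commute)
  show "eqm (TR (sgraph N (N - a) v (v - S) \<Gamma>)) (Sp (N - a) v (v - S) (gen (\<Gamma>, os, ws, ss, ns)))
    (trl (swap2 (new_half \<Gamma>)) (sgraph N (N - a) v (v - S) \<Gamma>) (Sp a v S (gen (\<Gamma>, os, ws, ss, ns))))"
    unfolding L n_def[symmetric] G_def[symmetric] R
    by (intro eqm_scale eqm_sum Sp_flip_term[OF s D] n_def G_def)
qed

abbreviation new_edge :: "nat \<Rightarrow> nat set \<times> 'k tensor" where
  "new_edge n \<equiv> ({n, Suc n}, gen [n, Suc n])"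

lemma splittable_other:
  assumes "splittable a v S \<Gamma>" "splittable b w T \<Gamma>" "v \<noteq> w"
  shows "splittable b w T (sgraph N a v S \<Gamma>)"
  using assms is_graph_sgraph[OF assms(1)] normals_sgraph[OF assms(1)] by (auto simp: splittable_def)

lemma cyc_sgraph:
  assumes "is_graph \<Gamma>" "set us \<subseteq> halves \<Gamma>"
  shows "cyc (hdeg (sgraph N a v S \<Gamma>)) us = cyc (hdeg \<Gamma>) us"
  by (rule cyc_cong) (use assms new_half_gt[OF graph_finite[OF assms(1)]] in \<open>fastforce simp: sgraph_simps(4)\<close>)

text \<open>The factor \<open>(- 1) ^ length ss\<close> enters with both splittings and cancels.
  Pulling \<open>w\<close> to the front past the new pair costs a sign with exponent
  \<open>vdeg N \<Gamma> v * vdeg N \<Gamma> w\<close>, because the degrees of the pair add up to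
  that of \<open>v\<close>.\<close>

lemma Sp_Sp_other:
  assumes sv: "splittable a v S \<Gamma>" and sw: "splittable b w T \<Gamma>" and vw: "v \<noteq> w"
    and D: "(\<Gamma>, os, ws, ss, ns) \<in> DG" and n: "n = new_half \<Gamma>"
    and G2: "G2 = sgraph N b w T (sgraph N a v S \<Gamma>)"
  shows "Sp b w T (Sp a v S (gen (\<Gamma>, os, ws, ss, ns))) =
    (\<Sum>A\<in>perms S. \<Sum>B\<in>perms (v - S).
     \<Sum>C\<in>perms T. \<Sum>E\<in>perms (w - T).
      scale (front_sgn (vdeg N \<Gamma>) v ns * (sgn_pow (vdeg N \<Gamma> v * vdeg N \<Gamma> w) * front_sgn (vdeg N \<Gamma>) w (others v ns)) *
          (coeff (entry v ns) (A @ B) * coeff (entry w ns) (C @ E)))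
       (gen (G2, os @ [new_edge n, new_edge (Suc (Suc n))], ws, ss,
          (insert (Suc (Suc n)) T, cyc (hdeg G2) (C @ [Suc (Suc n)])) #
          (insert (Suc (Suc (Suc n))) (w - T), cyc (hdeg G2) (Suc (Suc (Suc n)) # E)) #
          (insert n S, cyc (hdeg G2) (A @ [n])) # (insert (Suc n) (v - S), cyc (hdeg G2) (Suc n # B)) #
          others w (others v ns))))"
proof -
  define G1 where "G1 = sgraph N a v S \<Gamma>"
  note s = splittableD[OF sv]
  have g1: "is_graph G1" unfolding G1_def by (rule is_graph_sgraph[OF sv])
  have n1: "new_half G1 = Suc (Suc n)" unfolding G1_def n by (rule new_half_sgraph[OF s(4)])
  have wv: "w \<in> verts \<Gamma>" "v \<in> verts \<Gamma>" using splittableD(3) sv sw by blast+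
  have nw: "insert n S \<noteq> w" "insert (Suc n) (v - S) \<noteq> w"
    using new_verts_sgraph[OF sv] wv by (auto simp: n)
  have fw: "front_sgn (vdeg N G1) w (others v ns) = (front_sgn (vdeg N \<Gamma>) w (others v ns) :: 'k)"
  proof (rule front_sgn_cong)
    fix u assume "u \<in> fst ` set (others v ns)"
    then have "u \<in> normals \<Gamma>" using D by (auto simp: set_others DG_iff normal_words_def words_iff)
    then show "vdeg N G1 u = vdeg N \<Gamma> u" unfolding G1_def by (rule vdeg_sgraph_old[OF s(1) normal_vert])
  qed (simp add: G1_def vdeg_sgraph_old[OF s(1) wv(1)])
  have "vdeg N G1 (insert n S) * vdeg N G1 w + vdeg N G1 (insert (Suc n) (v - S)) * vdeg N G1 w = vdeg N \<Gamma> v * vdeg N \<Gamma> w"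
    using vdeg_sgraph_sum[OF sv] vdeg_sgraph_old[OF s(1) wv(1)] by (simp add: G1_def n flip: distrib_right)
  then have sg: "sgn_alt (vdeg N G1) (insert n S) w * sgn_alt (vdeg N G1) (insert (Suc n) (v - S)) w = (sgn_pow (vdeg N \<Gamma> v * vdeg N \<Gamma> w) :: 'k)"
    by (simp add: sgn_alt_def flip: sgn_pow_add)
  have inner: "Sp b w T (gen (G1, os @ [new_edge n], ws, ss, (insert n S, \<alpha>) # (insert (Suc n) (v - S), \<beta>) # others v ns)) =
    scale ((- 1) ^ length ss * (sgn_pow (vdeg N \<Gamma> v * vdeg N \<Gamma> w) * front_sgn (vdeg N \<Gamma>) w (others v ns)))
    (\<Sum>C\<in>perms T. \<Sum>E\<in>perms (w - T).
      scale (coeff (entry w ns) (C @ E))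
       (gen (G2, os @ [new_edge n, new_edge (Suc (Suc n))], ws, ss,
          (insert (Suc (Suc n)) T, cyc (hdeg G2) (C @ [Suc (Suc n)])) #
          (insert (Suc (Suc (Suc n))) (w - T), cyc (hdeg G2) (Suc (Suc (Suc n)) # E)) #
          (insert n S, \<alpha>) # (insert (Suc n) (v - S), \<beta>) # others w (others v ns))))" for \<alpha> \<beta>
    unfolding Sp_gen split_sum_def n1 G2[folded G1_def, symmetric]
    using nw vw by (simp add: entry_others fw sg[symmetric] mult.assoc)
  have cycs: "cyc (hdeg G2) us = cyc (hdeg G1) us" if "set us \<subseteq> halves G1" for us
    unfolding G2 G1_def[symmetric] by (rule cyc_sgraph[OF g1 that])
  have SG: "S \<subseteq> halves G1" "v - S \<subseteq> halves G1" "n \<in> halves G1" "Suc n \<in> halves G1"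
    using vert_halves[OF s(1,3)] s(7) by (auto simp: G1_def n)
  have cA: "cyc (hdeg G2) (A @ [n]) = cyc (hdeg G1) (A @ [n])" if "A \<in> perms S" for A
    using SG that by (intro cycs) (auto simp: perms_def)
  have cB: "cyc (hdeg G2) (Suc n # B) = cyc (hdeg G1) (Suc n # B)" if "B \<in> perms (v - S)" for B
    using SG that by (intro cycs) (auto simp: perms_def)
  have e: "(- 1) ^ m * ((- 1) ^ m * x) = (x :: 'k)" for m x
    by (simp flip: mult.assoc power_mult_distrib)
  show ?thesis
    unfolding Sp_gen[of a v S] split_sum_def lin_scale[OF lin_Sp] lin_sum[OF lin_Sp] n[symmetric]
      G1_def[symmetric] inner free.scale_sum_right
    by (intro sum.cong refl) (simp add: cA cB e mult.assoc mult.left_commute)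
qed

lemma graph_iso_swap4_other:
  assumes sv: "splittable a v S \<Gamma>" and sw: "splittable b w T \<Gamma>" and vw: "v \<noteq> w"
  shows "graph_iso (swap4 (new_half \<Gamma>)) (sgraph N a v S (sgraph N b w T \<Gamma>)) (sgraph N b w T (sgraph N a v S \<Gamma>))"
proof -
  define n where "n = new_half \<Gamma>"
  note s = splittableD[OF sv] and t = splittableD[OF sw]
  note f = swap4_fix[OF s(1), folded n_def]
  note n1 = new_half_sgraph[OF s(4), folded n_def]
  have nv: "insert n S \<noteq> w" "insert (Suc n) (v - S) \<noteq> w" "insert n T \<noteq> v" "insert (Suc n) (w - T) \<noteq> v"
    using new_verts_sgraph[OF sv] new_verts_sgraph[OF sw] s(3) t(3) by (auto simp: n_def)
  have 1: "verts (sgraph N b w T (sgraph N a v S \<Gamma>)) = (verts \<Gamma> - {v, w}) \<union>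
    {insert n S, insert (Suc n) (v - S), insert (Suc (Suc n)) T, insert (Suc (Suc (Suc n))) (w - T)}"
    using nv by (auto simp: n1 n_def[symmetric])
  have 2: "verts (sgraph N a v S (sgraph N b w T \<Gamma>)) = (verts \<Gamma> - {v, w}) \<union>
    {insert n T, insert (Suc n) (w - T), insert (Suc (Suc n)) S, insert (Suc (Suc (Suc n))) (v - S)}"
    using nv by (auto simp: n1 n_def[symmetric])
  have fu: "swap4 n ` S = S" "swap4 n ` (v - S) = v - S" "swap4 n ` T = T" "swap4 n ` (w - T) = w - T"
    using f(6)[OF s(3), of S] f(6)[OF s(3), of "v - S"] f(6)[OF t(3), of T] f(6)[OF t(3), of "w - T"] s(7) t(7)
    by simp_all
  show ?thesis
    unfolding n_def[symmetric]
  proof (rule graph_iso_swap4I[OF s(1) n_def])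
    show "(`) (swap4 n) ` verts (sgraph N a v S (sgraph N b w T \<Gamma>)) = verts (sgraph N b w T (sgraph N a v S \<Gamma>))"
      unfolding 1 2 image_Un by (simp add: f(4) fu insert_commute)
  qed (auto simp: n1 n_def[symmetric] sgraph_simps(4))
qed

text \<open>Exchanging the two new pairs cancels the sign acquired in one of the two expansions, and
  the two new edges commute. Pulling out \<open>v\<close> and \<open>w\<close> in the other order
  restores that sign together with a minus.\<close>

lemma Sp_commute:
  assumes sv: "splittable a v S \<Gamma>" and sw: "splittable b w T \<Gamma>" and vw: "v \<noteq> w"
    and x: "x \<in> chainsG \<Gamma>"
  shows "eqm (TR (sgraph N b w T (sgraph N a v S \<Gamma>))) (Sp b w T (Sp a v S x))
    (- trl (swap4 (new_half \<Gamma>)) (sgraph N b w T (sgraph N a v S \<Gamma>)) (Sp a v S (Sp b w T x)))"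
proof (rule chainsG_eqm[OF lin_compose[OF lin_Sp lin_Sp] _ _ x])
  show "lin (\<lambda>x. - trl (swap4 (new_half \<Gamma>)) (sgraph N b w T (sgraph N a v S \<Gamma>)) (Sp a v S (Sp b w T x)))"
    by (rule linI) (simp_all add: lin_add[OF lin_Sp] lin_add[OF lin_trl] lin_scale[OF lin_Sp] lin_scale[OF lin_trl])
  fix os ws ss ns assume D: "(\<Gamma>, os, ws, ss, ns) \<in> DG"
  define n where "n = new_half \<Gamma>"
  define G1 where "G1 = sgraph N a v S \<Gamma>"
  define G2 where "G2 = sgraph N b w T G1"
  define G2' where "G2' = sgraph N a v S (sgraph N b w T \<Gamma>)"
  let ?n2 = "Suc (Suc n)" and ?n3 = "Suc (Suc (Suc n))" and ?r = "others w (others v ns)"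
  note s = splittableD[OF sv] and t = splittableD[OF sw]
  note n1 = new_half_sgraph[OF s(4), folded n_def]
  have n1': "new_half G1 = ?n2" by (simp add: n1 G1_def)
  note sw1 = splittable_other[OF sv sw vw, folded G1_def]
  let ?d = "hdeg G2"
  let ?wa = "insert ?n2 T" and ?wb = "insert ?n3 (w - T)" and ?va = "insert n S" and ?vb = "insert (Suc n) (v - S)"
  have hd: "?d = (hdeg \<Gamma>)(n := a, Suc n := N - a, ?n2 := b, ?n3 := N - b)"
    "hdeg G2' = (hdeg \<Gamma>)(n := b, Suc n := N - b, ?n2 := a, ?n3 := N - a)"
    by (simp_all add: G2_def G2'_def G1_def n1 n_def[symmetric] sgraph_simps(4))
  have lt: "h < n" if "h \<in> v \<or> h \<in> w" for h
    using vert_lt[OF s(1,3)] vert_lt[OF t(1,3)] that by (auto simp: n_def)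
  have c: "lin_ext (gen \<circ> map (swap4 n)) (cyc (hdeg G2') (A @ [h])) = cyc ?d (A @ [swap4 n h])"
     "lin_ext (gen \<circ> map (swap4 n)) (cyc (hdeg G2') (h # A)) = cyc ?d (swap4 n h # A)"
    if "set A \<subseteq> v \<or> set A \<subseteq> w" "h \<in> {n, Suc n, ?n2, ?n3}" for A h
  proof -
    have ltA: "k < n" if "k \<in> set A" for k using that \<open>set A \<subseteq> v \<or> set A \<subseteq> w\<close> lt by blast
    then have m: "map (swap4 n) A = A" by (intro map_below[of _ n]) auto
    have "?d (swap4 n k) = hdeg G2' k" if "k \<in> insert h (set A)" for k
      using that ltA[of k] \<open>h \<in> _\<close> by (auto simp: hd)
    then show "lin_ext (gen \<circ> map (swap4 n)) (cyc (hdeg G2') (A @ [h])) = cyc ?d (A @ [swap4 n h])"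
     "lin_ext (gen \<circ> map (swap4 n)) (cyc (hdeg G2') (h # A)) = cyc ?d (swap4 n h # A)"
      using m by (subst cyc_map_involution[of _ _ ?d]; simp)+
  qed
  have fixh: "swap4 n h = h" if "h \<in> halves \<Gamma>" for h using new_half_gt[OF s(4) that] by (simp add: n_def)
  have fu: "swap4 n ` S = S" "swap4 n ` (v - S) = v - S" "swap4 n ` T = T" "swap4 n ` (w - T) = w - T"
    by (rule image_below[of _ n]; use lt s(7) t(7) in auto)+
  note ids = tword_id[OF DG_supported(1)[OF D] fixh] tword_id[OF DG_supported(2)[OF D] fixh]
    tword_id[OF supported_others[OF supported_others[OF DG_supported(3)[OF D]]] fixh] external_words_id[OF D fixh]
  have dist: "distinct (map fst ns)" "v \<in> fst ` set ns" "w \<in> fst ` set ns"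
    using D s(2) t(2) by (auto simp: DG_iff normal_words_def words_iff)
  let ?l = "\<lambda>A B C E. coeff (entry v ns) (A @ B) * coeff (entry w ns) (C @ E) :: 'k"
  let ?fv = "front_sgn (vdeg N \<Gamma>) v ns :: 'k" and ?fw = "front_sgn (vdeg N \<Gamma>) w ns :: 'k"
  let ?fwv = "front_sgn (vdeg N \<Gamma>) w (others v ns) :: 'k" and ?fvw = "front_sgn (vdeg N \<Gamma>) v (others w ns) :: 'k"
  let ?s = "sgn_pow (vdeg N \<Gamma> v * vdeg N \<Gamma> w) :: 'k"
  let ?X = "\<lambda>A B C E. gen (G2, os @ [new_edge n, new_edge ?n2], ws, ss,
     (?wa, cyc ?d (C @ [?n2])) # (?wb, cyc ?d (?n3 # E)) # (?va, cyc ?d (A @ [n])) # (?vb, cyc ?d (Suc n # B)) # ?r) :: _ \<Rightarrow>\<^sub>0 'k"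
  let ?Y = "\<lambda>A B C E. gen (G2, os @ [new_edge ?n2, new_edge n], ws, ss,
     (?va, cyc ?d (A @ [n])) # (?vb, cyc ?d (Suc n # B)) # (?wa, cyc ?d (C @ [?n2])) # (?wb, cyc ?d (?n3 # E)) # ?r) :: _ \<Rightarrow>\<^sub>0 'k"
  have L: "Sp b w T (Sp a v S (gen (\<Gamma>, os, ws, ss, ns))) =
    (\<Sum>A\<in>perms S. \<Sum>B\<in>perms (v - S).
     \<Sum>C\<in>perms T. \<Sum>E\<in>perms (w - T).
      scale (?fv * (?s * ?fwv) * ?l A B C E) (?X A B C E))"
    by (rule Sp_Sp_other[OF sv sw vw D n_def G2_def[unfolded G1_def]])
  have "trl (swap4 n) G2 (Sp a v S (Sp b w T (gen (\<Gamma>, os, ws, ss, ns)))) =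
    (\<Sum>C\<in>perms T. \<Sum>E\<in>perms (w - T).
     \<Sum>A\<in>perms S. \<Sum>B\<in>perms (v - S).
      scale (?fw * (?s * ?fvw) * ?l A B C E) (?Y A B C E))"
    unfolding Sp_Sp_other[OF sw sv vw[symmetric] D n_def G2'_def] lin_sum[OF lin_trl] lin_scale[OF lin_trl] trl_gen
  proof (intro sum.cong refl arg_cong2[of _ _ _ _ scale], goal_cases)
    case (1 C E A B)
    then show ?case by (simp add: mult.commute mult.left_commute)
  next
    case (2 C E A B)
    then have "set C \<subseteq> w" "set E \<subseteq> w" "set A \<subseteq> v" "set B \<subseteq> v"
      using s(7) t(7) by (auto simp: perms_def)
    then show ?case by (simp add: ids c fu insert_commute others_commute)
  qed
  then have R: "- trl (swap4 n) G2 (Sp a v S (Sp b w T (gen (\<Gamma>, os, ws, ss, ns)))) =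
    (\<Sum>A\<in>perms S. \<Sum>B\<in>perms (v - S).
     \<Sum>C\<in>perms T. \<Sum>E\<in>perms (w - T).
      scale (- (?fw * (?s * ?fvw) * ?l A B C E)) (?Y A B C E))"
    by (simp only: free.scale_minus_left sum_negf) (rule arg_cong[of _ _ uminus, OF sum_swap4])
  have "eqm (TR G2) (scale (?fv * (?s * ?fwv) * ?l A B C E) (?X A B C E)) (scale (- (?fw * (?s * ?fvw) * ?l A B C E)) (?Y A B C E))"
    if P: "A \<in> perms S" "B \<in> perms (v - S)" "C \<in> perms T" "E \<in> perms (w - T)" for A B C E
  proof -
    have SG: "S \<subseteq> halves G1" "v - S \<subseteq> halves G1" "n \<in> halves G1" "Suc n \<in> halves G1"
      using vert_halves[OF s(1,3)] s(7) by (auto simp: G1_def n_def)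
    have cA: "cyc ?d (A @ [n]) = cyc (hdeg G1) (A @ [n])" "cyc ?d (Suc n # B) = cyc (hdeg G1) (Suc n # B)"
      unfolding G2_def by (rule cyc_sgraph[OF is_graph_sgraph[OF sv, folded G1_def]]; use SG P in \<open>auto simp: perms_def\<close>)+
    have D1: "(G1, os @ [new_edge n], ws, ss, (?va, cyc ?d (A @ [n])) # (?vb, cyc ?d (Suc n # B)) # others v ns) \<in> DG"
      unfolding cA unfolding G1_def n_def by (rule split_DG'[OF sv D]; rule cyc_new[OF sv]; fact P)
    have nw: "?va \<noteq> w" "?vb \<noteq> w"
      using new_verts_sgraph[OF sv] t(3) by (auto simp: n_def)
    have "(G2, (os @ [new_edge n]) @ [new_edge ?n2], ws, ss, (?wa, cyc ?d (C @ [?n2])) # (?wb, cyc ?d (?n3 # E)) # others w ((?va, cyc ?d (A @ [n])) # (?vb, cyc ?d (Suc n # B)) # others v ns)) \<in> DG"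
      unfolding G2_def n1'[symmetric]
      by (rule split_DG'[OF sw1]; (rule cyc_new[OF sw1])?; (fact P D1[unfolded G2_def n1'[symmetric]])?)
    then have D2: "(G2, os @ [new_edge n, new_edge ?n2], ws, ss, (?wa, cyc ?d (C @ [?n2])) # (?wb, cyc ?d (?n3 # E)) # (?va, cyc ?d (A @ [n])) # (?vb, cyc ?d (Suc n # B)) # ?r) \<in> DG"
      using nw by simp
    then have D3: "(G2, os @ [new_edge n, new_edge ?n2], ws, ss, (?va, cyc ?d (A @ [n])) # (?vb, cyc ?d (Suc n # B)) # (?wa, cyc ?d (C @ [?n2])) # (?wb, cyc ?d (?n3 # E)) # ?r) \<in> DG"
      by (rule DG_permute) (simp_all add: add_mset_commute)
    have vd: "vdeg N G2 ?wa + vdeg N G2 ?wb = vdeg N \<Gamma> w" "vdeg N G2 ?va + vdeg N G2 ?vb = vdeg N \<Gamma> v"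
    proof -
      show "vdeg N G2 ?wa + vdeg N G2 ?wb = vdeg N \<Gamma> w"
        using vdeg_sgraph_sum[OF sw1, folded G2_def, unfolded n1']
          vdeg_sgraph_old[OF s(1) t(3), of a v S, folded G1_def] by simp
      have "vdeg N G2 ?va = vdeg N G1 ?va" "vdeg N G2 ?vb = vdeg N G1 ?vb"
        unfolding G2_def
        by (rule vdeg_sgraph_old[OF is_graph_sgraph[OF sv, folded G1_def]]; simp add: G1_def n_def)+
      then show "vdeg N G2 ?va + vdeg N G2 ?vb = vdeg N \<Gamma> v"
        using vdeg_sgraph_sum[OF sv] by (simp add: G1_def n_def)
    qed
    have 1: "eqm (TR G2) (?X A B C E) (scale ?s
       (gen (G2, os @ [new_edge n, new_edge ?n2], ws, ss, (?va, cyc ?d (A @ [n])) # (?vb, cyc ?d (Suc n # B)) # (?wa, cyc ?d (C @ [?n2])) # (?wb, cyc ?d (?n3 # E)) # ?r)))"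
      using TR_ns_swap22[OF D2] by (simp add: vd mult.commute)
    have 2: "eqm (TR G2) (gen (G2, os @ [new_edge n, new_edge ?n2], ws, ss, (?va, cyc ?d (A @ [n])) # (?vb, cyc ?d (Suc n # B)) # (?wa, cyc ?d (C @ [?n2])) # (?wb, cyc ?d (?n3 # E)) # ?r)) (scale 1 (?Y A B C E))"
      using TR_os_swap[of G2 os "new_edge n" "new_edge ?n2" "[]" ws ss] D3 by simp
    have "?fv * (?s * ?fwv) * ?l A B C E * (?s * 1) = - (?fw * (?s * ?fvw) * ?l A B C E)"
    proof -
      have "?fv * (?s * ?fwv) * ?l A B C E * (?s * 1) = (?fv * ?fwv) * ?l A B C E * (?s * ?s)"
        by (simp only: mult_ac mult_1_right mult_1_left)
      also have "\<dots> = - (?fw * (?s * ?fvw) * ?l A B C E)"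
        unfolding front_sgn_others[OF dist vw] by (simp add: mult_ac)
      finally show ?thesis .
    qed
    with eqm_scale[OF eqm_scale_trans[OF 1 2], of "?fv * (?s * ?fwv) * ?l A B C E"] show ?thesis
      by simp
  qed
  then show "eqm (TR (sgraph N b w T (sgraph N a v S \<Gamma>))) (Sp b w T (Sp a v S (gen (\<Gamma>, os, ws, ss, ns))))
    (- trl (swap4 (new_half \<Gamma>)) (sgraph N b w T (sgraph N a v S \<Gamma>)) (Sp a v S (Sp b w T (gen (\<Gamma>, os, ws, ss, ns)))))"
    unfolding n_def[symmetric] G1_def[symmetric] G2_def[symmetric] L R
    by (intro eqm_sum)
qed

end

text \<open>The cyclic word \<open>h B\<close> is cut into \<open>C\<close> and \<open>E\<close>. As
  \<open>h\<close> is not a letter of \<open>C\<close>, the block \<open>C\<close> lies inside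
  \<open>B = V1 C V2\<close>, and then \<open>E = V2 h V1\<close> is forced; all other pairs
  contribute zero.\<close>

lemma sum_over_rotation:
  fixes f :: "nat list \<Rightarrow> nat list \<Rightarrow> 'b::comm_monoid_add"
  assumes C: "C \<in> perms T" and T: "T \<subseteq> U" "T \<noteq> {}" and h: "h \<notin> U"
    and f0: "\<And>B E. B \<in> perms U \<Longrightarrow> E \<in> perms (insert h U - T) \<Longrightarrow>
      \<not> (\<exists>k. C @ E = rotate k (h # B)) \<Longrightarrow> f B E = 0"
  shows "(\<Sum>B\<in>perms U. \<Sum>E\<in>perms (insert h U - T). f B E) =
    (\<Sum>(V1, V2)\<in>{(V1, V2). V1 @ V2 \<in> perms (U - T)}. f (V1 @ C @ V2) (V2 @ h # V1))"
proof -
  let ?P = "{(V1, V2). V1 @ V2 \<in> perms (U - T)}"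
  let ?g = "\<lambda>(V1, V2). (V1 @ C @ V2, V2 @ h # V1)"
  have C': "distinct C" "set C = T" "C \<noteq> []" using C T by (auto simp: perms_def)
  have inj: "inj_on ?g ?P"
  proof (rule inj_onI)
    fix p q assume pq: "p \<in> ?P" "q \<in> ?P" "?g p = ?g q"
    obtain V1 V2 X1 X2 where eq: "p = (V1, V2)" "q = (X1, X2)" by force
    have "distinct (V2 @ [h] @ V1)" using pq(1) h eq by (auto simp: perms_def)
    then show "p = q" using append_eq_middle[of V2 "[h]" V1 X2 X1] pq(3) eq by simp
  qed
  have img: "?g ` ?P \<subseteq> perms U \<times> perms (insert h U - T)"
    using C' T h by (auto simp: perms_def)
  have "(\<Sum>B\<in>perms U. \<Sum>E\<in>perms (insert h U - T). f B E) =
    (\<Sum>p\<in>perms U \<times> perms (insert h U - T). f (fst p) (snd p))"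
    by (simp add: sum.cartesian_product case_prod_unfold)
  also have "\<dots> = (\<Sum>p\<in>?g ` ?P. f (fst p) (snd p))"
  proof (rule sum.mono_neutral_right[OF _ img], safe)
    fix B E assume BE: "B \<in> perms U" "E \<in> perms (insert h U - T)"
      "(B, E) \<notin> ?g ` ?P"
    have "\<not> (\<exists>k. C @ E = rotate k (h # B))"
    proof
      assume "\<exists>k. C @ E = rotate k (h # B)"
      then obtain xs ys where *: "h # B = xs @ ys" "C @ E = ys @ xs" unfolding rotate_iff by blast
      have "xs \<noteq> []"
      proof
        assume "xs = []"
        then have "C @ E = h # B" using * by simp
        then have "h \<in> set C" using C'(3) by (cases C) auto
        then show False using C' T h by auto
      qed
      then obtain V1 where xs: "xs = h # V1" "B = V1 @ ys" using * by (cases xs) auto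
      have "h \<in> set E" using BE T h by (auto simp: perms_def)
      then obtain V2 X where E: "E = V2 @ h # X" by (meson split_list)
      have d: "distinct (C @ E)" using BE C' by (auto simp: perms_def)
      have "(C @ V2) @ [h] @ X = ys @ [h] @ V1" using *(2) by (simp add: E xs)
      then have "C @ V2 = ys \<and> X = V1" using append_eq_middle[of "C @ V2" "[h]" X ys V1] d by (simp add: E)
      then have BE': "B = V1 @ C @ V2" "E = V2 @ h # V1" using xs E by auto
      have "V1 @ V2 \<in> perms (U - T)"
        using BE(1) C' unfolding BE' by (auto simp: perms_def)
      then have "(B, E) \<in> ?g ` ?P" unfolding BE' by force
      with BE(3) show False by blast
    qed
    then show "f (fst (B, E)) (snd (B, E)) = 0" using f0 BE by simp
  qed simp
  also have "\<dots> = (\<Sum>p\<in>?P. f (fst (?g p)) (snd (?g p)))"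
    using inj by (simp add: sum.reindex)
  finally show ?thesis by (simp add: case_prod_unfold)
qed

context graph_complex
begin

text \<open>Reversing three factors takes three transpositions, an odd number. The resulting minus
  sign is the one by which the two ways of building a chain of three vertices cancel.\<close>

lemma TR_ns_swap13:
  assumes D: "(\<Gamma>, os, ws, ss, p1 # p2 # p3 # ys) \<in> DG"
  shows "eqm (TR \<Gamma>) (gen (\<Gamma>, os, ws, ss, p1 # p2 # p3 # ys))
    (scale (- sgn_pow (vdeg N \<Gamma> (fst p1) * vdeg N \<Gamma> (fst p2) + vdeg N \<Gamma> (fst p1) * vdeg N \<Gamma> (fst p3) + vdeg N \<Gamma> (fst p2) * vdeg N \<Gamma> (fst p3)))
      (gen (\<Gamma>, os, ws, ss, p3 # p2 # p1 # ys)))"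
proof -
  let ?s = "sgn_alt (vdeg N \<Gamma>) :: _ \<Rightarrow> _ \<Rightarrow> 'k"
  have D2: "(\<Gamma>, os, ws, ss, p2 # p1 # p3 # ys) \<in> DG" by (rule DG_permute[OF D]) (simp_all add: add_mset_commute)
  have D3: "(\<Gamma>, os, ws, ss, p2 # p3 # p1 # ys) \<in> DG" by (rule DG_permute[OF D]) (simp_all add: add_mset_commute)
  have 1: "eqm (TR \<Gamma>) (gen (\<Gamma>, os, ws, ss, p1 # p2 # p3 # ys)) (scale (?s (fst p1) (fst p2)) (gen (\<Gamma>, os, ws, ss, p2 # p1 # p3 # ys)))"
    using TR_ns_swap[of \<Gamma> os ws ss "[]"] D by simp
  have 2: "eqm (TR \<Gamma>) (gen (\<Gamma>, os, ws, ss, p2 # p1 # p3 # ys)) (scale (?s (fst p1) (fst p3)) (gen (\<Gamma>, os, ws, ss, p2 # p3 # p1 # ys)))"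
    using TR_ns_swap[of \<Gamma> os ws ss "[p2]"] D2 by simp
  have 3: "eqm (TR \<Gamma>) (gen (\<Gamma>, os, ws, ss, p2 # p3 # p1 # ys)) (scale (?s (fst p2) (fst p3)) (gen (\<Gamma>, os, ws, ss, p3 # p2 # p1 # ys)))"
    using TR_ns_swap[of \<Gamma> os ws ss "[]"] D3 by simp
  have "?s (fst p1) (fst p2) * (?s (fst p1) (fst p3) * ?s (fst p2) (fst p3)) =
     - sgn_pow (vdeg N \<Gamma> (fst p1) * vdeg N \<Gamma> (fst p2) + vdeg N \<Gamma> (fst p1) * vdeg N \<Gamma> (fst p3) + vdeg N \<Gamma> (fst p2) * vdeg N \<Gamma> (fst p3))"
    by (simp add: sgn_alt_def sgn_pow_add)
  then show ?thesis
    using eqm_scale_trans[OF 1 eqm_scale_trans[OF 2 3]] by simp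
qed

lemma splittable_tree:
  assumes "splittable a v S \<Gamma>" "T \<subseteq> v - S" "T \<noteq> {}" "b \<in> degrees W" "N - b \<in> degrees W"
  shows "splittable b (vert2 \<Gamma> v S) T (sgraph N a v S \<Gamma>)"
proof -
  have "Suc (new_half \<Gamma>) \<notin> T" using assms(2) splittableD(14)[OF assms(1)] by blast
  then show ?thesis
    using assms is_graph_sgraph[OF assms(1)] normals_sgraph[OF assms(1)] by (auto simp: splittable_def)
qed

text \<open>The vertex that is split again carries the cyclic word \<open>h'' B\<close>. Its
  coefficient at \<open>C E\<close> is a rotation sign if \<open>C\<close> is a block of
  \<open>B\<close> and zero otherwise, so \<open>V1\<close> and \<open>V2\<close> are the arcs on
  the two sides of this block. They stay with the middle vertex, separated by its first connecting
  half-edge.\<close>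

lemma Sp_Sp_tree:
  assumes sv: "splittable a v S \<Gamma>" and T: "T \<subseteq> v - S" "T \<noteq> {}" and b: "b \<in> degrees W" "N - b \<in> degrees W"
    and D: "(\<Gamma>, os, ws, ss, ns) \<in> DG" and n: "n = new_half \<Gamma>"
    and v2: "v2 = insert (Suc n) (v - S)"
    and G2: "G2 = sgraph N b v2 T (sgraph N a v S \<Gamma>)"
  shows "Sp b v2 T (Sp a v S (gen (\<Gamma>, os, ws, ss, ns))) =
    (\<Sum>A\<in>perms S. \<Sum>C\<in>perms T.
     \<Sum>(V1, V2)\<in>{(V1, V2). V1 @ V2 \<in> perms (v - S - T)}.
      scale (front_sgn (vdeg N \<Gamma>) v ns *
          (- sgn_pow ((sum (hdeg \<Gamma>) S + a - N) * (sum (hdeg \<Gamma>) (v - S) - a)) *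
           sgn_pow ((N - a + sum (hdeg \<Gamma>) (set V1)) * (sum (hdeg \<Gamma>) T + sum (hdeg \<Gamma>) (set V2)))) *
          coeff (entry v ns) (A @ V1 @ C @ V2))
       (gen (G2, os @ [new_edge n, new_edge (Suc (Suc n))], ws, ss,
          (insert (Suc (Suc n)) T, cyc (hdeg G2) (C @ [Suc (Suc n)])) #
          (insert (Suc (Suc (Suc n))) (v2 - T), cyc (hdeg G2) (Suc (Suc (Suc n)) # V2 @ Suc n # V1)) #
          (insert n S, cyc (hdeg G2) (A @ [n])) # others v ns)))"
proof -
  define G1 where "G1 = sgraph N a v S \<Gamma>"
  let ?n2 = "Suc (Suc n)" and ?n3 = "Suc (Suc (Suc n))" and ?v1 = "insert n S" and ?r = "others v ns"
  let ?P = "{(V1, V2). V1 @ V2 \<in> perms (v - S - T)}"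
  let ?F = "\<lambda>A C E. gen (G2, os @ [new_edge n, new_edge ?n2], ws, ss,
          (insert ?n2 T, cyc (hdeg G2) (C @ [?n2])) #
          (insert ?n3 (v2 - T), cyc (hdeg G2) (?n3 # E)) #
          (insert n S, cyc (hdeg G2) (A @ [n])) # ?r) :: _ \<Rightarrow>\<^sub>0 'k"
  note s = splittableD[OF sv]
  have g1: "is_graph G1" unfolding G1_def by (rule is_graph_sgraph[OF sv])
  have n1: "new_half G1 = ?n2" unfolding G1_def n by (rule new_half_sgraph[OF s(4)])
  have nv: "n \<notin> v" "Suc n \<notin> v" using s(13,14) by (simp_all add: n)
  have v12: "?v1 \<noteq> v2" using new_verts_sgraph(3)[OF sv] by (simp add: n v2)
  have oth: "others v2 ?r = ?r"
  proof (rule others_absent)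
    have "fst ` set ?r \<subseteq> verts \<Gamma>"
      using D normal_vert by (auto simp: set_others DG_iff normal_words_def words_iff)
    then show "v2 \<notin> fst ` set ?r" using new_verts_sgraph(2)[OF sv] by (auto simp: n v2)
  qed
  have d1: "hdeg G1 (Suc n) = N - a" "sum (hdeg G1) U = sum (hdeg \<Gamma>) U" if "U \<subseteq> v" for U
    using hdeg_sgraph_S[OF sv that] by (simp_all add: G1_def n sgraph_simps(4))
  have sg: "sgn_alt (vdeg N G1) ?v1 v2 = (- sgn_pow ((sum (hdeg \<Gamma>) S + a - N) * (sum (hdeg \<Gamma>) (v - S) - a)) :: 'k)"
    using vdeg_sgraph_new[OF sv] by (simp add: sgn_alt_def G1_def n v2)
  let ?sg = "- sgn_pow ((sum (hdeg \<Gamma>) S + a - N) * (sum (hdeg \<Gamma>) (v - S) - a)) :: 'k"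
  have inner: "Sp b v2 T (gen (G1, os @ [new_edge n], ws, ss, (?v1, cyc (hdeg G1) (A @ [n])) # (v2, cyc (hdeg G1) (Suc n # B)) # ?r)) =
    scale ((- 1) ^ length ss * ?sg) (\<Sum>C\<in>perms T. \<Sum>E\<in>perms (v2 - T).
      scale (coeff (cyc (hdeg G1) (Suc n # B)) (C @ E)) (?F A C E))"
    if "A \<in> perms S" for A B
  proof -
    have "set (A @ [n]) \<subseteq> halves G1"
      using that vert_halves[OF s(1,3)] s(7) by (auto simp: perms_def G1_def n)
    then have "cyc (hdeg G2) (A @ [n]) = (cyc (hdeg G1) (A @ [n]) :: _ \<Rightarrow>\<^sub>0 'k)"
      unfolding G2 G1_def[symmetric] by (rule cyc_sgraph[OF g1])
    then show ?thesis
      unfolding Sp_gen split_sum_def n1 G2[folded G1_def, symmetric]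
      using v12 by (simp add: sg oth)
  qed
  have e: "(- 1) ^ m * ((- 1) ^ m * x) = (x :: 'k)" for m x
    by (simp flip: mult.assoc power_mult_distrib)
  have rot: "(\<Sum>B\<in>perms (v - S). \<Sum>E\<in>perms (v2 - T).
      scale (coeff (entry v ns) (A @ B) * coeff (cyc (hdeg G1) (Suc n # B)) (C @ E)) (?F A C E)) =
    (\<Sum>(V1, V2)\<in>?P. scale (coeff (entry v ns) (A @ V1 @ C @ V2) *
       sgn_pow ((N - a + sum (hdeg \<Gamma>) (set V1)) * (sum (hdeg \<Gamma>) T + sum (hdeg \<Gamma>) (set V2)))) (?F A C (V2 @ Suc n # V1)))"
    if A: "A \<in> perms S" and C: "C \<in> perms T" for A C
  proof -
    have "(\<Sum>B\<in>perms (v - S). \<Sum>E\<in>perms (v2 - T).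
        scale (coeff (entry v ns) (A @ B) * coeff (cyc (hdeg G1) (Suc n # B)) (C @ E)) (?F A C E)) =
      (\<Sum>(V1, V2)\<in>?P. scale (coeff (entry v ns) (A @ V1 @ C @ V2) *
         coeff (cyc (hdeg G1) (Suc n # V1 @ C @ V2)) (C @ V2 @ Suc n # V1)) (?F A C (V2 @ Suc n # V1)))"
      unfolding v2
    proof (rule sum_over_rotation[OF C T], goal_cases)
      case 1 then show ?case using nv by simp
    next
      case (2 B E)
      then have "distinct (Suc n # B)" using nv by (auto simp: perms_def)
      with 2(3) show ?case by (subst lookup_cyc) auto
    qed
    also have "\<dots> = (\<Sum>(V1, V2)\<in>?P. scale (coeff (entry v ns) (A @ V1 @ C @ V2) *
       sgn_pow ((N - a + sum (hdeg \<Gamma>) (set V1)) * (sum (hdeg \<Gamma>) T + sum (hdeg \<Gamma>) (set V2)))) (?F A C (V2 @ Suc n # V1)))"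
    proof (rule sum.cong[OF refl], safe)
      fix V1 V2 assume V: "V1 @ V2 \<in> perms (v - S - T)"
      then have V': "distinct V1" "distinct V2" "set V1 \<inter> set V2 = {}" "set V1 \<union> set V2 = v - S - T"
        by (auto simp: perms_def)
      have C': "distinct C" "set C = T" using C by (auto simp: perms_def)
      have sub: "set V1 \<subseteq> v" "set V2 \<subseteq> v" "T \<subseteq> v" using V'(4) T by auto
      have fr: "Suc n \<notin> set V1" "Suc n \<notin> set V2" "Suc n \<notin> T" using sub nv by auto
      have TV: "T \<inter> set V1 = {}" "T \<inter> set V2 = {}" using V'(4) by auto
      have dist: "distinct ((Suc n # V1) @ (C @ V2))" using V' C' fr TV by auto
      have "coeff (cyc (hdeg G1) (Suc n # V1 @ C @ V2)) (C @ V2 @ Suc n # V1) =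
        (koszul (hdeg G1) ((Suc n # V1) @ (C @ V2)) ((C @ V2) @ (Suc n # V1)) :: 'k)"
      proof -
        have "\<exists>k. C @ V2 @ Suc n # V1 = rotate k (Suc n # V1 @ C @ V2)"
          unfolding rotate_iff by (intro exI[of _ "Suc n # V1"] exI[of _ "C @ V2"]) simp
        then show ?thesis using dist by (subst lookup_cyc) auto
      qed
      also have "\<dots> = sgn_pow (sum (hdeg G1) (set (Suc n # V1)) * sum (hdeg G1) (set (C @ V2)))"
        by (rule koszul_swap[OF dist])
      also have "sum (hdeg G1) (set (Suc n # V1)) = N - a + sum (hdeg \<Gamma>) (set V1)"
        using fr d1[OF sub(1)] by simp
      also have "sum (hdeg G1) (set (C @ V2)) = sum (hdeg \<Gamma>) T + sum (hdeg \<Gamma>) (set V2)"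
        using C' TV d1(2)[OF sub(2)] d1(2)[OF sub(3)] finite_subset[OF sub(3) s(5)] by (simp add: sum.union_disjoint)
      finally show "scale (coeff (entry v ns) (A @ V1 @ C @ V2) *
         coeff (cyc (hdeg G1) (Suc n # V1 @ C @ V2)) (C @ V2 @ Suc n # V1)) (?F A C (V2 @ Suc n # V1)) =
        scale (coeff (entry v ns) (A @ V1 @ C @ V2) *
       sgn_pow ((N - a + sum (hdeg \<Gamma>) (set V1)) * (sum (hdeg \<Gamma>) T + sum (hdeg \<Gamma>) (set V2)))) (?F A C (V2 @ Suc n # V1))"
        by simp
    qed
    finally show ?thesis .
  qed
  have "Sp b v2 T (Sp a v S (gen (\<Gamma>, os, ws, ss, ns))) =
    (\<Sum>A\<in>perms S. \<Sum>B\<in>perms (v - S). \<Sum>C\<in>perms T. \<Sum>E\<in>perms (v2 - T).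
      scale (front_sgn (vdeg N \<Gamma>) v ns * ?sg) (scale (coeff (entry v ns) (A @ B) * coeff (cyc (hdeg G1) (Suc n # B)) (C @ E)) (?F A C E)))"
    unfolding Sp_gen[of a v S] split_sum_def lin_scale[OF lin_Sp] lin_sum[OF lin_Sp] n[symmetric] v2[symmetric]
      G1_def[symmetric]
    by (simp add: inner free.scale_sum_right e mult.assoc mult.left_commute cong: sum.cong)
  also have "\<dots> = (\<Sum>A\<in>perms S. \<Sum>C\<in>perms T. scale (front_sgn (vdeg N \<Gamma>) v ns * ?sg)
      (\<Sum>B\<in>perms (v - S). \<Sum>E\<in>perms (v2 - T).
       scale (coeff (entry v ns) (A @ B) * coeff (cyc (hdeg G1) (Suc n # B)) (C @ E)) (?F A C E)))"
    unfolding free.scale_sum_right by (intro sum.cong refl sum.swap)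
  also have "\<dots> = (\<Sum>A\<in>perms S. \<Sum>C\<in>perms T. scale (front_sgn (vdeg N \<Gamma>) v ns * ?sg)
      (\<Sum>(V1, V2)\<in>?P. scale (coeff (entry v ns) (A @ V1 @ C @ V2) *
       sgn_pow ((N - a + sum (hdeg \<Gamma>) (set V1)) * (sum (hdeg \<Gamma>) T + sum (hdeg \<Gamma>) (set V2)))) (?F A C (V2 @ Suc n # V1))))"
    by (intro sum.cong refl arg_cong[of _ _ "scale _"] rot)
  also have "\<dots> = (\<Sum>A\<in>perms S. \<Sum>C\<in>perms T. \<Sum>(V1, V2)\<in>?P.
      scale (front_sgn (vdeg N \<Gamma>) v ns * (?sg *
           sgn_pow ((N - a + sum (hdeg \<Gamma>) (set V1)) * (sum (hdeg \<Gamma>) T + sum (hdeg \<Gamma>) (set V2)))) *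
          coeff (entry v ns) (A @ V1 @ C @ V2)) (?F A C (V2 @ Suc n # V1)))"
    unfolding free.scale_sum_right by (intro sum.cong refl) (simp add: case_prod_unfold mult_ac)
  finally show ?thesis .
qed

text \<open>In both orders the middle vertex contains \<open>Suc n\<close> and
  \<open>Suc (Suc (Suc n))\<close>, one end of each new edge, and \<open>swap4\<close> exchanges
  these. The end vertices keep \<open>S\<close> and \<open>T\<close> and exchange the labels
  \<open>n\<close> and \<open>Suc (Suc n)\<close>.\<close>

lemma graph_iso_swap4_tree:
  assumes sv: "splittable a v S \<Gamma>" and tv: "splittable b v T \<Gamma>" and ST: "S \<inter> T = {}"
  shows "graph_iso (swap4 (new_half \<Gamma>))
    (sgraph N a (insert (Suc (new_half \<Gamma>)) (v - T)) S (sgraph N b v T \<Gamma>))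
    (sgraph N b (vert2 \<Gamma> v S) T (sgraph N a v S \<Gamma>))"
proof -
  define n where "n = new_half \<Gamma>"
  note s = splittableD[OF sv] and t = splittableD[OF tv]
  note f = swap4_fix[OF s(1), folded n_def]
  note n1 = new_half_sgraph[OF s(4), folded n_def]
  have fr: "Suc n \<notin> S" "Suc n \<notin> T" using s(7,14) t(7) by (auto simp: n_def)
  have nv: "insert n S \<noteq> insert (Suc n) (v - S)" "insert (Suc n) (v - S) \<notin> verts \<Gamma>"
     "insert n T \<noteq> insert (Suc n) (v - T)" "insert (Suc n) (v - T) \<notin> verts \<Gamma>"
    using new_verts_sgraph[OF sv] new_verts_sgraph[OF tv] by (auto simp: n_def)
  have 1: "verts (sgraph N b (insert (Suc n) (v - S)) T (sgraph N a v S \<Gamma>)) = (verts \<Gamma> - {v}) \<union>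
    {insert n S, insert (Suc (Suc n)) T, insert (Suc (Suc (Suc n))) (insert (Suc n) (v - S - T))}"
    using nv fr by (auto simp: n1 n_def[symmetric] insert_Diff_if)
  have "v - T - S = v - S - T" by auto
  then have 2: "verts (sgraph N a (insert (Suc n) (v - T)) S (sgraph N b v T \<Gamma>)) = (verts \<Gamma> - {v}) \<union>
    {insert n T, insert (Suc (Suc n)) S, insert (Suc (Suc (Suc n))) (insert (Suc n) (v - S - T))}"
    using nv fr by (auto simp: n1 n_def[symmetric] insert_Diff_if)
  have fu: "swap4 n ` S = S" "swap4 n ` T = T" "swap4 n ` (v - S - T) = v - S - T"
    using f(6)[OF s(3), of S] f(6)[OF s(3), of T] f(6)[OF s(3), of "v - S - T"] s(7) t(7)
    by auto
  show ?thesis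
    unfolding n_def[symmetric]
  proof (rule graph_iso_swap4I[OF s(1) n_def])
    show "(`) (swap4 n) ` verts (sgraph N a (insert (Suc n) (v - T)) S (sgraph N b v T \<Gamma>)) =
      verts (sgraph N b (insert (Suc n) (v - S)) T (sgraph N a v S \<Gamma>))"
      unfolding 1 2 image_Un by (simp add: f(4) fu insert_commute)
  qed (auto simp: n1 n_def[symmetric] sgraph_simps(4))
qed

text \<open>Both sides run over the cyclic orders \<open>A V1 C V2\<close> of \<open>v\<close>,
  where \<open>V1\<close> and \<open>V2\<close> are the arcs left to the middle vertex; their roles
  are exchanged when the other end is split off first. The signs that depend on degrees cancel
  between the rotation of \<open>v\<close>, the rotation of the middle vertex and the reversal of
  the three vertices, and the minus sign of the reversal remains.\<close>

lemma Sp_tree: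
  assumes sv: "splittable a v S \<Gamma>" and tv: "splittable b v T \<Gamma>" and ST: "S \<inter> T = {}"
    and x: "x \<in> chainsG \<Gamma>" and n: "n = new_half \<Gamma>"
    and G2: "G2 = sgraph N b (insert (Suc n) (v - S)) T (sgraph N a v S \<Gamma>)"
  shows "eqm (TR G2) (Sp b (insert (Suc n) (v - S)) T (Sp a v S x))
    (- trl (swap4 n) G2 (Sp a (insert (Suc n) (v - T)) S (Sp b v T x)))"
proof (rule chainsG_eqm[OF lin_compose[OF lin_Sp lin_Sp] _ _ x])
  show "lin (\<lambda>x. - trl (swap4 n) G2 (Sp a (insert (Suc n) (v - T)) S (Sp b v T x)))"
    by (rule linI) (simp_all add: lin_add[OF lin_Sp] lin_add[OF lin_trl] lin_scale[OF lin_Sp] lin_scale[OF lin_trl])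
  fix os ws ss ns assume D: "(\<Gamma>, os, ws, ss, ns) \<in> DG"
  define G1 where "G1 = sgraph N a v S \<Gamma>"
  define G2' where "G2' = sgraph N a (insert (Suc n) (v - T)) S (sgraph N b v T \<Gamma>)"
  let ?n2 = "Suc (Suc n)" and ?n3 = "Suc (Suc (Suc n))" and ?r = "others v ns"
  note s = splittableD[OF sv] and t = splittableD[OF tv]
  let ?M = "v - S - T"
  have M: "v - T - S = ?M" by auto
  have TS: "T \<subseteq> v - S" "S \<subseteq> v - T" using s(7) t(7) ST by auto
  have nv: "n \<notin> v" "Suc n \<notin> v" using s(13,14) by (simp_all add: n)
  have fr: "Suc n \<notin> S" "Suc n \<notin> T" using nv s(7) t(7) by auto
  have v2: "insert (Suc n) (v - S) - T = insert (Suc n) ?M" "insert (Suc n) (v - T) - S = insert (Suc n) ?M"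
    using fr by auto
  note n1 = new_half_sgraph[OF s(4), folded n]
  have n1': "new_half G1 = ?n2" by (simp add: n1 G1_def)
  have ab: "a \<in> degrees W" "N - a \<in> degrees W" "b \<in> degrees W" "N - b \<in> degrees W"
    using sv tv by (auto simp: splittable_def)
  note sw1 = splittable_tree[OF sv TS(1) t(8) ab(3,4), folded G1_def n]
  let ?d = "hdeg G2"
  let ?t = "insert ?n2 T" and ?m = "insert ?n3 (insert (Suc n) ?M)" and ?s = "insert n S"
  have hd: "?d = (hdeg \<Gamma>)(n := a, Suc n := N - a, ?n2 := b, ?n3 := N - b)"
    "hdeg G2' = (hdeg \<Gamma>)(n := b, Suc n := N - b, ?n2 := a, ?n3 := N - a)"
    by (simp_all add: G2 G2'_def n1 n[symmetric] sgraph_simps(4))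
  have lt: "h < n" if "h \<in> v" for h
    using vert_lt[OF s(1,3) that] by (simp add: n)
  have c: "lin_ext (gen \<circ> map (swap4 n)) (cyc (hdeg G2') us) = cyc ?d (map (swap4 n) us)"
    if "set us \<subseteq> v \<union> {n, Suc n, ?n2, ?n3}" for us
  proof (rule cyc_map_involution)
    fix k assume "k \<in> set us"
    with that lt[of k] show "?d (swap4 n k) = hdeg G2' k"
      by (auto simp: hd)
  qed simp
  have mp: "map (swap4 n) A = A" if "set A \<subseteq> v" for A
    using that lt by (intro map_below[of _ n]) auto
  have fixh: "swap4 n h = h" if "h \<in> halves \<Gamma>" for h using new_half_gt[OF s(4) that] by (simp add: n)
  have fu: "swap4 n ` S = S" "swap4 n ` T = T" "swap4 n ` ?M = ?M"
    by (rule image_below[of _ n]; use lt s(7) t(7) in auto)+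
  note ids = tword_id[OF DG_supported(1)[OF D] fixh] tword_id[OF DG_supported(2)[OF D] fixh]
    tword_id[OF supported_others[OF DG_supported(3)[OF D]] fixh] external_words_id[OF D fixh]
  let ?P = "{(V1, V2). V1 @ V2 \<in> perms ?M}"
  let ?c = "coeff (entry v ns)"
  let ?f = "front_sgn (vdeg N \<Gamma>) v ns :: 'k"
  let ?hs = "sum (hdeg \<Gamma>)"
  let ?k1 = "\<lambda>A C V1 V2. ?f * (- sgn_pow ((?hs S + a - N) * (?hs (v - S) - a)) * sgn_pow ((N - a + ?hs (set V1)) * (?hs T + ?hs (set V2)))) * ?c (A @ V1 @ C @ V2)"
  let ?k2 = "\<lambda>A C V1 V2. ?f * (- sgn_pow ((?hs T + b - N) * (?hs (v - T) - b)) * sgn_pow ((N - b + ?hs (set V2)) * (?hs S + ?hs (set V1)))) * ?c (C @ V2 @ A @ V1)"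
  let ?X = "\<lambda>A C V1 V2. gen (G2, os @ [new_edge n, new_edge ?n2], ws, ss,
     (?t, cyc ?d (C @ [?n2])) # (?m, cyc ?d (?n3 # V2 @ Suc n # V1)) # (?s, cyc ?d (A @ [n])) # ?r) :: _ \<Rightarrow>\<^sub>0 'k"
  let ?Y = "\<lambda>A C V1 V2. gen (G2, os @ [new_edge ?n2, new_edge n], ws, ss,
     (?s, cyc ?d (A @ [n])) # (?m, cyc ?d (Suc n # V1 @ ?n3 # V2)) # (?t, cyc ?d (C @ [?n2])) # ?r) :: _ \<Rightarrow>\<^sub>0 'k"
  have L: "Sp b (insert (Suc n) (v - S)) T (Sp a v S (gen (\<Gamma>, os, ws, ss, ns))) =
    (\<Sum>A\<in>perms S. \<Sum>C\<in>perms T. \<Sum>(V1, V2)\<in>?P.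
      scale (?k1 A C V1 V2) (?X A C V1 V2))"
    using Sp_Sp_tree[OF sv TS(1) t(8) ab(3,4) D n refl G2] by (simp only: v2)
  have Pswap: "(\<Sum>(V1, V2)\<in>?P. g V1 V2) = (\<Sum>(V1, V2)\<in>?P. g V2 V1)" for g :: "nat list \<Rightarrow> nat list \<Rightarrow> ('k, 'w) chain"
    by (rule sum.reindex_bij_witness[of _ "\<lambda>(x, y). (y, x)" "\<lambda>(x, y). (y, x)"])
      (auto simp: perms_def)
  have "trl (swap4 n) G2 (Sp a (insert (Suc n) (v - T)) S (Sp b v T (gen (\<Gamma>, os, ws, ss, ns)))) =
    (\<Sum>C\<in>perms T. \<Sum>A\<in>perms S. \<Sum>(V2, V1)\<in>?P.
      scale (?k2 A C V1 V2) (?Y A C V1 V2))"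
    unfolding Sp_Sp_tree[OF tv TS(2) s(8) ab(1,2) D n refl G2'_def] lin_sum[OF lin_trl] M v2
  proof (intro sum.cong refl, safe, goal_cases)
    case (1 C A V2 V1)
    then have "set C \<subseteq> v" "set A \<subseteq> v" "set V1 \<subseteq> v" "set V2 \<subseteq> v"
      using s(7) t(7) by (auto simp: perms_def)
    note sub = this
    have "lin_ext (gen \<circ> map (swap4 n)) (cyc (hdeg G2') (A @ [?n2])) = (cyc ?d (A @ [n]) :: _ \<Rightarrow>\<^sub>0 'k)"
      "lin_ext (gen \<circ> map (swap4 n)) (cyc (hdeg G2') (?n3 # V1 @ Suc n # V2)) = (cyc ?d (Suc n # V1 @ ?n3 # V2) :: _ \<Rightarrow>\<^sub>0 'k)"
      "lin_ext (gen \<circ> map (swap4 n)) (cyc (hdeg G2') (C @ [n])) = (cyc ?d (C @ [?n2]) :: _ \<Rightarrow>\<^sub>0 'k)"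
      by (subst c; use sub in \<open>auto simp: mp\<close>)+
    then show ?case
      by (simp add: lin_scale[OF lin_trl] lin_neg[OF lin_trl] trl_gen ids fu insert_commute)
  qed
  also have "\<dots> = (\<Sum>A\<in>perms S. \<Sum>C\<in>perms T. \<Sum>(V1, V2)\<in>?P.
      scale (?k2 A C V1 V2) (?Y A C V1 V2))"
    by (rule trans[OF sum.swap]) (intro sum.cong refl Pswap)
  finally have R': "trl (swap4 n) G2 (Sp a (insert (Suc n) (v - T)) S (Sp b v T (gen (\<Gamma>, os, ws, ss, ns)))) =
    (\<Sum>A\<in>perms S. \<Sum>C\<in>perms T. \<Sum>(V1, V2)\<in>?P.
      scale (?k2 A C V1 V2) (?Y A C V1 V2))" .
  have R: "- trl (swap4 n) G2 (Sp a (insert (Suc n) (v - T)) S (Sp b v T (gen (\<Gamma>, os, ws, ss, ns)))) =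
    (\<Sum>A\<in>perms S. \<Sum>C\<in>perms T. \<Sum>(V1, V2)\<in>?P.
      scale (- ?k2 A C V1 V2) (?Y A C V1 V2))"
    by (simp only: R' free.scale_minus_left sum_negf case_prod_unfold)
  have "eqm (TR G2) (scale (?k1 A C V1 V2) (?X A C V1 V2)) (scale (- ?k2 A C V1 V2) (?Y A C V1 V2))"
    if P: "A \<in> perms S" "C \<in> perms T" "V1 @ V2 \<in> perms ?M" for A C V1 V2
  proof -
    have A': "distinct A" "set A = S" and C': "distinct C" "set C = T"
      and V': "distinct V1" "distinct V2" "set V1 \<inter> set V2 = {}" "set V1 \<union> set V2 = ?M"
      using P by (auto simp: perms_def)
    have sub: "set V1 \<subseteq> v" "set V2 \<subseteq> v" "?M \<subseteq> v" using V'(4) by auto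
    have frV: "n \<notin> set V1" "n \<notin> set V2" "Suc n \<notin> set V1" "Suc n \<notin> set V2" "?n3 \<notin> set V1" "?n3 \<notin> set V2" "?n3 \<notin> v" "?n2 \<notin> v"
      using sub nv lt by fastforce+
    have disj: "S \<inter> set V1 = {}" "S \<inter> set V2 = {}" "T \<inter> set V1 = {}" "T \<inter> set V2 = {}" using V'(4) by auto
    have hM: "?hs ?M = ?hs (set V1) + ?hs (set V2)"
      using V' by (simp flip: V'(4) add: sum.union_disjoint)
    have hvS: "?hs (v - S) = ?hs T + (?hs (set V1) + ?hs (set V2))"
      using sum.subset_diff[OF TS(1), of "hdeg \<Gamma>"] s(5) hM by simp
    have hvT: "?hs (v - T) = ?hs S + (?hs (set V1) + ?hs (set V2))"
      using sum.subset_diff[OF TS(2), of "hdeg \<Gamma>"] s(5) hM M by simp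
    have SG: "S \<subseteq> halves G1" "v - S \<subseteq> halves G1" "n \<in> halves G1" "Suc n \<in> halves G1"
      using vert_halves[OF s(1,3)] s(7) by (auto simp: G1_def n)
    have g1: "is_graph G1" unfolding G1_def by (rule is_graph_sgraph[OF sv])
    have cA: "cyc ?d (A @ [n]) = (cyc (hdeg G1) (A @ [n]) :: _ \<Rightarrow>\<^sub>0 'k)"
      unfolding G2 G1_def[symmetric] by (rule cyc_sgraph[OF g1]) (use SG A' in auto)
    let ?\<beta> = "cyc (hdeg G1) (Suc n # V1 @ C @ V2) :: _ \<Rightarrow>\<^sub>0 'k"
    have VCV: "V1 @ C @ V2 \<in> perms (v - S)"
      using V' C' TS disj by (auto simp: perms_def)
    have D1: "(G1, os @ [new_edge n], ws, ss, (?s, cyc ?d (A @ [n])) # (insert (Suc n) (v - S), ?\<beta>) # ?r) \<in> DG"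
      unfolding cA unfolding G1_def n by (rule split_DG'[OF sv D]; rule cyc_new[OF sv]; fact P VCV)
    have v12: "?s \<noteq> insert (Suc n) (v - S)" using new_verts_sgraph(3)[OF sv] by (simp add: n)
    have oth: "others (insert (Suc n) (v - S)) ?r = ?r"
    proof (rule others_absent)
      have "fst ` set ?r \<subseteq> verts \<Gamma>"
        using D normal_vert by (auto simp: set_others DG_iff normal_words_def words_iff)
      then show "insert (Suc n) (v - S) \<notin> fst ` set ?r" using new_verts_sgraph(2)[OF sv] by (auto simp: n)
    qed
    have mperm: "V2 @ Suc n # V1 \<in> perms (insert (Suc n) (v - S) - T)"
      unfolding v2 using V' frV by (auto simp: perms_def)
    have "(G2, (os @ [new_edge n]) @ [new_edge ?n2], ws, ss, (?t, cyc ?d (C @ [?n2])) # (insert ?n3 (insert (Suc n) (v - S) - T), cyc ?d (?n3 # V2 @ Suc n # V1)) #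
        others (insert (Suc n) (v - S)) ((?s, cyc ?d (A @ [n])) # (insert (Suc n) (v - S), ?\<beta>) # ?r)) \<in> DG"
      unfolding G2 G1_def[symmetric] n1'[symmetric]
      by (rule split_DG'[OF sw1]; (rule cyc_new[OF sw1])?; (fact P mperm D1[unfolded G2 G1_def[symmetric] n1'[symmetric]])?)
    then have D2: "(G2, os @ [new_edge n, new_edge ?n2], ws, ss, (?t, cyc ?d (C @ [?n2])) # (?m, cyc ?d (?n3 # V2 @ Suc n # V1)) # (?s, cyc ?d (A @ [n])) # ?r) \<in> DG"
      using v12 by (simp add: oth v2)
    then have D3: "(G2, os @ [new_edge n, new_edge ?n2], ws, ss, (?s, cyc ?d (A @ [n])) # (?m, cyc ?d (?n3 # V2 @ Suc n # V1)) # (?t, cyc ?d (C @ [?n2])) # ?r) \<in> DG"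
      by (rule DG_permute) (simp_all add: add_mset_commute)
    have vd: "vdeg N G2 ?t = ?hs T + b - N" "vdeg N G2 ?m = (N - a + (?hs (set V1) + ?hs (set V2))) - b"
      "vdeg N G2 ?s = ?hs S + a - N"
    proof -
      note vn = vdeg_sgraph_new[OF sw1, unfolded n1']
      have hT: "(\<Sum>h\<in>T. hdeg G1 h) = ?hs T" "(\<Sum>h\<in>?M. hdeg G1 h) = ?hs ?M"
        unfolding G1_def by (rule hdeg_sgraph_S[OF sv]; use t(7) sub in auto)+
      have hm: "(\<Sum>h\<in>insert (Suc n) ?M. hdeg G1 h) = N - a + ?hs ?M"
        using nv hT(2) s(5) by (subst sum.insert) (auto simp: G1_def n sgraph_simps(4))
      show "vdeg N G2 ?t = ?hs T + b - N" "vdeg N G2 ?m = (N - a + (?hs (set V1) + ?hs (set V2))) - b"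
        using vn by (simp_all add: G2 G1_def[symmetric] hT v2 hm hM)
      have "vdeg N G2 ?s = vdeg N G1 ?s"
        unfolding G2 G1_def[symmetric] by (rule vdeg_sgraph_old[OF g1]) (simp add: G1_def n)
      then show "vdeg N G2 ?s = ?hs S + a - N" using vdeg_sgraph_new(1)[OF sv] by (simp add: G1_def n)
    qed
    have dV: "sum ?d (set V1) = ?hs (set V1)" "sum ?d (set V2) = ?hs (set V2)"
      by (rule sum.cong; use frV sub lt in \<open>fastforce simp: hd\<close>)+
    let ?rot = "sgn_pow ((N - a + ?hs (set V1)) * (N - b + ?hs (set V2))) :: 'k"
    have rot: "cyc ?d (Suc n # V1 @ ?n3 # V2) = scale ?rot (cyc ?d (?n3 # V2 @ Suc n # V1) :: _ \<Rightarrow>\<^sub>0 'k)"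
    proof -
      have dd: "distinct ((Suc n # V1) @ (?n3 # V2))" using V' frV by auto
      then have "cyc ?d ((Suc n # V1) @ (?n3 # V2)) = scale (koszul ?d ((Suc n # V1) @ (?n3 # V2)) ((?n3 # V2) @ (Suc n # V1))) (cyc ?d ((?n3 # V2) @ (Suc n # V1)) :: _ \<Rightarrow>\<^sub>0 'k)"
        by (intro cyc_swap) auto
      also have "koszul ?d ((Suc n # V1) @ (?n3 # V2)) ((?n3 # V2) @ (Suc n # V1)) = ?rot"
        using frV by (subst koszul_swap[OF dd]) (simp add: dV, simp add: hd)
      finally show ?thesis by simp
    qed
    have 1: "eqm (TR G2) (?Y A C V1 V2) (scale ?rot (gen (G2, os @ [new_edge ?n2, new_edge n], ws, ss,
       (?s, cyc ?d (A @ [n])) # (?m, cyc ?d (?n3 # V2 @ Suc n # V1)) # (?t, cyc ?d (C @ [?n2])) # ?r)))"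
      unfolding rot
      using TR_ns_scale[of G2 "os @ [new_edge ?n2, new_edge n]" ws ss "[(?s, cyc ?d (A @ [n]))]" ?m "cyc ?d (?n3 # V2 @ Suc n # V1)" "(?t, cyc ?d (C @ [?n2])) # ?r" ?rot]
        DG_permute[OF D3 _ refl refl, of "os @ [new_edge ?n2, new_edge n]"] by simp
    have 2: "eqm (TR G2) (gen (G2, os @ [new_edge ?n2, new_edge n], ws, ss,
       (?s, cyc ?d (A @ [n])) # (?m, cyc ?d (?n3 # V2 @ Suc n # V1)) # (?t, cyc ?d (C @ [?n2])) # ?r))
       (scale 1 (gen (G2, os @ [new_edge n, new_edge ?n2], ws, ss,
       (?s, cyc ?d (A @ [n])) # (?m, cyc ?d (?n3 # V2 @ Suc n # V1)) # (?t, cyc ?d (C @ [?n2])) # ?r)))"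
      using eqm_sym[OF TR_os_swap[of G2 os "new_edge n" "new_edge ?n2" "[]" ws ss]] D3 by simp
    note 3 = TR_ns_swap13[OF D3, unfolded fst_conv vd]
    let ?w = "- sgn_pow ((?hs S + a - N) * ((N - a + (?hs (set V1) + ?hs (set V2))) - b) + (?hs S + a - N) * (?hs T + b - N)
       + ((N - a + (?hs (set V1) + ?hs (set V2))) - b) * (?hs T + b - N)) :: 'k"
    have 4: "eqm (TR G2) (?Y A C V1 V2) (scale (?rot * (1 * ?w)) (?X A C V1 V2))"
      by (rule eqm_scale_trans[OF 1 eqm_scale_trans[OF 2 3]])
    have "entry v ns \<in> Cyc (hdeg \<Gamma>) v" using D s(2) by (intro words_entry[of _ "normals \<Gamma>"]) (auto simp: DG_iff normal_words_def)
    moreover have AVCV: "(A @ V1) @ (C @ V2) \<in> perms v"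
      using A' C' V' disj ST s(7) t(7) by (auto simp: perms_def)
    ultimately have "?c ((C @ V2) @ (A @ V1)) = koszul (hdeg \<Gamma>) ((A @ V1) @ (C @ V2)) ((C @ V2) @ (A @ V1)) * ?c ((A @ V1) @ (C @ V2))"
      by (rule lookup_Cyc_swap)
    also have "koszul (hdeg \<Gamma>) ((A @ V1) @ (C @ V2)) ((C @ V2) @ (A @ V1)) =
      (sgn_pow (?hs (set (A @ V1)) * ?hs (set (C @ V2))) :: 'k)"
      using AVCV by (intro koszul_swap) (simp add: perms_def)
    also have "?hs (set (A @ V1)) = ?hs S + ?hs (set V1)"
      using A' disj s(6) by (simp add: sum.union_disjoint)
    also have "?hs (set (C @ V2)) = ?hs T + ?hs (set V2)"
      using C' disj t(6) by (simp add: sum.union_disjoint)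
    finally have lc: "?c (C @ V2 @ A @ V1) = sgn_pow ((?hs S + ?hs (set V1)) * (?hs T + ?hs (set V2))) * ?c (A @ V1 @ C @ V2)"
      by simp
    \<comment> \<open>As \<open>N\<close> is even, the exponents depend modulo 2 only on the
      parities of \<open>a\<close>, \<open>b\<close> and the degrees of the four blocks; the 64
      cases are checked.\<close>
    have sgn: "- (- sgn_pow ((?hs T + b - N) * (?hs (v - T) - b)) * sgn_pow ((N - b + ?hs (set V2)) * (?hs S + ?hs (set V1)))) *
         sgn_pow ((?hs S + ?hs (set V1)) * (?hs T + ?hs (set V2))) * (?rot * (1 * ?w)) =
       (- sgn_pow ((?hs S + a - N) * (?hs (v - S) - a)) * sgn_pow ((N - a + ?hs (set V1)) * (?hs T + ?hs (set V2))) :: 'k)"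
      unfolding hvS hvT using even_N
      by (cases "even a"; cases "even b"; cases "even (?hs S)"; cases "even (?hs T)"; cases "even (?hs (set V1))"; cases "even (?hs (set V2))")
        (simp_all add: sgn_pow_def)
    have kk: "- ?k2 A C V1 V2 * (?rot * (1 * ?w)) = ?k1 A C V1 V2"
      unfolding lc sgn[symmetric] by (simp add: mult_ac)
    show ?thesis
      using eqm_sym[OF eqm_scale[OF 4, of "- ?k2 A C V1 V2"]] unfolding free.scale_scale kk .
  qed
  then show "eqm (TR G2) (Sp b (insert (Suc n) (v - S)) T (Sp a v S (gen (\<Gamma>, os, ws, ss, ns))))
    (- trl (swap4 n) G2 (Sp a (insert (Suc n) (v - T)) S (Sp b v T (gen (\<Gamma>, os, ws, ss, ns)))))"
    unfolding L R by (intro eqm_sum) auto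
qed

end

section \<open>The operators converting vertices to special ones\<close>

lemma entry_tword:
  assumes "supported H xs" "inj_on \<phi> H" "v \<subseteq> H" "v \<in> fst ` set xs"
  shows "entry (\<phi> ` v) (tword \<phi> xs) = lin_ext (gen \<circ> map \<phi>) (entry v xs)"
  using assms
proof (induction xs)
  case (Cons p xs)
  then have "fst p \<subseteq> H" "supported H xs" by (auto simp: supported_def)
  then have "\<phi> ` fst p = \<phi> ` v \<longleftrightarrow> fst p = v" using Cons.prems by (simp add: inj_on_image_eq_iff)
  then show ?case using Cons.IH Cons.prems \<open>supported H xs\<close> by auto
qed simp

lemma others_tword:
  assumes "supported H xs" "inj_on \<phi> H" "v \<subseteq> H"
  shows "others (\<phi> ` v) (tword \<phi> xs) = tword \<phi> (others v xs)"
  using assms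
proof (induction xs)
  case (Cons p xs)
  then have "fst p \<subseteq> H" "supported H xs" by (auto simp: supported_def)
  then have "\<phi> ` fst p = \<phi> ` v \<longleftrightarrow> fst p = v" using Cons.prems by (simp add: inj_on_image_eq_iff)
  then show ?case using Cons.IH Cons.prems \<open>supported H xs\<close> by simp
qed simp

lemma front_sgn_tword:
  assumes "supported H xs" "inj_on \<phi> H" "v \<subseteq> H"
    and "\<And>u. u \<in> insert v (fst ` set xs) \<Longrightarrow> \<delta>' (\<phi> ` u) = \<delta> u"
  shows "front_sgn \<delta>' (\<phi> ` v) (tword \<phi> xs) = (front_sgn \<delta> v xs :: 'c::field)"
  using assms
proof (induction xs)
  case (Cons p xs)
  then have "fst p \<subseteq> H" "supported H xs" by (auto simp: supported_def)
  then have "\<phi> ` fst p = \<phi> ` v \<longleftrightarrow> fst p = v" using Cons.prems by (simp add: inj_on_image_eq_iff)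
  moreover have "front_sgn \<delta>' (\<phi> ` v) (tword \<phi> xs) = (front_sgn \<delta> v xs :: 'c)"
    by (rule Cons.IH[OF \<open>supported H xs\<close> Cons.prems(2,3)]) (use Cons.prems(4) in auto)
  ultimately show ?case using Cons.prems(4)[of v] Cons.prems(4)[of "fst p"]
    by (simp add: sgn_alt_def comp_def)
qed simp

context graph_complex
begin

text \<open>Marking a vertex of wrong degree gives no \<open>N\<close>-graded graph.  With no relations and no decorations in
  this case, marking preserves the relations without a case distinction.\<close>

definition LH :: "ngraph \<Rightarrow> ('k, 'w) chain set" where
  "LH \<Gamma> = (if is_graph \<Gamma> then TR \<Gamma> else {})"

lemma LH_HR: "LH \<Gamma> \<subseteq> free.span HR"
  using TR_HR[of \<Gamma>] free.span_superset[of HR] by (auto simp: LH_def)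

definition markable :: "ngraph \<Rightarrow> nat set \<Rightarrow> bool" where
  "markable \<Gamma> v \<longleftrightarrow> v \<in> normals \<Gamma> \<and> vdeg N \<Gamma> v = - 1 \<and> card v \<ge> 3"

lemma lin_op_iv: "lin (op_iv N v)"
  unfolding op_iv_def by (rule lin_lin_ext)

lemma op_iv_gen: "op_iv N v (gen (\<Gamma>, os, ws, ss, ns)) =
   (if markable \<Gamma> v then scale (front_sgn (vdeg N \<Gamma>) v ns)
     (gen (mark v \<Gamma>, os, ws, ss @ [(v, entry v ns)], others v ns)) else 0)"
  by (simp add: op_iv_def i_vertex_def markable_def mark_def)

lemma is_graph_markable: "is_graph \<Gamma> \<Longrightarrow> markable \<Gamma> v \<Longrightarrow> is_graph (mark v \<Gamma>)"
  unfolding markable_def using is_graph_mark by blast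

lemma is_graph_mark_iff:
  "v \<in> normals \<Gamma> \<Longrightarrow> is_graph (mark v \<Gamma>) \<longleftrightarrow> is_graph \<Gamma> \<and> markable \<Gamma> v"
  using is_graph_markable by (auto simp: is_ngraph_def markable_def)

lemma mark_DG:
  assumes D: "(\<Gamma>, os, ws, ss, ns) \<in> DG" and v: "markable \<Gamma> v" and c: "c \<in> Cyc (hdeg \<Gamma>) v"
  shows "(mark v \<Gamma>, os, ws, ss @ [(v, c)], others v ns) \<in> DG"
proof -
  have "v \<notin> specials \<Gamma>" "v \<in> normals \<Gamma>" using v by (auto simp: markable_def normals_def)
  moreover have "is_graph \<Gamma>" using D by (simp add: DG_iff)
  ultimately show ?thesis
    using D c is_graph_markable[OF _ v] others_normal_words[of ns \<Gamma> v]
    by (auto simp: DG_iff edge_words_def external_words_def special_words_def normal_words_def words_iff)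
qed

lemma entry_Cyc: "(\<Gamma>, os, ws, ss, ns) \<in> DG \<Longrightarrow> v \<in> normals \<Gamma> \<Longrightarrow> entry v ns \<in> Cyc (hdeg \<Gamma>) v"
  by (intro words_entry[of _ "normals \<Gamma>"]) (auto simp: DG_iff normal_words_def)

lemma op_iv_chainsG:
  assumes "x \<in> chainsG \<Gamma>"
  shows "op_iv N v x \<in> chainsG (mark v \<Gamma>)"
  unfolding chainsG_def[of "mark v \<Gamma>"]
proof (rule chainsG_image[OF lin_op_iv _ assms])
  fix os ws ss ns assume D: "(\<Gamma>, os, ws, ss, ns) \<in> DG"
  show "op_iv N v (gen (\<Gamma>, os, ws, ss, ns)) \<in> free.span (gen ` {s \<in> DG. fst s = mark v \<Gamma>})"
  proof (cases "markable \<Gamma> v")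
    case True
    then have "entry v ns \<in> Cyc (hdeg \<Gamma>) v" using entry_Cyc[OF D] by (simp add: markable_def)
    then show ?thesis
      unfolding op_iv_gen using True mark_DG[OF D True]
      by (simp only: if_True) (intro free.span_scale free.span_base imageI CollectI conjI; simp)
  qed (simp add: op_iv_gen free.span_zero)
qed

text \<open>The decoration of \<open>v\<close> becomes the last special factor and keeps its
  linearity and its null relations, so \<open>front_respects\<close> applies to the normal word.
  Relations of the special word are extended by this factor, and the remaining ones are
  unchanged.\<close>

lemma op_iv_LH:
  assumes r: "r \<in> LH \<Gamma>"
  shows "op_iv N v r \<in> free.span (LH (mark v \<Gamma>))"
proof -
  have g: "is_graph \<Gamma>" and r: "r \<in> TR \<Gamma>" using r by (auto simp: LH_def split: if_splits)
  show ?thesis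
  proof (cases "markable \<Gamma> v")
    case False
    have [simp]: "lin_ext (\<lambda>_. 0) x = 0" for x :: "'e \<Rightarrow>\<^sub>0 'k" by (simp add: lin_ext_def)
    show ?thesis
      by (rule tensor_rels_image[OF r lin_op_iv]) (simp_all add: op_iv_gen False free.span_zero)
  next
    case True
    let ?G = "mark v \<Gamma>"
    have LH: "LH ?G = TR ?G" using is_graph_markable[OF g True] by (simp add: LH_def)
    have v: "v \<in> normals \<Gamma>" "v \<notin> specials \<Gamma>" using True by (auto simp: markable_def normals_def)
    have ew: "edge_words ?G = (edge_words \<Gamma> :: (nat set \<times> 'k tensor) list set)"
      and xw: "external_words N W ?G = external_words N W \<Gamma>"
      by (simp_all add: edge_words_def external_words_def)
    have nw: "others v ns \<in> normal_words ?G" if "ns \<in> normal_words \<Gamma>" for ns :: "(nat set \<times> 'k tensor) list"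
      using others_normal_words[OF that, of v] by (simp add: normal_words_def)
    have sw: "ss @ [(v, c)] \<in> special_words ?G" if "ss \<in> special_words \<Gamma>" "c \<in> Cyc (hdeg \<Gamma>) v"
      for ss :: "(nat set \<times> 'k tensor) list" and c
      using that v by (auto simp: special_words_def words_iff)
    have en: "entry v ns \<in> Cyc (hdeg \<Gamma>) v" if "ns \<in> normal_words \<Gamma>" for ns :: "(nat set \<times> 'k tensor) list"
      using that v(1) unfolding normal_words_def by (rule words_entry)
    show ?thesis
      unfolding LH
    proof (rule tensor_rels_image[OF r lin_op_iv], goal_cases)
      case (1 r ws ss ns)
      have "eqm (EP ?G) r 0" using 1(1) by (auto simp: eqm_0_iff intro: free.span_base)
      from TR_os[OF this, of ws "ss @ [(v, entry v ns)]" "others v ns"] show ?case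
        using 1 True by (simp add: op_iv_gen lin_ext_scale_fun xw nw sw en lin_ext_0 eqm_0_iff free.span_scale)
    next
      case (2 r os ss ns)
      have "eqm (XP ?G) r 0" using 2(1) by (auto simp: eqm_0_iff intro: free.span_base)
      from TR_ws[OF this, of os "ss @ [(v, entry v ns)]" "others v ns"] show ?case
        using 2 True by (simp add: op_iv_gen lin_ext_scale_fun ew nw sw en lin_ext_0 eqm_0_iff free.span_scale)
    next
      case (3 r os ws ns)
      have "lin_ext (\<lambda>ss. gen ([] @ ss @ [(v, entry v ns)])) r \<in> free.span (SP ?G)"
      proof (rule product_rels_extend[OF 3(1)])
        show "[] @ xs @ [(v, entry v ns)] \<in> words (specials ?G) (Cyc (hdeg ?G))"
          if "xs \<in> words (specials \<Gamma>) (Cyc (hdeg \<Gamma>))" for xs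
          using sw[of xs "entry v ns"] that en[OF 3(4)] by (simp add: special_words_def)
      qed simp_all
      then have "eqm (SP ?G) (lin_ext (\<lambda>ss. gen (ss @ [(v, entry v ns)])) r) 0" by (simp add: eqm_0_iff)
      from TR_ss[OF this, of os ws "others v ns"] show ?case
        using 3 True by (simp add: op_iv_gen lin_ext_scale_fun ew xw nw lin_lin_ext_compose[OF lin_lin_ext]
            lin_ext_0 eqm_0_iff free.span_scale)
    next
      case (4 r os ws ss)
      have "lin_ext (\<lambda>ns. scale (front_sgn (vdeg N \<Gamma>) v ns) (gen (?G, os, ws, ss @ [(v, entry v ns)], others v ns))) r
         \<in> free.span (TR ?G)"
      proof (rule front_respects[OF v(1) _ _ _ 4(1)], goal_cases)
        case (1 ns x y c)
        have ns: "ns \<in> normal_words ?G" using 1(1) by (simp add: normal_words_def)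
        from 4(4) sw have "ss @ (v, z) # [] \<in> words (specials ?G) (Cyc (hdeg ?G))" if "z \<in> Cyc (hdeg \<Gamma>) v" for z
          using that by (simp add: special_words_def)
        from TR_ss[OF product_rels_lin[of ss v x "[]" _ _ y, OF this[OF 1(2)] this[OF 1(3)]], of os ws ns c] show ?case
          using 4 ns by (simp add: ew xw lin_ext_add lin_ext_scale)
      next
        case (2 ns x)
        have ns: "ns \<in> normal_words ?G" using 2(1) by (simp add: normal_words_def)
        have w: "ss @ (v, x) # [] \<in> words (specials ?G) (Cyc (hdeg ?G))"
          using sw[OF 4(4) 2(2)] by (simp add: special_words_def)
        have "x \<in> C_null (hdeg ?G) v" using 2(3) by simp
        from TR_ss[OF product_rels_null[where B = "C_null (hdeg ?G)", OF w this], of os ws ns] show ?case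
          using 4 ns by (simp add: ew xw lin_ext_0 eqm_0_iff)
      next
        case (3 r x)
        have "eqm (NP ?G) r 0" using 3(2) by (auto simp: eqm_0_iff intro: free.span_base)
        from TR_ns[OF this, of os ws "ss @ [(v, x)]"] show ?case
          using 3 4 by (simp add: ew xw sw lin_ext_0 eqm_0_iff)
      qed
      then show ?case using True by (simp add: op_iv_gen)
    qed
  qed
qed

lemma op_iv_eqm: "eqm (LH \<Gamma>) x y \<Longrightarrow> eqm (LH (mark v \<Gamma>)) (op_iv N v x) (op_iv N v y)"
  by (rule eqm_lin[OF lin_op_iv op_iv_LH])

lemma markable_sgraph:
  assumes "splittable a w T \<Gamma>" "v \<in> normals \<Gamma>" "v \<noteq> w"
  shows "markable (sgraph N a w T \<Gamma>) v \<longleftrightarrow> markable \<Gamma> v"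
  using assms by (simp add: markable_def normals_sgraph vdeg_sgraph_old[OF splittableD(1)[OF assms(1)] normal_vert])

lemma op_iv_Sp:
  assumes s: "splittable a w T \<Gamma>" and v: "v \<in> normals \<Gamma>" "v \<noteq> w" and x: "x \<in> chainsG \<Gamma>"
  shows "op_iv N v (Sp a w T x) = Sp a w T (op_iv N v x)"
proof (rule chainsG_eq[OF lin_compose[OF lin_Sp lin_op_iv] lin_compose[OF lin_op_iv lin_Sp] _ x])
  fix os ws ss ns assume D: "(\<Gamma>, os, ws, ss, ns) \<in> DG"
  let ?n = "new_half \<Gamma>" and ?G = "sgraph N a w T \<Gamma>"
  let ?v1 = "insert ?n T" and ?v2 = "insert (Suc ?n) (w - T)"
  note sD = splittableD[OF s]
  show "op_iv N v (Sp a w T (gen (\<Gamma>, os, ws, ss, ns))) = Sp a w T (op_iv N v (gen (\<Gamma>, os, ws, ss, ns)))"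
  proof (cases "markable \<Gamma> v")
    case False
    then show ?thesis
      by (simp add: Sp_gen split_sum_def lin_scale[OF lin_op_iv] lin_sum[OF lin_op_iv] op_iv_gen
          markable_sgraph[OF s v] lin_0[OF lin_Sp])
  next
    case True
    have nv: "?v1 \<noteq> v" "?v2 \<noteq> v"
      using new_verts_sgraph[OF s] normal_vert[OF v(1)] by auto
    have fv: "front_sgn (vdeg N ?G) v (others w ns) = (front_sgn (vdeg N \<Gamma>) v (others w ns) :: 'k)"
    proof (rule front_sgn_cong)
      fix u assume "u \<in> fst ` set (others w ns)"
      then have "u \<in> normals \<Gamma>" using D by (auto simp: set_others DG_iff normal_words_def words_iff)
      then show "vdeg N ?G u = vdeg N \<Gamma> u" by (rule vdeg_sgraph_old[OF sD(1) normal_vert])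
    qed (rule vdeg_sgraph_old[OF sD(1) normal_vert[OF v(1)]])
    have "vdeg N ?G ?v1 * vdeg N ?G v + vdeg N ?G ?v2 * vdeg N ?G v = vdeg N \<Gamma> w * vdeg N \<Gamma> v"
      using vdeg_sgraph_sum[OF s] vdeg_sgraph_old[OF sD(1) normal_vert[OF v(1)]] by (simp flip: distrib_right)
    then have sg: "sgn_alt (vdeg N ?G) ?v1 v * sgn_alt (vdeg N ?G) ?v2 v = (sgn_pow (vdeg N \<Gamma> w * vdeg N \<Gamma> v) :: 'k)"
      by (simp add: sgn_alt_def flip: sgn_pow_add)
    have fr: "front_sgn (vdeg N ?G) v ((?v1, \<alpha>) # (?v2, \<beta>) # others w ns) =
        (sgn_pow (vdeg N \<Gamma> w * vdeg N \<Gamma> v) * front_sgn (vdeg N \<Gamma>) v (others w ns) :: 'k)" for \<alpha> \<beta> :: "nat list \<Rightarrow>\<^sub>0 'k"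
      using nv by (simp add: fv sg flip: mult.assoc)
    have dist: "distinct (map fst ns)" "v \<in> fst ` set ns" "w \<in> fst ` set ns"
      using D v sD(2) by (auto simp: DG_iff normal_words_def words_iff)
    let ?F = "\<lambda>A B. gen (mark v ?G, os @ [({?n, Suc ?n}, gen [?n, Suc ?n])], ws, ss @ [(v, entry v ns)],
        (?v1, cyc (hdeg ?G) (A @ [?n])) # (?v2, cyc (hdeg ?G) (Suc ?n # B)) # others v (others w ns)) :: _ \<Rightarrow>\<^sub>0 'k"
    let ?S = "\<Sum>A\<in>perms T. \<Sum>B\<in>perms (w - T). scale (coeff (entry w ns) (A @ B)) (?F A B)"
    have "op_iv N v (Sp a w T (gen (\<Gamma>, os, ws, ss, ns))) =
      scale ((- 1) ^ length ss * front_sgn (vdeg N \<Gamma>) w ns * (sgn_pow (vdeg N \<Gamma> w * vdeg N \<Gamma> v) * front_sgn (vdeg N \<Gamma>) v (others w ns))) ?S"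
      unfolding Sp_gen split_sum_def lin_scale[OF lin_op_iv] lin_sum[OF lin_op_iv] op_iv_gen markable_sgraph[OF s v]
        free.scale_sum_right
      using True nv v(2) by (intro sum.cong refl) (simp add: fr entry_others mult_ac del: front_sgn_Cons)
    moreover have "Sp a w T (op_iv N v (gen (\<Gamma>, os, ws, ss, ns))) =
      scale (front_sgn (vdeg N \<Gamma>) v ns * (- ((- 1) ^ length ss) * front_sgn (vdeg N \<Gamma>) w (others v ns))) ?S"
      using True v(2) by (simp add: op_iv_gen lin_scale[OF lin_Sp] Sp_gen split_sum_def sgraph_mark entry_others
          others_commute[of v w])
    \<comment> \<open>The minus sign on the right comes from the additional special factor counted
      by \<open>length ss\<close>; it is compensated by pulling out \<open>v\<close> and
      \<open>w\<close> in the other order.\<close>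
    moreover have "(- 1) ^ length ss * front_sgn (vdeg N \<Gamma>) w ns * (sgn_pow (vdeg N \<Gamma> w * vdeg N \<Gamma> v) * front_sgn (vdeg N \<Gamma>) v (others w ns)) =
      front_sgn (vdeg N \<Gamma>) v ns * (- ((- 1) ^ length ss) * front_sgn (vdeg N \<Gamma>) w (others v ns) :: 'k)"
    proof -
      have "front_sgn (vdeg N \<Gamma>) v ns * front_sgn (vdeg N \<Gamma>) w (others v ns) =
        - sgn_pow (vdeg N \<Gamma> w * vdeg N \<Gamma> v) * (front_sgn (vdeg N \<Gamma>) w ns * front_sgn (vdeg N \<Gamma>) v (others w ns) :: 'k)"
        using front_sgn_others[OF dist v(2), of "vdeg N \<Gamma>"] by (simp add: mult.commute)
      then show ?thesis by (simp add: mult_ac)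
    qed
    ultimately show ?thesis by simp
  qed
qed

lemma markable_mark: "u \<noteq> v \<Longrightarrow> markable (mark v \<Gamma>) u \<longleftrightarrow> markable \<Gamma> u"
  by (auto simp: markable_def)

text \<open>Two exterior signs cancel: one from pulling the normal factors out in the other order,
  one from exchanging the two new special factors. The second exchange is a relation, so the
  identity holds only as a congruence.\<close>

lemma op_iv_commute:
  assumes uv: "u \<noteq> v" and x: "x \<in> chainsG \<Gamma>"
  shows "eqm (LH (mark u (mark v \<Gamma>))) (op_iv N u (op_iv N v x)) (op_iv N v (op_iv N u x))"
proof (rule chainsG_eqm[OF lin_compose[OF lin_op_iv lin_op_iv] lin_compose[OF lin_op_iv lin_op_iv] _ x])
  fix os ws ss ns assume D: "(\<Gamma>, os, ws, ss, ns) \<in> DG"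
  show "eqm (LH (mark u (mark v \<Gamma>))) (op_iv N u (op_iv N v (gen (\<Gamma>, os, ws, ss, ns))))
    (op_iv N v (op_iv N u (gen (\<Gamma>, os, ws, ss, ns))))"
  proof (cases "markable \<Gamma> u \<and> markable \<Gamma> v")
    case False
    then have "op_iv N u (op_iv N v (gen (\<Gamma>, os, ws, ss, ns))) = 0" "op_iv N v (op_iv N u (gen (\<Gamma>, os, ws, ss, ns))) = 0"
      using uv by (auto simp: op_iv_gen lin_scale[OF lin_op_iv] lin_0[OF lin_op_iv] markable_mark)
    then show ?thesis by simp
  next
    case True
    then have uvn: "u \<in> normals \<Gamma>" "v \<in> normals \<Gamma>" by (auto simp: markable_def)
    have m: "markable (mark v \<Gamma>) u" "markable (mark u \<Gamma>) v" using True uv by (auto simp: markable_mark)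
    have g: "is_graph (mark u (mark v \<Gamma>))"
      using D True m by (intro is_graph_markable) (auto simp: DG_iff)
    have dist: "distinct (map fst ns)" "u \<in> fst ` set ns" "v \<in> fst ` set ns"
      using D uvn by (auto simp: DG_iff normal_words_def words_iff)
    have Dv: "(mark v \<Gamma>, os, ws, ss @ [(v, entry v ns)], others v ns) \<in> DG"
      by (rule mark_DG[OF D]) (use True entry_Cyc[OF D] uvn in auto)
    have "entry u (others v ns) \<in> Cyc (hdeg (mark v \<Gamma>)) u"
      using uvn uv by (intro entry_Cyc[OF Dv]) auto
    then have Duv: "(mark u (mark v \<Gamma>), os, ws, ss @ (v, entry v ns) # (u, entry u ns) # [], others u (others v ns)) \<in> DG"
      using mark_DG[OF Dv m(1)] uv by (simp add: entry_others)
    have "eqm (LH (mark u (mark v \<Gamma>)))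
      (gen (mark u (mark v \<Gamma>), os, ws, ss @ (v, entry v ns) # (u, entry u ns) # [], others u (others v ns)))
      (scale (- sgn_pow (vdeg N \<Gamma> v * vdeg N \<Gamma> u))
       (gen (mark u (mark v \<Gamma>), os, ws, ss @ (u, entry u ns) # (v, entry v ns) # [], others u (others v ns))))"
      using TR_ss_swap[OF Duv] g by (simp add: LH_def sgn_alt_def)
    moreover have E: "scale (front_sgn (vdeg N \<Gamma>) v ns * front_sgn (vdeg N \<Gamma>) u (others v ns))
         (gen (mark u (mark v \<Gamma>), os, ws, ss @ (v, entry v ns) # (u, entry u ns) # [], others u (others v ns))) =
        op_iv N u (op_iv N v (gen (\<Gamma>, os, ws, ss, ns)))"
      using True m uv by (simp add: op_iv_gen lin_scale[OF lin_op_iv] entry_others)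
    ultimately have "eqm (LH (mark u (mark v \<Gamma>))) (op_iv N u (op_iv N v (gen (\<Gamma>, os, ws, ss, ns))))
      (scale (front_sgn (vdeg N \<Gamma>) v ns * front_sgn (vdeg N \<Gamma>) u (others v ns)) (scale (- sgn_pow (vdeg N \<Gamma> v * vdeg N \<Gamma> u))
       (gen (mark u (mark v \<Gamma>), os, ws, ss @ (u, entry u ns) # (v, entry v ns) # [], others u (others v ns)))))"
      unfolding E[symmetric] by (intro eqm_scale)
    also have "\<dots> = op_iv N v (op_iv N u (gen (\<Gamma>, os, ws, ss, ns)))"
      using True m uv front_sgn_others[OF dist uv, of "vdeg N \<Gamma>"]
      by (simp add: op_iv_gen lin_scale[OF lin_op_iv] entry_others mark_commute[of v u] others_commute[of v u] mult_ac)
    finally show ?thesis .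
  qed
qed

text \<open>The implication, in place of a graph condition on both sides, makes the notion stable
  under marking: a marked graph may violate the degree condition, and then it carries no
  chains.\<close>

definition giso :: "(nat \<Rightarrow> nat) \<Rightarrow> ngraph \<Rightarrow> ngraph \<Rightarrow> bool" where
  "giso \<phi> \<Gamma> \<Gamma>' \<longleftrightarrow> graph_iso \<phi> \<Gamma> \<Gamma>' \<and> (is_graph \<Gamma> \<longrightarrow> is_graph \<Gamma>')"

text \<open>Lets statements about marked graphs hold without a check of the degree conditions; where
  these fail, all chains are zero.\<close>

lemma chainsG_no_graph: "\<not> is_graph \<Gamma> \<Longrightarrow> x \<in> chainsG \<Gamma> \<Longrightarrow> x = 0"
proof -
  assume "\<not> is_graph \<Gamma>" "x \<in> chainsG \<Gamma>"
  moreover from this have "{s \<in> DG. fst s = \<Gamma>} = {}" by (auto simp: dgraphs_def)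
  ultimately show "x = 0" by (simp add: chainsG_def free.span_empty)
qed

lemma giso_HR:
  assumes "x \<in> chainsG \<Gamma>" "giso \<phi> \<Gamma> \<Gamma>'"
  shows "eqm HR x (trl \<phi> \<Gamma>' x)"
proof (cases "is_graph \<Gamma>")
  case True
  then show ?thesis using assms trl_HR by (simp add: giso_def)
next
  case False
  then have "x = 0" using chainsG_no_graph assms by blast
  then show ?thesis by (simp add: lin_0[OF lin_trl])
qed

lemma graph_iso_facts:
  assumes iso: "graph_iso \<phi> \<Gamma> \<Gamma>'" and g: "is_graph \<Gamma>"
  shows "inj_on \<phi> (halves \<Gamma>)"
    and "\<And>u. u \<in> verts \<Gamma> \<Longrightarrow> vdeg N \<Gamma>' (\<phi> ` u) = vdeg N \<Gamma> u"
    and "\<And>u. u \<in> verts \<Gamma> \<Longrightarrow> card (\<phi> ` u) = card u"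
    and "normals \<Gamma>' = (`) \<phi> ` normals \<Gamma>"
    and "\<And>u. u \<in> normals \<Gamma> \<Longrightarrow> markable \<Gamma>' (\<phi> ` u) \<longleftrightarrow> markable \<Gamma> u"
proof -
  show inj: "inj_on \<phi> (halves \<Gamma>)" using iso by (auto simp: graph_iso_def bij_betw_def)
  then have injv: "inj_on \<phi> u" if "u \<in> verts \<Gamma>" for u
    using vert_halves[OF g that] inj_on_subset by blast
  show vd: "\<And>u. u \<in> verts \<Gamma> \<Longrightarrow> vdeg N \<Gamma>' (\<phi> ` u) = vdeg N \<Gamma> u"
  proof -
    fix u assume u: "u \<in> verts \<Gamma>"
    have "(\<Sum>h\<in>\<phi> ` u. hdeg \<Gamma>' h) = (\<Sum>h\<in>u. hdeg \<Gamma>' (\<phi> h))"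
      using injv[OF u] by (simp add: sum.reindex)
    also have "\<dots> = (\<Sum>h\<in>u. hdeg \<Gamma> h)"
      using iso vert_halves[OF g u] by (intro sum.cong) (auto simp: graph_iso_def)
    finally show "vdeg N \<Gamma>' (\<phi> ` u) = vdeg N \<Gamma> u" by (simp add: vdeg_def)
  qed
  show cd: "\<And>u. u \<in> verts \<Gamma> \<Longrightarrow> card (\<phi> ` u) = card u"
    using injv by (simp add: card_image)
  have injV: "\<phi> ` u = \<phi> ` w \<longleftrightarrow> u = w" if "u \<in> verts \<Gamma>" "w \<in> verts \<Gamma>" for u w
    using inj vert_halves[OF g] that by (simp add: inj_on_image_eq_iff)
  show nm: "normals \<Gamma>' = (`) \<phi> ` normals \<Gamma>"
  proof -
    have V: "verts \<Gamma>' = (`) \<phi> ` verts \<Gamma>" and Sp: "specials \<Gamma>' = (`) \<phi> ` specials \<Gamma>"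
      using iso by (auto simp: graph_iso_def)
    have "specials \<Gamma> \<subseteq> verts \<Gamma>" using special_vert[OF g] by blast
    then have "\<phi> ` u \<in> specials \<Gamma>' \<longleftrightarrow> u \<in> specials \<Gamma>" if "u \<in> verts \<Gamma>" for u
      unfolding Sp using injV that by (auto simp: image_iff)
    then show ?thesis
      unfolding normals_def internals_def V using cd by auto
  qed
  show "\<And>u. u \<in> normals \<Gamma> \<Longrightarrow> markable \<Gamma>' (\<phi> ` u) \<longleftrightarrow> markable \<Gamma> u"
    using vd cd normal_vert by (auto simp: markable_def nm)
qed

lemma giso_mark:
  assumes "giso \<phi> \<Gamma> \<Gamma>'" "v \<in> normals \<Gamma>"
  shows "giso \<phi> (mark v \<Gamma>) (mark (\<phi> ` v) \<Gamma>')"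
proof -
  have "graph_iso \<phi> (mark v \<Gamma>) (mark (\<phi> ` v) \<Gamma>')"
    using assms by (auto simp: giso_def graph_iso_def)
  moreover have "is_graph (mark (\<phi> ` v) \<Gamma>')" if "is_graph (mark v \<Gamma>)"
  proof -
    have g: "is_graph \<Gamma>" "markable \<Gamma> v" using that is_graph_mark_iff[OF assms(2)] by auto
    then have "markable \<Gamma>' (\<phi> ` v)" "is_graph \<Gamma>'"
      using graph_iso_facts(5)[of \<phi> \<Gamma> \<Gamma>'] assms by (auto simp: giso_def)
    then show ?thesis by (intro is_graph_markable)
  qed
  ultimately show ?thesis by (simp add: giso_def)
qed

lemma op_iv_trl:
  assumes iso: "giso \<phi> \<Gamma> \<Gamma>'" and v: "v \<in> normals \<Gamma>" and x: "x \<in> chainsG \<Gamma>"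
  shows "op_iv N (\<phi> ` v) (trl \<phi> \<Gamma>' x) = trl \<phi> (mark (\<phi> ` v) \<Gamma>') (op_iv N v x)"
proof (rule chainsG_eq[OF lin_compose[OF lin_trl lin_op_iv] lin_compose[OF lin_op_iv lin_trl] _ x])
  fix os ws ss ns assume D: "(\<Gamma>, os, ws, ss, ns) \<in> DG"
  then have g: "is_graph \<Gamma>" by (simp add: DG_iff)
  note f = graph_iso_facts[OF iso[unfolded giso_def, THEN conjunct1] g]
  note sup = DG_supported(3)[OF D]
  have vh: "v \<subseteq> halves \<Gamma>" using vert_halves[OF g normal_vert[OF v]] .
  have fs: "fst ` set ns = normals \<Gamma>" using D by (auto simp: DG_iff normal_words_def words_iff)
  have fr: "front_sgn (vdeg N \<Gamma>') (\<phi> ` v) (tword \<phi> ns) = (front_sgn (vdeg N \<Gamma>) v ns :: 'k)"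
    by (rule front_sgn_tword[OF sup f(1) vh]) (use fs v f(2) normal_vert in auto)
  show "op_iv N (\<phi> ` v) (trl \<phi> \<Gamma>' (gen (\<Gamma>, os, ws, ss, ns))) = trl \<phi> (mark (\<phi> ` v) \<Gamma>') (op_iv N v (gen (\<Gamma>, os, ws, ss, ns)))"
    using f(5)[OF v] fs v
    by (simp add: trl_gen op_iv_gen fr lin_scale[OF lin_trl] lin_0[OF lin_trl]
        entry_tword[OF sup f(1) vh] others_tword[OF sup f(1) vh])
qed

text \<open>The labels of the new half-edges depend on the labels already present and differ in the
  two graphs; \<open>\<psi>\<close> extends \<open>\<phi>\<close> by matching them. For this
  extension splitting is natural exactly, without any relation.\<close>

lemma Sp_iso:
  assumes iso: "giso \<phi> \<Gamma> \<Gamma>'" and s: "splittable a v S \<Gamma>"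
    and n: "n = new_half \<Gamma>" and m: "m = new_half \<Gamma>'" and \<psi>: "\<psi> = \<phi>(n := m, Suc n := Suc m)"
  shows "splittable a (\<phi> ` v) (\<phi> ` S) \<Gamma>'"
    and "giso \<psi> (sgraph N a v S \<Gamma>) (sgraph N a (\<phi> ` v) (\<phi> ` S) \<Gamma>')"
    and "\<psi> ` insert n S = insert m (\<phi> ` S)" "\<psi> ` insert (Suc n) (v - S) = insert (Suc m) (\<phi> ` v - \<phi> ` S)"
    and "x \<in> chainsG \<Gamma> \<Longrightarrow> Sp a (\<phi> ` v) (\<phi> ` S) (trl \<phi> \<Gamma>' x) = trl \<psi> (sgraph N a (\<phi> ` v) (\<phi> ` S) \<Gamma>') (Sp a v S x)"
proof -
  note sD = splittableD[OF s]
  have gi: "graph_iso \<phi> \<Gamma> \<Gamma>'" and g': "is_graph \<Gamma>'" using iso sD(1) by (auto simp: giso_def)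
  note f = graph_iso_facts[OF gi sD(1)]
  have hv: "v \<subseteq> halves \<Gamma>" by (rule vert_halves[OF sD(1,3)])
  have hS: "S \<subseteq> halves \<Gamma>" using hv sD(7) by blast
  have injv: "inj_on \<phi> v" using f(1) hv inj_on_subset by blast
  have lt: "h < n" if "h \<in> halves \<Gamma>" for h using new_half_gt[OF sD(4) that] by (simp add: n)
  have ps: "\<psi> h = \<phi> h" if "h \<in> halves \<Gamma>" for h using lt[OF that] by (simp add: \<psi>)
  have pn: "\<psi> n = m" "\<psi> (Suc n) = Suc m" by (simp_all add: \<psi>)
  have lt': "\<phi> h < m" if "h \<in> halves \<Gamma>" for h
  proof -
    have "\<phi> h \<in> halves \<Gamma>'" using gi that by (auto simp: graph_iso_def bij_betw_def)
    then show ?thesis using new_half_gt[OF graph_finite[OF g']] by (simp add: m)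
  qed
  have vS: "\<phi> ` v - \<phi> ` S = \<phi> ` (v - S)" using injv sD(7) by (simp add: inj_on_image_set_diff)
  have pS: "\<psi> ` U = \<phi> ` U" if "U \<subseteq> halves \<Gamma>" for U
    using ps that by (intro image_cong) auto
  show s': "splittable a (\<phi> ` v) (\<phi> ` S) \<Gamma>'"
    unfolding splittable_def
  proof (intro conjI)
    show "\<phi> ` v \<in> normals \<Gamma>'" using f(4) sD(2) by blast
    show "\<phi> ` S \<subseteq> \<phi> ` v" using sD(7) by blast
    show "\<phi> ` S \<noteq> {}" using sD(8) by blast
    show "\<phi> ` S \<noteq> \<phi> ` v" using vS sD(9) by force
  qed (use s g' in \<open>auto simp: splittable_def\<close>)
  show i1: "\<psi> ` insert n S = insert m (\<phi> ` S)" using pS[OF hS] by (simp add: pn)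
  show i2: "\<psi> ` insert (Suc n) (v - S) = insert (Suc m) (\<phi> ` v - \<phi> ` S)"
    unfolding vS using pS[of "v - S"] hv by (auto simp: pn)
  have pe: "\<psi> ` {n, Suc n} = {m, Suc m}" by (simp only: image_insert image_empty pn)
  let ?G = "sgraph N a v S \<Gamma>" and ?G' = "sgraph N a (\<phi> ` v) (\<phi> ` S) \<Gamma>'"
  have gp: "graph_iso \<psi> ?G ?G'"
    unfolding graph_iso_def
  proof (intro conjI)
    have "inj_on \<psi> (insert n (insert (Suc n) (halves \<Gamma>)))"
    proof (rule inj_onI)
      fix x y assume xy: "x \<in> insert n (insert (Suc n) (halves \<Gamma>))" "y \<in> insert n (insert (Suc n) (halves \<Gamma>))" "\<psi> x = \<psi> y"
      then show "x = y"
        using inj_onD[OF f(1), of x y] ps[of x] ps[of y] pn lt'[of x] lt'[of y] by (auto simp del: fun_upd_apply)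
    qed
    moreover have "\<psi> ` halves \<Gamma> = halves \<Gamma>'" using pS[of "halves \<Gamma>"] gi by (simp add: graph_iso_def bij_betw_def)
    ultimately show "bij_betw \<psi> (halves ?G) (halves ?G')"
      using pn by (auto simp: bij_betw_def n[symmetric] m[symmetric])
    have im: "(`) \<psi> ` \<U> = (`) \<phi> ` \<U>" if "\<And>u. u \<in> \<U> \<Longrightarrow> u \<subseteq> halves \<Gamma>" for \<U>
      by (rule image_cong[OF refl]) (rule pS[OF that])
    have "(`) \<psi> ` (verts \<Gamma> - {v}) = verts \<Gamma>' - {\<phi> ` v}"
    proof -
      have "(`) \<psi> ` (verts \<Gamma> - {v}) = (`) \<phi> ` (verts \<Gamma> - {v})" by (rule im) (use vert_halves[OF sD(1)] in auto)
      also have "\<dots> = (`) \<phi> ` verts \<Gamma> - {\<phi> ` v}"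
        using inj_on_image_eq_iff[OF f(1) vert_halves[OF sD(1)] hv] by auto
      finally show ?thesis using gi by (simp add: graph_iso_def)
    qed
    then show "(`) \<psi> ` verts ?G = verts ?G'"
      by (simp add: image_Un n[symmetric] m[symmetric] i1[unfolded image_insert] i2[unfolded image_insert])
    have "(`) \<psi> ` edges \<Gamma> = edges \<Gamma>'"
      using im[of "edges \<Gamma>"] edge_halves[OF sD(1)] gi by (simp add: graph_iso_def)
    then show "(`) \<psi> ` edges ?G = edges ?G'" by (simp add: image_Un n[symmetric] m[symmetric] pn)
    have "(`) \<psi> ` specials \<Gamma> = (`) \<phi> ` specials \<Gamma>"
      by (rule im) (use special_vert[OF sD(1)] vert_halves[OF sD(1)] in blast)
    then show "(`) \<psi> ` specials ?G = specials ?G'" using gi by (simp add: graph_iso_def)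
    show "\<forall>h\<in>halves ?G. hdeg ?G' (\<psi> h) = hdeg ?G h"
    proof
      fix h assume "h \<in> halves ?G"
      then consider "h \<in> halves \<Gamma>" | "h = n" | "h = Suc n" by (auto simp: n)
      then show "hdeg ?G' (\<psi> h) = hdeg ?G h"
      proof cases
        case 1
        then have "hdeg \<Gamma>' (\<phi> h) = hdeg \<Gamma> h" using gi by (simp add: graph_iso_def)
        then show ?thesis using lt[OF 1] lt'[OF 1] ps[OF 1] by (simp add: sgraph_simps(4) n[symmetric] m[symmetric])
      qed (simp_all add: pn sgraph_simps(4) n[symmetric] m[symmetric] del: fun_upd_apply, simp_all)
    qed
  qed
  then show "giso \<psi> ?G ?G'" using is_graph_sgraph[OF s'] by (simp add: giso_def)
  assume x: "x \<in> chainsG \<Gamma>"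
  show "Sp a (\<phi> ` v) (\<phi> ` S) (trl \<phi> \<Gamma>' x) = trl \<psi> ?G' (Sp a v S x)"
  proof (rule chainsG_eq[OF lin_compose[OF lin_trl lin_Sp] lin_compose[OF lin_Sp lin_trl] _ x])
    fix os ws ss ns assume D: "(\<Gamma>, os, ws, ss, ns) \<in> DG"
    note sup = DG_supported[OF D]
    have fs: "fst ` set ns = normals \<Gamma>" using D by (auto simp: DG_iff normal_words_def words_iff)
    have fr: "front_sgn (vdeg N \<Gamma>') (\<phi> ` v) (tword \<phi> ns) = (front_sgn (vdeg N \<Gamma>) v ns :: 'k)"
      by (rule front_sgn_tword[OF sup(3) f(1) hv]) (use fs sD(3) f(2) normal_vert in auto)
    have en: "entry (\<phi> ` v) (tword \<phi> ns) = lin_ext (gen \<circ> map \<phi>) (entry v ns)"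
      by (rule entry_tword[OF sup(3) f(1) hv]) (use fs sD(2) in simp)
    have lk: "coeff (lin_ext (gen \<circ> map \<phi>) (entry v ns)) (map \<phi> A @ map \<phi> B) = coeff (entry v ns) (A @ B)"
      if "A \<in> perms S" "B \<in> perms (v - S)" for A B
      using lookup_map_gen[OF keys_Cyc[OF entry_Cyc[OF D sD(2)]] injv, of "A @ B"] that sD(7)
      by (auto simp: perms_def)
    have tw: "tword \<phi> os = tword \<psi> os" "tword \<phi> ss = tword \<psi> ss" "tword \<phi> (others v ns) = tword \<psi> (others v ns)"
      using tword_cong[OF sup(1), of \<psi> \<phi>] tword_cong[OF sup(2), of \<psi> \<phi>] tword_cong[OF supported_others[OF sup(3)], of \<psi> \<phi>] ps
      by simp_all
    have tx: "map (map_prod ((`) \<phi>) id) ws = map (map_prod ((`) \<psi>) id) ws"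
    proof (rule map_cong[OF refl])
      fix p assume "p \<in> set ws"
      then have "fst p \<in> verts \<Gamma>" using D by (auto simp: DG_iff external_words_def words_iff externals_def)
      then have "\<psi> ` fst p = \<phi> ` fst p" using pS vert_halves[OF sD(1)] by blast
      then show "map_prod ((`) \<phi>) id p = map_prod ((`) \<psi>) id p" by (cases p) simp
    qed
    have injp: "inj_on \<psi> (halves ?G)" using gp unfolding graph_iso_def bij_betw_def by blast
    have hp: "hdeg ?G' (\<psi> h) = hdeg ?G h" if "h \<in> halves ?G" for h using gp that unfolding graph_iso_def by blast
    have mA: "map \<psi> A = map \<phi> A" if "set A \<subseteq> halves \<Gamma>" for A using ps that by (intro map_cong) auto
    have c0: "lin_ext (gen \<circ> map \<psi>) (cyc (hdeg ?G) us) = (cyc (hdeg ?G') (map \<psi> us) :: _ \<Rightarrow>\<^sub>0 'k)"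
      if "set us \<subseteq> halves ?G" for us
      by (rule cyc_map[OF inj_on_subset[OF injp that]]) (use hp that in blast)
    have c1: "lin_ext (gen \<circ> map \<psi>) (cyc (hdeg ?G) (A @ [n])) = (cyc (hdeg ?G') (map \<phi> A @ [m]) :: _ \<Rightarrow>\<^sub>0 'k)"
      if "A \<in> perms S" for A
    proof -
      have sA: "set A \<subseteq> halves \<Gamma>" using that hS by (auto simp: perms_def)
      then have "set (A @ [n]) \<subseteq> halves ?G" by (auto simp: n)
      from c0[OF this] show ?thesis by (simp only: map_append list.map mA[OF sA] pn)
    qed
    have c2: "lin_ext (gen \<circ> map \<psi>) (cyc (hdeg ?G) (Suc n # B)) = (cyc (hdeg ?G') (Suc m # map \<phi> B) :: _ \<Rightarrow>\<^sub>0 'k)"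
      if "B \<in> perms (v - S)" for B
    proof -
      have sB: "set B \<subseteq> halves \<Gamma>" using that hv by (auto simp: perms_def)
      then have "set (Suc n # B) \<subseteq> halves ?G" by (auto simp: n)
      from c0[OF this] show ?thesis by (simp only: list.map mA[OF sB] pn)
    qed
    have inS: "inj_on \<phi> S" "inj_on \<phi> (v - S)" using injv sD(7) inj_on_subset by blast+
    have injm: "inj_on (map \<phi>) (perms U)" if "inj_on \<phi> U" for U
      using that by (intro inj_onI) (auto simp: perms_def dest: map_inj_on)
    have "Sp a (\<phi> ` v) (\<phi> ` S) (trl \<phi> \<Gamma>' (gen (\<Gamma>, os, ws, ss, ns))) =
      scale ((- 1) ^ length ss * front_sgn (vdeg N \<Gamma>) v ns)
       (\<Sum>A\<in>perms S. \<Sum>B\<in>perms (v - S). scale (coeff (entry v ns) (A @ B))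
        (gen (?G', tword \<psi> os @ [({m, Suc m}, gen [m, Suc m])], map (map_prod ((`) \<psi>) id) ws, tword \<psi> ss,
          (insert m (\<phi> ` S), cyc (hdeg ?G') (map \<phi> A @ [m])) # (insert (Suc m) (\<phi> ` v - \<phi> ` S), cyc (hdeg ?G') (Suc m # map \<phi> B)) # tword \<psi> (others v ns))))"
      unfolding trl_gen Sp_gen split_sum_def fr en others_tword[OF sup(3) f(1) hv] tw(3) vS
        permutations_of_set_image_inj[OF inS(1)] permutations_of_set_image_inj[OF inS(2)] m[symmetric]
      unfolding sum.reindex[OF injm[OF inS(1)]] sum.reindex[OF injm[OF inS(2)]] comp_def length_map
        tw(1)[unfolded comp_def] tw(2)[unfolded comp_def] tx
      by (intro arg_cong[of _ _ "scale _"] sum.cong refl) (simp add: lk[unfolded comp_def])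
    also have "\<dots> = trl \<psi> ?G' (Sp a v S (gen (\<Gamma>, os, ws, ss, ns)))"
      unfolding Sp_gen split_sum_def lin_scale[OF lin_trl] lin_sum[OF lin_trl] trl_gen n[symmetric]
      by (intro arg_cong[of _ _ "scale _"] sum.cong refl)
        (simp add: c1 c2 i1 i2 pn pe del: fun_upd_apply image_insert)
    finally show "Sp a (\<phi> ` v) (\<phi> ` S) (trl \<phi> \<Gamma>' (gen (\<Gamma>, os, ws, ss, ns))) = trl \<psi> ?G' (Sp a v S (gen (\<Gamma>, os, ws, ss, ns)))" .
  qed
qed

section \<open>Splitting followed by marking\<close>

text \<open>The flags \<open>p\<close>, \<open>q\<close> in the following definitions tell whether \<open>v'\<close>, \<open>v''\<close> become special.  Thus
  \<open>DD \<Gamma> p q v\<close> below is one of \<open>d\<^sub>v\<close>, \<open>i\<^bsub>v'\<^esub> d\<^sub>v\<close>, \<open>i\<^bsub>v''\<^esub> d\<^sub>v\<close>, \<open>i\<^bsub>v'\<^esub> i\<^bsub>v''\<^esub> d\<^sub>v\<close>; \<open>Dt \<Gamma> p q a v S\<close> are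
  its terms, with values in the decorations of the graph \<open>Dg \<Gamma> p q a v S\<close>.\<close>

definition I :: "bool \<Rightarrow> nat set \<Rightarrow> ('k, 'w) chain \<Rightarrow> ('k, 'w) chain" where
  "I p v x = (if p then op_iv N v x else x)"

definition Im :: "bool \<Rightarrow> nat set \<Rightarrow> ngraph \<Rightarrow> ngraph" where
  "Im p v \<Gamma> = (if p then mark v \<Gamma> else \<Gamma>)"

lemma lin_I: "lin (I p v)"
  unfolding I_def by (cases p) (simp_all add: lin_op_iv lin_id)

lemma I_chainsG: "x \<in> chainsG \<Gamma> \<Longrightarrow> I p v x \<in> chainsG (Im p v \<Gamma>)"
  by (simp add: I_def Im_def op_iv_chainsG)

lemma I_eqm: "eqm (LH \<Gamma>) x y \<Longrightarrow> eqm (LH (Im p v \<Gamma>)) (I p v x) (I p v y)"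
  by (simp add: I_def Im_def op_iv_eqm)

lemma LH_eqm_HR: "eqm (LH \<Gamma>) x y \<Longrightarrow> eqm HR x y"
  by (erule eqm_mono) (rule LH_HR)

lemma I_commute: "u \<noteq> v \<Longrightarrow> x \<in> chainsG \<Gamma> \<Longrightarrow> eqm (LH (Im p u (Im q v \<Gamma>))) (I p u (I q v x)) (I q v (I p u x))"
  by (simp add: I_def Im_def op_iv_commute)

lemma I_trl: "giso \<phi> \<Gamma> \<Gamma>' \<Longrightarrow> v \<in> normals \<Gamma> \<Longrightarrow> x \<in> chainsG \<Gamma> \<Longrightarrow>
    I p (\<phi> ` v) (trl \<phi> \<Gamma>' x) = trl \<phi> (Im p (\<phi> ` v) \<Gamma>') (I p v x)"
  by (simp add: I_def Im_def op_iv_trl)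

lemma giso_Im: "giso \<phi> \<Gamma> \<Gamma>' \<Longrightarrow> v \<in> normals \<Gamma> \<Longrightarrow> giso \<phi> (Im p v \<Gamma>) (Im p (\<phi> ` v) \<Gamma>')"
  by (simp add: Im_def giso_mark)

lemma Im_simps [simp]:
  "new_half (Im p v \<Gamma>) = new_half \<Gamma>" "normals (Im p v \<Gamma>) = (if p then normals \<Gamma> - {v} else normals \<Gamma>)"
  "vdeg N (Im p v \<Gamma>) = vdeg N \<Gamma>" "sgraph N a w T (Im p v \<Gamma>) = Im p v (sgraph N a w T \<Gamma>)"
  "halves (Im p v \<Gamma>) = halves \<Gamma>" "verts (Im p v \<Gamma>) = verts \<Gamma>"
  by (simp_all add: Im_def sgraph_mark)

lemma is_graph_Im: "v \<in> normals \<Gamma> \<Longrightarrow> is_graph (Im p v \<Gamma>) \<Longrightarrow> is_graph \<Gamma>"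
  by (auto simp: Im_def is_graph_mark_iff split: if_splits)

lemma I_Sp:
  assumes s: "splittable a w T \<Gamma>" and v: "v \<in> normals \<Gamma>" "v \<noteq> w" and x: "x \<in> chainsG \<Gamma>"
  shows "I p v (Sp a w T x) = Sp a w T (I p v x)"
  using op_iv_Sp[OF assms] by (simp add: I_def)

lemma splittable_Im:
  "splittable a w T \<Gamma> \<Longrightarrow> v \<noteq> w \<Longrightarrow> is_graph (Im p v \<Gamma>) \<Longrightarrow> splittable a w T (Im p v \<Gamma>)"
  by (auto simp: splittable_def)

lemma II_trl:
  assumes iso: "giso \<phi> \<Gamma> \<Gamma>'" and uv: "u \<in> normals \<Gamma>" "v \<in> normals \<Gamma>" "u \<noteq> v" and x: "x \<in> chainsG \<Gamma>"
  shows "I p (\<phi> ` u) (I q (\<phi> ` v) (trl \<phi> \<Gamma>' x)) = trl \<phi> (Im p (\<phi> ` u) (Im q (\<phi> ` v) \<Gamma>')) (I p u (I q v x))"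
    "giso \<phi> (Im p u (Im q v \<Gamma>)) (Im p (\<phi> ` u) (Im q (\<phi> ` v) \<Gamma>'))"
proof -
  have u: "u \<in> normals (Im q v \<Gamma>)" using uv by simp
  show "giso \<phi> (Im p u (Im q v \<Gamma>)) (Im p (\<phi> ` u) (Im q (\<phi> ` v) \<Gamma>'))"
    by (intro giso_Im iso uv u)
  show "I p (\<phi> ` u) (I q (\<phi> ` v) (trl \<phi> \<Gamma>' x)) = trl \<phi> (Im p (\<phi> ` u) (Im q (\<phi> ` v) \<Gamma>')) (I p u (I q v x))"
    unfolding I_trl[OF iso uv(2) x] by (rule I_trl[OF giso_Im[OF iso uv(2)] u I_chainsG[OF x]])
qed

definition Dt :: "ngraph \<Rightarrow> bool \<Rightarrow> bool \<Rightarrow> int \<Rightarrow> nat set \<Rightarrow> nat set \<Rightarrow> ('k, 'w) chain \<Rightarrow> ('k, 'w) chain" where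
  "Dt \<Gamma> p q a v S x = I p (vert1 \<Gamma> S) (I q (vert2 \<Gamma> v S) (Sp a v S x))"

definition Dg :: "ngraph \<Rightarrow> bool \<Rightarrow> bool \<Rightarrow> int \<Rightarrow> nat set \<Rightarrow> nat set \<Rightarrow> ngraph" where
  "Dg \<Gamma> p q a v S = Im p (vert1 \<Gamma> S) (Im q (vert2 \<Gamma> v S) (sgraph N a v S \<Gamma>))"

lemma lin_Dt: "lin (Dt \<Gamma> p q a v S)"
  unfolding Dt_def by (intro lin_compose[OF lin_Sp] lin_compose[OF lin_I] lin_I)

lemma Dt_chainsG:
  assumes "splittable a v S \<Gamma>" "x \<in> chainsG \<Gamma>"
  shows "Dt \<Gamma> p q a v S x \<in> chainsG (Dg \<Gamma> p q a v S)"
  unfolding Dt_def Dg_def by (intro I_chainsG Sp_chainsG assms)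

lemma Sp_LH:
  assumes "splittable a v S \<Gamma>" "eqm (LH \<Gamma>) x y"
  shows "eqm (LH (sgraph N a v S \<Gamma>)) (Sp a v S x) (Sp a v S y)"
proof (rule eqm_lin[OF lin_Sp _ assms(2)])
  fix r assume "r \<in> LH \<Gamma>"
  then show "Sp a v S r \<in> free.span (LH (sgraph N a v S \<Gamma>))"
    using Sp_TR[OF assms(1)] splittableD(1)[OF assms(1)] is_graph_sgraph[OF assms(1)] by (simp add: LH_def)
qed

lemma Dt_LH:
  assumes "splittable a v S \<Gamma>" "eqm (LH \<Gamma>) x y"
  shows "eqm HR (Dt \<Gamma> p q a v S x) (Dt \<Gamma> p q a v S y)"
  unfolding Dt_def by (rule LH_eqm_HR, (rule I_eqm)+, rule Sp_LH[OF assms])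

lemma new_normals:
  assumes "splittable a v S \<Gamma>"
  shows "vert1 \<Gamma> S \<in> normals (sgraph N a v S \<Gamma>)"
    "vert2 \<Gamma> v S \<in> normals (sgraph N a v S \<Gamma>)"
    "vert1 \<Gamma> S \<noteq> vert2 \<Gamma> v S"
  using normals_sgraph[OF assms] new_verts_sgraph(3)[OF assms] by auto

lemma Dt_iso:
  assumes iso: "giso \<phi> \<Gamma> \<Gamma>'" and s: "splittable a v S \<Gamma>" and x: "x \<in> chainsG \<Gamma>"
  shows "eqm HR (Dt \<Gamma>' p q a (\<phi> ` v) (\<phi> ` S) (trl \<phi> \<Gamma>' x)) (Dt \<Gamma> p q a v S x)"
proof -
  define \<psi> where "\<psi> = \<phi>(new_half \<Gamma> := new_half \<Gamma>', Suc (new_half \<Gamma>) := Suc (new_half \<Gamma>'))"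
  note i = Sp_iso[OF iso s refl refl \<psi>_def]
  note t = II_trl[OF i(2) new_normals[OF s] Sp_chainsG[OF s x], of p q, unfolded i(3,4)]
  show ?thesis
    unfolding Dt_def i(5)[OF x] t(1)
    by (intro eqm_sym[OF giso_HR[OF _ t(2)]] I_chainsG Sp_chainsG[OF s x])
qed

lemma TR_LH: "is_graph \<Gamma> \<Longrightarrow> LH \<Gamma> = TR \<Gamma>"
  by (simp add: LH_def)

text \<open>The flip interchanges \<open>v'\<close> and \<open>v''\<close>, hence the flags.
  Afterwards the two markings stand in the other order and are exchanged by
  \<open>I_commute\<close>.\<close>

lemma Dt_flip:
  assumes s: "splittable a v S \<Gamma>" and x: "x \<in> chainsG \<Gamma>"
  shows "eqm HR (Dt \<Gamma> p q (N - a) v (v - S) x) (Dt \<Gamma> q p a v S x)"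
proof -
  let ?n = "new_half \<Gamma>" and ?G = "sgraph N a v S \<Gamma>" and ?G' = "sgraph N (N - a) v (v - S) \<Gamma>"
  note s' = splittable_flip[OF s]
  note sD = splittableD[OF s]
  have vS: "v - (v - S) = S" using sD(7) by auto
  have lt: "h < ?n" if "h \<in> v" for h using vert_lt[OF sD(1,3) that] .
  have fS: "swap2 ?n ` S = S" "swap2 ?n ` (v - S) = v - S"
    by (rule image_below[of _ ?n]; use lt sD(7) in auto)+
  have iso: "giso (swap2 ?n) ?G ?G'"
    using graph_iso_swap2[OF s] is_graph_sgraph[OF s'] by (simp add: giso_def)
  have 1: "eqm (LH ?G') (Sp (N - a) v (v - S) x) (trl (swap2 ?n) ?G' (Sp a v S x))"
    unfolding TR_LH[OF is_graph_sgraph[OF s']] by (rule Sp_flip[OF s x])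
  have im: "swap2 ?n ` insert (Suc ?n) (v - S) = insert ?n (v - S)" "swap2 ?n ` insert ?n S = insert (Suc ?n) S"
    by (simp_all add: fS)
  note nn = new_normals[OF s]
  note t = II_trl[OF iso nn(2,1) nn(3)[symmetric] Sp_chainsG[OF s x], of p q, unfolded im]
  have "eqm HR (Dt \<Gamma> p q (N - a) v (v - S) x) (I p (insert ?n (v - S)) (I q (insert (Suc ?n) S) (trl (swap2 ?n) ?G' (Sp a v S x))))"
    unfolding Dt_def vS by (rule LH_eqm_HR, (rule I_eqm)+, rule 1)
  also have "eqm HR \<dots> (I p (insert (Suc ?n) (v - S)) (I q (insert ?n S) (Sp a v S x)))"
    unfolding t(1) by (intro eqm_sym[OF giso_HR[OF _ t(2)]] I_chainsG Sp_chainsG[OF s x])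
  also have "eqm HR \<dots> (Dt \<Gamma> q p a v S x)"
    unfolding Dt_def by (rule LH_eqm_HR, rule I_commute[OF nn(3)[symmetric] Sp_chainsG[OF s x]])
  finally show ?thesis .
qed

section \<open>Splitting twice\<close>

lemma I_HR: "eqm (LH \<Gamma>) x y \<Longrightarrow> eqm HR (I p u x) (I p u y)"
  by (rule LH_eqm_HR) (rule I_eqm)

lemma I3_commute:
  assumes "s \<noteq> m" "s \<noteq> t" "m \<noteq> t" and x: "x \<in> chainsG \<Gamma>"
  shows "eqm HR (I r s (I q m (I p t x))) (I p t (I q m (I r s x)))"
proof -
  have "eqm HR (I r s (I q m (I p t x))) (I r s (I p t (I q m x)))"
    by (rule I_HR[OF I_commute]) (fact assms)+
  also have "eqm HR \<dots> (I p t (I r s (I q m x)))"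
    by (rule LH_eqm_HR[OF I_commute]) (fact assms I_chainsG[OF x])+
  also have "eqm HR \<dots> (I p t (I q m (I r s x)))"
    by (rule I_HR[OF I_commute]) (fact assms)+
  finally show ?thesis .
qed

lemma I4_commute:
  assumes "w1 \<noteq> v1" "w1 \<noteq> v2" "w2 \<noteq> v1" "w2 \<noteq> v2" and x: "x \<in> chainsG \<Gamma>"
  shows "eqm HR (I r w1 (I t w2 (I p v1 (I q v2 x)))) (I p v1 (I q v2 (I r w1 (I t w2 x))))"
proof -
  have "eqm HR (I r w1 (I t w2 (I p v1 (I q v2 x)))) (I r w1 (I p v1 (I t w2 (I q v2 x))))"
    by (rule I_HR[OF I_commute]) (fact assms I_chainsG[OF x])+
  also have "eqm HR \<dots> (I p v1 (I r w1 (I t w2 (I q v2 x))))"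
    by (rule LH_eqm_HR[OF I_commute]) (fact assms I_chainsG[OF I_chainsG[OF x]])+
  also have "eqm HR \<dots> (I p v1 (I r w1 (I q v2 (I t w2 x))))"
    by (rule LH_eqm_HR, (rule I_eqm)+, rule I_commute) (fact assms)+
  also have "eqm HR \<dots> (I p v1 (I q v2 (I r w1 (I t w2 x))))"
    by (rule I_HR[OF I_commute]) (fact assms I_chainsG[OF x])+
  finally show ?thesis .
qed

text \<open>After a marking the graph conditions may fail; then the chain is zero and so are both
  sides. This makes splittability necessary only for actual graphs.\<close>

lemma I_Sp':
  assumes s: "is_graph \<Gamma> \<Longrightarrow> splittable a w T \<Gamma>" and v: "v \<in> normals \<Gamma>" "v \<noteq> w" and x: "x \<in> chainsG \<Gamma>"
  shows "Sp a w T (I p v x) = I p v (Sp a w T x)"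
proof (cases "is_graph \<Gamma>")
  case True
  show ?thesis by (rule I_Sp[OF s[OF True] v x, symmetric])
next
  case False
  then have "x = 0" using chainsG_no_graph x by blast
  then show ?thesis by (simp add: lin_0[OF lin_I] lin_0[OF lin_Sp])
qed

lemma II_Sp:
  assumes s: "splittable b w T G" and u: "u1 \<in> normals G" "u2 \<in> normals G" "u1 \<noteq> u2" "u1 \<noteq> w" "u2 \<noteq> w"
    and y: "y \<in> chainsG G"
  shows "Sp b w T (I p u1 (I q u2 y)) = I p u1 (I q u2 (Sp b w T y))"
proof -
  have "Sp b w T (I p u1 (I q u2 y)) = I p u1 (Sp b w T (I q u2 y))"
    by (rule I_Sp'[of "Im q u2 G"]) (use u splittable_Im[OF s u(5)] I_chainsG[OF y] in auto)
  also have "Sp b w T (I q u2 y) = I q u2 (Sp b w T y)"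
    by (rule I_Sp'[OF s u(2,5) y])
  finally show ?thesis .
qed

text \<open>All markings are moved outside both splittings, where they commute modulo relations.
  What remains is \<open>Sp_commute\<close>, transported along \<open>swap4\<close>.\<close>

lemma Dt_commute:
  assumes sv: "splittable a v S \<Gamma>" and sw: "splittable b w T \<Gamma>" and vw: "v \<noteq> w" and x: "x \<in> chainsG \<Gamma>"
  shows "eqm HR (Dt (Dg \<Gamma> p q a v S) r t b w T (Dt \<Gamma> p q a v S x))
    (- Dt (Dg \<Gamma> r t b w T) p q a v S (Dt \<Gamma> r t b w T x))"
proof -
  define n where "n = new_half \<Gamma>"
  let ?n2 = "Suc (Suc n)" and ?n3 = "Suc (Suc (Suc n))"
  let ?v1 = "insert n S" and ?v2 = "insert (Suc n) (v - S)" and ?w1 = "insert ?n2 T" and ?w2 = "insert ?n3 (w - T)"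
  let ?v1' = "insert ?n2 S" and ?v2' = "insert ?n3 (v - S)" and ?w1' = "insert n T" and ?w2' = "insert (Suc n) (w - T)"
  let ?Ga = "sgraph N a v S \<Gamma>" and ?Gb = "sgraph N b w T \<Gamma>"
  let ?G2 = "sgraph N b w T ?Ga" and ?G2' = "sgraph N a v S ?Gb"
  let ?\<phi> = "swap4 n"
  note s = splittableD[OF sv] and t = splittableD[OF sw]
  note sw1 = splittable_other[OF sv sw vw] and sv1 = splittable_other[OF sw sv vw[symmetric]]
  have nh: "new_half ?Ga = ?n2" "new_half ?Gb = ?n2" using new_half_sgraph[OF s(4)] by (simp_all add: n_def)
  note na = new_normals[OF sv, folded n_def] and nb = new_normals[OF sw, folded n_def]
  have nv: "?v1 \<noteq> w" "?v2 \<noteq> w" "?w1' \<noteq> v" "?w2' \<noteq> v"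
    using new_verts_sgraph[OF sv] new_verts_sgraph[OF sw] s(3) t(3) by (auto simp: n_def)
  note n2 = new_normals[OF sw1, unfolded nh] and n2' = new_normals[OF sv1, unfolded nh]
  have dist: "?w1 \<notin> verts ?Ga" "?w2 \<notin> verts ?Ga" "?v1' \<notin> verts ?Gb" "?v2' \<notin> verts ?Gb"
    using new_verts_sgraph[OF sw1] new_verts_sgraph[OF sv1] by (simp_all only: nh not_False_eq_True)
  then have ne: "?w1 \<noteq> ?v1" "?w1 \<noteq> ?v2" "?w2 \<noteq> ?v1" "?w2 \<noteq> ?v2" "?v1' \<noteq> ?w1'" "?v1' \<noteq> ?w2'" "?v2' \<noteq> ?w1'" "?v2' \<noteq> ?w2'"
    using na nb normal_vert by metis+
  have wn: "?w1' \<in> normals ?G2'" "?w2' \<in> normals ?G2'"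
    using nb nv normals_sgraph[OF sv1] by auto
  define u where "u = Sp b w T (Sp a v S x)"
  define u' where "u' = Sp a v S (Sp b w T x)"
  have u: "u \<in> chainsG ?G2" and u': "u' \<in> chainsG ?G2'"
    unfolding u_def u'_def by (intro Sp_chainsG sw1 sv1 sv sw x)+
  have L: "Dt (Dg \<Gamma> p q a v S) r t b w T (Dt \<Gamma> p q a v S x) = I r ?w1 (I t ?w2 (I p ?v1 (I q ?v2 u)))"
    unfolding Dt_def Dg_def u_def n_def[symmetric] Im_simps nh
    by (subst II_Sp[OF sw1 na(1,2,3) nv(1,2) Sp_chainsG[OF sv x]]) (rule refl)
  have R: "Dt (Dg \<Gamma> r t b w T) p q a v S (Dt \<Gamma> r t b w T x) = I p ?v1' (I q ?v2' (I r ?w1' (I t ?w2' u')))"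
    unfolding Dt_def Dg_def u'_def n_def[symmetric] Im_simps nh
    by (subst II_Sp[OF sv1 nb(1,2,3) nv(3,4) Sp_chainsG[OF sw x]]) (rule refl)
  have iso: "giso ?\<phi> ?G2' ?G2"
    using graph_iso_swap4_other[OF sv sw vw] is_graph_sgraph[OF sw1] by (simp add: giso_def n_def)
  have lt: "h < n" if "h \<in> v \<or> h \<in> w" for h
    using vert_lt[OF s(1,3)] vert_lt[OF t(1,3)] that by (auto simp: n_def)
  have fu: "?\<phi> ` S = S" "?\<phi> ` (v - S) = v - S" "?\<phi> ` T = T" "?\<phi> ` (w - T) = w - T"
    by (rule image_below[of _ n]; use lt s(7) t(7) in auto)+
  have im: "?\<phi> ` ?v1' = ?v1" "?\<phi> ` ?v2' = ?v2" "?\<phi> ` ?w1' = ?w1" "?\<phi> ` ?w2' = ?w2"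
    by (simp_all add: fu)
  note t1 = II_trl[OF iso wn nb(3) u', of r t, unfolded im]
  have vn: "?v1' \<in> normals (Im r ?w1' (Im t ?w2' ?G2'))" "?v2' \<in> normals (Im r ?w1' (Im t ?w2' ?G2'))"
    using n2' ne by auto
  note t2 = II_trl[OF t1(2) vn n2'(3) I_chainsG[OF I_chainsG[OF u']], of p q, unfolded im]
  have "eqm HR (I p ?v1' (I q ?v2' (I r ?w1' (I t ?w2' u')))) (I p ?v1 (I q ?v2 (I r ?w1 (I t ?w2 (trl ?\<phi> ?G2 u')))))"
    unfolding t1(1) t2(1) by (intro giso_HR[OF _ t2(2)] I_chainsG u')
  from eqm_neg[OF this] have R': "eqm HR (- I p ?v1' (I q ?v2' (I r ?w1' (I t ?w2' u')))) (I p ?v1 (I q ?v2 (I r ?w1 (I t ?w2 (- trl ?\<phi> ?G2 u')))))"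
    by (simp add: lin_neg[OF lin_I])
  have "eqm (LH ?G2) u (- trl ?\<phi> ?G2 u')"
    using Sp_commute[OF sv sw vw x] by (simp add: TR_LH is_graph_sgraph[OF sw1] u_def u'_def n_def)
  then have "eqm HR (I p ?v1 (I q ?v2 (I r ?w1 (I t ?w2 u)))) (I p ?v1 (I q ?v2 (I r ?w1 (I t ?w2 (- trl ?\<phi> ?G2 u')))))"
    by - (rule LH_eqm_HR, (rule I_eqm)+)
  then show ?thesis
    unfolding L R by (meson I4_commute[OF ne(1-4) u] R' eqm_trans eqm_sym)
qed

text \<open>The term of the operators applied twice in which \<open>v\<close> is replaced by a chain with end vertices
  containing \<open>S\<close> and \<open>T\<close>, where the end containing \<open>S\<close> is split off first.  The flags \<open>r\<close>, \<open>p\<close>, \<open>q\<close> tell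
  which of the end \<open>S\<close>, the end \<open>T\<close> and the middle vertex become special.\<close>

definition X :: "ngraph \<Rightarrow> bool \<Rightarrow> bool \<Rightarrow> bool \<Rightarrow> int \<Rightarrow> nat set \<Rightarrow> nat set \<Rightarrow> int \<Rightarrow> nat set \<Rightarrow>
    ('k, 'w) chain \<Rightarrow> ('k, 'w) chain" where
  "X \<Gamma> r p q a v S b T x = Dt (Im r (vert1 \<Gamma> S) (sgraph N a v S \<Gamma>)) p q b
     (vert2 \<Gamma> v S) T (I r (vert1 \<Gamma> S) (Sp a v S x))"

text \<open>A normal form with the markings outside the two splittings: the end vertex that was
  split off first is not touched by the second splitting, so its marking commutes with it. The
  further conclusions say that the three vertices of the chain are distinct and normal, as needed
  for permuting their markings.\<close>

lemma X_expand:
  assumes sv: "splittable a v S \<Gamma>" and tv: "splittable b v T \<Gamma>" and ST: "S \<inter> T = {}" and x: "x \<in> chainsG \<Gamma>"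
    and n: "n = new_half \<Gamma>"
  shows "X \<Gamma> r p q a v S b T x = I p (insert (Suc (Suc n)) T)
     (I q (insert (Suc (Suc (Suc n))) (insert (Suc n) (v - S - T))) (I r (insert n S) (Sp b (insert (Suc n) (v - S)) T (Sp a v S x))))"
    and "Sp b (insert (Suc n) (v - S)) T (Sp a v S x) \<in> chainsG (sgraph N b (insert (Suc n) (v - S)) T (sgraph N a v S \<Gamma>))"
    and "insert (Suc (Suc n)) T \<in> normals (sgraph N b (insert (Suc n) (v - S)) T (sgraph N a v S \<Gamma>))"
     "insert (Suc (Suc (Suc n))) (insert (Suc n) (v - S - T)) \<in> normals (sgraph N b (insert (Suc n) (v - S)) T (sgraph N a v S \<Gamma>))"
     "insert n S \<in> normals (sgraph N b (insert (Suc n) (v - S)) T (sgraph N a v S \<Gamma>))"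
    and "insert n S \<noteq> insert (Suc (Suc (Suc n))) (insert (Suc n) (v - S - T))" "insert n S \<noteq> insert (Suc (Suc n)) T"
      "insert (Suc (Suc (Suc n))) (insert (Suc n) (v - S - T)) \<noteq> insert (Suc (Suc n)) T"
    and "is_graph (sgraph N b (insert (Suc n) (v - S)) T (sgraph N a v S \<Gamma>))"
proof -
  let ?vv = "insert (Suc n) (v - S)" and ?n2 = "Suc (Suc n)" and ?n3 = "Suc (Suc (Suc n))" and ?s1 = "insert n S"
  let ?Ga = "sgraph N a v S \<Gamma>"
  let ?m = "insert ?n3 (insert (Suc n) (v - S - T))"
  note s = splittableD[OF sv] and t = splittableD[OF tv]
  have nh: "new_half ?Ga = ?n2" using new_half_sgraph[OF s(4)] by (simp add: n)
  have TS: "T \<subseteq> v - S" using t(7) ST by auto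
  have b: "b \<in> degrees W" "N - b \<in> degrees W" using tv by (auto simp: splittable_def)
  note st = splittable_tree[OF sv TS t(8) b, folded n]
  note na = new_normals[OF sv, folded n]
  have "Suc n \<notin> T" using t(7,14) by (auto simp: n)
  then have m: "?vv - T = insert (Suc n) (v - S - T)" by auto
  note n2 = new_normals[OF st, unfolded nh m]
  show g: "is_graph (sgraph N b ?vv T ?Ga)" by (rule is_graph_sgraph[OF st])
  show "Sp b ?vv T (Sp a v S x) \<in> chainsG (sgraph N b ?vv T ?Ga)"
    by (intro Sp_chainsG st sv x)
  show "insert ?n2 T \<in> normals (sgraph N b ?vv T ?Ga)" "?m \<in> normals (sgraph N b ?vv T ?Ga)" by (rule n2)+
  show "?s1 \<in> normals (sgraph N b ?vv T ?Ga)" using na normals_sgraph[OF st] by auto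
  have "insert ?n2 T \<notin> verts ?Ga" "?m \<notin> verts ?Ga"
    using new_verts_sgraph[OF st] by (simp_all only: nh m not_False_eq_True)
  then show "?s1 \<noteq> ?m" "?s1 \<noteq> insert ?n2 T"
    using na(1) normal_vert by metis+
  show "?m \<noteq> insert ?n2 T" using n2(3) by (rule not_sym)
  have "Sp b ?vv T (I r ?s1 (Sp a v S x)) = I r ?s1 (Sp b ?vv T (Sp a v S x))"
    by (rule I_Sp'[OF st na(1,3) Sp_chainsG[OF sv x]])
  then show "X \<Gamma> r p q a v S b T x = I p (insert ?n2 T) (I q ?m (I r ?s1 (Sp b ?vv T (Sp a v S x))))"
    by (simp add: X_def Dt_def n[symmetric] nh m)
qed

text \<open>Exchanging the ends exchanges the flags \<open>r\<close> and \<open>p\<close> and leaves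
  the flag \<open>q\<close> of the middle vertex. The sign is that of \<open>Sp_tree\<close>, since
  the three markings commute modulo relations.\<close>

lemma X_antisym:
  assumes sv: "splittable a v S \<Gamma>" and tv: "splittable b v T \<Gamma>" and ST: "S \<inter> T = {}" and x: "x \<in> chainsG \<Gamma>"
  shows "eqm HR (X \<Gamma> r p q a v S b T x) (- X \<Gamma> p r q b v T a S x)"
proof -
  define n where "n = new_half \<Gamma>"
  let ?n2 = "Suc (Suc n)" and ?n3 = "Suc (Suc (Suc n))" and ?\<phi> = "swap4 n"
  let ?vv = "insert (Suc n) (v - S)" and ?vv' = "insert (Suc n) (v - T)"
  define G2 where "G2 = sgraph N b ?vv T (sgraph N a v S \<Gamma>)"
  define G2' where "G2' = sgraph N a ?vv' S (sgraph N b v T \<Gamma>)"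
  let ?s1 = "insert n S" and ?t2 = "insert ?n2 T" and ?m = "insert ?n3 (insert (Suc n) (v - S - T))"
  let ?t1 = "insert n T" and ?s2 = "insert ?n2 S"
  have TS: "T \<inter> S = {}" using ST by blast
  have M: "v - T - S = v - S - T" by auto
  define u where "u = Sp b ?vv T (Sp a v S x)"
  define u' where "u' = Sp a ?vv' S (Sp b v T x)"
  note e = X_expand[OF sv tv ST x n_def, folded u_def G2_def]
  note e' = X_expand[OF tv sv TS x n_def, unfolded M, folded u'_def G2'_def]
  have iso: "giso ?\<phi> G2' G2"
    using graph_iso_swap4_tree[OF sv tv ST] e(9) by (simp add: giso_def n_def G2_def G2'_def)
  note s = splittableD[OF sv] and t = splittableD[OF tv]
  have lt: "h < n" if "h \<in> v" for h using vert_lt[OF s(1,3) that] by (simp add: n_def)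
  have fu: "?\<phi> ` S = S" "?\<phi> ` T = T" "?\<phi> ` (v - S - T) = v - S - T"
    by (rule image_below[of _ n]; use lt s(7) t(7) in auto)+
  have im: "?\<phi> ` ?s2 = ?s1" "?\<phi> ` ?m = ?m" "?\<phi> ` ?t1 = ?t2"
    by (simp_all add: fu insert_commute)
  note t1 = I_trl[OF iso e'(5) e'(2), of p, unfolded im]
  have iso1: "giso ?\<phi> (Im p ?t1 G2') (Im p ?t2 G2)" using giso_Im[OF iso e'(5), of p] unfolding im .
  have nn: "?s2 \<in> normals (Im p ?t1 G2')" "?m \<in> normals (Im p ?t1 G2')" using e'(3-8) by auto
  note t2 = II_trl[OF iso1 nn not_sym[OF e'(8)] I_chainsG[OF e'(2)], of r q, unfolded im]
  have "eqm HR (I r ?s2 (I q ?m (I p ?t1 u'))) (I r ?s1 (I q ?m (I p ?t2 (trl ?\<phi> G2 u'))))"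
    unfolding t1 t2(1) by (intro giso_HR[OF _ t2(2)] I_chainsG e'(2))
  from eqm_neg[OF this] have R: "eqm HR (- X \<Gamma> p r q b v T a S x) (I r ?s1 (I q ?m (I p ?t2 (- trl ?\<phi> G2 u'))))"
    by (simp add: lin_neg[OF lin_I] e'(1))
  have "eqm (LH G2) u (- trl ?\<phi> G2 u')"
    using Sp_tree[OF sv tv ST x n_def G2_def] by (simp add: TR_LH e(9) u_def u'_def)
  then have "eqm HR (I r ?s1 (I q ?m (I p ?t2 u))) (I r ?s1 (I q ?m (I p ?t2 (- trl ?\<phi> G2 u'))))"
    by - (rule LH_eqm_HR, (rule I_eqm)+)
  moreover have "eqm HR (I r ?s1 (I q ?m (I p ?t2 u))) (X \<Gamma> r p q a v S b T x)"
    unfolding e(1) by (rule I3_commute[OF e(6,7,8,2)])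
  ultimately show ?thesis using R by (meson eqm_trans eqm_sym)
qed

section \<open>Summation over degrees and pieces\<close>

definition AD :: "int set" where "AD = {a. a \<in> degrees W \<and> N - a \<in> degrees W}"
definition proper :: "nat set \<Rightarrow> nat set set" where "proper v = {S. S \<subseteq> v \<and> S \<noteq> {} \<and> S \<noteq> v}"

lemma AD_flip: "(\<Sum>a\<in>AD. f (N - a)) = (\<Sum>a\<in>AD. f a)"
  by (rule sum.reindex_bij_witness[of _ "\<lambda>a. N - a" "\<lambda>a. N - a"]) (auto simp: AD_def)

lemma proper_flip: "(\<Sum>S\<in>proper v. f (v - S)) = (\<Sum>S\<in>proper v. f S)"
  by (rule sum.reindex_bij_witness[of _ "\<lambda>S. v - S" "\<lambda>S. v - S"]) (auto simp: proper_def)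

lemma splittable_proper: "is_graph \<Gamma> \<Longrightarrow> v \<in> normals \<Gamma> \<Longrightarrow> a \<in> AD \<Longrightarrow> S \<in> proper v \<Longrightarrow> splittable a v S \<Gamma>"
  by (auto simp: AD_def proper_def splittable_def)

definition DD :: "ngraph \<Rightarrow> bool \<Rightarrow> bool \<Rightarrow> nat set \<Rightarrow> ('k, 'w) chain \<Rightarrow> ('k, 'w) chain" where
  "DD \<Gamma> p q v x = scale (1 / 2) (\<Sum>a\<in>AD. \<Sum>S\<in>proper v. Dt \<Gamma> p q a v S x)"

lemma lin_DD: "lin (DD \<Gamma> p q v)"
  unfolding DD_def by (intro lin_compose[OF _ lin_scale_op] lin_sum_op lin_Dt)

lemma DD_LH:
  assumes "v \<in> normals \<Gamma>" "eqm (LH \<Gamma>) x y"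
  shows "eqm HR (DD \<Gamma> p q v x) (DD \<Gamma> p q v y)"
proof (cases "is_graph \<Gamma>")
  case True
  then show ?thesis
    unfolding DD_def by (intro eqm_scale eqm_sum Dt_LH[OF splittable_proper assms(2)] assms(1))
next
  case False
  then have "x = y" using assms(2) by (simp add: LH_def eqm_def free.span_empty)
  then show ?thesis by simp
qed

lemma DD_iso:
  assumes iso: "giso \<phi> \<Gamma> \<Gamma>'" and v: "v \<in> normals \<Gamma>" and x: "x \<in> chainsG \<Gamma>"
  shows "eqm HR (DD \<Gamma>' p q (\<phi> ` v) (trl \<phi> \<Gamma>' x)) (DD \<Gamma> p q v x)"
proof (cases "is_graph \<Gamma>")
  case True
  have "inj_on \<phi> (halves \<Gamma>)" using iso by (auto simp: giso_def graph_iso_def bij_betw_def)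
  then have inj: "inj_on \<phi> v" using vert_halves[OF True normal_vert[OF v]] inj_on_subset by blast
  have pr: "proper (\<phi> ` v) = (`) \<phi> ` proper v"
  proof (intro equalityI subsetI)
    fix S' assume "S' \<in> proper (\<phi> ` v)"
    then have S': "S' \<subseteq> \<phi> ` v" "S' \<noteq> {}" "S' \<noteq> \<phi> ` v" by (auto simp: proper_def)
    then obtain S where S: "S \<subseteq> v" "S' = \<phi> ` S" by (meson subset_imageE)
    then show "S' \<in> (`) \<phi> ` proper v" using S' by (auto simp: proper_def)
  next
    fix S' assume "S' \<in> (`) \<phi> ` proper v"
    then obtain S where S: "S \<in> proper v" "S' = \<phi> ` S" by blast
    then have "\<phi> ` S \<noteq> \<phi> ` v" using inj_on_image_eq_iff[OF inj, of S v] by (auto simp: proper_def)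
    then show "S' \<in> proper (\<phi> ` v)" using S by (auto simp: proper_def)
  qed
  have inj2: "inj_on ((`) \<phi>) (proper v)"
    by (rule inj_onI) (use inj_on_image_eq_iff[OF inj] in \<open>auto simp: proper_def\<close>)
  have "DD \<Gamma>' p q (\<phi> ` v) (trl \<phi> \<Gamma>' x) = scale (1 / 2) (\<Sum>a\<in>AD. \<Sum>S\<in>proper v. Dt \<Gamma>' p q a (\<phi> ` v) (\<phi> ` S) (trl \<phi> \<Gamma>' x))"
    unfolding DD_def pr sum.reindex[OF inj2] comp_def ..
  also have "eqm HR \<dots> (DD \<Gamma> p q v x)"
    unfolding DD_def by (intro eqm_scale eqm_sum Dt_iso[OF iso splittable_proper[OF True v] x])
  finally show ?thesis .
next
  case False
  then have "x = 0" using chainsG_no_graph x by blast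
  then show ?thesis by (simp add: lin_0[OF lin_trl] lin_0[OF lin_DD])
qed

lemma DD_DD_commute:
  assumes g: "is_graph \<Gamma>" and vw: "v \<in> normals \<Gamma>" "w \<in> normals \<Gamma>" "v \<noteq> w" and x: "x \<in> chainsG \<Gamma>"
  shows "eqm HR (\<Sum>a\<in>AD. \<Sum>S\<in>proper v. DD (Dg \<Gamma> p q a v S) r t w (Dt \<Gamma> p q a v S x))
    (- (\<Sum>b\<in>AD. \<Sum>T\<in>proper w. DD (Dg \<Gamma> r t b w T) p q v (Dt \<Gamma> r t b w T x)))"
proof -
  have "- (\<Sum>b\<in>AD. \<Sum>T\<in>proper w. DD (Dg \<Gamma> r t b w T) p q v (Dt \<Gamma> r t b w T x)) =
    (\<Sum>b\<in>AD. \<Sum>T\<in>proper w. \<Sum>a\<in>AD. \<Sum>S\<in>proper v. scale (1 / 2) (- Dt (Dg \<Gamma> r t b w T) p q a v S (Dt \<Gamma> r t b w T x)))"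
    unfolding DD_def free.scale_sum_right free.scale_minus_right sum_negf ..
  also have "\<dots> = (\<Sum>a\<in>AD. \<Sum>S\<in>proper v. \<Sum>b\<in>AD. \<Sum>T\<in>proper w. scale (1 / 2) (- Dt (Dg \<Gamma> r t b w T) p q a v S (Dt \<Gamma> r t b w T x)))"
    by (rule sum_swap4)
  finally show ?thesis
    unfolding DD_def free.scale_sum_right
    using vw(3) by (simp only:) (intro eqm_sum eqm_scale Dt_commute splittable_proper g vw x)
qed

text \<open>In \<open>EE\<close> the new vertex \<open>v''\<close> is split again, in \<open>EE'\<close> the new vertex \<open>v'\<close>; the flag \<open>r\<close> belongs to the
  other one.\<close>

definition EE :: "ngraph \<Rightarrow> bool \<Rightarrow> bool \<Rightarrow> bool \<Rightarrow> nat set \<Rightarrow> ('k, 'w) chain \<Rightarrow> ('k, 'w) chain" where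
  "EE \<Gamma> p q r v x = (\<Sum>a\<in>AD. \<Sum>S\<in>proper v. DD (Im r (vert1 \<Gamma> S) (sgraph N a v S \<Gamma>)) p q
     (vert2 \<Gamma> v S) (I r (vert1 \<Gamma> S) (Sp a v S x)))"

definition EE' :: "ngraph \<Rightarrow> bool \<Rightarrow> bool \<Rightarrow> bool \<Rightarrow> nat set \<Rightarrow> ('k, 'w) chain \<Rightarrow> ('k, 'w) chain" where
  "EE' \<Gamma> p q r v x = (\<Sum>a\<in>AD. \<Sum>S\<in>proper v. DD (Im r (vert2 \<Gamma> v S) (sgraph N a v S \<Gamma>)) p q
     (vert1 \<Gamma> S) (I r (vert2 \<Gamma> v S) (Sp a v S x)))"

lemma flip_both: "(\<Sum>a\<in>AD. \<Sum>S\<in>proper v. f a S) = (\<Sum>a\<in>AD. \<Sum>S\<in>proper v. f (N - a) (v - S))"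
  unfolding proper_flip by (rule AD_flip[symmetric])

text \<open>Flipping the first splitting turns the vertex that is split again from the first new
  vertex into the second one; the index set of all \<open>a\<close> and \<open>S\<close> is
  invariant under the flip.\<close>

lemma EE'_EE:
  assumes g: "is_graph \<Gamma>" and v: "v \<in> normals \<Gamma>" and x: "x \<in> chainsG \<Gamma>"
  shows "eqm HR (EE' \<Gamma> p q r v x) (EE \<Gamma> p q r v x)"
proof -
  let ?n = "new_half \<Gamma>"
  have "EE' \<Gamma> p q r v x = (\<Sum>a\<in>AD. \<Sum>S\<in>proper v.
     DD (Im r (insert (Suc ?n) (v - (v - S))) (sgraph N (N - a) v (v - S) \<Gamma>)) p q
     (insert ?n (v - S)) (I r (insert (Suc ?n) (v - (v - S))) (Sp (N - a) v (v - S) x)))"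
    unfolding EE'_def by (rule flip_both)
  also have "eqm HR \<dots> (EE \<Gamma> p q r v x)"
    unfolding EE_def
  proof (intro eqm_sum)
    fix a S assume aS: "a \<in> AD" "S \<in> proper v"
    note s = splittable_proper[OF g v aS]
    note s' = splittable_flip[OF s]
    note sD = splittableD[OF s]
    let ?G = "sgraph N a v S \<Gamma>" and ?G' = "sgraph N (N - a) v (v - S) \<Gamma>"
    have vS: "v - (v - S) = S" using sD(7) by auto
    have lt: "h < ?n" if "h \<in> v" for h using vert_lt[OF sD(1,3) that] .
    have fS: "swap2 ?n ` S = S" "swap2 ?n ` (v - S) = v - S"
      by (rule image_below[of _ ?n]; use lt sD(7) in auto)+
    have im: "swap2 ?n ` insert (Suc ?n) (v - S) = insert ?n (v - S)" "swap2 ?n ` insert ?n S = insert (Suc ?n) S"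
      by (simp_all add: fS)
    have iso: "giso (swap2 ?n) ?G ?G'"
      using graph_iso_swap2[OF s] is_graph_sgraph[OF s'] by (simp add: giso_def)
    note nn = new_normals[OF s]
    have 1: "eqm (LH ?G') (Sp (N - a) v (v - S) x) (trl (swap2 ?n) ?G' (Sp a v S x))"
      unfolding TR_LH[OF is_graph_sgraph[OF s']] by (rule Sp_flip[OF s x])
    have nf: "insert ?n (v - S) \<in> normals (Im r (insert (Suc ?n) S) ?G')"
      using new_normals[OF s', unfolded vS] by simp
    have "eqm HR (DD (Im r (insert (Suc ?n) S) ?G') p q (insert ?n (v - S)) (I r (insert (Suc ?n) S) (Sp (N - a) v (v - S) x)))
       (DD (Im r (insert (Suc ?n) S) ?G') p q (insert ?n (v - S)) (I r (insert (Suc ?n) S) (trl (swap2 ?n) ?G' (Sp a v S x))))"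
      by (rule DD_LH[OF nf I_eqm[OF 1]])
    also have "I r (insert (Suc ?n) S) (trl (swap2 ?n) ?G' (Sp a v S x)) =
       trl (swap2 ?n) (Im r (insert (Suc ?n) S) ?G') (I r (insert ?n S) (Sp a v S x))"
      using I_trl[OF iso nn(1) Sp_chainsG[OF s x], of r] unfolding im .
    also have "eqm HR (DD (Im r (insert (Suc ?n) S) ?G') p q (insert ?n (v - S)) \<dots>)
       (DD (Im r (insert ?n S) ?G) p q (insert (Suc ?n) (v - S)) (I r (insert ?n S) (Sp a v S x)))"
      using DD_iso[OF giso_Im[OF iso nn(1), of r], of "insert (Suc ?n) (v - S)" _ p q] nn I_chainsG[OF Sp_chainsG[OF s x]]
      unfolding im by simp
    finally show "eqm HR (DD (Im r (insert (Suc ?n) (v - (v - S))) ?G') p q (insert ?n (v - S)) (I r (insert (Suc ?n) (v - (v - S))) (Sp (N - a) v (v - S) x)))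
       (DD (Im r (insert ?n S) ?G) p q (insert (Suc ?n) (v - S)) (I r (insert ?n S) (Sp a v S x)))"
      unfolding vS .
  qed
  finally show ?thesis .
qed

text \<open>Of a nonempty proper subset and its complement exactly one misses \<open>h\<close>, so
  the sum runs over complementary pairs, indexed by that member.\<close>

lemma proper_insert:
  assumes "h \<notin> U" "finite U"
  shows "(\<Sum>T\<in>proper (insert h U). f T) = (\<Sum>T\<in>Pow U - {{}}. f T + f (insert h U - T))"
proof -
  let ?A = "Pow U - {{}}" and ?g = "\<lambda>T. insert h U - T"
  have eq: "proper (insert h U) = ?A \<union> ?g ` ?A"
  proof (intro equalityI subsetI)
    fix T assume T: "T \<in> proper (insert h U)"
    show "T \<in> ?A \<union> ?g ` ?A"
    proof (cases "h \<in> T")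
      case True
      then have "T = ?g (insert h U - T)" "insert h U - T \<in> ?A" using T by (auto simp: proper_def)
      then show ?thesis by blast
    qed (use T in \<open>auto simp: proper_def\<close>)
  qed (use assms in \<open>auto simp: proper_def\<close>)
  have disj: "?A \<inter> ?g ` ?A = {}" using assms by auto
  have inj: "inj_on ?g ?A"
    by (rule inj_onI) blast
  show ?thesis
    unfolding eq sum.distrib using assms(2) disj by (simp add: sum.union_disjoint sum.reindex[OF inj])
qed

definition XX :: "ngraph \<Rightarrow> bool \<Rightarrow> bool \<Rightarrow> bool \<Rightarrow> nat set \<Rightarrow> ('k, 'w) chain \<Rightarrow> ('k, 'w) chain" where
  "XX \<Gamma> r p q v x = (\<Sum>a\<in>AD. \<Sum>b\<in>AD. \<Sum>(S, T)\<in>{(S, T). S \<in> proper v \<and> T \<in> proper v \<and> S \<inter> T = {}}. X \<Gamma> r p q a v S b T x)"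

lemma XX_antisym:
  assumes g: "is_graph \<Gamma>" and v: "v \<in> normals \<Gamma>" and x: "x \<in> chainsG \<Gamma>"
  shows "eqm HR (XX \<Gamma> r p q v x) (- XX \<Gamma> p r q v x)"
proof -
  let ?P = "{(S, T). S \<in> proper v \<and> T \<in> proper v \<and> S \<inter> T = {}}"
  have "XX \<Gamma> p r q v x = (\<Sum>b\<in>AD. \<Sum>a\<in>AD. \<Sum>(S, T)\<in>?P. X \<Gamma> p r q b v T a S x)"
    unfolding XX_def
    by (intro sum.cong refl sum.reindex_bij_witness[of _ "\<lambda>(S, T). (T, S)" "\<lambda>(S, T). (T, S)"]) auto
  also have "\<dots> = (\<Sum>a\<in>AD. \<Sum>b\<in>AD. \<Sum>(S, T)\<in>?P. X \<Gamma> p r q b v T a S x)"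
    by (rule sum.swap)
  finally have "- XX \<Gamma> p r q v x = (\<Sum>a\<in>AD. \<Sum>b\<in>AD. \<Sum>(S, T)\<in>?P. - X \<Gamma> p r q b v T a S x)"
    by (simp only: sum_negf case_prod_unfold)
  then show ?thesis
    unfolding XX_def
    by (simp only:) (intro eqm_sum, auto intro!: X_antisym splittable_proper g v x)
qed

text \<open>When \<open>v''\<close> is split again, \<open>h''\<close> may fall into either part.
  The terms with \<open>h''\<close> in the first part are flipped, which exchanges \<open>p\<close>
  and \<open>q\<close>. Both kinds thus become chains whose end \<open>T\<close> consists of
  half-edges of \<open>v\<close>, and the factor 1/2 of the second splitting remains.\<close>

lemma EE_XX:
  assumes g: "is_graph \<Gamma>" and v: "v \<in> normals \<Gamma>" and x: "x \<in> chainsG \<Gamma>"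
  shows "eqm HR (EE \<Gamma> p q r v x) (scale (1 / 2) (XX \<Gamma> r p q v x + XX \<Gamma> r q p v x))"
proof -
  let ?n = "new_half \<Gamma>"
  let ?P = "{(S, T). S \<in> proper v \<and> T \<in> proper v \<and> S \<inter> T = {}}"
  have fv: "finite v" using vert_finite[OF g normal_vert[OF v]] .
  then have fp: "finite (proper v)" by (simp add: proper_def)
  have "Pow (v - S) - {{}} = {T. T \<in> proper v \<and> S \<inter> T = {}}" if "S \<in> proper v" for S
    using that by (auto simp: proper_def)
  then have sig: "(\<Sum>S\<in>proper v. \<Sum>T\<in>Pow (v - S) - {{}}. f S T) = (\<Sum>(S, T)\<in>?P. f S T)" for f :: "nat set \<Rightarrow> nat set \<Rightarrow> ('k, 'w) chain"
    using fp by (simp add: sum.Sigma) (auto intro!: sum.cong simp: Sigma_def)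
  have f1: "eqm HR (EE \<Gamma> p q r v x) (\<Sum>a\<in>AD. \<Sum>S\<in>proper v. scale (1 / 2)
     (\<Sum>b\<in>AD. \<Sum>T\<in>Pow (v - S) - {{}}. X \<Gamma> r p q a v S b T x + X \<Gamma> r q p a v S b T x))"
    unfolding EE_def
  proof (intro eqm_sum)
    fix a S assume aS: "a \<in> AD" "S \<in> proper v"
    note s = splittable_proper[OF g v aS]
    note sD = splittableD[OF s]
    let ?s = "insert ?n S" and ?vv = "insert (Suc ?n) (v - S)"
    let ?Gy = "Im r ?s (sgraph N a v S \<Gamma>)" and ?y = "I r ?s (Sp a v S x)"
    have y: "?y \<in> chainsG ?Gy" by (intro I_chainsG Sp_chainsG s x)
    have e1: "DD ?Gy p q ?vv ?y = scale (1 / 2) (\<Sum>b\<in>AD. \<Sum>T\<in>Pow (v - S) - {{}}. Dt ?Gy p q b ?vv T ?y + Dt ?Gy p q b ?vv (?vv - T) ?y)"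
      unfolding DD_def using sD(14) fv by (simp add: proper_insert)
    have e2: "(\<Sum>b\<in>AD. \<Sum>T\<in>Pow (v - S) - {{}}. Dt ?Gy p q b ?vv T ?y + Dt ?Gy p q b ?vv (?vv - T) ?y) =
      (\<Sum>b\<in>AD. \<Sum>T\<in>Pow (v - S) - {{}}. Dt ?Gy p q b ?vv T ?y + Dt ?Gy p q (N - b) ?vv (?vv - T) ?y)"
      unfolding sum.distrib
      using AD_flip[of "\<lambda>b. \<Sum>T\<in>Pow (v - S) - {{}}. Dt ?Gy p q b ?vv (?vv - T) ?y"] by simp
    have e3: "eqm HR (scale (1 / 2) (\<Sum>b\<in>AD. \<Sum>T\<in>Pow (v - S) - {{}}. Dt ?Gy p q b ?vv T ?y + Dt ?Gy p q (N - b) ?vv (?vv - T) ?y)) (scale (1 / 2) (\<Sum>b\<in>AD. \<Sum>T\<in>Pow (v - S) - {{}}. X \<Gamma> r p q a v S b T x + X \<Gamma> r q p a v S b T x))"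
      unfolding X_def
    proof (intro eqm_scale eqm_sum eqm_add eqm_refl)
      fix b T assume bT: "b \<in> AD" "T \<in> Pow (v - S) - {{}}"
      show "eqm HR (Dt ?Gy p q (N - b) ?vv (?vv - T) ?y) (Dt ?Gy q p b ?vv T ?y)"
      proof (cases "is_graph ?Gy")
        case True
        have "splittable b ?vv T (sgraph N a v S \<Gamma>)"
          by (rule splittable_tree[OF s]) (use bT in \<open>auto simp: AD_def\<close>)
        then have "splittable b ?vv T ?Gy"
          by (rule splittable_Im[OF _ new_normals(3)[OF s] True])
        then show ?thesis by (rule Dt_flip[OF _ y])
      next
        case False
        then have "?y = 0" using chainsG_no_graph y by blast
        then show ?thesis by (simp add: lin_0[OF lin_Dt])
      qed
    qed
    show "eqm HR (DD ?Gy p q ?vv ?y) (scale (1 / 2) (\<Sum>b\<in>AD. \<Sum>T\<in>Pow (v - S) - {{}}. X \<Gamma> r p q a v S b T x + X \<Gamma> r q p a v S b T x))"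
      unfolding e1 e2 by (rule e3)
  qed
  have f2: "(\<Sum>a\<in>AD. \<Sum>S\<in>proper v. scale (1 / 2)
     (\<Sum>b\<in>AD. \<Sum>T\<in>Pow (v - S) - {{}}. X \<Gamma> r p q a v S b T x + X \<Gamma> r q p a v S b T x)) =
    scale (1 / 2) (\<Sum>a\<in>AD. \<Sum>b\<in>AD. \<Sum>S\<in>proper v. \<Sum>T\<in>Pow (v - S) - {{}}. X \<Gamma> r p q a v S b T x + X \<Gamma> r q p a v S b T x)"
    unfolding free.scale_sum_right[symmetric]
    by (intro arg_cong[of _ _ "scale _"] sum.cong refl sum.swap)
  have f3: "scale (1 / 2) (\<Sum>a\<in>AD. \<Sum>b\<in>AD. \<Sum>S\<in>proper v. \<Sum>T\<in>Pow (v - S) - {{}}. X \<Gamma> r p q a v S b T x + X \<Gamma> r q p a v S b T x) = scale (1 / 2) (XX \<Gamma> r p q v x + XX \<Gamma> r q p v x)"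
    unfolding sig XX_def sum.distrib[symmetric] by (simp add: case_prod_unfold)
  show ?thesis using f1 unfolding f2 f3 .
qed

lemma EE_d:
  assumes g: "is_graph \<Gamma>" and v: "v \<in> normals \<Gamma>" and x: "x \<in> chainsG \<Gamma>"
  shows "eqm HR (EE \<Gamma> False False False v x) 0"
proof -
  let ?X = "XX \<Gamma> False False False v x"
  have "eqm HR (EE \<Gamma> False False False v x) (scale (1 / 2) (?X + ?X))" by (rule EE_XX[OF assms])
  also have "eqm HR \<dots> (scale (1 / 2) (- ?X + ?X))"
    by (intro eqm_scale eqm_add XX_antisym[OF assms] eqm_refl)
  finally show ?thesis by simp
qed

text \<open>With equal flags at the two ends, antisymmetry makes the sum congruent to its own
  negative; characteristic 0 permits the division by 2.\<close>

lemma XX_diag: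
  assumes g: "is_graph \<Gamma>" and v: "v \<in> normals \<Gamma>" and x: "x \<in> chainsG \<Gamma>"
  shows "eqm HR (XX \<Gamma> r r q v x) 0"
proof -
  let ?X = "XX \<Gamma> r r q v x"
  have "?X = scale (1 / 2) (?X + ?X)"
    by (simp add: free.scale_right_distrib flip: free.scale_left_distrib)
  also have "eqm HR \<dots> (scale (1 / 2) (- ?X + ?X))"
    by (intro eqm_scale eqm_add XX_antisym[OF assms] eqm_refl)
  finally show ?thesis by simp
qed

text \<open>\<open>?A\<close> has two special ends and vanishes by antisymmetry. In
  \<open>?B\<close> and \<open>?C\<close> the middle vertex and one end are special; they differ in
  the end that is split off first. In \<open>?C\<close> this is the normal end, so its second step
  splits a vertex into two special ones, as in the A-infinity relation.\<close>

lemma EE_L: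
  assumes g: "is_graph \<Gamma>" and v: "v \<in> normals \<Gamma>" and x: "x \<in> chainsG \<Gamma>"
  shows "eqm HR (EE \<Gamma> True False True v x + EE \<Gamma> False True True v x) (- EE \<Gamma> True True False v x)"
proof -
  let ?A = "XX \<Gamma> True True False v x" and ?B = "XX \<Gamma> True False True v x" and ?C = "XX \<Gamma> False True True v x"
  have half: "scale (1 / 2) (z + z) = z" for z :: "('k, 'w) chain"
    by (simp add: free.scale_right_distrib flip: free.scale_left_distrib)
  have "eqm HR (EE \<Gamma> True False True v x + EE \<Gamma> False True True v x) (scale (1 / 2) (?A + ?B) + scale (1 / 2) (?B + ?A))"
    by (intro eqm_add EE_XX[OF assms])
  also have "\<dots> = ?A + ?B"
    using half[of "?A + ?B"] by (simp add: free.scale_right_distrib add_ac)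
  also have "eqm HR \<dots> (0 + - ?C)"
    by (intro eqm_add XX_diag[OF assms] XX_antisym[OF assms])
  also have "0 + - ?C = - scale (1 / 2) (?C + ?C)" unfolding half by simp
  also have "eqm HR \<dots> (- EE \<Gamma> True True False v x)"
    by (intro eqm_neg eqm_sym[OF EE_XX[OF assms]])
  finally show ?thesis .
qed

section \<open>The operators on decorations of a fixed graph\<close>

text \<open>Both sides group the same index set, the decompositions of orderings of \<open>v\<close>
  into two nonempty words \<open>A\<close> and \<open>B\<close>: on the left by the last letters of
  \<open>B\<close> and \<open>A\<close>, on the right by the set of letters of
  \<open>A\<close>.\<close>

lemma sum_orderings:
  fixes g :: "'a list \<Rightarrow> 'a list \<Rightarrow> 'c::comm_monoid_add"
  assumes fv: "finite v"
  shows "(\<Sum>(h1, h2)\<in>{(h1, h2). h1 \<in> v \<and> h2 \<in> v \<and> h1 \<noteq> h2}.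
      \<Sum>(A, B)\<in>{(A, B). A @ B \<in> perms v \<and> A \<noteq> [] \<and> B \<noteq> [] \<and> last B = h1 \<and> last A = h2}. g A B) =
    (\<Sum>S\<in>{S. S \<subseteq> v \<and> S \<noteq> {} \<and> S \<noteq> v}. \<Sum>A\<in>perms S. \<Sum>B\<in>perms (v - S). g A B)"
proof -
  let ?Z = "{(A, B). A @ B \<in> perms v \<and> A \<noteq> [] \<and> B \<noteq> []}"
  let ?P = "{S. S \<subseteq> v \<and> S \<noteq> {} \<and> S \<noteq> v}"
  let ?H = "{(h1, h2). h1 \<in> v \<and> h2 \<in> v \<and> h1 \<noteq> h2}"
  have "?Z \<subseteq> {A. set A \<subseteq> v \<and> length A \<le> card v} \<times> {A. set A \<subseteq> v \<and> length A \<le> card v}"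
    by (auto simp: perms_def distinct_card[symmetric] intro!: card_mono)
  then have fZ: "finite ?Z"
    by (rule finite_subset) (intro finite_cartesian_product finite_lists_length_le fv)
  have "?H \<subseteq> v \<times> v" by auto
  then have fH: "finite ?H" by (rule finite_subset) (simp add: fv)
  have "(\<lambda>(A, B). (last B, last A)) ` ?Z \<subseteq> ?H"
  proof clarsimp
    fix A B assume *: "A @ B \<in> perms v" "A \<noteq> []" "B \<noteq> []"
    then have "last A \<in> set A" "last B \<in> set B" "set A \<union> set B = v" "set A \<inter> set B = {}"
      by (auto simp: perms_def)
    then show "last B \<in> v \<and> last A \<in> v \<and> last B \<noteq> last A" by auto
  qed
  from sum.group[OF fZ fH this, of "\<lambda>(A, B). g A B"]
  have 1: "(\<Sum>(A, B)\<in>?Z. g A B) = (\<Sum>y\<in>?H. \<Sum>(A, B)\<in>{x \<in> ?Z. (case x of (A, B) \<Rightarrow> (last B, last A)) = y}. g A B)" ..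
  have fP: "finite ?P" using fv by simp
  have "(\<lambda>(A, B). set A) ` ?Z \<subseteq> ?P"
  proof clarsimp
    fix A B assume *: "A @ B \<in> perms v" "A \<noteq> []" "B \<noteq> []"
    then have B: "set B \<noteq> {}" and v: "v = set A \<union> set B" and d: "set A \<inter> set B = {}"
      by (simp_all add: perms_def)
    show "set A \<subseteq> v \<and> set A \<noteq> v" unfolding v using B d by (metis Un_upper1 inf_sup_absorb inf_commute Un_commute)
  qed
  from sum.group[OF fZ fP this, of "\<lambda>(A, B). g A B"]
  have 2: "(\<Sum>(A, B)\<in>?Z. g A B) = (\<Sum>S\<in>?P. \<Sum>(A, B)\<in>{x \<in> ?Z. (case x of (A, B) \<Rightarrow> set A) = S}. g A B)" ..
  have "{x \<in> ?Z. (case x of (A, B) \<Rightarrow> set A) = S} = perms S \<times> perms (v - S)"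
    if "S \<in> ?P" for S
    using that by (auto simp: perms_def)
  then have 3: "(\<Sum>(A, B)\<in>?Z. g A B) = (\<Sum>S\<in>?P. \<Sum>A\<in>perms S. \<Sum>B\<in>perms (v - S). g A B)"
    unfolding 2 by (intro sum.cong refl) (simp add: sum.cartesian_product)
  have 4: "{x \<in> ?Z. (case x of (A, B) \<Rightarrow> (last B, last A)) = y} =
     (case y of (h1, h2) \<Rightarrow> {(A, B). A @ B \<in> perms v \<and> A \<noteq> [] \<and> B \<noteq> [] \<and> last B = h1 \<and> last A = h2})" for y
    by (auto split: prod.splits)
  show ?thesis
    unfolding 3[symmetric] 1 4 by (rule sum.cong[OF refl]) (simp only: split_paired_all prod.case)
qed

text \<open>The operator \<open>F\<close> depends on the two new vertices, and these are determined
  by \<open>S\<close>; it can therefore be pulled out of the sums over orderings once these are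
  grouped by \<open>S\<close>.\<close>

lemma d_vertex_eq:
  assumes D: "(\<Gamma>, os, ws, ss, ns) \<in> DG" and v: "v \<in> normals \<Gamma>" and F: "\<And>u w. lin (F u w)"
  shows "d_vertex F N W v (\<Gamma>, os, ws, ss, ns) = scale (1 / 2) (\<Sum>a\<in>AD. \<Sum>S\<in>proper v.
    F (vert1 \<Gamma> S) (vert2 \<Gamma> v S) (Sp a v S (gen (\<Gamma>, os, ws, ss, ns))))"
proof -
  let ?s = "(\<Gamma>, os, ws, ss, ns)" and ?n = "new_half \<Gamma>"
  have g: "is_graph \<Gamma>" using D by (simp add: DG_iff)
  have fv: "finite v" using vert_finite[OF g normal_vert[OF v]] .
  have "(\<Sum>(h1, h2)\<in>{(h1, h2). h1 \<in> v \<and> h2 \<in> v \<and> h1 \<noteq> h2}. d_half F N a v h1 h2 ?s) =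
    (\<Sum>S\<in>proper v. F (insert ?n S) (insert (Suc ?n) (v - S)) (Sp a v S (gen ?s)))" for a
    unfolding d_half_def prod.case sum_orderings[OF fv] proper_def
  proof (intro sum.cong refl)
    fix S assume "S \<in> {S. S \<subseteq> v \<and> S \<noteq> {} \<and> S \<noteq> v}"
    let ?F = "F (insert ?n S) (insert (Suc ?n) (v - S))"
    have "scale (coeff (entry v ns) (A @ B)) (F (set (A @ [?n])) (set (Suc ?n # B)) (split_term N a v A B ?s)) =
       ?F (scale (coeff (entry v ns) (A @ B)) (split_term N a v A B ?s))"
      if "A \<in> perms S" "B \<in> perms (v - S)" for A B
      using that by (simp add: lin_scale[OF F] perms_def)
    then have "(\<Sum>A\<in>perms S. \<Sum>B\<in>perms (v - S).
        scale (coeff (entry v ns) (A @ B)) (F (set (A @ [?n])) (set (Suc ?n # B)) (split_term N a v A B ?s))) =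
      ?F (\<Sum>A\<in>perms S. \<Sum>B\<in>perms (v - S).
        scale (coeff (entry v ns) (A @ B)) (split_term N a v A B ?s))"
      by (simp add: lin_sum[OF F])
    also have "(\<Sum>A\<in>perms S. \<Sum>B\<in>perms (v - S).
        scale (coeff (entry v ns) (A @ B)) (split_term N a v A B ?s)) = Sp a v S (gen ?s)"
      unfolding Sp_gen split_sum_def free.scale_sum_right
    proof (intro sum.cong refl)
      fix A B assume AB: "A \<in> perms S" "B \<in> perms (v - S)"
      then have "split_graph N a v A B \<Gamma> = sgraph N a v S \<Gamma>"
        by (intro split_graph_eq) (auto simp: perms_def)
      then show "scale (coeff (entry v ns) (A @ B)) (split_term N a v A B ?s) =
        scale ((- 1) ^ length ss * front_sgn (vdeg N \<Gamma>) v ns) (scale (coeff (entry v ns) (A @ B))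
          (gen (sgraph N a v S \<Gamma>, os @ [({?n, Suc ?n}, gen [?n, Suc ?n])], ws, ss,
            (insert ?n S, cyc (hdeg (sgraph N a v S \<Gamma>)) (A @ [?n])) #
            (insert (Suc ?n) (v - S), cyc (hdeg (sgraph N a v S \<Gamma>)) (Suc ?n # B)) # others v ns)))"
        using AB by (simp add: split_term_def Let_def perms_def mult.commute del: sgraph_simps)
    qed
    finally show "(\<Sum>A\<in>perms S. \<Sum>B\<in>perms (v - S).
        scale (coeff (entry v ns) (A @ B)) (F (set (A @ [?n])) (set (Suc ?n # B)) (split_term N a v A B ?s))) =
        ?F (Sp a v S (gen ?s))" .
  qed
  then show ?thesis unfolding d_vertex_def AD_def by simp
qed

lemma d_vertex_DD:
  assumes D: "s \<in> DG" and v: "v \<in> normals (fst s)"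
  shows "d_vertex (\<lambda>v' v'' x. x) N W v s = DD (fst s) False False v (gen s)"
    and "d_vertex (\<lambda>v' v'' x. op_iv N v' (op_iv N v'' x)) N W v s = DD (fst s) True True v (gen s)"
    and "d_vertex (\<lambda>v' v'' x. op_iv N v' x + op_iv N v'' x) N W v s =
      DD (fst s) True False v (gen s) + DD (fst s) False True v (gen s)"
proof -
  obtain \<Gamma> os ws ss ns where s: "s = (\<Gamma>, os, ws, ss, ns)" by (cases s)
  note e = d_vertex_eq[OF D[unfolded s] v[unfolded s fst_conv]]
  show "d_vertex (\<lambda>v' v'' x. x) N W v s = DD (fst s) False False v (gen s)"
    unfolding s fst_conv by (subst e) (simp_all add: lin_id DD_def Dt_def I_def)
  show "d_vertex (\<lambda>v' v'' x. op_iv N v' (op_iv N v'' x)) N W v s = DD (fst s) True True v (gen s)"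
    unfolding s fst_conv by (subst e) (simp_all add: lin_compose[OF lin_op_iv lin_op_iv] DD_def Dt_def I_def)
  show "d_vertex (\<lambda>v' v'' x. op_iv N v' x + op_iv N v'' x) N W v s =
      DD (fst s) True False v (gen s) + DD (fst s) False True v (gen s)"
    unfolding s fst_conv
    by (subst e) (simp_all add: lin_plus_op lin_op_iv DD_def Dt_def I_def sum.distrib free.scale_right_distrib)
qed

section \<open>Decomposition of d and L over the vertices of a graph\<close>

lemma lin_op_d: "lin (op_d N W)"
  unfolding op_d_def by (rule lin_lin_ext)

lemma lin_op_i: "lin (op_i N)"
  unfolding op_i_def by (rule lin_lin_ext)

lemma lin_op_L: "lin (op_L N W)"
  unfolding op_L_def by (intro lin_minus_op lin_compose[OF lin_op_d lin_op_i] lin_compose[OF lin_op_i lin_op_d])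

lemma op_d_chainsG: "x \<in> chainsG \<Gamma> \<Longrightarrow> op_d N W x = (\<Sum>v\<in>normals \<Gamma>. DD \<Gamma> False False v x)"
  by (rule chainsG_eq[OF lin_op_d lin_sum_op[OF lin_DD]]) (auto simp: op_d_def d_vertex_DD)

lemma op_i_chainsG: "x \<in> chainsG \<Gamma> \<Longrightarrow> op_i N x = (\<Sum>v\<in>normals \<Gamma>. op_iv N v x)"
  by (rule chainsG_eq[OF lin_op_i lin_sum_op[OF lin_op_iv]]) (auto simp: op_i_def op_iv_def)

lemma sum_distinct_swap:
  "finite A \<Longrightarrow> (\<Sum>v\<in>A. \<Sum>w\<in>A - {v}. f v w) = (\<Sum>w\<in>A. \<Sum>v\<in>A - {w}. f v w :: 'c::comm_monoid_add)"
proof -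
  assume "finite A"
  then have "(\<Sum>v\<in>A. \<Sum>w\<in>{w \<in> A. v \<noteq> w}. f v w) = (\<Sum>w\<in>A. \<Sum>v\<in>{v \<in> A. v \<noteq> w}. f v w)"
    by (intro sum.swap_restrict)
  moreover have "{w \<in> A. v \<noteq> w} = A - {v}" "{w \<in> A. w \<noteq> v} = A - {v}" for v by auto
  ultimately show ?thesis by simp
qed

lemma sum_normals_sgraph:
  assumes s: "splittable a v S \<Gamma>"
  shows "(\<Sum>w\<in>normals (sgraph N a v S \<Gamma>). f w) = (\<Sum>w\<in>normals \<Gamma> - {v}. f w) +
     (f (vert1 \<Gamma> S) + f (vert2 \<Gamma> v S) :: 'c::comm_monoid_add)"
proof -
  note sD = splittableD[OF s]
  have "(normals \<Gamma> - {v}) \<inter> {vert1 \<Gamma> S, vert2 \<Gamma> v S} = {}"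
    using new_verts_sgraph[OF s] normal_vert by blast
  then show ?thesis
    unfolding normals_sgraph[OF s]
    by (subst sum.union_disjoint) (use finite_normals[OF sD(1)] new_normals(3)[OF s] normal_vert new_verts_sgraph[OF s] in auto)
qed

lemma op_L_chainsG:
  assumes x: "x \<in> chainsG \<Gamma>"
  shows "op_L N W x = (\<Sum>v\<in>normals \<Gamma>. DD \<Gamma> True False v x + DD \<Gamma> False True v x)"
proof (cases "is_graph \<Gamma>")
  case g: True
  let ?n = "new_half \<Gamma>"
  let ?f = "\<lambda>v w. scale (1 / 2) (\<Sum>a\<in>AD. \<Sum>S\<in>proper v. Sp a v S (op_iv N w x))"
  have "op_i N (op_d N W x) = (\<Sum>v\<in>normals \<Gamma>. scale (1 / 2) (\<Sum>a\<in>AD. \<Sum>S\<in>proper v. op_i N (Sp a v S x)))"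
    unfolding op_d_chainsG[OF x] DD_def Dt_def I_def if_False
    unfolding lin_sum[OF lin_op_i] lin_scale[OF lin_op_i] ..
  also have "\<dots> = (\<Sum>v\<in>normals \<Gamma>. scale (1 / 2) (\<Sum>a\<in>AD. \<Sum>S\<in>proper v. (\<Sum>w\<in>normals \<Gamma> - {v}. Sp a v S (op_iv N w x)) +
     (Dt \<Gamma> True False a v S x + Dt \<Gamma> False True a v S x)))"
  proof (intro sum.cong refl arg_cong[of _ _ "scale _"])
    fix v a S assume v: "v \<in> normals \<Gamma>" and aS: "a \<in> AD" "S \<in> proper v"
    note s = splittable_proper[OF g v aS]
    have "op_iv N w (Sp a v S x) = Sp a v S (op_iv N w x)" if "w \<in> normals \<Gamma> - {v}" for w
      using that by (intro op_iv_Sp[OF s _ _ x]) auto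
    then show "op_i N (Sp a v S x) = (\<Sum>w\<in>normals \<Gamma> - {v}. Sp a v S (op_iv N w x)) +
       (Dt \<Gamma> True False a v S x + Dt \<Gamma> False True a v S x)"
      unfolding op_i_chainsG[OF Sp_chainsG[OF s x]] sum_normals_sgraph[OF s] by (simp add: Dt_def I_def)
  qed
  also have "\<dots> = (\<Sum>v\<in>normals \<Gamma>. (\<Sum>w\<in>normals \<Gamma> - {v}. ?f v w) + (DD \<Gamma> True False v x + DD \<Gamma> False True v x))"
  proof (intro sum.cong refl)
    fix v
    have "(\<Sum>a\<in>AD. \<Sum>S\<in>proper v. \<Sum>w\<in>normals \<Gamma> - {v}. Sp a v S (op_iv N w x)) =
       (\<Sum>w\<in>normals \<Gamma> - {v}. \<Sum>a\<in>AD. \<Sum>S\<in>proper v. Sp a v S (op_iv N w x))"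
      by (simp only: sum.swap[of _ "normals \<Gamma> - {v}"])
    then show "scale (1 / 2) (\<Sum>a\<in>AD. \<Sum>S\<in>proper v. (\<Sum>w\<in>normals \<Gamma> - {v}. Sp a v S (op_iv N w x)) +
     (Dt \<Gamma> True False a v S x + Dt \<Gamma> False True a v S x)) = (\<Sum>w\<in>normals \<Gamma> - {v}. ?f v w) + (DD \<Gamma> True False v x + DD \<Gamma> False True v x)"
      by (simp only: sum.distrib DD_def free.scale_right_distrib free.scale_sum_right[of _ _ "normals \<Gamma> - {v}"])
  qed
  finally have 1: "op_i N (op_d N W x) = (\<Sum>v\<in>normals \<Gamma>. \<Sum>w\<in>normals \<Gamma> - {v}. ?f v w) +
     (\<Sum>v\<in>normals \<Gamma>. DD \<Gamma> True False v x + DD \<Gamma> False True v x)" by (simp only: sum.distrib)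
  have "op_d N W (op_i N x) = (\<Sum>w\<in>normals \<Gamma>. op_d N W (op_iv N w x))"
    unfolding op_i_chainsG[OF x] by (simp add: lin_sum[OF lin_op_d])
  also have "\<dots> = (\<Sum>w\<in>normals \<Gamma>. \<Sum>v\<in>normals \<Gamma> - {w}. ?f v w)"
    by (intro sum.cong refl) (simp add: op_d_chainsG[OF op_iv_chainsG[OF x]] DD_def Dt_def I_def)
  also have "\<dots> = (\<Sum>v\<in>normals \<Gamma>. \<Sum>w\<in>normals \<Gamma> - {v}. ?f v w)"
    by (rule sum_distinct_swap[symmetric]) (rule finite_normals[OF g])
  finally show ?thesis unfolding op_L_def 1 by simp
next
  case False
  then have "x = 0" using chainsG_no_graph x by blast
  then show ?thesis by (simp add: lin_0[OF lin_op_L] lin_0[OF lin_DD])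
qed

text \<open>The contribution of one vertex to \<open>L\<close> if \<open>m\<close> holds, to
  \<open>d\<close> otherwise. A single flag lets both operators share the later arguments and
  includes the mixed compositions.\<close>

definition DM :: "bool \<Rightarrow> ngraph \<Rightarrow> nat set \<Rightarrow> ('k, 'w) chain \<Rightarrow> ('k, 'w) chain" where
  "DM m \<Gamma> v x = (if m then DD \<Gamma> True False v x + DD \<Gamma> False True v x else DD \<Gamma> False False v x)"

definition op :: "bool \<Rightarrow> ('k, 'w) chain \<Rightarrow> ('k, 'w) chain" where
  "op m = (if m then op_L N W else op_d N W)"

lemma lin_op: "lin (op m)"
  by (simp add: op_def lin_op_L lin_op_d)

lemma lin_DM: "lin (DM m \<Gamma> v)"
  unfolding DM_def by (cases m) (simp_all add: lin_plus_op lin_DD)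

lemma op_chainsG: "x \<in> chainsG \<Gamma> \<Longrightarrow> op m x = (\<Sum>v\<in>normals \<Gamma>. DM m \<Gamma> v x)"
  by (simp add: op_def DM_def op_L_chainsG op_d_chainsG)

lemma DM_LH: "v \<in> normals \<Gamma> \<Longrightarrow> eqm (LH \<Gamma>) x y \<Longrightarrow> eqm HR (DM m \<Gamma> v x) (DM m \<Gamma> v y)"
  by (cases m) (simp_all add: DM_def DD_LH eqm_add)

lemma DM_iso: "giso \<phi> \<Gamma> \<Gamma>' \<Longrightarrow> v \<in> normals \<Gamma> \<Longrightarrow> x \<in> chainsG \<Gamma> \<Longrightarrow>
    eqm HR (DM m \<Gamma>' (\<phi> ` v) (trl \<phi> \<Gamma>' x)) (DM m \<Gamma> v x)"
  by (cases m) (simp_all add: DM_def DD_iso eqm_add)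

end

text \<open>Multilinearity replaces the entries one after another by combinations of elements of
  \<open>G\<close>; \<open>pre\<close> is the part of the word already treated.\<close>

lemma words_span:
  fixes G :: "'u \<Rightarrow> ('v \<Rightarrow>\<^sub>0 'k::field) set"
  assumes A: "\<And>u. A u = free.span (G u)" and xs: "xs \<in> words U A"
  obtains y where "y \<in> free.span (gen ` words U G)" "eqm (product_rels scale U A B sg) (gen xs) y"
proof -
  let ?R = "product_rels scale U A B sg"
  let ?ok = "\<lambda>xs. \<exists>y\<in>free.span (gen ` words U G). eqm ?R (gen xs) y"
  have GA: "c \<in> G u \<Longrightarrow> c \<in> A u" for c u by (simp add: A free.span_base)
  have "pre @ post \<in> words U A \<Longrightarrow> (\<forall>p\<in>set pre. snd p \<in> G (fst p)) \<Longrightarrow> ?ok (pre @ post)" for pre post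
  proof (induction post arbitrary: pre)
    case Nil
    then have "pre \<in> words U G" by (auto simp: words_iff)
    then show ?case by (auto intro!: bexI[of _ "gen pre"] free.span_base)
  next
    case (Cons p post)
    obtain u c where p: "p = (u, c)" by (cases p)
    have w: "pre @ (u, c') # post \<in> words U A" if "c' \<in> A u" for c'
      using Cons.prems(1) that unfolding p words_iff by auto
    have "c \<in> free.span (G u)" using Cons.prems(1) unfolding p words_iff A by auto
    then have "c \<in> A u \<and> ?ok (pre @ (u, c) # post)"
    proof (induction rule: free.span_induct_alt)
      case base
      have 0: "(0 :: 'v \<Rightarrow>\<^sub>0 'k) \<in> A u" by (simp add: A free.span_zero)
      \<comment> \<open>By linearity a word with a zero entry is congruent to twice itself, hence to
        0.\<close>
      have "eqm ?R (gen (pre @ (u, 0) # post)) (gen (pre @ (u, 0) # post) + gen (pre @ (u, 0) # post))"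
        using product_rels_lin[OF w[OF 0] w[OF 0], where sc = scale and c = 1 and B = B and sg = sg] by simp
      from eqm_diff[OF this eqm_refl[of _ "gen (pre @ (u, 0) # post)"]]
      have "eqm ?R 0 (gen (pre @ (u, 0) # post))" by simp
      then show ?case using 0 by (intro conjI bexI[of _ 0] eqm_sym[of _ 0]) (auto simp: free.span_zero)
    next
      case (step k x y)
      have x: "x \<in> A u" using GA step(1) .
      have "?ok (pre @ (u, x) # post)"
        using Cons.IH[of "pre @ [(u, x)]"] w[OF x] Cons.prems(2) step(1) by auto
      then obtain z where z: "z \<in> free.span (gen ` words U G)" "eqm ?R (gen (pre @ (u, x) # post)) z" by blast
      obtain z' where z': "z' \<in> free.span (gen ` words U G)" "eqm ?R (gen (pre @ (u, y) # post)) z'" using step(2) by blast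
      show ?case
      proof
        have y: "y \<in> A u" using step(2) by blast
        then show "scale k x + y \<in> A u" using x by (simp add: A free.span_add free.span_scale)
        have "eqm ?R (gen (pre @ (u, scale k x + y) # post)) (scale k (gen (pre @ (u, x) # post)) + gen (pre @ (u, y) # post))"
          by (rule product_rels_lin[OF w[OF x] w[OF y]])
        also have "eqm ?R \<dots> (scale k z + z')" by (intro eqm_add eqm_scale z z')
        finally show "?ok (pre @ (u, scale k x + y) # post)"
          using z z' by (blast intro: free.span_add free.span_scale)
      qed
    qed
    then show ?case using p by simp
  qed
  from this[of "[]" xs] xs show ?thesis using that by auto
qed

lemma product_rels_span:
  assumes "r \<in> product_rels sc U A B sg" "\<And>u c x y. x \<in> A u \<Longrightarrow> y \<in> A u \<Longrightarrow> sc c x + y \<in> A u"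
  shows "r \<in> free.span (gen ` words U A)"
proof -
  have 1: "xs @ (u, sc c x + y) # ys \<in> words U A"
    if "xs @ (u, x) # ys \<in> words U A" "xs @ (u, y) # ys \<in> words U A" for xs u c x y ys
    using that assms(2) by (auto simp: words_iff)
  have 2: "xs @ q # p # ys \<in> words U A" if "xs @ p # q # ys \<in> words U A" for xs p q ys
    by (rule words_permute[OF _ that]) simp
  show ?thesis
    using assms(1) unfolding product_rels_def
    by (elim UnE CollectE exE conjE; hypsubst)
      ((rule free.span_diff free.span_scale free.span_base imageI | assumption | erule (1) 1 | erule 2)+)
qed

lemma words_map:
  assumes "xs \<in> words U A" "inj_on \<phi> U" "\<And>u x. u \<in> U \<Longrightarrow> x \<in> A u \<Longrightarrow> f x \<in> A' (\<phi> u)"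
  shows "map (map_prod \<phi> f) xs \<in> words (\<phi> ` U) A'"
proof -
  have "distinct (map \<phi> (map fst xs))"
    using assms(1,2) comp_inj_on[of fst "set xs" \<phi>] by (simp add: words_iff distinct_map)
  then show ?thesis
    using assms by (auto simp: words_iff image_image comp_def dest: bspec)
qed

lemma map_permutations: "inj_on \<phi> u \<Longrightarrow> us \<in> perms u \<Longrightarrow> map \<phi> us \<in> perms (\<phi> ` u)"
  by (auto simp: perms_def distinct_map)

context graph_complex
begin

section \<open>Relations preserved by the operators\<close>

text \<open>The decomposition of an operator into vertex terms is available on
  \<open>chainsG\<close>. To apply it to a relation, the relation must be known to consist of
  well-formed decorations of one graph.\<close>

lemma TR_chainsG:
  assumes g: "is_graph \<Gamma>" and r: "r \<in> TR \<Gamma>"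
  shows "r \<in> chainsG \<Gamma>"
proof -
  interpret W: vector_space scW by (rule vsW)
  have O: "scale c x + y \<in> O_space u" if "x \<in> O_space u" "y \<in> O_space u" for c u and x y :: "nat list \<Rightarrow>\<^sub>0 'k"
    using that by (simp add: O_space_def free.span_add free.span_scale)
  have C: "scale c x + y \<in> Cyc \<delta> u" if "x \<in> Cyc \<delta> u" "y \<in> Cyc \<delta> u" for c \<delta> u and x y :: "nat list \<Rightarrow>\<^sub>0 'k"
    using that by (simp add: Cyc_def free.span_add free.span_scale)
  have Ws: "scW c x + y \<in> W a" if "x \<in> W a" "y \<in> W a" for c x y a
    using that subspaceW[of a] by (simp add: W.subspace_add W.subspace_scale)
  have ext: "lin_ext f r \<in> chainsG \<Gamma>"
    if "r \<in> free.span (gen ` S)" "\<And>s. s \<in> S \<Longrightarrow> f s \<in> chainsG \<Gamma>" for f r and S :: "'c set"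
    unfolding chainsG_def by (rule lin_span[OF lin_lin_ext _ that(1)]) (auto simp: that(2)[unfolded chainsG_def])
  have D: "gen (\<Gamma>, os, ws, ss, ns) \<in> chainsG \<Gamma>"
    if "os \<in> edge_words \<Gamma>" "ws \<in> external_words N W \<Gamma>" "ss \<in> special_words \<Gamma>" "ns \<in> normal_words \<Gamma>" for os ws ss ns
    using that g by (intro gen_chainsG) (simp add: DG_iff)
  consider (os) q ws ss ns where "q \<in> EP \<Gamma>" "ws \<in> external_words N W \<Gamma>" "ss \<in> special_words \<Gamma>" "ns \<in> normal_words \<Gamma>"
      "r = lin_ext (\<lambda>os. gen (\<Gamma>, os, ws, ss, ns)) q"
    | (ws) q os ss ns where "q \<in> XP \<Gamma>" "os \<in> edge_words \<Gamma>" "ss \<in> special_words \<Gamma>" "ns \<in> normal_words \<Gamma>"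
      "r = lin_ext (\<lambda>ws. gen (\<Gamma>, os, ws, ss, ns)) q"
    | (ss) q os ws ns where "q \<in> SP \<Gamma>" "os \<in> edge_words \<Gamma>" "ws \<in> external_words N W \<Gamma>" "ns \<in> normal_words \<Gamma>"
      "r = lin_ext (\<lambda>ss. gen (\<Gamma>, os, ws, ss, ns)) q"
    | (ns) q os ws ss where "q \<in> NP \<Gamma>" "os \<in> edge_words \<Gamma>" "ws \<in> external_words N W \<Gamma>" "ss \<in> special_words \<Gamma>"
      "r = lin_ext (\<lambda>ns. gen (\<Gamma>, os, ws, ss, ns)) q"
    using r unfolding tensor_rels_def by blast
  then show ?thesis
  proof cases
    case os
    show ?thesis unfolding os(5)
      by (rule ext[OF product_rels_span[OF os(1) O]]) (use os D in \<open>auto simp: edge_words_def\<close>)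
  next
    case ws
    show ?thesis unfolding ws(5)
      by (rule ext[OF product_rels_span[OF ws(1) Ws]]) (use ws D in \<open>auto simp: external_words_def\<close>)
  next
    case ss
    show ?thesis unfolding ss(5)
      by (rule ext[OF product_rels_span[OF ss(1) C]]) (use ss D in \<open>auto simp: special_words_def\<close>)
  next
    case ns
    show ?thesis unfolding ns(5)
      by (rule ext[OF product_rels_span[OF ns(1) C]]) (use ns D in \<open>auto simp: normal_words_def\<close>)
  qed
qed

text \<open>Positivity condition (ii) is imposed on oriented graphs only. Multilinearity in the
  edge, special and normal factors reduces every decoration to orientations, provided that
  \<open>f\<close> respects the tensor relations.\<close>

lemma oriented_induct:
  assumes f: "lin f" and TR: "\<And>r. r \<in> TR \<Gamma> \<Longrightarrow> f r \<in> free.span R"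
    and ori: "\<And>s. s \<in> oriented_graphs N W \<Longrightarrow> fst s = \<Gamma> \<Longrightarrow> f (gen s) \<in> free.span R"
    and x: "x \<in> chainsG \<Gamma>"
  shows "f x \<in> free.span R"
proof (rule chainsG_image[OF f _ x])
  fix os ws ss ns assume D: "(\<Gamma>, os, ws, ss, ns) \<in> DG"
  let ?GO = "\<lambda>e. gen ` perms e :: 'k tensor set"
  let ?GC = "\<lambda>v. cyc (hdeg \<Gamma>) ` perms v :: 'k tensor set"
  have red: "f a \<in> free.span R" if "eqm (TR \<Gamma>) a b" "f b \<in> free.span R" for a b
    using eqm_in_span[OF eqm_lin[OF f TR that(1)] that(2)] .
  have ext: "f (lin_ext g y) \<in> free.span R"
    if "y \<in> free.span (gen ` S)" "\<And>s. s \<in> S \<Longrightarrow> f (g s) \<in> free.span R" for g y and S :: "'c set"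
    by (rule lin_span[OF lin_compose[OF lin_lin_ext f] _ that(1)]) (auto simp: that(2))
  have O: "os \<in> edge_words \<Gamma>" "ws \<in> external_words N W \<Gamma>" "ss \<in> special_words \<Gamma>" "ns \<in> normal_words \<Gamma>" "is_graph \<Gamma>"
    using D by (auto simp: DG_iff)
  have OS: "O_space u = free.span (?GO u)" "Cyc (hdeg \<Gamma>) u = free.span (?GC u)" for u
    by (simp_all add: O_space_def Cyc_def)
  have sub: "words U ?GO \<subseteq> words U O_space" "words U ?GC \<subseteq> words U (Cyc (hdeg \<Gamma>))" for U
    unfolding words_iff[abs_def] OS by (auto simp: words_iff intro!: free.span_base dest: bspec)
  obtain yo where yo: "yo \<in> free.span (gen ` words (edges \<Gamma>) ?GO)" "eqm (EP \<Gamma>) (gen os) yo"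
    using words_span[of O_space ?GO os "edges \<Gamma>"] O(1) OS(1) unfolding edge_words_def by blast
  obtain ys where ys: "ys \<in> free.span (gen ` words (specials \<Gamma>) ?GC)" "eqm (SP \<Gamma>) (gen ss) ys"
    using words_span[of "Cyc (hdeg \<Gamma>)" ?GC ss "specials \<Gamma>"] O(3) OS(2) unfolding special_words_def by blast
  obtain yn where yn: "yn \<in> free.span (gen ` words (normals \<Gamma>) ?GC)" "eqm (NP \<Gamma>) (gen ns) yn"
    using words_span[of "Cyc (hdeg \<Gamma>)" ?GC ns "normals \<Gamma>"] O(4) OS(2) unfolding normal_words_def by blast
  show "f (gen (\<Gamma>, os, ws, ss, ns)) \<in> free.span R"
  proof (rule red[OF TR_os[OF yo(2) O(2-4), unfolded lin_ext_gen]], rule ext[OF yo(1)])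
    fix os' assume os': "os' \<in> words (edges \<Gamma>) ?GO"
    then have o1: "os' \<in> edge_words \<Gamma>" using sub by (auto simp: edge_words_def)
    show "f (gen (\<Gamma>, os', ws, ss, ns)) \<in> free.span R"
    proof (rule red[OF TR_ss[OF ys(2) o1 O(2,4), unfolded lin_ext_gen]], rule ext[OF ys(1)])
      fix ss' assume ss': "ss' \<in> words (specials \<Gamma>) ?GC"
      then have s1: "ss' \<in> special_words \<Gamma>" using sub by (auto simp: special_words_def)
      show "f (gen (\<Gamma>, os', ws, ss', ns)) \<in> free.span R"
      proof (rule red[OF TR_ns[OF yn(2) o1 O(2) s1, unfolded lin_ext_gen]], rule ext[OF yn(1)])
        fix ns' assume ns': "ns' \<in> words (normals \<Gamma>) ?GC"
        then have n1: "ns' \<in> normal_words \<Gamma>" using sub by (auto simp: normal_words_def)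
        have "(\<Gamma>, os', ws, ss', ns') \<in> oriented_graphs N W"
          unfolding oriented_graphs_def using o1 s1 n1 O(2,5) os' ss' ns'
          by (auto simp: DG_iff words_def)
        then show "f (gen (\<Gamma>, os', ws, ss', ns')) \<in> free.span R" by (intro ori) auto
      qed
    qed
  qed
qed

lemma trl_chainsG:
  assumes iso: "giso \<phi> \<Gamma> \<Gamma>'" and x: "x \<in> chainsG \<Gamma>"
  shows "trl \<phi> \<Gamma>' x \<in> chainsG \<Gamma>'"
  unfolding chainsG_def
proof (rule chainsG_image[OF lin_trl _ x])
  fix os ws ss ns assume D: "(\<Gamma>, os, ws, ss, ns) \<in> DG"
  have g: "is_graph \<Gamma>" and ww: "os \<in> edge_words \<Gamma>" "ws \<in> external_words N W \<Gamma>" "ss \<in> special_words \<Gamma>" "ns \<in> normal_words \<Gamma>"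
    using D by (auto simp: DG_iff)
  have i: "graph_iso \<phi> \<Gamma> \<Gamma>'" and g': "is_graph \<Gamma>'" using iso g by (auto simp: giso_def)
  note if' = graph_iso_facts[OF i g]
  have injP: "inj_on ((`) \<phi>) U" if "\<And>u. u \<in> U \<Longrightarrow> u \<subseteq> halves \<Gamma>" for U
    using inj_on_image_eq_iff[OF if'(1)] that by (intro inj_onI) blast
  have eh: "u \<subseteq> halves \<Gamma>" if "u \<in> edges \<Gamma>" for u using edge_halves[OF g that] .
  have vh: "u \<subseteq> halves \<Gamma>" if "u \<in> verts \<Gamma>" for u using vert_halves[OF g that] .
  have dg: "hdeg \<Gamma>' (\<phi> h) = hdeg \<Gamma> h" if "h \<in> halves \<Gamma>" for h using i that by (auto simp: graph_iso_def)
  have im: "edges \<Gamma>' = (`) \<phi> ` edges \<Gamma>" "verts \<Gamma>' = (`) \<phi> ` verts \<Gamma>" "specials \<Gamma>' = (`) \<phi> ` specials \<Gamma>"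
    using i by (auto simp: graph_iso_def)
  have ex: "externals \<Gamma>' = (`) \<phi> ` externals \<Gamma>"
    unfolding externals_def im using if'(3) by auto
  have fO: "lin_ext (gen \<circ> map \<phi>) c \<in> (O_space (\<phi> ` u) :: 'k tensor set)" if "u \<in> edges \<Gamma>" "c \<in> O_space u" for u c
    using that(2) unfolding O_space_def
    by (rule lin_span[OF lin_lin_ext, rotated])
      (auto intro!: free.span_base imageI map_permutations inj_on_subset[OF if'(1) eh[OF that(1)]])
  have fC: "lin_ext (gen \<circ> map \<phi>) c \<in> (Cyc (hdeg \<Gamma>') (\<phi> ` u) :: 'k tensor set)" if "u \<in> verts \<Gamma>" "c \<in> Cyc (hdeg \<Gamma>) u" for u c
    using that(2) unfolding Cyc_def
  proof (rule lin_span[OF lin_lin_ext, rotated])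
    fix c :: "nat list \<Rightarrow>\<^sub>0 'k" assume "c \<in> cyc (hdeg \<Gamma>) ` perms u"
    then obtain us where us: "c = cyc (hdeg \<Gamma>) us" "us \<in> perms u" by blast
    then have su: "set us = u" by (simp add: perms_def)
    have inj: "inj_on \<phi> u" using inj_on_subset[OF if'(1) vh[OF that(1)]] .
    have "lin_ext (gen \<circ> map \<phi>) c = (cyc (hdeg \<Gamma>') (map \<phi> us) :: 'k tensor)"
      unfolding us(1) using inj dg vh[OF that(1)] by (intro cyc_map) (auto simp: su)
    then show "lin_ext (gen \<circ> map \<phi>) c \<in> free.span (cyc (hdeg \<Gamma>') ` perms (\<phi> ` u) :: 'k tensor set)"
      using map_permutations[OF inj us(2)] by (auto intro!: free.span_base)
  qed
  have "(\<Gamma>', tword \<phi> os, map (map_prod ((`) \<phi>) id) ws, tword \<phi> ss, tword \<phi> ns) \<in> DG"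
    unfolding DG_iff
  proof (intro conjI g')
    show "tword \<phi> os \<in> edge_words \<Gamma>'"
      unfolding edge_words_def im
      by (rule words_map[OF ww(1)[unfolded edge_words_def]]) (auto intro!: injP intro: fO dest: eh)
    show "map (map_prod ((`) \<phi>) id) ws \<in> external_words N W \<Gamma>'"
      unfolding external_words_def ex
      by (rule words_map[OF ww(2)[unfolded external_words_def]]) (auto intro!: injP simp: externals_def if'(2) dest: vh)
    show "tword \<phi> ss \<in> special_words \<Gamma>'"
      unfolding special_words_def im
      by (rule words_map[OF ww(3)[unfolded special_words_def]]) (auto intro!: injP intro: fC special_vert[OF g] dest: vh special_vert[OF g])
    show "tword \<phi> ns \<in> normal_words \<Gamma>'"
      unfolding normal_words_def if'(4)
      by (rule words_map[OF ww(4)[unfolded normal_words_def]]) (auto intro!: injP intro: fC normal_vert dest: vh normal_vert)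
  qed
  then show "trl \<phi> \<Gamma>' (gen (\<Gamma>, os, ws, ss, ns)) \<in> free.span (gen ` {s \<in> DG. fst s = \<Gamma>'})"
    unfolding trl_gen by (intro free.span_base) auto
qed

end

section \<open>Degrees of new vertices and the positivity relation\<close>

locale double_complex = graph_complex scW W N
  for scW :: "'k::field_char_0 \<Rightarrow> 'w::ab_group_add \<Rightarrow> 'w" and W :: "int \<Rightarrow> 'w set" and N :: int +
  fixes B :: "'w set" and P :: "'w \<Rightarrow> 'w \<Rightarrow> 'k"
begin

abbreviation RR :: "('k, 'w) chain set" where
  "RR \<equiv> com_rels scW N W B P \<union> positivity_rels N W"

lemma RR_span:
  "HR \<subseteq> free.span RR" "Ainf_rels N W \<subseteq> free.span RR" "cutoff_rels N W B P \<subseteq> free.span RR" "positivity_rels N W \<subseteq> free.span RR"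
  unfolding com_rels_def by (auto intro: free.span_base)

lemma HR_RR: "eqm HR x y \<Longrightarrow> eqm RR x y"
  by (erule eqm_mono) (rule RR_span)

lemma HR_in_span: "eqm HR x y \<Longrightarrow> y \<in> free.span RR \<Longrightarrow> x \<in> free.span RR"
  by (rule eqm_in_span[OF HR_RR])

lemma chainsG_pos:
  assumes "x \<in> chainsG \<Gamma>" "v \<in> normals \<Gamma>" "vdeg N \<Gamma> v \<le> 0"
  shows "x \<in> free.span RR"
proof (rule chainsG_image[OF lin_id _ assms(1)])
  fix os ws ss ns assume "(\<Gamma>, os, ws, ss, ns) \<in> DG"
  then have "gen (\<Gamma>, os, ws, ss, ns) \<in> positivity_rels N W"
    unfolding positivity_rels_def using assms(2,3) by force
  then show "gen (\<Gamma>, os, ws, ss, ns) \<in> free.span RR" using RR_span by blast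
qed

lemma Dg_vdeg: "vdeg N (Dg \<Gamma> p q a v S) = vdeg N (sgraph N a v S \<Gamma>)"
  by (simp add: Dg_def del: sgraph_simps)

lemma Dg_normals:
  assumes s: "splittable a v S \<Gamma>"
  shows "w \<in> normals \<Gamma> \<Longrightarrow> w \<noteq> v \<Longrightarrow> w \<in> normals (Dg \<Gamma> p q a v S)"
    and "\<not> p \<Longrightarrow> vert1 \<Gamma> S \<in> normals (Dg \<Gamma> p q a v S)"
    and "\<not> q \<Longrightarrow> vert2 \<Gamma> v S \<in> normals (Dg \<Gamma> p q a v S)"
proof -
  note nn = new_normals[OF s] and nv = new_verts_sgraph[OF s]
  show "w \<in> normals \<Gamma> \<Longrightarrow> w \<noteq> v \<Longrightarrow> w \<in> normals (Dg \<Gamma> p q a v S)"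
    using nv normal_vert[of w \<Gamma>] by (auto simp: Dg_def normals_sgraph[OF s])
  show "\<not> p \<Longrightarrow> vert1 \<Gamma> S \<in> normals (Dg \<Gamma> p q a v S)"
    using nn by (simp add: Dg_def)
  show "\<not> q \<Longrightarrow> vert2 \<Gamma> v S \<in> normals (Dg \<Gamma> p q a v S)"
    using nn by (simp add: Dg_def)
qed

lemma sum_normals_Dg:
  assumes s: "splittable a v S \<Gamma>"
  shows "(\<Sum>w\<in>normals (Dg \<Gamma> p q a v S). f w) = (\<Sum>w\<in>normals \<Gamma> - {v}. f w) +
    ((if p then 0 else f (vert1 \<Gamma> S)) + (if q then 0 else f (vert2 \<Gamma> v S)) :: 'c::ab_group_add)"
proof -
  let ?u = "vert1 \<Gamma> S" and ?w = "vert2 \<Gamma> v S"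
  let ?G = "sgraph N a v S \<Gamma>"
  note nn = new_normals[OF s]
  have fin: "finite (normals ?G)" by (rule finite_normals[OF is_graph_sgraph[OF s]])
  have "normals (Dg \<Gamma> p q a v S) = normals ?G - ((if p then {?u} else {}) \<union> (if q then {?w} else {}))"
    by (auto simp: Dg_def)
  then have "(\<Sum>w\<in>normals (Dg \<Gamma> p q a v S). f w) = (\<Sum>w\<in>normals ?G. f w) - (\<Sum>w\<in>(if p then {?u} else {}) \<union> (if q then {?w} else {}). f w)"
    using nn fin by (simp add: sum_diff)
  also have "\<dots> = (\<Sum>w\<in>normals \<Gamma> - {v}. f w) + ((if p then 0 else f ?u) + (if q then 0 else f ?w))"
    unfolding sum_normals_sgraph[OF s] using nn(3) by simp
  finally show ?thesis .
qed

text \<open>Where the marked graph satisfies the degree conditions, a marked new vertex is special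
  and so has degree -1. Since the two degrees add up to that of \<open>v\<close>, marking one of the
  new vertices fixes the degree of the other.\<close>

lemma Dg_markable:
  assumes s: "splittable a v S \<Gamma>" and g: "is_graph (Dg \<Gamma> p q a v S)"
  shows "p \<Longrightarrow> vdeg N (sgraph N a v S \<Gamma>) (vert1 \<Gamma> S) = - 1"
    and "q \<Longrightarrow> vdeg N (sgraph N a v S \<Gamma>) (vert2 \<Gamma> v S) = - 1"
proof -
  let ?u = "vert1 \<Gamma> S" and ?w = "vert2 \<Gamma> v S"
  let ?G = "sgraph N a v S \<Gamma>"
  note nn = new_normals[OF s]
  have u: "?u \<in> normals (Im q ?w ?G)" using nn by simp
  show "vdeg N ?G ?u = - 1" if p
    using g that u is_graph_mark_iff[OF u] unfolding Dg_def by (auto simp: Im_def markable_def split: if_splits)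
  have "is_graph (Im q ?w ?G)" using is_graph_Im[OF u] g unfolding Dg_def .
  then show "vdeg N ?G ?w = - 1" if q
    using that is_graph_mark_iff[OF nn(2)] by (simp add: Im_def markable_def)
qed

lemma Dt_zero: "splittable a v S \<Gamma> \<Longrightarrow> x \<in> chainsG \<Gamma> \<Longrightarrow> \<not> is_graph (Dg \<Gamma> p q a v S) \<Longrightarrow> Dt \<Gamma> p q a v S x = 0"
  using Dt_chainsG chainsG_no_graph by blast

text \<open>Terms whose target is not a graph vanish, so the degrees forced by the markings may be
  assumed in each term.\<close>

lemma DD_in_span:
  assumes x: "x \<in> chainsG \<Gamma>" and v: "v \<in> normals \<Gamma>"
    and D: "\<And>a S. splittable a v S \<Gamma> \<Longrightarrow> is_graph (Dg \<Gamma> p q a v S) \<Longrightarrow> Dt \<Gamma> p q a v S x \<in> free.span R"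
  shows "DD \<Gamma> p q v x \<in> free.span R"
proof (cases "is_graph \<Gamma>")
  case True
  have "Dt \<Gamma> p q a v S x \<in> free.span R" if "splittable a v S \<Gamma>" for a S
    by (cases "is_graph (Dg \<Gamma> p q a v S)") (simp_all add: D Dt_zero[OF that x] free.span_zero that)
  then show ?thesis
    unfolding DD_def using splittable_proper[OF True v] by (intro free.span_scale free.span_sum) blast
next
  case False
  then have "x = 0" using chainsG_no_graph x by blast
  then show ?thesis by (simp add: lin_0[OF lin_DD] free.span_zero)
qed

text \<open>In degree -2 this is the A-infinity relation. In any other degree the two new vertices
  cannot both have degree -1, and every term vanishes.\<close>

lemma DD_Ainf:
  assumes x: "x \<in> chainsG \<Gamma>" and v: "v \<in> normals \<Gamma>"
  shows "DD \<Gamma> True True v x \<in> free.span RR"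
proof (cases "vdeg N \<Gamma> v = - 2")
  case True
  show ?thesis
  proof (rule chainsG_image[OF lin_DD _ x])
    fix os ws ss ns assume D: "(\<Gamma>, os, ws, ss, ns) \<in> DG"
    have "DD \<Gamma> True True v (gen (\<Gamma>, os, ws, ss, ns)) \<in> Ainf_rels N W"
      unfolding Ainf_rels_def using D v True d_vertex_DD(2)[OF D, symmetric] by force
    then show "DD \<Gamma> True True v (gen (\<Gamma>, os, ws, ss, ns)) \<in> free.span RR" using RR_span by blast
  qed
next
  case False
  show ?thesis
  proof (rule DD_in_span[OF x v])
    fix a S assume s: "splittable a v S \<Gamma>" and g: "is_graph (Dg \<Gamma> True True a v S)"
    then have False using Dg_markable[OF s g] vdeg_sgraph_sum[OF s] \<open>vdeg N \<Gamma> v \<noteq> - 2\<close> by simp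
    then show "Dt \<Gamma> True True a v S x \<in> free.span RR" ..
  qed
qed

lemma DD_keep:
  assumes x: "x \<in> chainsG \<Gamma>" and v: "v \<in> normals \<Gamma>" and w: "w \<in> normals \<Gamma>" "w \<noteq> v" "vdeg N \<Gamma> w \<le> 0"
  shows "DD \<Gamma> p q v x \<in> free.span RR"
proof (rule DD_in_span[OF x v])
  fix a S assume s: "splittable a v S \<Gamma>"
  show "Dt \<Gamma> p q a v S x \<in> free.span RR"
    by (rule chainsG_pos[OF Dt_chainsG[OF s x] Dg_normals(1)[OF s w(1,2)]])
      (simp add: Dg_vdeg vdeg_sgraph_old[OF splittableD(1)[OF s] normal_vert[OF w(1)]] w(3))
qed

text \<open>Two integers with sum at most 1 are not both positive. The bound is 1 rather than 0 for
  the sake of condition (ii): if one part of a vertex of degree 0 becomes special, the other has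
  degree 1, and \<open>d\<close> splits it again.\<close>

lemma DM_False_pos:
  assumes x: "x \<in> chainsG \<Gamma>" and v: "v \<in> normals \<Gamma>" and d: "vdeg N \<Gamma> v \<le> 1"
  shows "DD \<Gamma> False False v x \<in> free.span RR"
proof (rule DD_in_span[OF x v])
  fix a S assume s: "splittable a v S \<Gamma>"
  let ?u = "vert1 \<Gamma> S" and ?w = "vert2 \<Gamma> v S"
  have "vdeg N (sgraph N a v S \<Gamma>) ?u \<le> 0 \<or> vdeg N (sgraph N a v S \<Gamma>) ?w \<le> 0"
    using vdeg_sgraph_sum[OF s] d by linarith
  then show "Dt \<Gamma> False False a v S x \<in> free.span RR"
    using chainsG_pos[OF Dt_chainsG[OF s x, of False False]] Dg_normals(2,3)[OF s, of False False] by (auto simp: Dg_vdeg)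
qed

text \<open>For \<open>L\<close> in degree 0 this is condition (ii), extended from oriented graphs
  to all decorations. Below 0, the new vertex that stays normal has degree
  \<open>vdeg N \<Gamma> v + 1 \<le> 0\<close>, so condition (i) applies term by term.\<close>

lemma DM_nonpos:
  assumes x: "x \<in> chainsG \<Gamma>" and v: "v \<in> normals \<Gamma>" and d: "vdeg N \<Gamma> v \<le> 0"
  shows "DM m \<Gamma> v x \<in> free.span RR"
proof (cases m)
  case False
  then show ?thesis using DM_False_pos[OF x v] d by (simp add: DM_def)
next
  case m: True
  show ?thesis
  proof (cases "vdeg N \<Gamma> v = 0")
    case True
    show ?thesis
    proof (cases "is_graph \<Gamma>")
      case g: True
      show ?thesis
      proof (rule oriented_induct[OF lin_DM _ _ x])
        fix r assume r: "r \<in> TR \<Gamma>"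
        then have "eqm (LH \<Gamma>) r 0" unfolding TR_LH[OF g] eqm_0_iff by (rule free.span_base)
        note e = DM_LH[OF v this, of m, unfolded lin_0[OF lin_DM]]
        show "DM m \<Gamma> v r \<in> free.span RR" by (rule HR_in_span[OF e free.span_zero])
      next
        fix s :: "('k, 'w) dgraph" assume s: "s \<in> oriented_graphs N W" "fst s = \<Gamma>"
        then have "s \<in> DG" by (auto simp: oriented_graphs_def)
        then have e: "DM m \<Gamma> v (gen s) = d_vertex (\<lambda>v' v'' x. op_iv N v' x + op_iv N v'' x) N W v s"
          using d_vertex_DD(3)[of s v] s(2) v m by (simp add: DM_def)
        have "DM m \<Gamma> v (gen s) \<in> positivity_rels N W"
          unfolding positivity_rels_def e using s v True by blast
        then show "DM m \<Gamma> v (gen s) \<in> free.span RR" using RR_span by blast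
      qed
    next
      case False
      then have "x = 0" using chainsG_no_graph x by blast
      then show ?thesis by (simp add: lin_0[OF lin_DM] free.span_zero)
    qed
  next
    case False
    then have d1: "vdeg N \<Gamma> v \<le> - 1" using d by simp
    have "DD \<Gamma> True False v x \<in> free.span RR"
    proof (rule DD_in_span[OF x v])
      fix a S assume s: "splittable a v S \<Gamma>" and g: "is_graph (Dg \<Gamma> True False a v S)"
      show "Dt \<Gamma> True False a v S x \<in> free.span RR"
        by (rule chainsG_pos[OF Dt_chainsG[OF s x] Dg_normals(3)[OF s]])
          (use Dg_markable[OF s g] vdeg_sgraph_sum[OF s] d1 in \<open>simp_all add: Dg_vdeg\<close>)
    qed
    moreover have "DD \<Gamma> False True v x \<in> free.span RR"
    proof (rule DD_in_span[OF x v])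
      fix a S assume s: "splittable a v S \<Gamma>" and g: "is_graph (Dg \<Gamma> False True a v S)"
      show "Dt \<Gamma> False True a v S x \<in> free.span RR"
        by (rule chainsG_pos[OF Dt_chainsG[OF s x] Dg_normals(2)[OF s]])
          (use Dg_markable[OF s g] vdeg_sgraph_sum[OF s] d1 in \<open>simp_all add: Dg_vdeg\<close>)
    qed
    ultimately show ?thesis using m by (simp add: DM_def free.span_add)
  qed
qed

section \<open>Composition of the operators\<close>

text \<open>The composition of \<open>DM m\<close> with \<open>DD \<Gamma> p q v\<close> splits either an old vertex \<open>w \<noteq> v\<close> (\<open>CC\<close>) or one of the
  two new vertices (\<open>NN\<close>).\<close>

definition CC :: "bool \<Rightarrow> ngraph \<Rightarrow> bool \<Rightarrow> bool \<Rightarrow> nat set \<Rightarrow> nat set \<Rightarrow> ('k, 'w) chain \<Rightarrow> ('k, 'w) chain" where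
  "CC m \<Gamma> p q v w x = scale (1 / 2) (\<Sum>a\<in>AD. \<Sum>S\<in>proper v. DM m (Dg \<Gamma> p q a v S) w (Dt \<Gamma> p q a v S x))"

definition NN :: "bool \<Rightarrow> ngraph \<Rightarrow> bool \<Rightarrow> bool \<Rightarrow> nat set \<Rightarrow> ('k, 'w) chain \<Rightarrow> ('k, 'w) chain" where
  "NN m \<Gamma> p q v x = scale (1 / 2) (\<Sum>a\<in>AD. \<Sum>S\<in>proper v.
     (if p then 0 else DM m (Dg \<Gamma> p q a v S) (vert1 \<Gamma> S) (Dt \<Gamma> p q a v S x)) +
     (if q then 0 else DM m (Dg \<Gamma> p q a v S) (vert2 \<Gamma> v S) (Dt \<Gamma> p q a v S x)))"

definition CM :: "bool \<Rightarrow> bool \<Rightarrow> ngraph \<Rightarrow> nat set \<Rightarrow> nat set \<Rightarrow> ('k, 'w) chain \<Rightarrow> ('k, 'w) chain" where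
  "CM m r \<Gamma> v w x = (if r then CC m \<Gamma> True False v w x + CC m \<Gamma> False True v w x else CC m \<Gamma> False False v w x)"

definition NM :: "bool \<Rightarrow> bool \<Rightarrow> ngraph \<Rightarrow> nat set \<Rightarrow> ('k, 'w) chain \<Rightarrow> ('k, 'w) chain" where
  "NM m r \<Gamma> v x = (if r then NN m \<Gamma> True False v x + NN m \<Gamma> False True v x else NN m \<Gamma> False False v x)"

lemma op_DD:
  assumes g: "is_graph \<Gamma>" and v: "v \<in> normals \<Gamma>" and x: "x \<in> chainsG \<Gamma>"
  shows "op m (DD \<Gamma> p q v x) = (\<Sum>w\<in>normals \<Gamma> - {v}. CC m \<Gamma> p q v w x) + NN m \<Gamma> p q v x"
proof -
  have "op m (DD \<Gamma> p q v x) = scale (1 / 2) (\<Sum>a\<in>AD. \<Sum>S\<in>proper v. op m (Dt \<Gamma> p q a v S x))"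
    unfolding DD_def by (simp only: lin_sum[OF lin_op] lin_scale[OF lin_op])
  also have "(\<Sum>a\<in>AD. \<Sum>S\<in>proper v. op m (Dt \<Gamma> p q a v S x)) =
    (\<Sum>a\<in>AD. \<Sum>S\<in>proper v. (\<Sum>w\<in>normals \<Gamma> - {v}. DM m (Dg \<Gamma> p q a v S) w (Dt \<Gamma> p q a v S x)) +
      ((if p then 0 else DM m (Dg \<Gamma> p q a v S) (vert1 \<Gamma> S) (Dt \<Gamma> p q a v S x)) +
     (if q then 0 else DM m (Dg \<Gamma> p q a v S) (vert2 \<Gamma> v S) (Dt \<Gamma> p q a v S x))))"
  proof (intro sum.cong refl)
    fix a S assume aS: "a \<in> AD" "S \<in> proper v"
    note s = splittable_proper[OF g v aS]
    show "op m (Dt \<Gamma> p q a v S x) = (\<Sum>w\<in>normals \<Gamma> - {v}. DM m (Dg \<Gamma> p q a v S) w (Dt \<Gamma> p q a v S x)) +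
      ((if p then 0 else DM m (Dg \<Gamma> p q a v S) (vert1 \<Gamma> S) (Dt \<Gamma> p q a v S x)) +
     (if q then 0 else DM m (Dg \<Gamma> p q a v S) (vert2 \<Gamma> v S) (Dt \<Gamma> p q a v S x)))"
      unfolding op_chainsG[OF Dt_chainsG[OF s x]] by (rule sum_normals_Dg[OF s])
  qed
  also have "scale (1 / 2) \<dots> = scale (1 / 2) (\<Sum>a\<in>AD. \<Sum>S\<in>proper v. \<Sum>w\<in>normals \<Gamma> - {v}. DM m (Dg \<Gamma> p q a v S) w (Dt \<Gamma> p q a v S x)) + NN m \<Gamma> p q v x"
    unfolding NN_def by (simp only: sum.distrib free.scale_right_distrib)
  also have "(\<Sum>a\<in>AD. \<Sum>S\<in>proper v. \<Sum>w\<in>normals \<Gamma> - {v}. DM m (Dg \<Gamma> p q a v S) w (Dt \<Gamma> p q a v S x)) =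
     (\<Sum>w\<in>normals \<Gamma> - {v}. \<Sum>a\<in>AD. \<Sum>S\<in>proper v. DM m (Dg \<Gamma> p q a v S) w (Dt \<Gamma> p q a v S x))"
    by (simp only: sum.swap[of _ "normals \<Gamma> - {v}"])
  finally show ?thesis unfolding CC_def free.scale_sum_right .
qed

lemma op_DM:
  assumes g: "is_graph \<Gamma>" and v: "v \<in> normals \<Gamma>" and x: "x \<in> chainsG \<Gamma>"
  shows "op m (DM r \<Gamma> v x) = (\<Sum>w\<in>normals \<Gamma> - {v}. CM m r \<Gamma> v w x) + NM m r \<Gamma> v x"
  by (cases r) (simp_all add: DM_def CM_def NM_def op_DD[OF assms] lin_add[OF lin_op] sum.distrib)

definition DC :: "ngraph \<Rightarrow> bool \<Rightarrow> bool \<Rightarrow> bool \<Rightarrow> bool \<Rightarrow> nat set \<Rightarrow> nat set \<Rightarrow> ('k, 'w) chain \<Rightarrow> ('k, 'w) chain" where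
  "DC \<Gamma> p q r t v w x = scale (1 / 2) (\<Sum>a\<in>AD. \<Sum>S\<in>proper v. DD (Dg \<Gamma> p q a v S) r t w (Dt \<Gamma> p q a v S x))"

lemma DC_commute:
  assumes "is_graph \<Gamma>" "v \<in> normals \<Gamma>" "w \<in> normals \<Gamma>" "v \<noteq> w" "x \<in> chainsG \<Gamma>"
  shows "eqm HR (DC \<Gamma> p q r t v w x) (- DC \<Gamma> r t p q w v x)"
  unfolding DC_def free.scale_minus_right[symmetric] by (intro eqm_scale DD_DD_commute assms)

lemma CC_DC: "CC m \<Gamma> p q v w x = (if m then DC \<Gamma> p q True False v w x + DC \<Gamma> p q False True v w x else DC \<Gamma> p q False False v w x)"
  by (simp add: CC_def DC_def DM_def sum.distrib free.scale_right_distrib)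

text \<open>The flag \<open>r\<close> belongs to the operator applied first, at \<open>v\<close>,
  and \<open>m\<close> to the one applied second, at \<open>w\<close>. Anticommutation exchanges
  vertices and operators together, so it also compares \<open>d\<close> after \<open>L\<close> with
  \<open>L\<close> after \<open>d\<close>.\<close>

lemma CM_commute:
  assumes "is_graph \<Gamma>" "v \<in> normals \<Gamma>" "w \<in> normals \<Gamma>" "v \<noteq> w" "x \<in> chainsG \<Gamma>"
  shows "eqm HR (CM m r \<Gamma> v w x) (- CM r m \<Gamma> w v x)"
proof -
  note c = DC_commute[OF assms]
  show ?thesis
  proof (cases m; cases r)
    assume mr: m r
    have "eqm HR ((DC \<Gamma> True False True False v w x + DC \<Gamma> True False False True v w x) + (DC \<Gamma> False True True False v w x + DC \<Gamma> False True False True v w x))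
       ((- DC \<Gamma> True False True False w v x + - DC \<Gamma> False True True False w v x) + (- DC \<Gamma> True False False True w v x + - DC \<Gamma> False True False True w v x))"
      by (intro eqm_add c)
    then show ?thesis using mr by (simp add: CM_def CC_DC algebra_simps)
  next
    assume mr: m "\<not> r"
    have "eqm HR (DC \<Gamma> False False True False v w x + DC \<Gamma> False False False True v w x)
       (- DC \<Gamma> True False False False w v x + - DC \<Gamma> False True False False w v x)"
      by (intro eqm_add c)
    then show ?thesis using mr by (simp add: CM_def CC_DC algebra_simps)
  next
    assume mr: "\<not> m" r
    have "eqm HR (DC \<Gamma> True False False False v w x + DC \<Gamma> False True False False v w x)
       (- DC \<Gamma> False False True False w v x + - DC \<Gamma> False False False True w v x)"
      by (intro eqm_add c)
    then show ?thesis using mr by (simp add: CM_def CC_DC algebra_simps)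
  next
    assume mr: "\<not> m" "\<not> r"
    then show ?thesis using c by (simp add: CM_def CC_DC)
  qed
qed

text \<open>A new vertex that has become special is not split again. Hence both new vertices
  contribute for \<open>d\<close>, and only the one that stayed normal contributes for
  \<open>L\<close>.\<close>

lemma NN_EE:
  shows "NN False \<Gamma> False False v x = scale (1 / 2) (EE' \<Gamma> False False False v x + EE \<Gamma> False False False v x)"
    and "NN True \<Gamma> True False v x = scale (1 / 2) (EE \<Gamma> True False True v x + EE \<Gamma> False True True v x)"
    and "NN True \<Gamma> False True v x = scale (1 / 2) (EE' \<Gamma> True False True v x + EE' \<Gamma> False True True v x)"
  by (simp_all add: NN_def EE_def EE'_def DM_def Dg_def Dt_def I_def Im_def sum.distrib)

text \<open>The end that stays normal is split off first; the other new vertex is then split into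
  two special ones, which is null by the A-infinity relation at that vertex.\<close>

lemma EE_Ainf:
  assumes g: "is_graph \<Gamma>" and v: "v \<in> normals \<Gamma>" and x: "x \<in> chainsG \<Gamma>"
  shows "EE \<Gamma> True True False v x \<in> free.span RR"
  unfolding EE_def
proof (intro free.span_sum)
  fix a S assume aS: "a \<in> AD" "S \<in> proper v"
  note s = splittable_proper[OF g v aS]
  show "DD (Im False (vert1 \<Gamma> S) (sgraph N a v S \<Gamma>)) True True (vert2 \<Gamma> v S)
     (I False (vert1 \<Gamma> S) (Sp a v S x)) \<in> free.span RR"
    by (rule DD_Ainf[OF I_chainsG[OF Sp_chainsG[OF s x]]]) (use new_normals[OF s] in simp)
qed

lemma NM_null:
  assumes g: "is_graph \<Gamma>" and v: "v \<in> normals \<Gamma>" and x: "x \<in> chainsG \<Gamma>"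
  shows "NM m m \<Gamma> v x \<in> free.span RR"
proof (cases m)
  case False
  have "eqm HR (EE' \<Gamma> False False False v x + EE \<Gamma> False False False v x) (0 + 0)"
    by (intro eqm_add eqm_trans[OF EE'_EE EE_d] EE_d assms)
  from HR_in_span[OF this] have "EE' \<Gamma> False False False v x + EE \<Gamma> False False False v x \<in> free.span RR"
    by (simp add: free.span_zero)
  then show ?thesis using False by (simp add: NM_def NN_EE(1) free.span_scale)
next
  case True
  let ?E = "EE \<Gamma> True False True v x + EE \<Gamma> False True True v x"
  have 1: "?E \<in> free.span RR"
    by (rule HR_in_span[OF EE_L[OF assms]]) (intro free.span_neg EE_Ainf assms)
  have 2: "EE' \<Gamma> True False True v x + EE' \<Gamma> False True True v x \<in> free.span RR"
    by (rule HR_in_span[OF _ 1]) (intro eqm_add EE'_EE assms)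
  show ?thesis using True 1 2 by (simp only: NM_def NN_EE if_True) (intro free.span_add[OF free.span_scale free.span_scale])
qed

text \<open>The double sum over distinct old vertices has a symmetric index set and is congruent to
  its own negative, so its double is null, and it may be halved. The terms in which a new vertex is
  split again are null by \<open>NM_null\<close>.\<close>

lemma op_op:
  assumes x: "x \<in> chainsG \<Gamma>"
  shows "op m (op m x) \<in> free.span RR"
proof (cases "is_graph \<Gamma>")
  case g: True
  let ?V = "normals \<Gamma>"
  let ?C = "\<Sum>v\<in>?V. \<Sum>w\<in>?V - {v}. CM m m \<Gamma> v w x"
  have 1: "op m (op m x) = ?C + (\<Sum>v\<in>?V. NM m m \<Gamma> v x)"
    unfolding op_chainsG[OF x] lin_sum[OF lin_op] sum.distrib[symmetric]
    by (intro sum.cong refl op_DM[OF g _ x])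
  have "eqm HR ?C (\<Sum>v\<in>?V. \<Sum>w\<in>?V - {v}. - CM m m \<Gamma> w v x)"
    by (intro eqm_sum CM_commute[OF g _ _ _ x]) auto
  also have "(\<Sum>v\<in>?V. \<Sum>w\<in>?V - {v}. - CM m m \<Gamma> w v x) = - ?C"
    unfolding sum_distinct_swap[OF finite_normals[OF g], of "\<lambda>v w. - CM m m \<Gamma> w v x"] by (simp add: sum_negf)
  finally have "?C + ?C \<in> free.span HR" by (simp add: eqm_def)
  from free.span_scale[OF this, of "1 / 2"] have "?C \<in> free.span HR"
    by (simp add: free.scale_right_distrib flip: free.scale_left_distrib)
  then have "?C \<in> free.span RR" using HR_in_span[of ?C 0] by (simp add: eqm_0_iff free.span_zero)
  then show ?thesis unfolding 1 by (rule free.span_add) (intro free.span_sum NM_null[OF g _ x])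
next
  case False
  then have "x = 0" using chainsG_no_graph x by blast
  then show ?thesis by (simp add: lin_0[OF lin_op] free.span_zero)
qed

section \<open>Cutting an edge\<close>

lemma cut_simps:
  "halves (cut_graph N h1 h2 \<Gamma>) = halves \<Gamma> \<union> {new_half \<Gamma>, Suc (new_half \<Gamma>)}"
  "verts (cut_graph N h1 h2 \<Gamma>) = verts \<Gamma> \<union> {{new_half \<Gamma>}, {Suc (new_half \<Gamma>)}}"
  "edges (cut_graph N h1 h2 \<Gamma>) = (edges \<Gamma> - {{h1, h2}}) \<union> {{h1, new_half \<Gamma>}, {h2, Suc (new_half \<Gamma>)}}"
  "hdeg (cut_graph N h1 h2 \<Gamma>) = (hdeg \<Gamma>)(new_half \<Gamma> := N - hdeg \<Gamma> h1, Suc (new_half \<Gamma>) := N - hdeg \<Gamma> h2)"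
  "specials (cut_graph N h1 h2 \<Gamma>) = specials \<Gamma>"
  by (simp_all add: cut_graph_def Let_def)

lemma cut_mark: "cut_graph N h1 h2 (mark v \<Gamma>) = mark v (cut_graph N h1 h2 \<Gamma>)"
  using mark_simps(6)[of v \<Gamma>] by (simp add: cut_graph_def mark_def Let_def)

lemma new_half_cut:
  assumes "finite (halves \<Gamma>)"
  shows "new_half (cut_graph N h1 h2 \<Gamma>) = Suc (Suc (new_half \<Gamma>))"
  unfolding new_half_def[of "cut_graph N h1 h2 \<Gamma>"]
  by (rule Least_equality) (use new_half_gt[OF assms] in \<open>auto intro: less_SucI simp: cut_simps\<close>)

definition cuttable :: "nat \<Rightarrow> nat \<Rightarrow> ngraph \<Rightarrow> bool" where
  "cuttable h1 h2 \<Gamma> \<longleftrightarrow> is_graph \<Gamma> \<and> {h1, h2} \<in> edges \<Gamma>"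

lemma cuttableD:
  assumes "cuttable h1 h2 \<Gamma>"
  shows "is_graph \<Gamma>" "{h1, h2} \<in> edges \<Gamma>" "h1 \<noteq> h2" "h1 \<in> halves \<Gamma>" "h2 \<in> halves \<Gamma>" "h1 < new_half \<Gamma>" "h2 < new_half \<Gamma>"
    "N - hdeg \<Gamma> h1 = hdeg \<Gamma> h2" "N - hdeg \<Gamma> h2 = hdeg \<Gamma> h1"
proof -
  show g: "is_graph \<Gamma>" and e: "{h1, h2} \<in> edges \<Gamma>" using assms by (auto simp: cuttable_def)
  have "card {h1, h2} = 2" using g e unfolding is_ngraph_def by blast
  then show "h1 \<noteq> h2" by auto
  show "h1 \<in> halves \<Gamma>" "h2 \<in> halves \<Gamma>" using edge_halves[OF g e] by auto
  show "h1 < new_half \<Gamma>" "h2 < new_half \<Gamma>" using edge_lt[OF g e] by auto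
  have "hdeg \<Gamma> h1 + hdeg \<Gamma> h2 = N" using g e unfolding is_ngraph_def by blast
  then show "N - hdeg \<Gamma> h1 = hdeg \<Gamma> h2" "N - hdeg \<Gamma> h2 = hdeg \<Gamma> h1" by auto
qed

lemma hdeg_cut_old: "is_graph \<Gamma> \<Longrightarrow> h \<in> halves \<Gamma> \<Longrightarrow> hdeg (cut_graph N h1 h2 \<Gamma>) h = hdeg \<Gamma> h"
  using new_half_gt[OF graph_finite, of \<Gamma> h] by (auto simp: cut_simps)

lemma vdeg_cut_old: "is_graph \<Gamma> \<Longrightarrow> u \<in> verts \<Gamma> \<Longrightarrow> vdeg N (cut_graph N h1 h2 \<Gamma>) u = vdeg N \<Gamma> u"
  unfolding vdeg_def using vert_halves[of \<Gamma> u] by (auto intro!: sum.cong hdeg_cut_old)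

lemma internals_cut: "is_graph \<Gamma> \<Longrightarrow> internals (cut_graph N h1 h2 \<Gamma>) = internals \<Gamma>"
  by (auto simp: internals_def cut_simps)

lemma normals_cut: "is_graph \<Gamma> \<Longrightarrow> normals (cut_graph N h1 h2 \<Gamma>) = normals \<Gamma>"
  by (simp add: normals_def internals_cut cut_simps)

lemma externals_cut: "externals (cut_graph N h1 h2 \<Gamma>) = externals \<Gamma> \<union> {{new_half \<Gamma>}, {Suc (new_half \<Gamma>)}}"
  by (auto simp: externals_def cut_simps)

lemma is_graph_cut:
  assumes c: "cuttable h1 h2 \<Gamma>"
  shows "is_graph (cut_graph N h1 h2 \<Gamma>)"
proof -
  note cD = cuttableD[OF c]
  note g = cD(1)
  let ?G = "cut_graph N h1 h2 \<Gamma>" and ?n = "new_half \<Gamma>"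
  have pv: "partition_on (halves \<Gamma>) (verts \<Gamma>)" and pe: "partition_on (halves \<Gamma>) (edges \<Gamma>)"
    using g by (auto simp: is_ngraph_def)
  have nn: "?n \<notin> halves \<Gamma>" "Suc ?n \<notin> halves \<Gamma>"
    using new_half_gt[OF graph_finite[OF g]] by (auto dest: Suc_lessD)
  have v0: "?n \<notin> u" "Suc ?n \<notin> u" if "u \<in> verts \<Gamma>" for u using vert_halves[OF g that] nn by auto
  have e0: "?n \<notin> u" "Suc ?n \<notin> u" if "u \<in> edges \<Gamma>" for u using edge_halves[OF g that] nn by auto
  have dis: "u = w" if "u \<in> edges \<Gamma>" "w \<in> edges \<Gamma>" "h \<in> u" "h \<in> w" for u w h
    using disjointD[OF partition_onD2[OF pe], of u w] that by blast
  have eh: "h1 \<notin> u" "h2 \<notin> u" if "u \<in> edges \<Gamma> - {{h1, h2}}" for u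
    using dis[of u "{h1, h2}"] that cD(2) by auto
  have "partition_on (halves ?G) (verts ?G)"
  proof (rule partition_onI)
    show "\<Union> (verts ?G) = halves ?G" using pv by (auto simp: partition_on_def cut_simps)
    show "{} \<notin> verts ?G" using pv by (auto simp: partition_on_def cut_simps)
    fix p q assume "p \<in> verts ?G" "q \<in> verts ?G" "p \<noteq> q"
    then show "disjnt p q"
      using v0 vert_disjoint[OF g, of p q] by (auto simp: cut_simps disjnt_def)
  qed
  moreover have "partition_on (halves ?G) (edges ?G)"
  proof (rule partition_onI)
    have "\<Union> (edges \<Gamma>) = halves \<Gamma>" using pe by (auto simp: partition_on_def)
    moreover have "\<Union> (edges \<Gamma>) = \<Union> (edges \<Gamma> - {{h1, h2}}) \<union> {h1, h2}" using cD(2) by auto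
    ultimately show "\<Union> (edges ?G) = halves ?G" unfolding cut_simps by auto
    show "{} \<notin> edges ?G" using pe by (auto simp: partition_on_def cut_simps)
    fix p q assume pq: "p \<in> edges ?G" "q \<in> edges ?G" "p \<noteq> q"
    let ?a = "{h1, ?n}" and ?b = "{h2, Suc ?n}"
    have ab: "?a \<inter> ?b = {}" "?b \<inter> ?a = {}" using cD(3,6,7) by auto
    have old: "u \<inter> ?a = {}" "u \<inter> ?b = {}" "?a \<inter> u = {}" "?b \<inter> u = {}" if "u \<in> edges \<Gamma> - {{h1, h2}}" for u
      using eh[OF that] e0[of u] that by auto
    have oo: "p \<inter> q = {}" if "p \<in> edges \<Gamma> - {{h1, h2}}" "q \<in> edges \<Gamma> - {{h1, h2}}"
      using dis[of p q] that pq(3) by auto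
    from pq have "p \<in> edges \<Gamma> - {{h1, h2}} \<or> p = ?a \<or> p = ?b" "q \<in> edges \<Gamma> - {{h1, h2}} \<or> q = ?a \<or> q = ?b"
      by (auto simp: cut_simps)
    then show "disjnt p q"
      unfolding disjnt_def using old oo ab pq(3) by metis
  qed
  moreover have "\<forall>e\<in>edges ?G. card e = 2"
    using g cD(6,7) by (auto simp: is_ngraph_def cut_simps)
  moreover have "N - hdeg \<Gamma> h1 \<in> degrees W" "N - hdeg \<Gamma> h2 \<in> degrees W"
    unfolding cD(8,9) using g cD(4,5) by (auto simp: is_ngraph_def)
  then have "\<forall>h\<in>halves ?G. hdeg ?G h \<in> degrees W"
    using g by (auto simp: is_ngraph_def cut_simps)
  moreover have "\<forall>k1 k2. {k1, k2} \<in> edges ?G \<longrightarrow> hdeg ?G k1 + hdeg ?G k2 = N"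
  proof (intro allI impI)
    fix k1 k2 assume e: "{k1, k2} \<in> edges ?G"
    show "hdeg ?G k1 + hdeg ?G k2 = N"
    proof (cases "{k1, k2} \<in> edges \<Gamma>")
      case True
      then have "k1 < ?n" "k2 < ?n" using edge_lt[OF g True] by auto
      then show ?thesis using True g by (auto simp: is_ngraph_def cut_simps)
    next
      case False
      with e have "{k1, k2} = {h1, ?n} \<or> {k1, k2} = {h2, Suc ?n}" by (auto simp: cut_simps)
      then show ?thesis using cD(6,7) by (auto simp: doubleton_eq_iff cut_simps)
    qed
  qed
  moreover have "specials ?G \<subseteq> internals ?G"
    using g unfolding internals_cut[OF g] by (auto simp: is_ngraph_def cut_simps)
  moreover have "\<forall>u\<in>specials ?G. vdeg N ?G u = - 1 \<and> card u \<ge> 3"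
    using g vdeg_cut_old[OF g] special_vert[OF g] by (auto simp: is_ngraph_def cut_simps(5))
  ultimately show ?thesis using graph_finite[OF g] by (simp add: is_ngraph_def cut_simps(1))
qed

abbreviation cut_edges :: "nat \<Rightarrow> nat \<Rightarrow> nat \<Rightarrow> (nat set \<times> 'k tensor) list" where
  "cut_edges h1 h2 n \<equiv> [({h1, n}, gen [h1, n]), ({Suc n, h2}, gen [Suc n, h2])]"

lemma cut_DG:
  assumes D: "(\<Gamma>, ({h1, h2}, gen [h1, h2]) # os, ws, ss, ns) \<in> DG"
    and xy: "x \<in> W (N - hdeg \<Gamma> h1)" "y \<in> W (N - hdeg \<Gamma> h2)"
  shows "cuttable h1 h2 \<Gamma>"
    and "(cut_graph N h1 h2 \<Gamma>, cut_edges h1 h2 (new_half \<Gamma>) @ os, ({new_half \<Gamma>}, x) # ({Suc (new_half \<Gamma>)}, y) # ws, ss, ns) \<in> DG"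
proof -
  let ?n = "new_half \<Gamma>" and ?G = "cut_graph N h1 h2 \<Gamma>"
  have g: "is_graph \<Gamma>" and w: "({h1, h2}, gen [h1, h2]) # os \<in> words (edges \<Gamma>) O_space"
    "ws \<in> words (externals \<Gamma>) (\<lambda>u. W (vdeg N \<Gamma> u + N))" "ss \<in> words (specials \<Gamma>) (Cyc (hdeg \<Gamma>))"
    "ns \<in> words (normals \<Gamma>) (Cyc (hdeg \<Gamma>))"
    using D by (auto simp: DG_iff edge_words_def external_words_def special_words_def normal_words_def)
  show c: "cuttable h1 h2 \<Gamma>" using g w(1) by (auto simp: cuttable_def words_iff)
  note cD = cuttableD[OF c]
  have e0: "{h1, ?n} \<notin> edges \<Gamma>" "{Suc ?n, h2} \<notin> edges \<Gamma>"
    using edge_lt[OF g, of "{h1, ?n}" ?n] edge_lt[OF g, of "{Suc ?n, h2}" "Suc ?n"] by auto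
  have v0: "{?n} \<notin> externals \<Gamma>" "{Suc ?n} \<notin> externals \<Gamma>"
    using vert_lt[OF g, of "{?n}" ?n] vert_lt[OF g, of "{Suc ?n}" "Suc ?n"] by (auto simp: externals_def)
  have O: "gen [a, b] \<in> O_space {a, b}" if "a \<noteq> b" for a b
    unfolding O_space_def using that by (intro free.span_base) (simp add: permutations_of_set_doubleton)
  have os: "os \<in> words (edges \<Gamma> - {{h1, h2}}) O_space"
    using w(1) by (auto simp: words_iff)
  have "cut_edges h1 h2 ?n @ os \<in> edge_words ?G"
    unfolding edge_words_def cut_simps append_Cons append_Nil
  proof (intro words_Cons O)
    show "os \<in> words (edges \<Gamma> - {{h1, h2}} \<union> {{h1, ?n}, {h2, Suc ?n}} - {{h1, ?n}} - {{Suc ?n, h2}}) O_space"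
      using os e0 by (auto simp: words_iff insert_commute)
  qed (use cD in \<open>auto simp: insert_commute doubleton_eq_iff\<close>)
  moreover have "({?n}, x) # ({Suc ?n}, y) # ws \<in> external_words N W ?G"
    unfolding external_words_def externals_cut
  proof (intro words_Cons)
    show "x \<in> W (vdeg N ?G {?n} + N)" "y \<in> W (vdeg N ?G {Suc ?n} + N)"
      using xy by (simp_all add: vdeg_def cut_simps)
    have "vdeg N ?G u = vdeg N \<Gamma> u" if "u \<in> externals \<Gamma>" for u
      using vdeg_cut_old[OF g, of u] that by (simp add: externals_def)
    then have "ws \<in> words (externals \<Gamma>) (\<lambda>u. W (vdeg N ?G u + N))"
      using w(2) by (subst words_cong) auto
    then show "ws \<in> words (externals \<Gamma> \<union> {{?n}, {Suc ?n}} - {{?n}} - {{Suc ?n}}) (\<lambda>u. W (vdeg N ?G u + N))"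
      using v0 by (auto simp: words_iff)
  qed auto
  moreover have C: "Cyc (hdeg ?G) u = (Cyc (hdeg \<Gamma>) u :: 'k tensor set)" if "u \<in> verts \<Gamma>" for u
    by (rule Cyc_cong) (use hdeg_cut_old[OF g] vert_halves[OF g that] in auto)
  have "ss \<in> special_words ?G"
    unfolding special_words_def cut_simps(5) using w(3) special_vert[OF g] C by (subst words_cong) auto
  moreover have "ns \<in> normal_words ?G"
    unfolding normal_words_def normals_cut[OF g] using w(4) normal_vert C by (subst words_cong) auto
  ultimately show "(?G, cut_edges h1 h2 ?n @ os, ({?n}, x) # ({Suc ?n}, y) # ws, ss, ns) \<in> DG"
    using is_graph_cut[OF c] by (simp add: DG_iff)
qed

text \<open>The cut-off relations are stated for words whose first factor decorates the cut edge; all operators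
  leave that factor in front.\<close>

definition chE :: "nat \<Rightarrow> nat \<Rightarrow> ngraph \<Rightarrow> ('k, 'w) chain set" where
  "chE h1 h2 \<Gamma> = free.span {gen (\<Gamma>, ({h1, h2}, gen [h1, h2]) # os, ws, ss, ns) | os ws ss ns.
     (\<Gamma>, ({h1, h2}, gen [h1, h2]) # os, ws, ss, ns) \<in> DG}"

lemma chE_base: "(\<Gamma>, ({h1, h2}, gen [h1, h2]) # os, ws, ss, ns) \<in> DG \<Longrightarrow>
    gen (\<Gamma>, ({h1, h2}, gen [h1, h2]) # os, ws, ss, ns) \<in> chE h1 h2 \<Gamma>"
  unfolding chE_def by (rule free.span_base) blast

lemma chE_image:
  assumes "lin f" "\<And>os ws ss ns. (\<Gamma>, ({h1, h2}, gen [h1, h2]) # os, ws, ss, ns) \<in> DG \<Longrightarrow>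
      f (gen (\<Gamma>, ({h1, h2}, gen [h1, h2]) # os, ws, ss, ns)) \<in> free.span R"
    and "z \<in> chE h1 h2 \<Gamma>"
  shows "f z \<in> free.span R"
  by (rule lin_span[OF assms(1) _ assms(3)[unfolded chE_def]]) (use assms(2) in auto)

lemma chE_eq:
  assumes "lin f" "lin g" "\<And>os ws ss ns. (\<Gamma>, ({h1, h2}, gen [h1, h2]) # os, ws, ss, ns) \<in> DG \<Longrightarrow>
      f (gen (\<Gamma>, ({h1, h2}, gen [h1, h2]) # os, ws, ss, ns)) = g (gen (\<Gamma>, ({h1, h2}, gen [h1, h2]) # os, ws, ss, ns))"
    and "z \<in> chE h1 h2 \<Gamma>"
  shows "f z = g z"
  by (rule lin_eq_on_span[OF assms(1,2) _ assms(4)[unfolded chE_def]]) (use assms(3) in auto)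

lemma chE_chainsG: "z \<in> chE h1 h2 \<Gamma> \<Longrightarrow> z \<in> chainsG \<Gamma>"
  unfolding chainsG_def[of \<Gamma>]
  by (rule chE_image[OF lin_id]) (auto intro!: free.span_base)

lemma op_iv_chE: "z \<in> chE h1 h2 \<Gamma> \<Longrightarrow> op_iv N v z \<in> chE h1 h2 (mark v \<Gamma>)"
  unfolding chE_def[of h1 h2 "mark v \<Gamma>"]
proof (erule chE_image[OF lin_op_iv, rotated])
  fix os ws ss ns assume D: "(\<Gamma>, ({h1, h2}, gen [h1, h2]) # os, ws, ss, ns) \<in> DG"
  show "op_iv N v (gen (\<Gamma>, ({h1, h2}, gen [h1, h2]) # os, ws, ss, ns)) \<in> free.span
     {gen (mark v \<Gamma>, ({h1, h2}, gen [h1, h2]) # os, ws, ss, ns) | os ws ss ns. (mark v \<Gamma>, ({h1, h2}, gen [h1, h2]) # os, ws, ss, ns) \<in> DG}"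
  proof (cases "markable \<Gamma> v")
    case True
    then have "entry v ns \<in> Cyc (hdeg \<Gamma>) v" using entry_Cyc[OF D] by (simp add: markable_def)
    from mark_DG[OF D True this] show ?thesis
      unfolding op_iv_gen using True by (simp only: if_True) (intro free.span_scale free.span_base, blast)
  qed (simp add: op_iv_gen free.span_zero)
qed

lemma I_chE: "z \<in> chE h1 h2 \<Gamma> \<Longrightarrow> I p v z \<in> chE h1 h2 (Im p v \<Gamma>)"
  by (simp add: I_def Im_def op_iv_chE)

lemma Sp_chE:
  assumes s: "splittable a v S \<Gamma>" and z: "z \<in> chE h1 h2 \<Gamma>"
  shows "Sp a v S z \<in> chE h1 h2 (sgraph N a v S \<Gamma>)"
  unfolding chE_def[of h1 h2 "sgraph N a v S \<Gamma>"]
proof (rule chE_image[OF lin_Sp _ z])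
  fix os ws ss ns assume D: "(\<Gamma>, ({h1, h2}, gen [h1, h2]) # os, ws, ss, ns) \<in> DG"
  let ?n = "new_half \<Gamma>" and ?G = "sgraph N a v S \<Gamma>"
  have "gen (?G, ({h1, h2}, gen [h1, h2]) # os @ [({?n, Suc ?n}, gen [?n, Suc ?n])], ws, ss,
       (insert ?n S, cyc (hdeg ?G) (A @ [?n])) # (insert (Suc ?n) (v - S), cyc (hdeg ?G) (Suc ?n # B)) # others v ns) \<in> chE h1 h2 ?G"
    if "A \<in> perms S" "B \<in> perms (v - S)" for A B
  proof (rule chE_base)
    have w: "({h1, h2}, gen [h1, h2]) # os \<in> edge_words \<Gamma>" "ws \<in> external_words N W \<Gamma>" "ss \<in> special_words \<Gamma>"
      "ns \<in> normal_words \<Gamma>" using D by (auto simp: DG_iff)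
    show "(?G, ({h1, h2}, gen [h1, h2]) # os @ [({?n, Suc ?n}, gen [?n, Suc ?n])], ws, ss,
       (insert ?n S, cyc (hdeg ?G) (A @ [?n])) # (insert (Suc ?n) (v - S), cyc (hdeg ?G) (Suc ?n # B)) # others v ns) \<in> DG"
      using split_DG[OF s w(1-3) others_normal_words[OF w(4)] cyc_new(1)[OF s that(1)] cyc_new(2)[OF s that(2)]]
      unfolding append_Cons .
  qed
  then show "Sp a v S (gen (\<Gamma>, ({h1, h2}, gen [h1, h2]) # os, ws, ss, ns)) \<in> free.span
     {gen (?G, ({h1, h2}, gen [h1, h2]) # os, ws, ss, ns) | os ws ss ns. (?G, ({h1, h2}, gen [h1, h2]) # os, ws, ss, ns) \<in> DG}"
    unfolding Sp_gen split_sum_def append_Cons chE_def by (intro free.span_scale free.span_sum)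
qed

text \<open>One term of the right-hand side of the cut-off relation, without its coefficient, as a
  linear operator. \<open>tl\<close> drops the factor of the cut edge, which is the first one on
  \<open>chE\<close>.\<close>

definition K :: "nat \<Rightarrow> nat \<Rightarrow> 'w \<Rightarrow> 'w \<Rightarrow> ('k, 'w) chain \<Rightarrow> ('k, 'w) chain" where
  "K h1 h2 x y = lin_ext (\<lambda>(\<Gamma>, os, ws, ss, ns). gen (cut_graph N h1 h2 \<Gamma>,
     cut_edges h1 h2 (new_half \<Gamma>) @ tl os, ({new_half \<Gamma>}, x) # ({Suc (new_half \<Gamma>)}, y) # ws, ss, ns))"

lemma lin_K: "lin (K h1 h2 x y)"
  unfolding K_def by (rule lin_lin_ext)

lemma K_gen: "K h1 h2 x y (gen (\<Gamma>, e # os, ws, ss, ns)) = gen (cut_graph N h1 h2 \<Gamma>,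
     cut_edges h1 h2 (new_half \<Gamma>) @ os, ({new_half \<Gamma>}, x) # ({Suc (new_half \<Gamma>)}, y) # ws, ss, ns)"
  by (simp add: K_def)

lemma K_chainsG:
  assumes z: "z \<in> chE h1 h2 \<Gamma>" and xy: "x \<in> W (N - hdeg \<Gamma> h1)" "y \<in> W (N - hdeg \<Gamma> h2)"
  shows "K h1 h2 x y z \<in> chainsG (cut_graph N h1 h2 \<Gamma>)"
  unfolding chainsG_def
proof (rule chE_image[OF lin_K _ z])
  fix os ws ss ns assume D: "(\<Gamma>, ({h1, h2}, gen [h1, h2]) # os, ws, ss, ns) \<in> DG"
  show "K h1 h2 x y (gen (\<Gamma>, ({h1, h2}, gen [h1, h2]) # os, ws, ss, ns)) \<in> free.span (gen ` {s \<in> DG. fst s = cut_graph N h1 h2 \<Gamma>})"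
    unfolding K_gen using cut_DG(2)[OF D xy] by (intro free.span_base) auto
qed

lemma markable_cut: "is_graph \<Gamma> \<Longrightarrow> markable (cut_graph N h1 h2 \<Gamma>) v \<longleftrightarrow> markable \<Gamma> v"
  by (auto simp: markable_def normals_cut vdeg_cut_old normal_vert)

lemma front_sgn_cut:
  assumes "(\<Gamma>, os, ws, ss, ns) \<in> DG" "v \<in> normals \<Gamma>"
  shows "front_sgn (vdeg N (cut_graph N h1 h2 \<Gamma>)) v ns = (front_sgn (vdeg N \<Gamma>) v ns :: 'k)"
proof (rule front_sgn_cong)
  have g: "is_graph \<Gamma>" using assms by (simp add: DG_iff)
  fix u assume "u \<in> fst ` set ns"
  then have "u \<in> normals \<Gamma>" using assms by (auto simp: DG_iff normal_words_def words_iff)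
  then show "vdeg N (cut_graph N h1 h2 \<Gamma>) u = vdeg N \<Gamma> u" by (rule vdeg_cut_old[OF g normal_vert])
next
  have g: "is_graph \<Gamma>" using assms by (simp add: DG_iff)
  show "vdeg N (cut_graph N h1 h2 \<Gamma>) v = vdeg N \<Gamma> v" by (rule vdeg_cut_old[OF g normal_vert[OF assms(2)]])
qed

lemma op_iv_K:
  assumes z: "z \<in> chE h1 h2 \<Gamma>"
  shows "op_iv N v (K h1 h2 x y z) = K h1 h2 x y (op_iv N v z)"
proof (rule chE_eq[OF lin_compose[OF lin_K lin_op_iv] lin_compose[OF lin_op_iv lin_K] _ z])
  fix os ws ss ns assume D: "(\<Gamma>, ({h1, h2}, gen [h1, h2]) # os, ws, ss, ns) \<in> DG"
  have g: "is_graph \<Gamma>" using D by (simp add: DG_iff)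
  show "op_iv N v (K h1 h2 x y (gen (\<Gamma>, ({h1, h2}, gen [h1, h2]) # os, ws, ss, ns))) =
     K h1 h2 x y (op_iv N v (gen (\<Gamma>, ({h1, h2}, gen [h1, h2]) # os, ws, ss, ns)))"
  proof (cases "markable \<Gamma> v")
    case True
    then have "v \<in> normals \<Gamma>" by (simp add: markable_def)
    from front_sgn_cut[OF D this] True show ?thesis
      unfolding K_gen op_iv_gen markable_cut[OF g] by (simp add: lin_scale[OF lin_K] K_gen cut_mark)
  next
    case False
    then show ?thesis unfolding K_gen op_iv_gen markable_cut[OF g] by (simp add: lin_0[OF lin_K])
  qed
qed

lemma I_K: "z \<in> chE h1 h2 \<Gamma> \<Longrightarrow> I p v (K h1 h2 x y z) = K h1 h2 x y (I p v z)"
  by (simp add: I_def op_iv_K)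

lemma splittable_cut: "splittable a v S \<Gamma> \<Longrightarrow> cuttable h1 h2 \<Gamma> \<Longrightarrow> splittable a v S (cut_graph N h1 h2 \<Gamma>)"
  using is_graph_cut by (auto simp: splittable_def normals_cut)

lemma cuttable_sgraph: "splittable a v S \<Gamma> \<Longrightarrow> cuttable h1 h2 \<Gamma> \<Longrightarrow> cuttable h1 h2 (sgraph N a v S \<Gamma>)"
  using is_graph_sgraph by (auto simp: cuttable_def)

text \<open>Cutting an edge and splitting a vertex create two half-edges each. Performing them in
  the other order exchanges the two pairs of labels, which is again \<open>swap4\<close>.\<close>

lemma graph_iso_cut:
  assumes s: "splittable a v S \<Gamma>" and c: "cuttable h1 h2 \<Gamma>"
  shows "graph_iso (swap4 (new_half \<Gamma>)) (cut_graph N h1 h2 (sgraph N a v S \<Gamma>)) (sgraph N a v S (cut_graph N h1 h2 \<Gamma>))"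
proof -
  define n where "n = new_half \<Gamma>"
  let ?\<phi> = "swap4 n" and ?G = "cut_graph N h1 h2 (sgraph N a v S \<Gamma>)" and ?G' = "sgraph N a v S (cut_graph N h1 h2 \<Gamma>)"
  note sD = splittableD[OF s] and cD = cuttableD[OF c]
  note f = swap4_fix[OF sD(1), folded n_def]
  have nh: "new_half (sgraph N a v S \<Gamma>) = Suc (Suc n)" "new_half (cut_graph N h1 h2 \<Gamma>) = Suc (Suc n)"
    using new_half_sgraph[OF sD(4)] new_half_cut[OF sD(4)] by (simp_all add: n_def)
  have fe: "(`) ?\<phi> ` (edges \<Gamma> - {{h1, h2}}) = edges \<Gamma> - {{h1, h2}}"
    by (rule image_fix[of _ "halves \<Gamma>"]) (use edge_halves[OF sD(1)] f(1) in auto)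
  have fS: "?\<phi> ` S = S" "?\<phi> ` (v - S) = v - S" using f(6)[OF sD(3)] sD(7) by auto
  have lt: "h1 < n" "h2 < n" using cD(6,7) by (simp_all add: n_def)
  have ne: "{n, Suc n} \<noteq> {h1, h2}" using lt by (auto simp: doubleton_eq_iff)
  have v0: "v \<noteq> {n}" "v \<noteq> {Suc n}" using sD(13,14) by (auto simp: n_def)
  have hd: "hdeg \<Gamma> h = hdeg \<Gamma> h" for h ..
  show ?thesis
    unfolding graph_iso_def n_def[symmetric]
  proof (intro conjI)
    show "bij_betw ?\<phi> (halves ?G) (halves ?G')"
      by (rule involution_bij_betw) (simp_all add: cut_simps nh image_Un f(2) n_def[symmetric] insert_commute)
    have e: "verts ?G = (verts \<Gamma> - {v}) \<union> {insert n S, insert (Suc n) (v - S), {Suc (Suc n)}, {Suc (Suc (Suc n))}}"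
      "verts ?G' = (verts \<Gamma> - {v}) \<union> {insert (Suc (Suc n)) S, insert (Suc (Suc (Suc n))) (v - S), {n}, {Suc n}}"
      using v0 by (auto simp: cut_simps nh n_def[symmetric])
    show "(`) ?\<phi> ` verts ?G = verts ?G'"
      unfolding e image_Un f(4)[OF Diff_subset] by (simp add: fS)
    have e: "edges ?G = (edges \<Gamma> - {{h1, h2}}) \<union> {{n, Suc n}, {h1, Suc (Suc n)}, {h2, Suc (Suc (Suc n))}}"
      "edges ?G' = (edges \<Gamma> - {{h1, h2}}) \<union> {{Suc (Suc n), Suc (Suc (Suc n))}, {h1, n}, {h2, Suc n}}"
      using ne by (auto simp: cut_simps nh n_def[symmetric])
    show "(`) ?\<phi> ` edges ?G = edges ?G'"
      unfolding e image_Un fe using lt by simp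
    show "(`) ?\<phi> ` specials ?G = specials ?G'" by (simp add: cut_simps f(5))
    show "\<forall>h\<in>halves ?G. hdeg ?G' (?\<phi> h) = hdeg ?G h"
    proof
      fix h assume "h \<in> halves ?G"
      then have "h \<in> halves \<Gamma> \<or> h = n \<or> h = Suc n \<or> h = Suc (Suc n) \<or> h = Suc (Suc (Suc n))"
        by (auto simp: cut_simps nh n_def[symmetric])
      moreover have "h \<in> halves \<Gamma> \<Longrightarrow> h < n" using new_half_gt[OF sD(4)] by (simp add: n_def)
      ultimately show "hdeg ?G' (?\<phi> h) = hdeg ?G h"
        using lt by (elim disjE) (simp_all add: cut_simps sgraph_simps(4) nh n_def[symmetric])
    qed
  qed
qed

lemma Sp_K:
  assumes s: "splittable a v S \<Gamma>" and z: "z \<in> chE h1 h2 \<Gamma>"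
  shows "Sp a v S (K h1 h2 x y z) =
    trl (swap4 (new_half \<Gamma>)) (sgraph N a v S (cut_graph N h1 h2 \<Gamma>)) (K h1 h2 x y (Sp a v S z))"
proof (rule chE_eq[OF lin_compose[OF lin_K lin_Sp] lin_compose[OF lin_compose[OF lin_Sp lin_K] lin_trl] _ z])
  fix os ws ss ns assume D: "(\<Gamma>, ({h1, h2}, gen [h1, h2]) # os, ws, ss, ns) \<in> DG"
  define n where "n = new_half \<Gamma>"
  let ?n2 = "Suc (Suc n)" and ?n3 = "Suc (Suc (Suc n))"
  let ?\<phi> = "swap4 n" and ?sg = "sgraph N a v S \<Gamma>" and ?G' = "sgraph N a v S (cut_graph N h1 h2 \<Gamma>)"
  have c: "cuttable h1 h2 \<Gamma>" using D by (auto simp: cuttable_def DG_iff edge_words_def words_iff)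
  note sD = splittableD[OF s] and cD = cuttableD[OF c]
  note f = swap4_fix[OF sD(1), folded n_def]
  have nh: "new_half ?sg = ?n2" "new_half (cut_graph N h1 h2 \<Gamma>) = ?n2"
    using new_half_sgraph[OF sD(4)] new_half_cut[OF sD(4)] by (simp_all add: n_def)
  have lt: "h1 < n" "h2 < n" using cD(6,7) by (simp_all add: n_def)
  have vlt: "h < n" if "h \<in> v" for h using vert_lt[OF sD(1,3) that] by (simp add: n_def)
  have fS: "?\<phi> ` S = S" "?\<phi> ` (v - S) = v - S" using f(6)[OF sD(3)] sD(7) by auto
  have sup: "supported (halves \<Gamma>) os" "supported (halves \<Gamma>) ss" "supported (halves \<Gamma>) (others v ns)"
    using DG_supported(1,2)[OF D] supported_others[OF DG_supported(3)[OF D]] by (simp_all add: supported_def)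
  have tw: "tword ?\<phi> os = os" "tword ?\<phi> ss = ss" "tword ?\<phi> (others v ns) = others v ns"
    by (rule tword_id[OF sup(1)] tword_id[OF sup(2)] tword_id[OF sup(3)], fact f(1))+
  have ws: "map (map_prod ((`) ?\<phi>) id) ws = ws" by (rule external_words_id[OF D f(1)])
  have inj: "inj_on ?\<phi> M" for M by (rule inj_on_inverseI[of _ ?\<phi>]) simp
  have dg: "hdeg ?G' (?\<phi> h) = hdeg ?sg h" if "h \<in> v \<or> h = n \<or> h = Suc n" for h
    using that vlt[of h] by (elim disjE) (simp_all add: cut_simps sgraph_simps(4) nh n_def[symmetric])
  have cA: "lin_ext (gen \<circ> map ?\<phi>) (cyc (hdeg ?sg) (A @ [n])) = (cyc (hdeg ?G') (A @ [?n2]) :: 'k tensor)"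
    if "A \<in> perms S" for A
  proof -
    have A: "set A = S" using that by (simp add: perms_def)
    have "map ?\<phi> A = A" using A sD(7) vlt by (intro map_idI) auto
    moreover have "lin_ext (gen \<circ> map ?\<phi>) (cyc (hdeg ?sg) (A @ [n])) = (cyc (hdeg ?G') (map ?\<phi> (A @ [n])) :: 'k tensor)"
      using A sD(7) by (intro cyc_map inj dg) auto
    ultimately show ?thesis by simp
  qed
  have cB: "lin_ext (gen \<circ> map ?\<phi>) (cyc (hdeg ?sg) (Suc n # B)) = (cyc (hdeg ?G') (?n3 # B) :: 'k tensor)"
    if "B \<in> perms (v - S)" for B
  proof -
    have B: "set B = v - S" using that by (simp add: perms_def)
    have "map ?\<phi> B = B" using B vlt by (intro map_idI) auto
    moreover have "lin_ext (gen \<circ> map ?\<phi>) (cyc (hdeg ?sg) (Suc n # B)) = (cyc (hdeg ?G') (map ?\<phi> (Suc n # B)) :: 'k tensor)"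
      using B by (intro cyc_map inj dg) auto
    ultimately show ?thesis by simp
  qed
  show "Sp a v S (K h1 h2 x y (gen (\<Gamma>, ({h1, h2}, gen [h1, h2]) # os, ws, ss, ns))) =
    trl (swap4 (new_half \<Gamma>)) ?G' (K h1 h2 x y (Sp a v S (gen (\<Gamma>, ({h1, h2}, gen [h1, h2]) # os, ws, ss, ns))))"
    unfolding K_gen Sp_gen split_sum_def append_Cons lin_scale[OF lin_K] lin_sum[OF lin_K] lin_scale[OF lin_trl] lin_sum[OF lin_trl]
      trl_gen nh n_def[symmetric] front_sgn_cut[OF D sD(2)]
    using lt by (intro arg_cong[of _ _ "scale _"] sum.cong refl) (simp add: tw ws fS cA cB)
qed

lemma Dt_K:
  assumes s: "splittable a v S \<Gamma>" and c: "cuttable h1 h2 \<Gamma>" and z: "z \<in> chE h1 h2 \<Gamma>"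
    and xy: "x \<in> W (N - hdeg \<Gamma> h1)" "y \<in> W (N - hdeg \<Gamma> h2)"
  shows "eqm HR (Dt (cut_graph N h1 h2 \<Gamma>) p q a v S (K h1 h2 x y z)) (K h1 h2 x y (Dt \<Gamma> p q a v S z))"
proof -
  define n where "n = new_half \<Gamma>"
  let ?n2 = "Suc (Suc n)" and ?n3 = "Suc (Suc (Suc n))"
  let ?\<phi> = "swap4 n" and ?sg = "sgraph N a v S \<Gamma>" and ?G' = "sgraph N a v S (cut_graph N h1 h2 \<Gamma>)"
  let ?G = "cut_graph N h1 h2 ?sg"
  let ?v1 = "insert n S" and ?v2 = "insert (Suc n) (v - S)"
  note sD = splittableD[OF s] and cD = cuttableD[OF c]
  note f = swap4_fix[OF sD(1), folded n_def]
  note cs = cuttable_sgraph[OF s c]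
  have nh: "new_half (cut_graph N h1 h2 \<Gamma>) = ?n2"
    using new_half_cut[OF sD(4)] by (simp add: n_def)
  have iso: "giso ?\<phi> ?G ?G'"
    using graph_iso_cut[OF s c] is_graph_sgraph[OF splittable_cut[OF s c]] by (simp add: giso_def n_def)
  note nn = new_normals[OF s, folded n_def]
  have nG: "?v1 \<in> normals ?G" "?v2 \<in> normals ?G"
    using nn by (simp_all add: normals_cut[OF is_graph_sgraph[OF s]] del: sgraph_simps)
  have im: "?\<phi> ` ?v1 = insert ?n2 S" "?\<phi> ` ?v2 = insert ?n3 (v - S)"
    using f(6)[OF sD(3)] sD(7) by auto
  let ?z = "Sp a v S z"
  have zE: "?z \<in> chE h1 h2 ?sg" by (rule Sp_chE[OF s z])
  have u: "K h1 h2 x y ?z \<in> chainsG ?G"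
    by (rule K_chainsG[OF zE]) (use xy cD(6,7) in \<open>simp_all add: sgraph_simps(4)\<close>)
  note t = II_trl[OF iso nG nn(3) u, of p q, unfolded im]
  have KI: "I p ?v1 (I q ?v2 (K h1 h2 x y ?z)) = K h1 h2 x y (Dt \<Gamma> p q a v S z)"
    by (simp only: Dt_def n_def[symmetric] I_K[OF zE] I_K[OF I_chE[OF zE]])
  have "Dt (cut_graph N h1 h2 \<Gamma>) p q a v S (K h1 h2 x y z) =
    I p (insert ?n2 S) (I q (insert ?n3 (v - S)) (trl ?\<phi> ?G' (K h1 h2 x y ?z)))"
    unfolding Dt_def nh Sp_K[OF s z] n_def[symmetric] ..
  also have "\<dots> = trl ?\<phi> (Im p (insert ?n2 S) (Im q (insert ?n3 (v - S)) ?G')) (I p ?v1 (I q ?v2 (K h1 h2 x y ?z)))"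
    by (rule t(1))
  finally have e: "Dt (cut_graph N h1 h2 \<Gamma>) p q a v S (K h1 h2 x y z) =
    trl ?\<phi> (Im p (insert ?n2 S) (Im q (insert ?n3 (v - S)) ?G')) (I p ?v1 (I q ?v2 (K h1 h2 x y ?z)))" .
  show ?thesis
    unfolding e KI[symmetric] by (rule eqm_sym, rule giso_HR[OF _ t(2)]) (intro I_chainsG u)
qed

lemma Dt_chE:
  assumes s: "splittable a v S \<Gamma>" and z: "z \<in> chE h1 h2 \<Gamma>"
  shows "Dt \<Gamma> p q a v S z \<in> chE h1 h2 (Dg \<Gamma> p q a v S)"
  unfolding Dt_def Dg_def by (intro I_chE Sp_chE s z)

definition cut_pairs :: "nat \<Rightarrow> nat \<Rightarrow> ngraph \<Rightarrow> ('w \<times> 'w) set" where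
  "cut_pairs h1 h2 \<Gamma> = {(x, y). x \<in> B \<and> y \<in> B \<and> x \<in> W (N - hdeg \<Gamma> h1) \<and> y \<in> W (N - hdeg \<Gamma> h2)}"

lemma cutoff_rels_K:
  "cutoff_rels N W B P = {gen (\<Gamma>, ({h1, h2}, gen [h1, h2]) # os, ws, ss, ns) -
     (\<Sum>(x, y)\<in>cut_pairs h1 h2 \<Gamma>. scale (P x y) (K h1 h2 x y (gen (\<Gamma>, ({h1, h2}, gen [h1, h2]) # os, ws, ss, ns)))) |
     \<Gamma> h1 h2 os ws ss ns. (\<Gamma>, ({h1, h2}, gen [h1, h2]) # os, ws, ss, ns) \<in> DG}"
  unfolding cutoff_rels_def cut_pairs_def K_gen append_Cons append_Nil ..

lemma chE_cutoff:
  assumes z: "z \<in> chE h1 h2 \<Gamma>"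
  shows "eqm RR z (\<Sum>(x, y)\<in>cut_pairs h1 h2 \<Gamma>. scale (P x y) (K h1 h2 x y z))"
proof -
  let ?f = "\<lambda>z. z - (\<Sum>(x, y)\<in>cut_pairs h1 h2 \<Gamma>. scale (P x y) (K h1 h2 x y z))"
  have "lin ?f"
    by (intro lin_minus_op lin_id lin_sum_op) (simp add: case_prod_unfold lin_compose[OF lin_K lin_scale_op])
  then have "?f z \<in> free.span RR"
  proof (rule chE_image[OF _ _ z])
    fix os ws ss ns assume D: "(\<Gamma>, ({h1, h2}, gen [h1, h2]) # os, ws, ss, ns) \<in> DG"
    then have "?f (gen (\<Gamma>, ({h1, h2}, gen [h1, h2]) # os, ws, ss, ns)) \<in> cutoff_rels N W B P"
      unfolding cutoff_rels_K by blast
    then show "?f (gen (\<Gamma>, ({h1, h2}, gen [h1, h2]) # os, ws, ss, ns)) \<in> free.span RR"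
      using RR_span by blast
  qed
  then show ?thesis by (simp add: eqm_def)
qed

text \<open>The cut-off relation is applied to each split graph, where the cut edge still stands in
  front; then the cut is moved before the splitting by \<open>Dt_K\<close>.\<close>

lemma DD_cutoff:
  assumes c: "cuttable h1 h2 \<Gamma>" and v: "v \<in> normals \<Gamma>" and z: "z \<in> chE h1 h2 \<Gamma>"
  shows "eqm RR (DD \<Gamma> p q v z) (\<Sum>(x, y)\<in>cut_pairs h1 h2 \<Gamma>. scale (P x y) (DD (cut_graph N h1 h2 \<Gamma>) p q v (K h1 h2 x y z)))"
proof -
  let ?J = "cut_pairs h1 h2 \<Gamma>" and ?C = "cut_graph N h1 h2 \<Gamma>"
  note cD = cuttableD[OF c]
  have "eqm RR (Dt \<Gamma> p q a v S z) (\<Sum>(x, y)\<in>?J. scale (P x y) (Dt ?C p q a v S (K h1 h2 x y z)))"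
    if "a \<in> AD" "S \<in> proper v" for a S
  proof -
    note s = splittable_proper[OF cD(1) v that]
    \<comment> \<open>Splitting does not change the degrees of \<open>h1\<close> and
      \<open>h2\<close>, so the same pairs of basis elements occur before and after it.\<close>
    have J: "cut_pairs h1 h2 (Dg \<Gamma> p q a v S) = ?J"
      using cD(6,7) by (simp add: cut_pairs_def Dg_def Im_def sgraph_simps(4))
    have 1: "eqm RR (Dt \<Gamma> p q a v S z) (\<Sum>(x, y)\<in>?J. scale (P x y) (K h1 h2 x y (Dt \<Gamma> p q a v S z)))"
      using chE_cutoff[OF Dt_chE[OF s z, of p q]] unfolding J .
    have "eqm RR (\<Sum>(x, y)\<in>?J. scale (P x y) (K h1 h2 x y (Dt \<Gamma> p q a v S z)))
      (\<Sum>(x, y)\<in>?J. scale (P x y) (Dt ?C p q a v S (K h1 h2 x y z)))"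
    proof (rule eqm_sum, clarify)
      fix x y assume "(x, y) \<in> ?J"
      then have "x \<in> W (N - hdeg \<Gamma> h1)" "y \<in> W (N - hdeg \<Gamma> h2)" by (auto simp: cut_pairs_def)
      from eqm_scale[OF HR_RR[OF eqm_sym[OF Dt_K[OF s c z this]]]]
      show "eqm RR (scale (P x y) (K h1 h2 x y (Dt \<Gamma> p q a v S z))) (scale (P x y) (Dt ?C p q a v S (K h1 h2 x y z)))"
        .
    qed
    with 1 show ?thesis by (rule eqm_trans)
  qed
  then have 2: "eqm RR (DD \<Gamma> p q v z) (scale (1 / 2) (\<Sum>a\<in>AD. \<Sum>S\<in>proper v. \<Sum>(x, y)\<in>?J. scale (P x y) (Dt ?C p q a v S (K h1 h2 x y z))))"
    unfolding DD_def by (intro eqm_scale eqm_sum) auto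
  let ?D = "\<lambda>j a S. Dt ?C p q a v S (K h1 h2 (fst j) (snd j) z)"
  have "scale (1 / 2) (\<Sum>a\<in>AD. \<Sum>S\<in>proper v. \<Sum>j\<in>?J. scale (P (fst j) (snd j)) (?D j a S)) =
    scale (1 / 2) (\<Sum>j\<in>?J. \<Sum>a\<in>AD. \<Sum>S\<in>proper v. scale (P (fst j) (snd j)) (?D j a S))"
    by (simp only: sum.swap[of _ ?J])
  also have "\<dots> = (\<Sum>j\<in>?J. scale (P (fst j) (snd j)) (scale (1 / 2) (\<Sum>a\<in>AD. \<Sum>S\<in>proper v. ?D j a S)))"
    unfolding free.scale_sum_right[of "1 / 2" _ ?J] free.scale_left_commute[of _ "1 / 2"]
    by (simp only: free.scale_sum_right)
  finally have 3: "scale (1 / 2) (\<Sum>a\<in>AD. \<Sum>S\<in>proper v. \<Sum>j\<in>?J. scale (P (fst j) (snd j)) (?D j a S)) =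
    (\<Sum>j\<in>?J. scale (P (fst j) (snd j)) (DD ?C p q v (K h1 h2 (fst j) (snd j) z)))" unfolding DD_def .
  show ?thesis using 2 unfolding case_prod_unfold 3 .
qed

lemma DM_cutoff:
  assumes c: "cuttable h1 h2 \<Gamma>" and v: "v \<in> normals \<Gamma>" and z: "z \<in> chE h1 h2 \<Gamma>"
  shows "eqm RR (DM m \<Gamma> v z) (\<Sum>(x, y)\<in>cut_pairs h1 h2 \<Gamma>. scale (P x y) (DM m (cut_graph N h1 h2 \<Gamma>) v (K h1 h2 x y z)))"
proof (cases m)
  case True
  from eqm_add[OF DD_cutoff[OF assms, of True False] DD_cutoff[OF assms, of False True]] True
  show ?thesis by (simp add: DM_def case_prod_unfold free.scale_right_distrib sum.distrib)
qed (use DD_cutoff[OF assms] in \<open>simp add: DM_def\<close>)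

lemma op_cutoff:
  assumes r: "r \<in> cutoff_rels N W B P"
  shows "op m r \<in> free.span RR"
proof -
  obtain \<Gamma> h1 h2 os ws ss ns where D: "(\<Gamma>, ({h1, h2}, gen [h1, h2]) # os, ws, ss, ns) \<in> DG"
    and r: "r = gen (\<Gamma>, ({h1, h2}, gen [h1, h2]) # os, ws, ss, ns) -
     (\<Sum>(x, y)\<in>cut_pairs h1 h2 \<Gamma>. scale (P x y) (K h1 h2 x y (gen (\<Gamma>, ({h1, h2}, gen [h1, h2]) # os, ws, ss, ns))))"
    using assms unfolding cutoff_rels_K by blast
  define z :: "('k, 'w) chain" where "z = gen (\<Gamma>, ({h1, h2}, gen [h1, h2]) # os, ws, ss, ns)"
  have z: "z \<in> chE h1 h2 \<Gamma>" unfolding z_def by (rule chE_base[OF D])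
  have c: "cuttable h1 h2 \<Gamma>" using D by (auto simp: cuttable_def DG_iff edge_words_def words_iff)
  let ?J = "cut_pairs h1 h2 \<Gamma>" and ?C = "cut_graph N h1 h2 \<Gamma>"
  have "op m (K h1 h2 x y z) = (\<Sum>v\<in>normals \<Gamma>. DM m ?C v (K h1 h2 x y z))" if "(x, y) \<in> ?J" for x y
    using op_chainsG[OF K_chainsG[OF z], of x y m] that
    by (simp add: cut_pairs_def normals_cut[OF cuttableD(1)[OF c]])
  then have "op m (\<Sum>(x, y)\<in>?J. scale (P x y) (K h1 h2 x y z)) = (\<Sum>(x, y)\<in>?J. scale (P x y) (\<Sum>v\<in>normals \<Gamma>. DM m ?C v (K h1 h2 x y z)))"
    unfolding lin_sum[OF lin_op] by (intro sum.cong refl) (auto simp: lin_scale[OF lin_op])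
  also have "\<dots> = (\<Sum>v\<in>normals \<Gamma>. \<Sum>(x, y)\<in>?J. scale (P x y) (DM m ?C v (K h1 h2 x y z)))"
    by (simp only: case_prod_unfold free.scale_sum_right sum.swap[of _ ?J])
  finally have e: "op m (\<Sum>(x, y)\<in>?J. scale (P x y) (K h1 h2 x y z)) =
    (\<Sum>v\<in>normals \<Gamma>. \<Sum>(x, y)\<in>?J. scale (P x y) (DM m ?C v (K h1 h2 x y z)))" .
  have "eqm RR (op m z) (op m (\<Sum>(x, y)\<in>?J. scale (P x y) (K h1 h2 x y z)))"
    unfolding e op_chainsG[OF chE_chainsG[OF z]] by (intro eqm_sum DM_cutoff[OF c _ z])
  then show ?thesis
    unfolding r z_def[symmetric] lin_diff[OF lin_op] by (simp add: eqm_def)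
qed

section \<open>The relations are preserved\<close>

lemma op_eqm_TR:
  assumes g: "is_graph \<Gamma>" and r: "r \<in> TR \<Gamma>"
  shows "op m r \<in> free.span RR"
proof -
  have "eqm (LH \<Gamma>) r 0" unfolding TR_LH[OF g] eqm_0_iff by (rule free.span_base[OF r])
  then have "eqm HR (DM m \<Gamma> v r) 0" if "v \<in> normals \<Gamma>" for v
    using DM_LH[OF that, of r 0 m] by (simp only: lin_0[OF lin_DM])
  then show ?thesis
    unfolding op_chainsG[OF TR_chainsG[OF g r]] by (intro free.span_sum HR_in_span[OF _ free.span_zero])
qed

text \<open>The sum over the normal vertices is reindexed along the isomorphism, and the
  contribution of each vertex is natural for it.\<close>

lemma op_iso:
  assumes D: "s \<in> DG" and g': "is_graph \<Gamma>'" and iso: "graph_iso \<phi> (fst s) \<Gamma>'"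
  shows "op m (gen s - gen (transport \<phi> \<Gamma>' s)) \<in> free.span RR"
proof -
  obtain \<Gamma> os ws ss ns where s: "s = (\<Gamma>, os, ws, ss, ns)" by (cases s)
  have g: "is_graph \<Gamma>" using D s by (simp add: DG_iff)
  have x: "gen s \<in> chainsG \<Gamma>" unfolding s by (rule gen_chainsG[OF D[unfolded s]])
  have i: "giso \<phi> \<Gamma> \<Gamma>'" using iso g' s by (simp add: giso_def)
  have t: "gen (transport \<phi> \<Gamma>' s) = trl \<phi> \<Gamma>' (gen s)" by (simp add: trl_def)
  note f = graph_iso_facts[OF iso[unfolded s fst_conv] g]
  have inj: "inj_on ((`) \<phi>) (normals \<Gamma>)"
    using inj_on_image_eq_iff[OF f(1)] vert_halves[OF g normal_vert] by (intro inj_onI) blast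
  have "op m (gen (transport \<phi> \<Gamma>' s)) = (\<Sum>v\<in>normals \<Gamma>. DM m \<Gamma>' (\<phi> ` v) (trl \<phi> \<Gamma>' (gen s)))"
    unfolding t op_chainsG[OF trl_chainsG[OF i x]] f(4) sum.reindex[OF inj] comp_def ..
  moreover have "eqm HR \<dots> (op m (gen s))"
    unfolding op_chainsG[OF x] by (intro eqm_sum DM_iso[OF i _ x])
  ultimately have "eqm RR (op m (gen s)) (op m (gen (transport \<phi> \<Gamma>' s)))"
    by (simp add: eqm_sym HR_RR)
  then show ?thesis unfolding lin_diff[OF lin_op] by (simp add: eqm_def)
qed

text \<open>Here the splitting of \<open>v\<close> into two special vertices comes first.
  Anticommutation performs it last, on the graph already split at \<open>w\<close>, where it is null
  by the A-infinity relation at \<open>v\<close>.\<close>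

lemma CC_TT:
  assumes "is_graph \<Gamma>" "v \<in> normals \<Gamma>" "w \<in> normals \<Gamma>" "v \<noteq> w" "x \<in> chainsG \<Gamma>"
  shows "CC m \<Gamma> True True v w x \<in> free.span RR"
proof -
  have "DC \<Gamma> r t True True w v x \<in> free.span RR" for r t
    unfolding DC_def
  proof (intro free.span_scale free.span_sum)
    fix b T assume bT: "b \<in> AD" "T \<in> proper w"
    note s = splittable_proper[OF assms(1,3) bT]
    show "DD (Dg \<Gamma> r t b w T) True True v (Dt \<Gamma> r t b w T x) \<in> free.span RR"
      by (rule DD_Ainf[OF Dt_chainsG[OF s assms(5)] Dg_normals(1)[OF s assms(2,4)]])
  qed
  then have "DC \<Gamma> True True r t v w x \<in> free.span RR" for r t
    by (intro HR_in_span[OF DC_commute[OF assms]] free.span_neg)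
  then show ?thesis by (simp add: CC_DC free.span_add)
qed

text \<open>Both new vertices are special and cannot be split again, so \<open>NN\<close> vanishes
  and only splittings of other vertices remain.\<close>

lemma op_Ainf:
  assumes D: "s \<in> DG" and v: "v \<in> normals (fst s)"
  shows "op m (DD (fst s) True True v (gen s)) \<in> free.span RR"
proof -
  obtain \<Gamma> os ws ss ns where s: "s = (\<Gamma>, os, ws, ss, ns)" by (cases s)
  have g: "is_graph \<Gamma>" using D s by (simp add: DG_iff)
  have x: "gen s \<in> chainsG \<Gamma>" unfolding s by (rule gen_chainsG[OF D[unfolded s]])
  have v: "v \<in> normals \<Gamma>" using v s by simp
  have "NN m \<Gamma> True True v (gen s) = 0" by (simp add: NN_def)
  then show ?thesis
    unfolding s fst_conv unfolding op_DD[OF g v x[unfolded s]] s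
    by (simp only: add_0_right) (intro free.span_sum CC_TT g v x[unfolded s]; blast)
qed

text \<open>The vertex of nonpositive degree either survives, and condition (i) applies to the
  result, or it is the one being split, which is \<open>DM_nonpos\<close>.\<close>

lemma op_positive:
  assumes D: "s \<in> DG" and v: "v \<in> normals (fst s)" "vdeg N (fst s) v \<le> 0"
  shows "op m (gen s) \<in> free.span RR"
proof -
  obtain \<Gamma> os ws ss ns where s: "s = (\<Gamma>, os, ws, ss, ns)" by (cases s)
  have x: "gen s \<in> chainsG \<Gamma>" unfolding s by (rule gen_chainsG[OF D[unfolded s]])
  have v: "v \<in> normals \<Gamma>" "vdeg N \<Gamma> v \<le> 0" using v s by simp_all
  show ?thesis
    unfolding op_chainsG[OF x]
  proof (rule free.span_sum)
    fix w assume w: "w \<in> normals \<Gamma>"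
    show "DM m \<Gamma> w (gen s) \<in> free.span RR"
    proof (cases "w = v")
      case True
      then show ?thesis using DM_nonpos[OF x v] by simp
    next
      case False
      then have "DD \<Gamma> p q w (gen s) \<in> free.span RR" for p q
        using DD_keep[OF x w v(1) _ v(2)] by blast
      then show ?thesis by (simp add: DM_def free.span_add)
    qed
  qed
qed

text \<open>If another vertex is split, anticommutation lets the splitting at \<open>v\<close> act
  last, while \<open>v\<close> still has degree 0. If a new vertex is split, the claim for
  \<open>L\<close> is \<open>NM_null\<close>; for \<open>d\<close> the vertex has degree 1, and one
  of its parts has nonpositive degree.\<close>

lemma op_positive':
  assumes D: "s \<in> DG" and v: "v \<in> normals (fst s)" "vdeg N (fst s) v = 0"
  shows "op m (DM True (fst s) v (gen s)) \<in> free.span RR"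
proof -
  obtain \<Gamma> os ws ss ns where s: "s = (\<Gamma>, os, ws, ss, ns)" by (cases s)
  have g: "is_graph \<Gamma>" using D s by (simp add: DG_iff)
  define x :: "('k, 'w) chain" where "x = gen s"
  have x: "x \<in> chainsG \<Gamma>" unfolding x_def s by (rule gen_chainsG[OF D[unfolded s]])
  have v: "v \<in> normals \<Gamma>" "vdeg N \<Gamma> v = 0" using v s by simp_all
  have "CM True m \<Gamma> w v x \<in> free.span RR" if w: "w \<in> normals \<Gamma> - {v}" for w
  proof -
    have w: "w \<in> normals \<Gamma>" "v \<noteq> w" using w by auto
    have "CC True \<Gamma> r t w v x \<in> free.span RR" for r t
      unfolding CC_def
    proof (intro free.span_scale free.span_sum)
      fix b T assume bT: "b \<in> AD" "T \<in> proper w"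
      note sp = splittable_proper[OF g w(1) bT]
      show "DM True (Dg \<Gamma> r t b w T) v (Dt \<Gamma> r t b w T x) \<in> free.span RR"
        by (rule DM_nonpos[OF Dt_chainsG[OF sp x] Dg_normals(1)[OF sp v(1) w(2)]])
          (simp add: Dg_vdeg vdeg_sgraph_old[OF g normal_vert[OF v(1)]] v(2))
    qed
    then show ?thesis by (simp add: CM_def free.span_add)
  qed
  then have CM: "CM m True \<Gamma> v w x \<in> free.span RR" if "w \<in> normals \<Gamma> - {v}" for w
    using that by (intro HR_in_span[OF CM_commute[OF g v(1) _ _ x]] free.span_neg) auto
  have NM: "NM m True \<Gamma> v x \<in> free.span RR"
  proof (cases m)
    case True
    then show ?thesis using NM_null[OF g v(1) x, of True] by simp
  next
    case m: False
    have 1: "NN False \<Gamma> True False v x \<in> free.span RR"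
      unfolding NN_def DM_def if_True if_False add_0_left add_0_right
    proof (intro free.span_scale free.span_sum)
      fix a S assume aS: "a \<in> AD" "S \<in> proper v"
      note sp = splittable_proper[OF g v(1) aS]
      show "DD (Dg \<Gamma> True False a v S) False False (vert2 \<Gamma> v S) (Dt \<Gamma> True False a v S x) \<in> free.span RR"
      proof (cases "is_graph (Dg \<Gamma> True False a v S)")
        case True
        show ?thesis
          by (rule DM_False_pos[OF Dt_chainsG[OF sp x] Dg_normals(3)[OF sp]])
            (use Dg_markable[OF sp True] vdeg_sgraph_sum[OF sp] v(2) in \<open>simp_all add: Dg_vdeg\<close>)
      qed (simp add: Dt_zero[OF sp x] lin_0[OF lin_DD] free.span_zero)
    qed
    have 2: "NN False \<Gamma> False True v x \<in> free.span RR"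
      unfolding NN_def DM_def if_True if_False add_0_left add_0_right
    proof (intro free.span_scale free.span_sum)
      fix a S assume aS: "a \<in> AD" "S \<in> proper v"
      note sp = splittable_proper[OF g v(1) aS]
      show "DD (Dg \<Gamma> False True a v S) False False (vert1 \<Gamma> S) (Dt \<Gamma> False True a v S x) \<in> free.span RR"
      proof (cases "is_graph (Dg \<Gamma> False True a v S)")
        case True
        show ?thesis
          by (rule DM_False_pos[OF Dt_chainsG[OF sp x] Dg_normals(2)[OF sp]])
            (use Dg_markable[OF sp True] vdeg_sgraph_sum[OF sp] v(2) in \<open>simp_all add: Dg_vdeg\<close>)
      qed (simp add: Dt_zero[OF sp x] lin_0[OF lin_DD] free.span_zero)
    qed
    show ?thesis using m 1 2 by (simp add: NM_def free.span_add)
  qed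
  have "op m (DM True \<Gamma> v x) \<in> free.span RR"
    unfolding op_DM[OF g v(1) x] by (rule free.span_add[OF _ NM]) (intro free.span_sum CM)
  then show ?thesis unfolding s fst_conv x_def .
qed

lemma op_RR:
  assumes "x \<in> free.span RR"
  shows "op m x \<in> free.span RR"
proof (rule lin_span[OF lin_op _ assms])
  fix r assume "r \<in> RR"
  then consider \<Gamma> where "is_graph \<Gamma>" "r \<in> TR \<Gamma>"
    | (iso) "r \<in> iso_rels N W" | (Ainf) "r \<in> Ainf_rels N W" | (cutoff) "r \<in> cutoff_rels N W B P"
    | (positivity) "r \<in> positivity_rels N W"
    unfolding com_rels_def hat_rels_def by blast
  then show "op m r \<in> free.span RR"
  proof cases
    case 1
    then show ?thesis by (rule op_eqm_TR)
  next
    case iso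
    then show ?thesis unfolding iso_rels_def using op_iso by blast
  next
    case Ainf
    then obtain s v where sv: "s \<in> DG" "v \<in> normals (fst s)"
      and r: "r = d_vertex (\<lambda>v' v'' x. op_iv N v' (op_iv N v'' x)) N W v s"
      unfolding Ainf_rels_def by blast
    show ?thesis unfolding r d_vertex_DD(2)[OF sv] by (rule op_Ainf[OF sv])
  next
    case cutoff
    then show ?thesis by (rule op_cutoff)
  next
    case positivity
    then consider (1) s v where "r = gen s" "s \<in> DG" "v \<in> normals (fst s)" "vdeg N (fst s) v \<le> 0"
      | (2) s v where "r = d_vertex (\<lambda>v' v'' x. op_iv N v' x + op_iv N v'' x) N W v s"
        "s \<in> oriented_graphs N W" "v \<in> normals (fst s)" "vdeg N (fst s) v = 0"
      unfolding positivity_rels_def by blast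
    then show ?thesis
    proof cases
      case 1
      then show ?thesis using op_positive by blast
    next
      case 2
      have D: "s \<in> DG" using 2(2) by (auto simp: oriented_graphs_def)
      have r: "r = DM True (fst s) v (gen s)"
        unfolding 2(1) d_vertex_DD(3)[OF D 2(3)] by (simp add: DM_def)
      show ?thesis unfolding r by (rule op_positive'[OF D 2(3,4)])
    qed
  qed
qed

section \<open>Bidegrees\<close>

lemma chainsG_bideg:
  assumes "x \<in> chainsG \<Gamma>" "int (card (normals \<Gamma>)) = p" "(\<Sum>v\<in>normals \<Gamma>. vdeg N \<Gamma> v) = q"
  shows "x \<in> chains_bideg N W p q"
  unfolding chains_bideg_def
  by (rule chainsG_image[OF lin_id _ assms(1)]) (use assms(2,3) in \<open>auto intro!: free.span_base\<close>)

lemma chains_bideg_subset: "chains_bideg N W p q \<subseteq> chains N W"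
  unfolding chains_bideg_def chains_def by (rule free.span_mono) auto

text \<open>A splitting adds one normal vertex and keeps the total degree. Each marking removes a
  normal vertex of degree -1, which lowers the number of normal vertices by 1 and raises their total
  degree by 1.\<close>

lemma DD_bideg:
  assumes x: "x \<in> chainsG \<Gamma>" and v: "v \<in> normals \<Gamma>"
  shows "DD \<Gamma> p q v x \<in> chains_bideg N W (int (card (normals \<Gamma>)) + 1 - of_bool p - of_bool q)
    ((\<Sum>w\<in>normals \<Gamma>. vdeg N \<Gamma> w) + of_bool p + of_bool q)"
  unfolding chains_bideg_def
proof (rule DD_in_span[OF x v])
  fix a S assume s: "splittable a v S \<Gamma>" and g: "is_graph (Dg \<Gamma> p q a v S)"
  let ?G = "sgraph N a v S \<Gamma>" and ?D = "Dg \<Gamma> p q a v S"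
  note sD = splittableD[OF s]
  have fin: "finite (normals \<Gamma>)" by (rule finite_normals[OF sD(1)])
  have "int (card (normals ?D)) = (\<Sum>w\<in>normals ?D. 1)" by simp
  also have "\<dots> = int (card (normals \<Gamma>)) + 1 - of_bool p - of_bool q"
    unfolding sum_normals_Dg[OF s] using fin v card_Diff_singleton[OF v] card_gt_0_iff[of "normals \<Gamma>"]
    by (auto simp: of_nat_diff)
  finally have 1: "int (card (normals ?D)) = int (card (normals \<Gamma>)) + 1 - of_bool p - of_bool q" .
  have "(\<Sum>w\<in>normals \<Gamma> - {v}. vdeg N ?G w) = (\<Sum>w\<in>normals \<Gamma> - {v}. vdeg N \<Gamma> w)"
    by (intro sum.cong refl vdeg_sgraph_old[OF sD(1)]) (simp add: normal_vert)
  also have "\<dots> = (\<Sum>w\<in>normals \<Gamma>. vdeg N \<Gamma> w) - vdeg N \<Gamma> v"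
    using sum.remove[OF fin v, of "vdeg N \<Gamma>"] by simp
  finally have 2: "(\<Sum>w\<in>normals ?D. vdeg N ?D w) = (\<Sum>w\<in>normals \<Gamma>. vdeg N \<Gamma> w) + of_bool p + of_bool q"
    unfolding sum_normals_Dg[OF s] Dg_vdeg
    using vdeg_sgraph_sum[OF s] Dg_markable[OF s g] by (cases p; cases q) simp_all
  show "Dt \<Gamma> p q a v S x \<in> free.span (gen ` {s \<in> DG. int (card (normals (fst s))) = int (card (normals \<Gamma>)) + 1 - of_bool p - of_bool q \<and>
     (\<Sum>v\<in>normals (fst s). vdeg N (fst s) v) = (\<Sum>w\<in>normals \<Gamma>. vdeg N \<Gamma> w) + of_bool p + of_bool q})"
    using chainsG_bideg[OF Dt_chainsG[OF s x] 1 2] unfolding chains_bideg_def .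
qed

lemma op_bideg:
  assumes x: "x \<in> chains_bideg N W p q"
  shows "op m x \<in> chains_bideg N W (p + of_bool (\<not> m)) (q + of_bool m)"
  using x unfolding chains_bideg_def
proof (rule lin_span[OF lin_op, rotated])
  fix y :: "('k, 'w) chain" assume "y \<in> gen ` {s \<in> DG. int (card (normals (fst s))) = p \<and> (\<Sum>v\<in>normals (fst s). vdeg N (fst s) v) = q}"
  then obtain \<Gamma> os ws ss ns where y: "y = gen (\<Gamma>, os, ws, ss, ns)" and D: "(\<Gamma>, os, ws, ss, ns) \<in> DG"
    and pq: "int (card (normals \<Gamma>)) = p" "(\<Sum>v\<in>normals \<Gamma>. vdeg N \<Gamma> v) = q" by auto
  have yG: "y \<in> chainsG \<Gamma>" unfolding y by (rule gen_chainsG[OF D])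
  have "DM m \<Gamma> v y \<in> chains_bideg N W (p + of_bool (\<not> m)) (q + of_bool m)" if "v \<in> normals \<Gamma>" for v
    using DD_bideg[OF yG that, of True False] DD_bideg[OF yG that, of False True] DD_bideg[OF yG that, of False False]
    unfolding DM_def pq chains_bideg_def by (cases m) (simp_all add: free.span_add)
  then show "op m y \<in> free.span (gen ` {s \<in> DG. int (card (normals (fst s))) = p + of_bool (\<not> m) \<and>
     (\<Sum>v\<in>normals (fst s). vdeg N (fst s) v) = q + of_bool m})"
    unfolding op_chainsG[OF yG] chains_bideg_def by (intro free.span_sum)
qed

lemma op_chains:
  assumes "x \<in> chains N W"
  shows "op m x \<in> chains N W" "op m (op m x) \<in> free.span RR"
proof -
  have D: "\<exists>p q. gen s \<in> chains_bideg N W p q" if "s \<in> DG" for s :: "('k, 'w) dgraph"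
    unfolding chains_bideg_def using that by (intro exI free.span_base imageI CollectI conjI) auto
  show "op m x \<in> chains N W"
    unfolding chains_def
  proof (rule lin_span[OF lin_op _ assms[unfolded chains_def]])
    fix y :: "('k, 'w) chain" assume "y \<in> gen ` DG"
    then obtain p q where "y \<in> chains_bideg N W p q" using D by blast
    then show "op m y \<in> free.span (gen ` DG)"
      using op_bideg chains_bideg_subset unfolding chains_def by blast
  qed
  show "op m (op m x) \<in> free.span RR"
  proof (rule lin_span[OF lin_compose[OF lin_op lin_op] _ assms[unfolded chains_def]])
    fix y :: "('k, 'w) chain" assume "y \<in> gen ` DG"
    then obtain \<Gamma> os ws ss ns where "y = gen (\<Gamma>, os, ws, ss, ns)" "(\<Gamma>, os, ws, ss, ns) \<in> DG" by auto
    then show "op m (op m y) \<in> free.span RR" using op_op[OF gen_chainsG] by blast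
  qed
qed

lemma op_differential:
  "induces_differential N W (com_plus_null scW N W B P) (of_bool (\<not> m)) (of_bool m) (op m)"
  unfolding induces_differential_def com_plus_null_def
  using lin_op op_chains op_RR op_bideg by blast

end

theorem proposition4p3:
  fixes scW :: "'k::field_char_0 \<Rightarrow> 'w::ab_group_add \<Rightarrow> 'w"
    and W :: "int \<Rightarrow> 'w set"
    and \<omega> P :: "'w \<Rightarrow> 'w \<Rightarrow> 'k"
    and N :: int
    and X :: "'w set"
  assumes "graded_space scW W"
    and "\<exists>B. finite B \<and> module.span scW B = UNIV"
    and "even N"
    and "symplectic_form scW W N \<omega>"
    and "degrees W \<subseteq> {0..N}"
    and "\<And>a. a \<le> 0 \<Longrightarrow> W a = {0}"
    and "homogeneous_basis scW W X"
    and "inverse_matrix X \<omega> P"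
  shows "induces_differential N W (com_plus_null scW N W X P) 1 0 (op_d N W) \<and>
         induces_differential N W (com_plus_null scW N W X P) 0 1 (op_L N W)"
proof -
  have "finite (degrees W)" using assms(5) finite_subset by blast
  then interpret G: double_complex scW W N X P
    using assms(1,3) by (intro double_complex.intro graph_complex.intro) (auto simp: graded_space_def)
  show ?thesis
    using G.op_differential[of False] G.op_differential[of True] by (simp add: G.op_def)
qed

end
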